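(* Let $\chi_1$ be a primitive Dirichlet character modulo $N_1\ge 2$. Then \[ L(s,\chi_1)=\prod^{\mathrm{reg}}_{\operatorname{Im}(\rho_{\chi_1})\neq 0}\big((s-\rho_{\chi_1})\big)\ \prod^{\mathrm{reg}}_{n=1}^{\infty}\Big(\Big(s+2n-\tfrac{3+\chi_1(-1)}{2}\Big)\Big)\ \Big(s-\tfrac12-\tau^{(0)}_{\chi_1}\Big)^{\mu_{\chi_1}(\tau^{(0)}_{\chi_1})}\Big(s-\tfrac12+\tau^{(0)}_{\chi_1}\Big)^{\mu_{\chi_1}(\tau^{(0)}_{\chi_1})}\Big(s-\tfrac12\Big)^{\mu_{\chi_1}(0)} . \]
   Context: $L(s,\chi_1)$ is the Dirichlet $L$-function of $\chi_1$. The $\rho_{\chi_1}$ run over the non-real zeros of $L(s,\chi_1)$, counted with multiplicity. $\tau^{(0)}_{\chi_1}$ denotes a real number with $0<\tau^{(0)}_{\chi_1}<\frac12$ and $L(\frac12\pm\tau^{(0)}_{\chi_1},\chi_1)=0$, if such a number exists (the paper treats it as the only possible pair of real zeros of $L(s,\chi_1)$ in $(0,1)\setminus\{\frac12\}$); $\mu_{\chi_1}(\tau^{(0)}_{\chi_1})$ is the (common) order of the zeros $\frac12\pm\tau^{(0)}_{\chi_1}$; if no such zero exists one sets $\mu_{\chi_1}(\tau^{(0)}_{\chi_1}):=0$ and $\tau^{(0)}_{\chi_1}:=\frac14$. $\mu_{\chi_1}(0)\ge 0$ is the order of $L(s,\chi_1)$ at $s=\frac12$. Zeta-regularized products: for complex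 sequences $a=(a_n)$, $b=(b_n)$ such that $Z_{a,b}(w,s):=\sum_n b_n(s-a_n)^{-w}$ converges absolutely and locally uniformly in some $s$-region for $\operatorname{Re}(w)>C$ and is meromorphic in $w$ at $w=0$, one defines $\prod^{\mathrm{reg}}_n((s-a_n))^{b_n}:=\exp\big(-\operatorname{Res}_{w=0}Z_{a,b}(w,s)/w^2\big)$ (for integer $b_n$ this is a meromorphic function of $s$ on $\mathbb{C}$, extended by continuation). A product $\prod^{\mathrm{reg}}((s-a_n))$ means $b_n=1$. *)

theory Defs
  imports "HOL-Complex_Analysis.Complex_Analysis"
begin

definition dirichlet_character :: "nat \<Rightarrow> (int \<Rightarrow> complex) \<Rightarrow> bool" where
  "dirichlet_character N chi \<longleftrightarrow>
     N > 0 \<and>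
     (\<forall>a b. chi (a * b) = chi a * chi b) \<and>
     (\<forall>a. chi (a + int N) = chi a) \<and>
     (\<forall>a. chi a \<noteq> 0 \<longleftrightarrow> coprime a (int N))"

definition primitive_dirichlet_character :: "nat \<Rightarrow> (int \<Rightarrow> complex) \<Rightarrow> bool" where
  "primitive_dirichlet_character N chi \<longleftrightarrow>
     dirichlet_character N chi \<and>
     \<not> (\<exists>d \<psi>. d dvd N \<and> d < N \<and> dirichlet_character d \<psi> \<and>
            (\<forall>a. coprime a (int N) \<longrightarrow> chi a = \<psi> a))"

text \<open>
  The meromorphic continuation to the whole plane of the Dirichlet series, which converges
  absolutely for \<open>Re s > 1\<close>; by the identity theorem there is at most one such function.
\<close>
definition dirichlet_L :: "(int \<Rightarrow> complex) \<Rightarrow> complex \<Rightarrow> complex" where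
  "dirichlet_L chi = (THE f. f nicely_meromorphic_on UNIV \<and>
     (\<forall>s. Re s > 1 \<longrightarrow> (\<lambda>n. chi (int (Suc n)) / of_nat (Suc n) powr s) sums f s))"

definition L_order :: "(int \<Rightarrow> complex) \<Rightarrow> complex \<Rightarrow> nat" where
  "L_order chi s = nat (zorder (dirichlet_L chi) s)"

text \<open>
  Each non-real zero \<open>\<rho>\<close> occurs in as many index pairs \<open>(\<rho>, k)\<close> as its multiplicity.
\<close>
definition nonreal_L_zeros :: "(int \<Rightarrow> complex) \<Rightarrow> (complex \<times> nat) set" where
  "nonreal_L_zeros chi = {(\<rho>, k). dirichlet_L chi \<rho> = 0 \<and> Im \<rho> \<noteq> 0 \<and> k < L_order chi \<rho>}"

definition real_zero_pair :: "(int \<Rightarrow> complex) \<Rightarrow> real \<Rightarrow> bool" where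
  "real_zero_pair chi t \<longleftrightarrow> 0 < t \<and> t < 1 / 2 \<and>
     dirichlet_L chi (1 / 2 + of_real t) = 0 \<and> dirichlet_L chi (1 / 2 - of_real t) = 0"

definition tau0 :: "(int \<Rightarrow> complex) \<Rightarrow> real" where
  "tau0 chi = (if \<exists>t. real_zero_pair chi t then SOME t. real_zero_pair chi t else 1 / 4)"

text \<open>
  By the functional equation and complex conjugation the zeros \<open>1/2 + \<tau>\<close> and \<open>1/2 - \<tau>\<close>
  have the same order.
\<close>
definition mu_tau0 :: "(int \<Rightarrow> complex) \<Rightarrow> nat" where
  "mu_tau0 chi = (if \<exists>t. real_zero_pair chi t then L_order chi (1 / 2 + of_real (tau0 chi)) else 0)"

definition reg_zeta ::
  "'i set \<Rightarrow> ('i \<Rightarrow> complex) \<Rightarrow> ('i \<Rightarrow> complex) \<Rightarrow> complex \<Rightarrow> complex \<Rightarrow> complex" where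
  "reg_zeta I a b w s = (\<Sum>\<^sub>\<infinity>n\<in>I. b n * (s - a n) powr (- w))"

definition reg_zeta_converges ::
  "'i set \<Rightarrow> ('i \<Rightarrow> complex) \<Rightarrow> ('i \<Rightarrow> complex) \<Rightarrow> real \<Rightarrow> complex set \<Rightarrow> bool" where
  "reg_zeta_converges I a b C U \<longleftrightarrow>
     (\<forall>w s. Re w > C \<and> s \<in> U \<longrightarrow> (\<lambda>n. norm (b n * (s - a n) powr (- w))) summable_on I) \<and>
     (\<forall>K. compact K \<and> K \<subseteq> {w. Re w > C} \<times> U \<longrightarrow>
        uniform_limit K (\<lambda>X (w, s). \<Sum>n\<in>X. b n * (s - a n) powr (- w))
          (\<lambda>(w, s). reg_zeta I a b w s) (finite_subsets_at_top I))"

text \<open>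
  The continuation in \<open>w\<close> to a neighbourhood of \<open>0\<close> takes place on a half-plane, so that
  it does not depend on a path from the half-plane of convergence to \<open>0\<close>.
\<close>
definition reg_zeta_continuation ::
  "'i set \<Rightarrow> ('i \<Rightarrow> complex) \<Rightarrow> ('i \<Rightarrow> complex) \<Rightarrow> real \<Rightarrow> complex \<Rightarrow> (complex \<Rightarrow> complex) \<Rightarrow> bool" where
  "reg_zeta_continuation I a b C s Z \<longleftrightarrow>
     (\<exists>\<epsilon>>0. Z meromorphic_on {w. Re w > - \<epsilon>}) \<and>
     (\<forall>w. Re w > C \<longrightarrow> Z w = reg_zeta I a b w s)"

text \<open>
  \<open>P\<close> is the zeta-regularized product of the \<open>(s - a n)\<close> with exponents \<open>b n\<close>: it is given by
  the residue formula on some region \<open>U\<close> and extended from there to a meromorphic function.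
  Powers use the principal branch.  For integer \<open>b n\<close> a change of branch in finitely many
  factors changes the residue by a multiple of \<open>2 \<pi> \<i>\<close> and hence does not affect \<open>P\<close>.
\<close>
definition has_reg_prod ::
  "'i set \<Rightarrow> ('i \<Rightarrow> complex) \<Rightarrow> ('i \<Rightarrow> complex) \<Rightarrow> (complex \<Rightarrow> complex) \<Rightarrow> bool" where
  "has_reg_prod I a b P \<longleftrightarrow>
     P nicely_meromorphic_on UNIV \<and>
     (\<exists>U C. open U \<and> connected U \<and> U \<noteq> {} \<and> U \<inter> a ` I = {} \<and>
        reg_zeta_converges I a b C U \<and>
        (\<forall>s\<in>U. \<exists>Z. reg_zeta_continuation I a b C s Z \<and>
                   P s = exp (- residue (\<lambda>w. Z w / w\<^sup>2) 0)))"

end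

theory Submission
  imports Defs "HOL-Number_Theory.Cong"
begin

text \<open>
  The Mellin transform of a Lipschitz-type sum gives the functional equation of the \<open>L\<close>-function, hence
  an entire continuation with growth \<open>exp (C (1 + |s|)^2)\<close> and simple trivial zeros \<open>-(2 n + \<delta>)\<close>.
  By a Jensen type zero count and a Borel--Caratheodory estimate, the second derivative of the logarithmic derivative at
  \<open>s\<close> is the sum of \<open>2 / (s - \<rho>)^3\<close> over all zeros.  Its Mellin transform along \<open>s + t\<close>, \<open>t > 0\<close>, is a Gamma
  factor times the zeta function \<open>Z(w)\<close> of all zeros, and it is also the Mellin transform of the third derivative of
  \<open>log L\<close>; three integrations by parts at \<open>w = 0\<close> give \<open>exp (- Z'(0)) = L(s)\<close> without any additional
  exponential factor.  The trivial zeros contribute \<open>2^(-w)\<close> times a Hurwitz zeta function, whose derivative at \<open>0\<close> is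
  computed by Lerch's formula, and the finitely many other real zeros contribute elementary terms; subtracting
  these from \<open>Z\<close> leaves the zeta function of the non-real zeros.
\<close>

section \<open>Mellin integrals\<close>

text \<open>The obstacle is an exponential factor: the zeros determine an entire function of order
  two only up to exp of a quadratic polynomial, and a regularized product could differ from L by
  exactly such a factor. Three derivatives of log L remove the polynomial, and the decay of log L
  like 2^(-Re s) far to the right makes all boundary terms vanish when the derivatives are
  integrated back. The number three is tied to the growth: O(R^2) zeros in a disc of radius R make
  the sum of (s - \<rho>)^(-w) converge for Re w > 2, while the Mellin integral of the third
  derivative converges for Re w < 3, so the series and its continuation meet in the strip between.
  The exponent two comes from a crude bound for Gamma. Nonvanishing at s = 1 enters because the
  functional equation reflects real points with Re s <= 0 to real points with Re s >= 1: a zero at 1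
  would be a real zero missing from the factorization, and it would disturb the order at its mirror
  point 0.\<close>

lemma holomorphic_on_lebesgue_integral:
  fixes F :: "complex \<Rightarrow> 'a \<Rightarrow> complex"
  assumes "open S"
    and hol: "\<And>t. t \<in> space M \<Longrightarrow> (\<lambda>z. F z t) holomorphic_on S"
    and meas: "\<And>z. z \<in> S \<Longrightarrow> F z \<in> borel_measurable M"
    and dom: "\<And>z0. z0 \<in> S \<Longrightarrow> \<exists>r>0. \<exists>g. integrable M g \<and>
       (\<forall>z\<in>ball z0 r. \<forall>t\<in>space M. norm (F z t) \<le> g t)"
  shows "(\<lambda>z. LINT t|M. F z t) holomorphic_on S"
proof -
  have "(\<lambda>z. LINT t|M. F z t) field_differentiable at z0" if z0: "z0 \<in> S" for z0
  proof -
    obtain r1 g where r1: "r1 > 0" and g: "integrable M g"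
      and gb1: "\<And>z t. z \<in> ball z0 r1 \<Longrightarrow> t \<in> space M \<Longrightarrow> norm (F z t) \<le> g t"
      using dom[OF z0] by blast
    obtain r2 where r2: "r2 > 0" "ball z0 r2 \<subseteq> S"
      using \<open>open S\<close> z0 openE by blast
    define r where "r = min r1 r2 / 2"
    have r: "r > 0" "cball z0 r \<subseteq> S" "cball z0 r \<subseteq> ball z0 r1"
      using r1 r2 unfolding r_def by (auto simp: subset_iff)
    have gb: "norm (F z t) \<le> g t" if "z \<in> cball z0 r" "t \<in> space M" for z t
      using gb1 r that by blast
    have intF: "integrable M (F z)" if "z \<in> cball z0 r" for z
      by (rule Bochner_Integration.integrable_bound[OF g])
         (use meas r that gb in \<open>force intro!: AE_I2\<close>)+
    define D where "D = (\<lambda>t. deriv (\<lambda>z. F z t) z0)"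
    have der: "((\<lambda>h. (F (z0 + h) t - F z0 t) / h) \<longlongrightarrow> D t) (at 0)" if "t \<in> space M" for t
    proof -
      have "((\<lambda>z. F z t) has_field_derivative D t) (at z0)"
        unfolding D_def using hol[OF that] \<open>open S\<close> z0 holomorphic_derivI by blast
      thus ?thesis by (simp add: DERIV_def)
    qed
    have bound: "norm ((F (z0 + h) t - F z0 t) / h) \<le> 2 * g t / r"
      if t: "t \<in> space M" and h: "norm h < r / 2" for h t
    proof (cases "h = 0")
      case True
      have "0 \<le> g t" using gb[of z0 t] r t by (smt (verit) centre_in_cball norm_ge_zero)
      thus ?thesis using True r by simp
    next
      case False
      \<comment> \<open>Cauchy's inequality on the disc of radius r/2 about w, which lies in the
        disc of radius r about z0, turns the domination of F into one of its derivative. The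
        difference quotients then have an integrable majorant.\<close>
      have der_bound: "norm (deriv (\<lambda>z. F z t) w) \<le> 2 * g t / r" if w: "w \<in> ball z0 (r/2)" for w
      proof -
        have sub: "cball w (r/2) \<subseteq> cball z0 r"
          using w r(1) by (auto simp: dist_norm) (smt (verit, best) norm_triangle_ineq4 norm_minus_commute norm_triangle_sub field_sum_of_halves norm_diff_triangle_ineq norm_triangle_lt dist_norm dist_triangle_half_l dist_commute dist_triangle)
        have "norm ((deriv ^^ 1) (\<lambda>z. F z t) w) \<le> fact 1 * g t / (r/2) ^ 1"
        proof (rule Cauchy_inequality)
          show "(\<lambda>z. F z t) holomorphic_on ball w (r/2)"
            by (rule holomorphic_on_subset[OF hol[OF t]]) (use sub r in \<open>auto simp: subset_iff\<close>)
          show "continuous_on (cball w (r/2)) (\<lambda>z. F z t)"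
            by (rule holomorphic_on_imp_continuous_on, rule holomorphic_on_subset[OF hol[OF t]]) (use sub r in \<open>auto simp: subset_iff\<close>)
          show "norm (F x t) \<le> g t" if "norm (w - x) = r/2" for x
            using gb[OF _ t, of x] sub that by (auto simp: dist_norm subset_iff)
        qed (use r in auto)
        thus ?thesis by (simp add: field_simps)
      qed
      have "norm (F (z0 + h) t - F z0 t) \<le> 2 * g t / r * norm ((z0 + h) - z0)"
      proof (rule field_differentiable_bound[of "ball z0 (r/2)"])
        show "((\<lambda>z. F z t) has_field_derivative deriv (\<lambda>z. F z t) w) (at w within ball z0 (r / 2))"
          if "w \<in> ball z0 (r/2)" for w
        proof -
          have "w \<in> S" using that r by (auto simp: subset_iff)
          thus ?thesis using hol[OF t] \<open>open S\<close> holomorphic_derivI has_field_derivative_at_within by blast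
        qed
      qed (use der_bound r h in \<open>auto simp: dist_norm\<close>)
      thus ?thesis using False by (simp add: norm_divide field_simps)
    qed
    have "((\<lambda>h. ((LINT t|M. F (z0 + h) t) - (LINT t|M. F z0 t)) / h) \<longlongrightarrow> (LINT t|M. D t)) (at 0)"
      unfolding tendsto_at_iff_sequentially
    proof (intro allI impI)
      fix X :: "nat \<Rightarrow> complex"
      assume X: "\<forall>i. X i \<in> UNIV - {0}" "X \<longlonglongrightarrow> 0"
      have "\<forall>\<^sub>F n in sequentially. norm (X n) < r / 2"
        using X(2) r(1) tendstoD[OF X(2), of "r/2"] by (simp add: dist_norm)
      then obtain n0 where n0: "\<And>n. n \<ge> n0 \<Longrightarrow> norm (X n) < r / 2"
        by (auto simp: eventually_sequentially)
      define Y where "Y = (\<lambda>n. X (n + n0))"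
      have Y0: "Y n \<noteq> 0" "norm (Y n) < r/2" for n using X n0 by (auto simp: Y_def)
      have Ylim: "Y \<longlonglongrightarrow> 0" unfolding Y_def using X(2) by (rule LIMSEQ_ignore_initial_segment)
      have inS: "z0 + Y n \<in> cball z0 r" for n using Y0(2)[of n] r(1) by (simp add: dist_norm)
      have mm: "(\<lambda>t. (F (z0 + Y n) t - F z0 t) / Y n) \<in> borel_measurable M" for n
      proof -
        have [measurable]: "F (z0 + Y n) \<in> borel_measurable M" "F z0 \<in> borel_measurable M"
          using meas inS r z0 by blast+
        show ?thesis by measurable
      qed
      have lim: "(\<lambda>n. (F (z0 + Y n) t - F z0 t) / Y n) \<longlonglongrightarrow> D t" if "t \<in> space M" for t
        using der[OF that] Ylim Y0(1) unfolding tendsto_at_iff_sequentially o_def by auto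
      have "(\<lambda>n. LINT t|M. (F (z0 + Y n) t - F z0 t) / Y n) \<longlonglongrightarrow> (LINT t|M. D t)"
      proof (rule integral_dominated_convergence)
        show "D \<in> borel_measurable M"
          by (rule borel_measurable_LIMSEQ_metric[OF mm lim])
        show "integrable M (\<lambda>t. 2 * g t / r)" using g by simp
      qed (use mm lim bound Y0 in auto)
      also have "(\<lambda>n. LINT t|M. (F (z0 + Y n) t - F z0 t) / Y n) =
         (\<lambda>n. ((LINT t|M. F (z0 + Y n) t) - (LINT t|M. F z0 t)) / Y n)"
        using intF inS r by (subst Bochner_Integration.integral_diff[symmetric]) (auto intro!: intF)
      finally have "(\<lambda>n. ((\<lambda>h. ((LINT t|M. F (z0 + h) t) - (LINT t|M. F z0 t)) / h) \<circ> X) (n + n0))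
          \<longlonglongrightarrow> (LINT t|M. D t)" by (simp add: Y_def)
      thus "((\<lambda>h. ((LINT t|M. F (z0 + h) t) - (LINT t|M. F z0 t)) / h) \<circ> X) \<longlonglongrightarrow> (LINT t|M. D t)"
        by (rule LIMSEQ_offset)
    qed
    thus ?thesis unfolding field_differentiable_def DERIV_def by blast
  qed
  thus ?thesis using \<open>open S\<close> by (simp add: holomorphic_on_open field_differentiable_def)
qed

text \<open>Euler's integral with t replaced by y t. It is moved from the completed measure to
  \<open>lborel\<close>, where Fubini's theorem for product measures applies.\<close>

lemma Gamma_integral_scaled:
  fixes a :: complex and y :: real
  assumes a: "Re a > 0" and y: "y > 0"
  shows "set_integrable lborel {0<..} (\<lambda>t. of_real t powr (a - 1) * exp (- of_real (y * t)))"
    and "(LINT t:{0<..}|lborel. of_real t powr (a - 1) * exp (- of_real (y * t))) = Gamma a * of_real y powr (- a)"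
proof -
  define f :: "real \<Rightarrow> complex" where "f = (\<lambda>t. indicator {0<..} t *\<^sub>R (of_real t powr (a - 1) * exp (- of_real t)))"
  have eq: "(\<lambda>t. complex_of_real t powr (a - 1) * exp (- of_real t)) = (\<lambda>t. of_real t powr (a - 1) / of_real (exp t))"
    by (simp add: exp_minus exp_of_real field_simps)
  have meas: "f \<in> borel_measurable lborel"
    unfolding f_def measurable_lborel2 by (intro borel_measurable_continuous_on_indicator) (auto intro!: continuous_intros)
  have 1: "set_integrable lebesgue {0<..} (\<lambda>t. complex_of_real t powr (a - 1) * exp (- of_real t))"
    unfolding eq by (rule absolutely_integrable_Gamma_integral'[OF a])
  have int: "integrable lborel f"
    using 1 meas unfolding f_def set_integrable_def by (simp add: integrable_completion)
  have "(LINT t|lborel. f t) = Gamma a"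
  proof -
    have "(LINT t|lborel. f t) = (LINT t|lebesgue. f t)"
      using meas by (simp add: integral_completion)
    also have "\<dots> = integral {0<..} (\<lambda>t. complex_of_real t powr (a - 1) * exp (- of_real t))"
      using set_lebesgue_integral_eq_integral(2)[OF 1] by (simp add: f_def set_lebesgue_integral_def)
    also have "\<dots> = Gamma a"
      unfolding eq using Gamma_integral_complex'[OF a] by (rule integral_unique)
    finally show ?thesis .
  qed
  have scale: "f (0 + y * t) = (of_real y powr (a - 1)) * (indicator {0<..} t *\<^sub>R (of_real t powr (a - 1) * exp (- of_real (y * t))))" for t
    using y by (auto simp: f_def indicator_def powr_times_real zero_less_mult_iff)
  have "integrable lborel (\<lambda>t. f (0 + y * t))"
    using lborel_integrable_real_affine[OF int, of y 0] y by simp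
  hence "integrable lborel (\<lambda>t. indicator {0<..} t *\<^sub>R (of_real t powr (a - 1) * exp (- complex_of_real (y * t))))"
    using integrable_mult_right[of "inverse (of_real y powr (a - 1))" lborel "\<lambda>t. f (0 + y * t)"] y
    unfolding scale mult.assoc[symmetric] by simp
  thus "set_integrable lborel {0<..} (\<lambda>t. of_real t powr (a - 1) * exp (- complex_of_real (y * t)))"
    by (simp add: set_integrable_def)
  have "Gamma a = \<bar>y\<bar> *\<^sub>R (LINT t|lborel. f (0 + y * t))"
    using lborel_integral_real_affine[of y f 0] y \<open>(LINT t|lborel. f t) = Gamma a\<close> by simp
  also have "\<dots> = of_real y * of_real y powr (a - 1) * (LINT t:{0<..}|lborel. of_real t powr (a - 1) * exp (- complex_of_real (y * t)))"
    unfolding scale integral_mult_right_zero set_lebesgue_integral_def by (use y in \<open>simp add: scaleR_conv_of_real\<close>)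
  also have "of_real y * of_real y powr (a - 1) = (of_real y :: complex) powr a"
    using y by (simp add: powr_diff)
  finally show "(LINT t:{0<..}|lborel. of_real t powr (a - 1) * exp (- complex_of_real (y * t))) = Gamma a * of_real y powr (- a)"
    using y by (simp add: powr_minus field_simps)
qed

lemma Gamma_integral_scaled_nat:
  assumes "y > 0" "k > 0"
  shows "(LINT t:{0<..}|lborel. of_real t ^ (k - 1) * exp (- complex_of_real (y * t))) = Gamma (of_nat k) / of_real y ^ k"
    and "set_integrable lborel {0<..} (\<lambda>t. of_real t ^ (k - 1) * exp (- complex_of_real (y * t)))"
proof -
  have eq: "indicator {0<..} t *\<^sub>R (complex_of_real t powr (of_nat k - 1) * X) = indicator {0<..} t *\<^sub>R (of_real t ^ (k - 1) * X)" for t X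
  proof (cases "t > 0")
    case True
    have "complex_of_real t powr (of_nat k - 1) = complex_of_real t powr (of_nat (k - 1))"
      using assms by (simp add: of_nat_diff)
    also have "\<dots> = of_real t ^ (k - 1)" using True by (subst powr_nat') auto
    finally show ?thesis by simp
  qed auto
  show "(LINT t:{0<..}|lborel. of_real t ^ (k - 1) * exp (- complex_of_real (y * t))) = Gamma (of_nat k) / of_real y ^ k"
    using Gamma_integral_scaled(2)[of "of_nat k" y, unfolded set_lebesgue_integral_def eq] assms
    by (simp add: set_lebesgue_integral_def powr_minus powr_nat' divide_inverse)
  show "set_integrable lborel {0<..} (\<lambda>t. of_real t ^ (k - 1) * exp (- complex_of_real (y * t)))"
    using Gamma_integral_scaled(1)[of "of_nat k" y] assms
    by (simp add: set_integrable_def eq)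
qed

text \<open>Writing 1 / (t + x)^k as a Gamma integral over u and exchanging the order leaves two
  Gamma integrals, first in t with exponent k - w, then in u with exponent w. The two bounds on
  \<open>Re w\<close> are their conditions of convergence.\<close>

lemma mellin_shifted_power_real:
  fixes w :: complex and x :: real and k :: nat
  assumes w: "0 < Re w" "Re w < real k" and x: "x > 0"
  shows "set_integrable lborel {0<..} (\<lambda>t. of_real t powr (of_nat k - 1 - w) / (of_real t + of_real x) ^ k)"
    and "(LINT t:{0<..}|lborel. of_real t powr (of_nat k - 1 - w) / (of_real t + of_real x) ^ k) =
           Gamma (of_nat k - w) * Gamma w / Gamma (of_nat k) * of_real x powr (- w)"
proof -
  have k: "k > 0" using w by (cases k) auto
  have [simp]: "Gamma (of_nat k :: complex) \<noteq> 0"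
    using k by (subst Gamma_eq_zero_iff) (auto elim!: nonpos_Ints_cases simp: complex_eq_iff)
  define f :: "real \<Rightarrow> real \<Rightarrow> complex" where
    "f = (\<lambda>u t. (indicator {0<..} u * indicator {0<..} t) *\<^sub>R (of_real t powr (of_nat k - 1 - w) * of_real u ^ (k - 1) * exp (- of_real (u * (t + x)))))"
  have fmeas: "case_prod f \<in> borel_measurable (lborel \<Otimes>\<^sub>M lborel)"
  proof -
    have "case_prod f = (\<lambda>p. indicator ({0<..} \<times> {0<..}) p *\<^sub>R (of_real (snd p) powr (of_nat k - 1 - w) * of_real (fst p) ^ (k - 1) * exp (- of_real (fst p * (snd p + x)))))"
      by (auto simp: f_def indicator_def fun_eq_iff)
    moreover have "\<dots> \<in> borel_measurable (borel :: (real \<times> real) measure)"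
      by (intro borel_measurable_continuous_on_indicator)
        (auto intro!: continuous_intros simp: borel_prod[symmetric] pair_measureI)
    ultimately show ?thesis by (simp add: lborel_prod)
  qed
  have f1: "f u t = indicator {0<..} u *\<^sub>R (of_real u ^ (k - 1) * exp (- of_real (u * x)) *
      (indicator {0<..} t *\<^sub>R (of_real t powr (of_nat k - w - 1) * exp (- of_real (u * t)))))" for u t
  proof -
    have "exp (- complex_of_real (u * (t + x))) = exp (- of_real (u * x)) * exp (- of_real (u * t))"
      by (simp add: exp_add[symmetric] algebra_simps)
    moreover have "of_nat k - 1 - w = of_nat k - w - 1" by simp
    ultimately show ?thesis unfolding f_def by (simp only:) (simp add: indicator_def)
  qed
  have f2: "f u t = indicator {0<..} t *\<^sub>R (of_real t powr (of_nat k - 1 - w) *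
      (indicator {0<..} u *\<^sub>R (of_real u ^ (k - 1) * exp (- of_real ((t + x) * u)))))" for u t
    by (simp add: f_def indicator_def algebra_simps)
  have sec: "integrable lborel (f u)" for u
  proof (cases "u > 0")
    case True
    have "integrable lborel (\<lambda>t. indicator {0<..} t *\<^sub>R (complex_of_real t powr (of_nat k - w - 1) * exp (- of_real (u * t))))"
      using Gamma_integral_scaled(1)[of "of_nat k - w" u] w True by (simp add: set_integrable_def)
    from integrable_mult_right[OF this, of "of_real u ^ (k - 1) * exp (- of_real (u * x))"]
    show ?thesis unfolding f1[abs_def] using True by simp
  qed (simp add: f_def[abs_def])
  \<comment> \<open>Taking absolute values only replaces w by its real part, so the same Gamma
    integral evaluates the inner norm and Fubini's condition reduces to a known integrable
    function.\<close>
  have norm_eq: "(LINT t|lborel. norm (f u t)) = Re (Gamma (of_nat k - of_real (Re w))) *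
      Re (indicator {0<..} u *\<^sub>R (of_real u powr (of_real (Re w) - 1) * exp (- complex_of_real (x * u))))" for u
  proof (cases "u > 0")
    case True
    define g where "g = (\<lambda>t. indicator {0<..} t *\<^sub>R (complex_of_real t powr (of_nat k - of_real (Re w) - 1) * exp (- of_real (u * t))))"
    have "norm (f u t) = u ^ (k - 1) * exp (- (u * x)) * Re (g t)" for t
    proof (cases "t > 0")
      case t: True
      have "of_nat k - of_real (Re w) - 1 = complex_of_real (real k - Re w - 1)" by simp
      hence e: "complex_of_real t powr (of_nat k - of_real (Re w) - 1) = of_real (t powr (real k - Re w - 1))"
        using t powr_of_real[of t "real k - Re w - 1"] by simp
      have e2: "exp (- complex_of_real (u * t)) = of_real (exp (- (u * t)))" by (simp flip: exp_of_real)
      have "Re (g t) = t powr (real k - Re w - 1) * exp (- (u * t))"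
        unfolding g_def e e2 using t by simp
      moreover have "norm (f u t) = u ^ (k - 1) * exp (- (u * x)) * (t powr (real k - Re w - 1) * exp (- (u * t)))"
        using t True by (simp add: f1 norm_mult norm_powr_real_powr norm_power)
      ultimately show ?thesis by simp
    qed (auto simp: f_def g_def)
    moreover have gi: "integrable lborel g" and gv: "(LINT t|lborel. g t) = Gamma (of_nat k - of_real (Re w)) * of_real u powr (- (of_nat k - of_real (Re w)))"
      using Gamma_integral_scaled[of "of_nat k - of_real (Re w)" u] w True
      by (simp_all add: g_def set_integrable_def set_lebesgue_integral_def)
    ultimately have "(LINT t|lborel. norm (f u t)) = u ^ (k - 1) * exp (- (u * x)) * Re (LINT t|lborel. g t)"
      by (simp add: integral_Re)
    also have "(LINT t|lborel. g t) = complex_of_real (Re (Gamma (of_nat k - of_real (Re w))) * u powr (Re w - real k))"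
    proof -
      have "of_nat k - complex_of_real (Re w) = of_real (real k - Re w)" by simp
      hence "Gamma (of_nat k - of_real (Re w)) = complex_of_real (Gamma (real k - Re w))"
        by (metis Gamma_complex_of_real)
      moreover have "of_real u powr (- (of_nat k - complex_of_real (Re w))) = of_real (u powr (Re w - real k))"
        using True powr_of_real[of u "Re w - real k"] by simp
      ultimately show ?thesis unfolding gv by simp
    qed
    also have "u ^ (k - 1) * exp (- (u * x)) * Re (complex_of_real (Re (Gamma (of_nat k - of_real (Re w))) * u powr (Re w - real k))) =
       Re (Gamma (of_nat k - of_real (Re w))) * (u powr (Re w - 1) * exp (- (x * u)))"
    proof -
      have "u ^ (k - 1) = u powr (real k - 1)" using True k by (simp add: powr_realpow[symmetric] of_nat_diff)
      hence "u ^ (k - 1) * u powr (Re w - real k) = u powr (Re w - 1)" by (simp add: powr_add[symmetric])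
      thus ?thesis by (simp add: mult_ac)
    qed
    also have "u powr (Re w - 1) * exp (- (x * u)) = Re (indicator {0<..} u *\<^sub>R (of_real u powr (of_real (Re w) - 1) * exp (- complex_of_real (x * u))))"
    proof -
      have "of_real u powr (of_real (Re w) - 1) = complex_of_real (u powr (Re w - 1))"
        using True powr_of_real[of u "Re w - 1"] by simp
      moreover have "exp (- complex_of_real (x * u)) = of_real (exp (- (x * u)))" by (simp flip: exp_of_real)
      ultimately show ?thesis using True by simp
    qed
    finally show ?thesis .
  qed (simp add: f_def)
  have "integrable lborel (\<lambda>u. LINT t|lborel. norm (f u t))"
    unfolding norm_eq using Gamma_integral_scaled(1)[of "of_real (Re w)" x] w x
    by (intro integrable_mult_right integrable_Re) (simp add: set_integrable_def)
  hence F: "integrable (lborel \<Otimes>\<^sub>M lborel) (case_prod f)"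
    by (intro lborel_pair.Fubini_integrable fmeas) (use sec in auto)
  have in2: "(LINT u|lborel. f u t) = indicator {0<..} t *\<^sub>R (of_real t powr (of_nat k - 1 - w) * (Gamma (of_nat k) / (of_real t + of_real x) ^ k))" for t
  proof (cases "t > 0")
    case True
    have "(\<lambda>u. f u t) = (\<lambda>u. of_real t powr (of_nat k - 1 - w) * (indicator {0<..} u *\<^sub>R (of_real u ^ (k - 1) * exp (- of_real ((t + x) * u)))))"
      unfolding f2 using True by simp
    hence "(LINT u|lborel. f u t) = of_real t powr (of_nat k - 1 - w) * (LINT u:{0<..}|lborel. of_real u ^ (k - 1) * exp (- of_real ((t + x) * u)))"
      by (simp only: set_lebesgue_integral_def integral_mult_right_zero)
    thus ?thesis using Gamma_integral_scaled_nat(1)[of "t + x" k] x k True by simp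
  qed (simp add: f_def)
  have in1: "(LINT t|lborel. f u t) = Gamma (of_nat k - w) * (indicator {0<..} u *\<^sub>R (of_real u powr (w - 1) * exp (- complex_of_real (x * u))))" for u
  proof (cases "u > 0")
    case True
    have "of_real u ^ (k - 1) * of_real u powr (- (of_nat k - w)) = complex_of_real u powr (w - 1)"
    proof -
      have "complex_of_real u ^ (k - 1) = of_real u powr (of_nat (k - 1))" using True by (simp add: powr_nat')
      thus ?thesis using k True by (simp add: powr_add[symmetric] of_nat_diff)
    qed
    note pw = this
    have "(\<lambda>t. f u t) = (\<lambda>t. (of_real u ^ (k - 1) * exp (- of_real (u * x))) *
      (indicator {0<..} t *\<^sub>R (of_real t powr (of_nat k - w - 1) * exp (- of_real (u * t)))))"
      unfolding f1 using True by simp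
    hence "(LINT t|lborel. f u t) = (of_real u ^ (k - 1) * exp (- of_real (u * x))) * (LINT t:{0<..}|lborel. of_real t powr (of_nat k - w - 1) * exp (- of_real (u * t)))"
      by (simp only: set_lebesgue_integral_def integral_mult_right_zero)
    also have "\<dots> = (of_real u ^ (k - 1) * exp (- of_real (u * x))) * (Gamma (of_nat k - w) * of_real u powr (- (of_nat k - w)))"
      using Gamma_integral_scaled(2)[of "of_nat k - w" u] w True by simp
    also have "\<dots> = Gamma (of_nat k - w) * ((of_real u ^ (k - 1) * of_real u powr (- (of_nat k - w))) * exp (- of_real (u * x)))"
      by (simp only: mult_ac)
    finally show ?thesis unfolding pw using True by (simp add: mult.commute)
  qed (simp add: f_def)
  have "integrable lborel (\<lambda>t. LINT u|lborel. f u t)"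
    by (rule lborel_pair.integrable_snd[OF F])
  hence "integrable lborel (\<lambda>t. (1 / Gamma (of_nat k)) * (LINT u|lborel. f u t))" by (rule integrable_mult_right)
  moreover have e: "(1 / Gamma (of_nat k)) * (LINT u|lborel. f u t) = indicator {0<..} t *\<^sub>R (of_real t powr (of_nat k - 1 - w) / (of_real t + of_real x) ^ k)" for t
    unfolding in2 by simp
  ultimately show "set_integrable lborel {0<..} (\<lambda>t. of_real t powr (of_nat k - 1 - w) / (of_real t + complex_of_real x) ^ k)"
    by (simp add: set_integrable_def)
  have "(LINT t|lborel. LINT u|lborel. f u t) = (LINT u|lborel. LINT t|lborel. f u t)"
    by (rule lborel_pair.Fubini_integral[OF F])
  also have "\<dots> = Gamma (of_nat k - w) * (Gamma w * of_real x powr (- w))"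
    unfolding in1 integral_mult_right_zero using Gamma_integral_scaled(2)[of w x] w x by (simp add: set_lebesgue_integral_def)
  finally have "(LINT t|lborel. (1 / Gamma (of_nat k)) * (LINT u|lborel. f u t)) = 
      (1 / Gamma (of_nat k)) * (Gamma (of_nat k - w) * (Gamma w * of_real x powr (- w)))" by simp
  thus "(LINT t:{0<..}|lborel. of_real t powr (of_nat k - 1 - w) / (of_real t + complex_of_real x) ^ k) =
           Gamma (of_nat k - w) * Gamma w / Gamma (of_nat k) * of_real x powr (- w)"
    unfolding e by (simp add: set_lebesgue_integral_def)
qed

text \<open>Off the slit the ray t + z keeps a positive distance from 0, and for large t its modulus
  grows linearly; the bound combines both effects uniformly in z. It supplies majorants for
  integrals in t that are holomorphic in z.\<close>

lemma slit_plane_lower_bound: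
  fixes z0 :: complex
  assumes "z0 \<notin> \<real>\<^sub>\<le>\<^sub>0"
  obtains r c where "r > 0" "c > 0" "ball z0 r \<inter> \<real>\<^sub>\<le>\<^sub>0 = {}"
    "\<And>z t. z \<in> ball z0 r \<Longrightarrow> t \<ge> 0 \<Longrightarrow> norm (of_real t + z) \<ge> c * (1 + t)"
proof -
  have "open (- \<real>\<^sub>\<le>\<^sub>0 :: complex set)" by auto
  then obtain e where e: "e > 0" "ball z0 e \<subseteq> - \<real>\<^sub>\<le>\<^sub>0" using assms openE by (metis ComplI)
  define r where "r = e / 2"
  \<comment> \<open>From |t + z| >= r one gets 1 + |z| <= ((1 + |z0| + r) / r) |t + z|. Adding t <=
    |t + z| + |z| yields 1 + t <= A |t + z|.\<close>
  define A where "A = 1 + (1 + norm z0 + r) / r"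
  have r: "r > 0" using e by (simp add: r_def)
  have A: "A > 0" using r by (simp add: A_def add_nonneg_nonneg add_pos_nonneg)
  show ?thesis
  proof (rule that[of r "1 / A"])
    have "ball z0 r \<subseteq> ball z0 e" using e by (auto simp: r_def)
    thus "ball z0 r \<inter> \<real>\<^sub>\<le>\<^sub>0 = {}" using e by blast
    fix z and t :: real assume z: "z \<in> ball z0 r" and t: "t \<ge> 0"
    have ge_r: "norm (of_real t + z) \<ge> r"
    proof (rule ccontr)
      assume "\<not> ?thesis"
      hence "norm (z - of_real (-t)) < r" by (simp add: add.commute)
      moreover have "norm (z0 - z) < r" using z by (simp add: dist_norm)
      ultimately have "norm (z0 - of_real (-t)) < e"
        unfolding r_def using norm_triangle_ineq[of "z0 - z" "z - of_real (-t)"] by simp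
      hence "complex_of_real (-t) \<in> ball z0 e" by (simp add: dist_norm)
      hence "complex_of_real (-t) \<in> - \<real>\<^sub>\<le>\<^sub>0" using e(2) by blast
      thus False using t by (simp add: complex_nonpos_Reals_iff)
    qed
    have "norm z < norm z0 + r" using z norm_triangle_sub[of z z0] by (simp add: dist_norm norm_minus_commute)
    moreover have "t \<le> norm (of_real t + z) + norm z"
      using norm_triangle_ineq4[of "of_real t + z" z] t by simp
    ultimately have "1 + t \<le> norm (of_real t + z) + (1 + norm z0 + r) / r * r" using r by simp
    also have "\<dots> \<le> norm (of_real t + z) + (1 + norm z0 + r) / r * norm (of_real t + z)"
      using ge_r r by (intro add_left_mono mult_left_mono) auto
    also have "\<dots> = A * norm (of_real t + z)" by (simp add: A_def algebra_simps)
    finally show "norm (of_real t + z) \<ge> 1 / A * (1 + t)" using A by (simp add: field_simps)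
  qed (use r A in auto)
qed

text \<open>Both sides are holomorphic in z on the slit plane and agree on the positive reals, so
  the identity theorem applies. Near each point the integrand is dominated by a multiple of its
  values at z = 1.\<close>

lemma mellin_shifted_power:
  fixes w z :: complex and k :: nat
  assumes w: "0 < Re w" "Re w < real k" and z: "z \<notin> \<real>\<^sub>\<le>\<^sub>0"
  shows "set_integrable lborel {0<..} (\<lambda>t. of_real t powr (of_nat k - 1 - w) / (of_real t + z) ^ k)"
    and "(LINT t:{0<..}|lborel. of_real t powr (of_nat k - 1 - w) / (of_real t + z) ^ k) =
           Gamma (of_nat k - w) * Gamma w / Gamma (of_nat k) * z powr (- w)"
proof -
  define F where "F = (\<lambda>z t. indicator {0<..} t *\<^sub>R (complex_of_real t powr (of_nat k - 1 - w) / (of_real t + z) ^ k))"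
  define S where "S = - (\<real>\<^sub>\<le>\<^sub>0 :: complex set)"
  have "(\<real>\<^sub>\<le>\<^sub>0 :: complex set) = of_real ` {..0}" by (auto simp: nonpos_Reals_def)
  hence S: "open S" "connected S" unfolding S_def
    using starlike_imp_connected[OF starlike_slotted_complex_plane_left[of 0]] by (auto simp: open_Compl)
  have nz: "of_real t + z \<noteq> 0" if "z \<in> S" "t > 0" for t z
  proof
    assume "complex_of_real t + z = 0"
    hence "z = of_real (- t)" by (simp add: add_eq_0_iff)
    thus False using that by (auto simp: S_def complex_nonpos_Reals_iff)
  qed
  have meas: "F z \<in> borel_measurable lborel" if "z \<in> S" for z
    unfolding F_def measurable_lborel2
    by (intro borel_measurable_continuous_on_indicator) (auto intro!: continuous_intros simp: nz[OF that])
  define G where "G = (\<lambda>t. norm (F 1 t))"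
  have G: "integrable lborel G"
    using mellin_shifted_power_real(1)[OF w, of 1] unfolding G_def F_def set_integrable_def
    by (intro integrable_norm) simp
  have dom: "\<exists>r>0. \<exists>g. integrable lborel g \<and> (\<forall>z\<in>ball z0 r. \<forall>t\<in>space lborel. norm (F z t) \<le> g t)" if "z0 \<in> S" for z0
  proof -
    from that have "z0 \<notin> \<real>\<^sub>\<le>\<^sub>0" by (simp add: S_def)
    from slit_plane_lower_bound[OF this] obtain r c where rc: "r > 0" "c > 0" 
      "\<And>z t. z \<in> ball z0 r \<Longrightarrow> t \<ge> 0 \<Longrightarrow> norm (of_real t + z) \<ge> c * (1 + t)" by metis
    have "norm (F z t) \<le> (1 / c ^ k) * G t" if "z \<in> ball z0 r" for z t
    proof (cases "t > 0")
      case True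
      have "c * norm (of_real t + 1 :: complex) \<le> norm (of_real t + z)"
        using rc(3)[OF that, of t] True by (metis add.commute less_imp_le norm_of_real of_real_1 of_real_add abs_of_pos add_pos_pos zero_less_one)
      hence le: "(c * norm (of_real t + 1 :: complex)) ^ k \<le> norm (of_real t + z) ^ k"
        using rc by (intro power_mono) auto
      have pos: "norm (of_real t + 1 :: complex) > 0" using True nz[of 1 t] by (simp add: S_def complex_nonpos_Reals_iff)
      have "norm (F z t) \<le> norm (complex_of_real t powr (of_nat k - 1 - w)) / (c * norm (of_real t + 1 :: complex)) ^ k"
        using True le pos rc unfolding F_def
        by (auto simp: norm_divide norm_power intro!: divide_left_mono mult_pos_pos)
           (smt (verit) le zero_less_power mult_pos_pos)+
      also have "\<dots> = (1 / c ^ k) * G t" using True by (simp add: G_def F_def norm_divide norm_power power_mult_distrib)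
      finally show ?thesis .
    qed (auto simp: F_def G_def)
    moreover have "integrable lborel (\<lambda>t. (1 / c ^ k) * G t)" using G by simp
    ultimately show ?thesis using rc(1) by blast
  qed
  have zS: "z \<in> S" using z by (simp add: S_def)
  show int: "set_integrable lborel {0<..} (\<lambda>t. of_real t powr (of_nat k - 1 - w) / (of_real t + z) ^ k)"
  proof -
    obtain r g where rg': "r > 0" "integrable lborel g" "\<forall>z'\<in>ball z r. \<forall>t\<in>space lborel. norm (F z' t) \<le> g t" using dom[OF zS] by blast
    hence rg: "integrable lborel g" "\<And>t. norm (F z t) \<le> g t" by auto
    have "integrable lborel (F z)"
      by (rule Bochner_Integration.integrable_bound[OF rg(1) meas[OF zS]]) (use rg(2) in \<open>auto intro!: AE_I2 intro: order.trans[OF _ abs_ge_self]\<close>)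
    thus ?thesis by (simp add: F_def set_integrable_def)
  qed
  define H where "H = (\<lambda>z. (LINT t|lborel. F z t) - Gamma (of_nat k - w) * Gamma w / Gamma (of_nat k) * z powr (- w))"
  have "(\<lambda>z. LINT t|lborel. F z t) holomorphic_on S"
  proof (rule holomorphic_on_lebesgue_integral[OF S(1) _ meas dom])
    fix t :: real
    show "(\<lambda>z. F z t) holomorphic_on S"
      unfolding F_def by (cases "t > 0") (auto intro!: holomorphic_intros simp: nz)
  qed
  hence "H holomorphic_on S" unfolding H_def by (auto intro!: holomorphic_intros simp: S_def)
  moreover have "H y = 0" if "y \<in> of_real ` {0<..}" for y
    using that mellin_shifted_power_real(2)[OF w] by (auto simp: H_def F_def set_lebesgue_integral_def)
  moreover have "(1::complex) islimpt (of_real ` {0<..})"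
  proof -
    have "(\<lambda>n. complex_of_real (1 + 1 / real (Suc n))) \<longlonglongrightarrow> of_real (1 + 0)"
      by (intro tendsto_intros LIMSEQ_inverse_real_of_nat[unfolded inverse_eq_divide])
    moreover have "complex_of_real (1 + 1 / real (Suc n)) \<in> of_real ` {0<..} - {1}" for n
    proof -
      have pos: "1 / real (Suc n) > 0" by simp
      have "complex_of_real (1 + 1 / real (Suc n)) \<noteq> of_real 1" unfolding of_real_eq_iff using pos by linarith
      moreover have "1 + 1 / real (Suc n) \<in> {0<..}" using pos unfolding greaterThan_iff by linarith
      ultimately show ?thesis by (metis DiffI imageI of_real_1 singletonD)
    qed
    ultimately show ?thesis unfolding islimpt_sequential by (intro exI[of _ "\<lambda>n. complex_of_real (1 + 1 / real (Suc n))"]) (auto simp del: of_nat_Suc)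
  qed
  ultimately have "H z = 0"
    by (intro analytic_continuation[of H S "of_real ` {0<..}" 1 z] S zS)
       (auto simp: S_def complex_nonpos_Reals_iff)
  thus "(LINT t:{0<..}|lborel. of_real t powr (of_nat k - 1 - w) / (of_real t + z) ^ k) =
           Gamma (of_nat k - w) * Gamma w / Gamma (of_nat k) * z powr (- w)"
    by (simp add: H_def F_def set_lebesgue_integral_def)
qed

section \<open>The Hurwitz zeta function\<close>

lemma norm_powr_le_exp:
  fixes z w :: complex
  shows "norm (z powr w) \<le> norm z powr Re w * exp (pi * \<bar>Im w\<bar>)"
proof (cases "z = 0")
  case False
  have "norm (z powr w) = exp (Re w * ln (norm z) - Im w * Im (Ln z))"
    using False by (simp add: powr_def)
  also have "- (Im w * Im (Ln z)) \<le> \<bar>Im w\<bar> * pi"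
  proof -
    have "\<bar>Im (Ln z)\<bar> \<le> pi" using mpi_less_Im_Ln[OF False] Im_Ln_le_pi[OF False] by simp
    hence "\<bar>Im w\<bar> * \<bar>Im (Ln z)\<bar> \<le> \<bar>Im w\<bar> * pi" by (intro mult_left_mono) auto
    thus ?thesis using abs_ge_minus_self[of "Im w * Im (Ln z)"] by (simp only: abs_mult)
  qed
  hence "exp (Re w * ln (norm z) - Im w * Im (Ln z)) \<le> exp (Re w * ln (norm z) + \<bar>Im w\<bar> * pi)" by simp
  also have "\<dots> = norm z powr Re w * exp (pi * \<bar>Im w\<bar>)"
    using False by (simp add: powr_def exp_add mult_ac)
  finally show ?thesis .
qed auto

text \<open>
  Euler--Maclaurin summation to first order: the limit \<open>hurwitz_K w x\<close> is \<open>(w - 1) \<zeta>(w, x)\<close>, whose removable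
  pole makes it holomorphic for \<open>Re w > -1\<close>.
\<close>

definition hurwitz_partial :: "nat \<Rightarrow> complex \<Rightarrow> complex \<Rightarrow> complex" where
  "hurwitz_partial M w x = (w - 1) * (\<Sum>n<M. (x + of_nat n) powr (- w)) + (x + of_nat M) powr (1 - w) +
     (w - 1) / 2 * (x + of_nat M) powr (- w)"

definition hurwitz_K :: "complex \<Rightarrow> complex \<Rightarrow> complex" where
  "hurwitz_K w x = lim (\<lambda>M. hurwitz_partial M w x)"

lemma not_nonpos_Reals_Re_pos: "Re z > 0 \<Longrightarrow> z \<notin> \<real>\<^sub>\<le>\<^sub>0"
  by (auto simp: complex_nonpos_Reals_iff)

lemma Re_pos_neq_0: "Re z > 0 \<Longrightarrow> z \<noteq> 0"
  by auto

lemma trapezoid_error: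
  fixes y w :: complex
  assumes y: "Re y > 0" and w: "Re w \<ge> -2"
  shows "norm ((w - 1) / 2 * (y powr (-w) + (y + 1) powr (-w)) + (y + 1) powr (1 - w) - y powr (1 - w))
     \<le> norm (w - 1) * norm w * norm (w + 1) * exp (pi * \<bar>Im w\<bar>) * Re y powr (- Re w - 2)"
proof -
  \<comment> \<open>Two integrations by parts against the kernel u (1 - u) / 2, which vanishes at
    both ends and has second derivative -1. \<open>P 1 - P 0\<close> is the error of the trapezoid
    rule, and P' is the kernel times (w - 1) times the second derivative of (y + u)^(-w).\<close>
  define P where "P = (\<lambda>u. (w - 1) * (u * (1 - u) / 2 * (- w) * (y + u) powr (- w - 1) - (1 - 2 * u) / 2 * (y + u) powr (- w)) + (y + u) powr (1 - w))"
  define P' where "P' = (\<lambda>u. (w - 1) * (u * (1 - u) / 2) * w * (w + 1) * (y + u) powr (- w - 2))"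
  have seg: "\<exists>t. u = of_real t \<and> 0 \<le> t \<and> t \<le> 1" if "u \<in> closed_segment 0 1" for u :: complex
    using that by (auto simp: closed_segment_def scaleR_conv_of_real)
  have der: "(P has_field_derivative P' u) (at u within closed_segment 0 1)" if u: "u \<in> closed_segment 0 1" for u
  proof -
    obtain t where t: "u = of_real t" "0 \<le> t" "t \<le> 1" using seg[OF u] by blast
    have nz: "y + u \<notin> \<real>\<^sub>\<le>\<^sub>0" using t y by (intro not_nonpos_Reals_Re_pos) simp
    hence nz0: "y + u \<noteq> 0" by auto
    have nz': "u + y \<notin> \<real>\<^sub>\<le>\<^sub>0" using nz by (simp add: add.commute)
    have a: "(y + u) powr (- w - 2) * (y + u) = (y + u) powr (- w - 1)"
    proof -
      have "- w - 1 = (- w - 2) + 1" by simp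
      thus ?thesis using nz0 by (simp only: powr_add powr_to_1 if_False)
    qed
    have b: "(y + u) powr (- w - 1) * (y + u) = (y + u) powr (- w)"
      using powr_add[of "y + u" "- w - 1" 1] nz0 by (simp add: powr_to_1)
    define X where "X = y + u"
    define R where "R = X powr (- w - 2)"
    have R: "X powr (- w - 1) = R * X" "X powr (- w) = R * X * X" "X powr (- w - 1 - 1) = R" "X powr (1 - w - 1) = R * X * X"
    proof -
      have "- w - 1 - 1 = - w - 2" "1 - w - 1 = - w" by simp_all
      thus "X powr (- w - 1 - 1) = R" "X powr (1 - w - 1) = R * X * X" using a b unfolding X_def R_def by metis+
    qed (use a b in \<open>simp_all only: X_def R_def\<close>)
    have *: "((\<lambda>u. (y + u) powr a) has_field_derivative a * X powr (a - 1)) (at u within closed_segment 0 1)" for a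
      using nz unfolding X_def by (auto intro!: derivative_eq_intros)
    have "(P has_field_derivative ((w - 1) * (((1 - 2 * u) / 2 * (- w)) * X powr (- w - 1) + ((- w - 1) * X powr (- w - 1 - 1)) * (u * (1 - u) / 2 * (- w))
        - ((- 1) * X powr (- w) + ((- w) * X powr (- w - 1)) * ((1 - 2 * u) / 2))) + (1 - w) * X powr (1 - w - 1))) (at u within closed_segment 0 1)"
      unfolding P_def
      by (intro DERIV_add DERIV_diff DERIV_cmult DERIV_mult[of _ _ _ _ "\<lambda>u. (y + u) powr a" for a, folded X_def] *) (auto simp: X_def nz' intro!: derivative_eq_intros simp: field_simps)
    moreover have "((w - 1) * (((1 - 2 * u) / 2 * (- w)) * X powr (- w - 1) + ((- w - 1) * X powr (- w - 1 - 1)) * (u * (1 - u) / 2 * (- w))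
        - ((- 1) * X powr (- w) + ((- w) * X powr (- w - 1)) * ((1 - 2 * u) / 2))) + (1 - w) * X powr (1 - w - 1)) = P' u"
      unfolding R P'_def X_def[symmetric] R_def[symmetric] by (simp add: field_simps)
    ultimately show ?thesis by simp
  qed
  have bound: "norm (P' u) \<le> norm (w - 1) * norm w * norm (w + 1) * exp (pi * \<bar>Im w\<bar>) * Re y powr (- Re w - 2)"
    if u: "u \<in> closed_segment 0 1" for u
  proof -
    obtain t where t: "u = of_real t" "0 \<le> t" "t \<le> 1" using seg[OF u] by blast
    have "u * (1 - u) / 2 = of_real (t * (1 - t) / 2)" by (simp add: t(1))
    hence "norm (u * (1 - u) / 2) = t * (1 - t) / 2"
      using t by (simp only: norm_of_real) simp
    also have "\<dots> \<le> 1 * 1 / 2" using t by (intro divide_right_mono mult_mono) auto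
    finally have 1: "norm (u * (1 - u) / 2) \<le> 1" by simp
    have "norm ((y + u) powr (- w - 2)) \<le> norm (y + u) powr (- Re w - 2) * exp (pi * \<bar>Im w\<bar>)"
      using norm_powr_le_exp[of "y + u" "- w - 2"] by simp
    also have "norm (y + u) powr (- Re w - 2) \<le> Re y powr (- Re w - 2)"
    proof (rule powr_mono2')
      show "Re y \<le> norm (y + u)" using t complex_Re_le_cmod[of "y + u"] by simp
    qed (use w y in auto)
    finally have 2: "norm ((y + u) powr (- w - 2)) \<le> Re y powr (- Re w - 2) * exp (pi * \<bar>Im w\<bar>)" by simp
    have "norm (P' u) = norm (w - 1) * norm (u * (1 - u) / 2) * norm w * norm (w + 1) * norm ((y + u) powr (- w - 2))"
      by (simp add: P'_def norm_mult)
    also have "\<dots> \<le> norm (w - 1) * 1 * norm w * norm (w + 1) * (Re y powr (- Re w - 2) * exp (pi * \<bar>Im w\<bar>))"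
      by (intro mult_mono 1 2) auto
    finally show ?thesis by (simp add: mult_ac)
  qed
  have "norm (P 1 - P 0) \<le> norm (w - 1) * norm w * norm (w + 1) * exp (pi * \<bar>Im w\<bar>) * Re y powr (- Re w - 2) * norm (1 - 0 :: complex)"
    by (rule field_differentiable_bound[OF convex_closed_segment der bound]) auto
  also have "P 1 - P 0 = (w - 1) / 2 * (y powr (-w) + (y + 1) powr (-w)) + (y + 1) powr (1 - w) - y powr (1 - w)"
    by (simp add: P_def field_simps)
  finally show ?thesis by simp
qed

definition hurwitz_inc :: "nat \<Rightarrow> complex \<Rightarrow> complex \<Rightarrow> complex" where
  "hurwitz_inc M w x = hurwitz_partial (Suc M) w x - hurwitz_partial M w x"

text \<open>An increment is one trapezoid error, at y = x + M. The decay of order M^(-Re w - 2) is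
  what pushes the existence of the limit from Re w > 1 down to Re w > -1.\<close>

lemma hurwitz_inc_bound:
  assumes x: "Re x > 0" and w: "Re w \<ge> -2"
  shows "norm (hurwitz_inc M w x) \<le> (norm w + 1) ^ 3 * exp (pi * norm w) * (Re x + real M) powr (- Re w - 2)"
proof -
  have "hurwitz_inc M w x = (w - 1) / 2 * ((x + of_nat M) powr (-w) + (x + of_nat M + 1) powr (-w)) + (x + of_nat M + 1) powr (1 - w) - (x + of_nat M) powr (1 - w)"
    by (simp add: hurwitz_inc_def hurwitz_partial_def algebra_simps)
  also have "norm \<dots> \<le> norm (w - 1) * norm w * norm (w + 1) * exp (pi * \<bar>Im w\<bar>) * Re (x + of_nat M) powr (- Re w - 2)"
    using x w by (intro trapezoid_error) auto
  also have "\<dots> \<le> (norm w + 1) * (norm w + 1) * (norm w + 1) * exp (pi * norm w) * Re (x + of_nat M) powr (- Re w - 2)"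
    using norm_triangle_ineq4[of w 1] norm_triangle_ineq[of w 1] abs_Im_le_cmod[of w]
    by (intro mult_mono) auto
  finally show ?thesis by (simp add: power3_eq_cube)
qed

lemma hurwitz_partial_sum: "hurwitz_partial M w x = hurwitz_partial 0 w x + (\<Sum>m<M. hurwitz_inc m w x)"
  by (induction M) (simp_all add: hurwitz_inc_def)

lemma summable_shifted_powr:
  assumes "c > 0" "a < -1"
  shows "summable (\<lambda>M. (c + real M) powr a)"
proof -
  have "summable (\<lambda>M. real (Suc M) powr a)"
    using assms by (subst summable_Suc_iff) (simp add: summable_real_powr_iff)
  hence "summable (\<lambda>M. (c + real (Suc M)) powr a)"
    by (rule summable_comparison_test_ev[rotated]) (use assms in \<open>auto intro!: always_eventually powr_mono2'\<close>)
  thus ?thesis by (subst (asm) summable_Suc_iff[of "\<lambda>M. (c + real M) powr a"])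
qed

lemma hurwitz_K_uniform_limit:
  assumes x: "Re x > 0" and w0: "Re w0 > -1"
  shows "\<exists>d>0. cball w0 d \<subseteq> {w. Re w > -1} \<and> uniform_limit (cball w0 d) (\<lambda>M w. hurwitz_partial M w x) (\<lambda>w. hurwitz_K w x) sequentially"
proof -
  define d where "d = (Re w0 + 1) / 2"
  have d: "d > 0" using w0 by (simp add: d_def)
  have Re: "Re w \<ge> -1 + d" if "w \<in> cball w0 d" for w
    using that abs_Re_le_cmod[of "w0 - w"] w0 by (auto simp: dist_norm d_def field_simps)
  define B where "B = norm w0 + d"
  have B: "norm w \<le> B" if "w \<in> cball w0 d" for w
    using that norm_triangle_sub[of w w0] by (simp add: B_def dist_norm norm_minus_commute)
  define A where "A = max 1 (Re x powr (- (norm w0 + d) - 2)) "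
  \<comment> \<open>Index 0 is left out: comparing powers with different exponents requires a base
    of at least 1, and \<open>Re x\<close> itself may be smaller.\<close>
  have bnd: "\<exists>C. \<forall>w\<in>cball w0 d. \<forall>M. norm (hurwitz_inc (Suc M) w x) \<le> C * (Re x + real (Suc M)) powr (- 1 - d)"
  proof (intro exI ballI allI)
    fix w M assume w: "w \<in> cball w0 d"
    have "norm (hurwitz_inc (Suc M) w x) \<le> (norm w + 1) ^ 3 * exp (pi * norm w) * (Re x + real (Suc M)) powr (- Re w - 2)"
      using Re[OF w] d by (intro hurwitz_inc_bound x) auto
    also have "\<dots> \<le> (B + 1) ^ 3 * exp (pi * B) * (Re x + real (Suc M)) powr (- 1 - d)"
      using B[OF w] Re[OF w] x order.trans[OF norm_ge_zero B[OF w]] by (intro mult_mono power_mono powr_mono) auto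
    finally show "norm (hurwitz_inc (Suc M) w x) \<le> ((B + 1) ^ 3 * exp (pi * B)) * (Re x + real (Suc M)) powr (- 1 - d)" .
  qed
  then obtain C where C: "\<And>w M. w \<in> cball w0 d \<Longrightarrow> norm (hurwitz_inc (Suc M) w x) \<le> C * (Re x + real (Suc M)) powr (- 1 - d)" by blast
  have sumC: "summable (\<lambda>M. C * (Re x + real M) powr (- 1 - d))"
    using x d by (intro summable_mult summable_shifted_powr) auto
  have "uniform_limit (cball w0 d) (\<lambda>M w. \<Sum>m<M. hurwitz_inc m w x) (\<lambda>w. \<Sum>m. hurwitz_inc m w x) sequentially"
  proof (rule Weierstrass_m_test_ev[OF _ sumC])
    show "\<forall>\<^sub>F n in sequentially. \<forall>w\<in>cball w0 d. norm (hurwitz_inc n w x) \<le> C * (Re x + real n) powr (- 1 - d)"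
      using eventually_gt_at_top[of 0]
    proof eventually_elim
      case (elim n)
      thus ?case using C[of _ "n - 1"] by auto
    qed
  qed
  hence "uniform_limit (cball w0 d) (\<lambda>M w. hurwitz_partial 0 w x + (\<Sum>m<M. hurwitz_inc m w x)) (\<lambda>w. hurwitz_partial 0 w x + (\<Sum>m. hurwitz_inc m w x)) sequentially"
    by (intro uniform_limit_intros)
  hence U: "uniform_limit (cball w0 d) (\<lambda>M w. hurwitz_partial M w x) (\<lambda>w. hurwitz_partial 0 w x + (\<Sum>m. hurwitz_inc m w x)) sequentially"
    by (simp flip: hurwitz_partial_sum)
  have "hurwitz_K w x = hurwitz_partial 0 w x + (\<Sum>m. hurwitz_inc m w x)" if "w \<in> cball w0 d" for w
    unfolding hurwitz_K_def using tendsto_uniform_limitI[OF U that] by (rule limI)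
  hence "uniform_limit (cball w0 d) (\<lambda>M w. hurwitz_partial M w x) (\<lambda>w. hurwitz_K w x) sequentially"
    using U by (subst uniform_limit_cong') (auto intro: refl)
  moreover have "cball w0 d \<subseteq> {w. Re w > -1}" using Re d by force
  ultimately show ?thesis using d by blast
qed

lemma hurwitz_K_LIMSEQ:
  assumes "Re x > 0" "Re w > -1"
  shows "(\<lambda>M. hurwitz_partial M w x) \<longlonglongrightarrow> hurwitz_K w x"
proof -
  obtain d where d: "d > 0" "uniform_limit (cball w d) (\<lambda>M w. hurwitz_partial M w x) (\<lambda>w. hurwitz_K w x) sequentially"
    using hurwitz_K_uniform_limit[OF assms] by blast
  show ?thesis using tendsto_uniform_limitI[OF d(2), of w] d(1) by simp
qed

lemma hurwitz_partial_holomorphic: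
  assumes "Re x > 0" shows "(\<lambda>w. hurwitz_partial M w x) holomorphic_on A"
proof -
  have "x + of_nat n \<noteq> 0" for n using assms by (intro Re_pos_neq_0) simp
  thus ?thesis unfolding hurwitz_partial_def by (auto intro!: holomorphic_intros)
qed

lemma open_Re_gt: "open {w. Re w > c}"
  by (rule open_halfspace_Re_gt)

lemma hurwitz_K_holomorphic:
  assumes "Re x > 0" shows "(\<lambda>w. hurwitz_K w x) holomorphic_on {w. Re w > -1}"
  using hurwitz_K_uniform_limit[OF assms]
  by (intro holomorphic_uniform_sequence[OF open_Re_gt hurwitz_partial_holomorphic[OF assms]]) auto

text \<open>All partial expressions equal 1 at w = 1. The value is the residue of \<zeta>(w, x);
  since it does not depend on x, the residues cancel in a sum weighted by the values of a nontrivial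
  character.\<close>

lemma hurwitz_K_1: "Re x > 0 \<Longrightarrow> hurwitz_K 1 x = 1"
proof -
  assume x: "Re x > 0"
  have "x + of_nat M \<noteq> 0" for M using x by (intro Re_pos_neq_0) simp
  hence "(\<lambda>M. hurwitz_partial M 1 x) = (\<lambda>_. 1)" by (auto simp: hurwitz_partial_def fun_eq_iff)
  hence "(\<lambda>_. 1 :: complex) \<longlonglongrightarrow> hurwitz_K 1 x" using hurwitz_K_LIMSEQ[of x 1] x by simp
  thus ?thesis by (simp add: LIMSEQ_const_iff)
qed

lemma hurwitz_norm_summable:
  assumes x: "Re x > 0" and w: "Re w > 1"
  shows "summable (\<lambda>n. norm ((x + of_nat n) powr (- w)))"
proof (rule summable_comparison_test_ev)
  show "summable (\<lambda>n. exp (pi * \<bar>Im w\<bar>) * (Re x + real n) powr (- Re w))"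
    using x w by (intro summable_mult summable_shifted_powr) auto
  show "\<forall>\<^sub>F n in sequentially. norm (norm ((x + of_nat n) powr (- w))) \<le> exp (pi * \<bar>Im w\<bar>) * (Re x + real n) powr (- Re w)"
  proof (intro always_eventually allI)
    fix n
    have "norm ((x + of_nat n) powr (- w)) \<le> norm (x + of_nat n) powr (- Re w) * exp (pi * \<bar>Im w\<bar>)"
      using norm_powr_le_exp[of "x + of_nat n" "- w"] by simp
    also have "norm (x + of_nat n) powr (- Re w) \<le> (Re x + real n) powr (- Re w)"
      using x w complex_Re_le_cmod[of "x + of_nat n"] by (intro powr_mono2') auto
    finally show "norm (norm ((x + of_nat n) powr (- w))) \<le> exp (pi * \<bar>Im w\<bar>) * (Re x + real n) powr (- Re w)"
      by (simp add: mult_ac)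
  qed
qed

lemma powr_shift_tendsto_0:
  assumes x: "Re x > 0" and a: "Re a < 0"
  shows "(\<lambda>M. (x + of_nat M) powr a) \<longlonglongrightarrow> 0"
proof (rule Lim_null_comparison)
  show "\<forall>\<^sub>F M in sequentially. norm ((x + of_nat M) powr a) \<le> real M powr (Re a) * exp (pi * \<bar>Im a\<bar>)"
    using eventually_gt_at_top[of 0]
  proof eventually_elim
    case (elim M)
    have "norm ((x + of_nat M) powr a) \<le> norm (x + of_nat M) powr (Re a) * exp (pi * \<bar>Im a\<bar>)"
      by (rule norm_powr_le_exp)
    also have "norm (x + of_nat M) powr (Re a) \<le> real M powr (Re a)"
      using x a elim complex_Re_le_cmod[of "x + of_nat M"] by (intro powr_mono2') auto
    finally show ?case by simp
  qed
  show "(\<lambda>M. real M powr Re a * exp (pi * \<bar>Im a\<bar>)) \<longlonglongrightarrow> 0"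
    using a by (intro tendsto_mult_left_zero tendsto_neg_powr filterlim_real_sequentially)
qed

lemma hurwitz_sums:
  assumes x: "Re x > 0" and w: "Re w > 1"
  shows "(\<lambda>n. (x + of_nat n) powr (- w)) sums (hurwitz_K w x / (w - 1))"
proof -
  define s where "s = (\<Sum>n. (x + of_nat n) powr (- w))"
  have s: "(\<lambda>n. (x + of_nat n) powr (- w)) sums s"
    unfolding s_def using summable_norm_cancel[OF hurwitz_norm_summable[OF assms]] by (rule summable_sums)
  have "(\<lambda>M. hurwitz_partial M w x) \<longlonglongrightarrow> (w - 1) * s + 0 + (w - 1) / 2 * 0"
    unfolding hurwitz_partial_def
  proof (intro tendsto_add tendsto_mult_left)
    show "(\<lambda>M. \<Sum>n<M. (x + of_nat n) powr (- w)) \<longlonglongrightarrow> s" using s by (simp add: sums_def)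
  qed (use w in \<open>auto intro!: powr_shift_tendsto_0 x\<close>)
  moreover have "(\<lambda>M. hurwitz_partial M w x) \<longlonglongrightarrow> hurwitz_K w x"
    using w by (intro hurwitz_K_LIMSEQ x) auto
  ultimately have "(w - 1) * s + 0 + (w - 1) / 2 * 0 = hurwitz_K w x" by (rule LIMSEQ_unique)
  hence "hurwitz_K w x = (w - 1) * s" by simp
  moreover have "w \<noteq> 1" using w by auto
  ultimately show ?thesis using s by simp
qed

text \<open>Increments of positive index are summed against \<open>real (Suc M) powr (-2)\<close>
  uniformly in w. The remaining terms involve powers of the fixed x, collected in \<open>E\<close>,
  and a polynomial times exp (\<pi> |w|), collected in \<open>D\<close>; all of these have exponents
  linear in |w|.\<close>

lemma hurwitz_K_growth:
  fixes x :: real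
  assumes x: "x > 0"
  shows "\<exists>C. \<forall>w. Re w \<ge> 1/2 \<longrightarrow> norm (hurwitz_K w (of_real x)) \<le> exp (C * (1 + norm w))"
proof -
  define l where "l = \<bar>ln x\<bar>"
  define S where "S = (\<Sum>M. real (Suc M) powr (-2))"
  have sumS: "summable (\<lambda>M. real (Suc M) powr (-2))"
    by (subst summable_Suc_iff) (simp add: summable_real_powr_iff)
  have S: "S \<ge> 0" unfolding S_def by (rule suminf_nonneg[OF sumS]) auto
  have xp: "x powr a \<le> exp (2 * l * (1 + norm w))" if "\<bar>a\<bar> \<le> 2 + norm w" for a and w :: complex
  proof -
    have "a * ln x \<le> \<bar>a\<bar> * l" unfolding l_def by (metis abs_ge_self abs_mult)
    also have "\<dots> \<le> (2 + norm w) * l" using that by (intro mult_right_mono) (auto simp: l_def)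
    also have "\<dots> \<le> 2 * l * (1 + norm w)" by (simp add: algebra_simps l_def)
    finally show ?thesis using x by (simp add: powr_def)
  qed
  show ?thesis
  proof (intro exI allI impI)
    fix w :: complex assume w: "Re w \<ge> 1/2"
    define E where "E = exp (2 * l * (1 + norm w))"
    define D where "D = (norm w + 1) ^ 3 * exp (pi * norm w)"
    have E: "E \<ge> 1" by (simp add: E_def l_def)
    have D: "D \<ge> 1 + norm w"
    proof -
      have "(norm w + 1) ^ 1 * 1 \<le> (norm w + 1) ^ 3 * exp (pi * norm w)"
        by (intro mult_mono power_increasing) auto
      thus ?thesis by (simp add: D_def)
    qed
    have D0: "D \<ge> 0" using D by (meson add_nonneg_nonneg norm_ge_zero order.trans zero_le_one)
    have inc: "norm (hurwitz_inc M w x) \<le> D * (x + real M) powr (- Re w - 2)" for M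
      unfolding D_def using hurwitz_inc_bound[of "of_real x" w M] x w by simp
    have Rew: "\<bar>Re w\<bar> \<le> norm w" by (rule abs_Re_le_cmod)
    have inc0: "norm (hurwitz_inc 0 w x) \<le> D * E"
    proof -
      have "x powr (- Re w - 2) \<le> E" unfolding E_def using Rew w by (intro xp) auto
      hence "D * x powr (- Re w - 2) \<le> D * E" using D0 by (rule mult_left_mono)
      thus ?thesis using inc[of 0] by simp
    qed
    have incS: "norm (hurwitz_inc (Suc M) w x) \<le> D * real (Suc M) powr (-2)" for M
    proof -
      have "(x + real (Suc M)) powr (- Re w - 2) \<le> (x + real (Suc M)) powr (-2)"
        using x w by (intro powr_mono) auto
      also have "\<dots> \<le> real (Suc M) powr (-2)" using x by (intro powr_mono2') auto
      finally show ?thesis using inc[of "Suc M"] D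
        by (meson mult_left_mono order.trans D0)
    qed
    have p0: "norm (hurwitz_partial 0 w x) \<le> 2 * D * E"
    proof -
      have "norm (hurwitz_partial 0 w x) \<le> norm (of_real x powr (1 - w)) + norm ((w - 1) / 2) * norm (of_real x powr (- w))"
        unfolding hurwitz_partial_def norm_mult[symmetric]
        using norm_triangle_ineq[of "complex_of_real x powr (1 - w)" "(w - 1) / 2 * of_real x powr (- w)"] by simp
      also have "norm (of_real x powr (1 - w)) = x powr (1 - Re w)" using x by (simp add: norm_powr_real_powr)
      also have "norm (of_real x powr (- w)) = x powr (- Re w)" using x by (simp add: norm_powr_real_powr)
      also have "x powr (1 - Re w) \<le> 1 * E" unfolding E_def using Rew by (simp add: xp)
      also have "norm ((w - 1) / 2) * x powr (- Re w) \<le> (1 + norm w) * E"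
        unfolding E_def using Rew norm_triangle_ineq4[of w 1] by (intro mult_mono xp) (auto simp: norm_divide)
      also have "1 * E + (1 + norm w) * E \<le> D * E + D * E"
      proof -
        have "1 \<le> D" using D norm_ge_zero[of w] by linarith
        thus ?thesis using D E by (intro add_mono mult_right_mono) auto
      qed
      finally show ?thesis by simp
    qed
    have part: "norm (hurwitz_partial (Suc M) w x) \<le> (3 + S) * (D * E)" for M
    proof -
      have "hurwitz_partial (Suc M) w x = hurwitz_partial 0 w x + hurwitz_inc 0 w x + (\<Sum>m<M. hurwitz_inc (Suc m) w x)"
        by (subst hurwitz_partial_sum) (simp add: sum.lessThan_Suc_shift del: sum.lessThan_Suc)
      also have "norm \<dots> \<le> norm (hurwitz_partial 0 w x) + norm (hurwitz_inc 0 w x) + (\<Sum>m<M. norm (hurwitz_inc (Suc m) w x))"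
        by (intro order.trans[OF norm_triangle_ineq] add_mono norm_sum order.refl)
      also have "(\<Sum>m<M. norm (hurwitz_inc (Suc m) w x)) \<le> (\<Sum>m<M. D * real (Suc m) powr (-2))"
        by (intro sum_mono incS)
      also have "\<dots> = D * (\<Sum>m<M. real (Suc m) powr (-2))" by (simp add: sum_distrib_left)
      also have "\<dots> \<le> D * S"
        unfolding S_def using D0 by (intro mult_left_mono sum_le_suminf sumS) auto
      also have "D * S \<le> D * S * E" using mult_left_mono[of 1 E "D * S"] E D0 S by simp
      finally show ?thesis using p0 inc0 by (simp add: algebra_simps)
    qed
    have "(\<lambda>M. hurwitz_partial (Suc M) w x) \<longlonglongrightarrow> hurwitz_K w x"
      using hurwitz_K_LIMSEQ[of "of_real x" w] x w by (intro LIMSEQ_Suc) auto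
    hence "norm (hurwitz_K w x) \<le> (3 + S) * (D * E)"
      by (intro tendsto_upperbound[OF tendsto_norm]) (use part in \<open>auto intro!: always_eventually\<close>)
    also have "\<dots> \<le> exp (3 + S) * ((exp (norm w) ^ 3 * exp (pi * norm w)) * E)"
      unfolding D_def using S E exp_ge_add_one_self[of "3 + S"] exp_ge_add_one_self[of "norm w"]
      by (intro mult_mono power_mono) (auto simp: add.commute)
    also have "\<dots> = exp (3 + S + 3 * norm w + pi * norm w + 2 * l * (1 + norm w))"
      by (simp add: E_def exp_add exp_of_nat_mult[symmetric] algebra_simps flip: exp_of_nat_mult)
    also have "\<dots> \<le> exp ((6 + S + pi + 2 * l) * (1 + norm w))"
      using S by (simp add: algebra_simps l_def)
    finally show "norm (hurwitz_K w (of_real x)) \<le> exp ((6 + S + pi + 2 * l) * (1 + norm w))" .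
  qed
qed

section \<open>Characters and Gauss sums\<close>

locale dirichlet_char =
  fixes N :: nat and chi :: "int \<Rightarrow> complex"
  assumes character: "dirichlet_character N chi"
begin

lemma N_pos: "N > 0" using character by (simp add: dirichlet_character_def)

lemma chi_mult: "chi (a * b) = chi a * chi b"
  using character by (simp add: dirichlet_character_def)

lemma chi_eq_0_iff: "chi a = 0 \<longleftrightarrow> \<not> coprime a (int N)"
  using character unfolding dirichlet_character_def by blast

lemma chi_add_N: "chi (a + int N) = chi a"
  using character by (simp add: dirichlet_character_def)

lemma chi_add_mult_N: "chi (a + k * int N) = chi a"
proof (induction k rule: int_induct[where k = 0])
  case (step1 i)
  thus ?case using chi_add_N[of "a + i * int N"] by (simp add: algebra_simps)
next
  case (step2 i)
  thus ?case using chi_add_N[of "a + (i - 1) * int N"] by (simp add: algebra_simps)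
qed simp

lemma chi_cong: "[a = b] (mod int N) \<Longrightarrow> chi a = chi b"
  using chi_add_mult_N by (metis cong_iff_lin mult.commute)

lemma chi_1: "chi 1 = 1"
  using chi_mult[of 1 1] chi_eq_0_iff[of 1] by simp

lemma chi_minus_1_cases: "chi (-1) = 1 \<or> chi (-1) = -1"
proof -
  have "chi (-1) * chi (-1) = 1" using chi_mult[of "-1" "-1"] chi_1 by simp
  thus ?thesis by (simp add: square_eq_1_iff)
qed

lemma chi_minus: "chi (- a) = chi (-1) * chi a"
  using chi_mult[of "-1" a] by simp

text \<open>By periodicity the modulus takes finitely many values, hence has a maximum, attained at
  some b. As \<open>chi (b * b)\<close> has modulus |chi b|^2, the maximum cannot exceed 1.\<close>

lemma norm_chi_le_1: "norm (chi a) \<le> 1"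
proof -
  have fin: "finite (range (\<lambda>a. norm (chi a)))"
  proof -
    have "norm (chi a) \<in> (\<lambda>a. norm (chi a)) ` {0..<int N}" for a
      using chi_cong[of a "a mod int N"] N_pos by (intro image_eqI[of _ _ "a mod int N"]) (auto simp: cong_def)
    hence "range (\<lambda>a. norm (chi a)) \<subseteq> (\<lambda>a. norm (chi a)) ` {0..<int N}" by blast
    thus ?thesis by (rule finite_subset) simp
  qed
  obtain b where b: "\<And>a. norm (chi a) \<le> norm (chi b)"
  proof -
    have "Max (range (\<lambda>a. norm (chi a))) \<in> range (\<lambda>a. norm (chi a))" using fin by (intro Max_in) auto
    then obtain b where "Max (range (\<lambda>a. norm (chi a))) = norm (chi b)" by auto
    thus ?thesis using that[of b] Max_ge[OF fin] by fastforce
  qed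
  have "norm (chi b) > 0" using b[of 1] chi_1 by (metis less_le_trans norm_one zero_less_one)
  moreover have "norm (chi b) * norm (chi b) \<le> norm (chi b)" using b[of "b * b"] by (simp add: chi_mult norm_mult)
  ultimately have "norm (chi b) \<le> 1" by simp
  thus ?thesis using b[of a] by simp
qed

lemma chi_coprime_inverse:
  assumes "coprime a (int N)"
  obtains b where "coprime b (int N)" "[a * b = 1] (mod int N)"
  using assms by (metis cong_solve_coprime_int coprime_iff_invertible_int mult.commute)

lemma norm_chi_coprime:
  assumes "coprime a (int N)" shows "norm (chi a) = 1"
proof -
  obtain b where "[a * b = 1] (mod int N)" using chi_coprime_inverse[OF assms] by blast
  hence "chi a * chi b = 1" using chi_cong chi_mult chi_1 by metis
  hence *: "norm (chi a) * norm (chi b) = 1" by (metis norm_mult norm_one)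
  have "norm (chi a) * norm (chi b) \<le> norm (chi a) * 1" by (intro mult_left_mono norm_chi_le_1) auto
  thus ?thesis using norm_chi_le_1[of a] * by linarith
qed

lemma chi_cnj_coprime: "coprime a (int N) \<Longrightarrow> chi a * cnj (chi a) = 1"
  using norm_chi_coprime[of a] by (simp add: complex_norm_square[symmetric])

lemma cnj_char: "dirichlet_char N (\<lambda>a. cnj (chi a))"
  using character unfolding dirichlet_char_def dirichlet_character_def by simp

lemma sum_residues_mult:
  fixes f :: "int \<Rightarrow> complex"
  assumes per: "\<And>a b. [a = b] (mod int N) \<Longrightarrow> f a = f b" and c: "coprime c (int N)"
  shows "(\<Sum>b\<in>{0..<int N}. f (c * b)) = (\<Sum>b\<in>{0..<int N}. f b)"
proof -
  define g where "g = (\<lambda>b. (c * b) mod int N)"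
  have inj: "inj_on g {0..<int N}"
  proof (rule inj_onI)
    fix x y assume xy: "x \<in> {0..<int N}" "y \<in> {0..<int N}" "g x = g y"
    hence "[c * x = c * y] (mod int N)" by (simp add: g_def cong_def)
    hence "[x = y] (mod int N)" using c cong_mult_lcancel by blast
    thus "x = y" using xy by (auto simp: cong_def)
  qed
  have sub: "g ` {0..<int N} \<subseteq> {0..<int N}" using N_pos by (auto simp: g_def)
  have "g ` {0..<int N} = {0..<int N}" by (rule endo_inj_surj[OF _ sub inj]) simp
  hence "bij_betw g {0..<int N} {0..<int N}" using inj by (simp add: bij_betw_def)
  hence "(\<Sum>b\<in>{0..<int N}. f (g b)) = (\<Sum>b\<in>{0..<int N}. f b)" by (rule sum.reindex_bij_betw)
  moreover have "f (g b) = f (c * b)" for b by (rule per) (simp add: g_def cong_def)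
  ultimately show ?thesis by simp
qed

end

definition unit_root :: "nat \<Rightarrow> int \<Rightarrow> complex" where
  "unit_root N n = exp (2 * of_real pi * \<i> * of_int n / of_nat N)"

lemma unit_root_cong:
  assumes "N > 0" "[a = b] (mod int N)" shows "unit_root N a = unit_root N b"
proof -
  obtain k where "b = a + int N * k" using assms(2) by (metis cong_iff_lin)
  hence "unit_root N b = unit_root N a * exp (2 * of_real pi * \<i> * of_int k)"
  proof -
    have "2 * of_real pi * \<i> * of_int b / of_nat N = 2 * of_real pi * \<i> * of_int a / of_nat N + 2 * of_real pi * \<i> * (of_int k :: complex)"
      using assms(1) \<open>b = _\<close> by (simp add: field_simps)
    thus ?thesis by (simp add: unit_root_def exp_add)
  qed
  also have "exp (2 * of_real pi * \<i> * of_int k) = (1 :: complex)"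
    using exp_integer_2pi[of "of_int k"] by (simp add: mult_ac)
  finally show ?thesis by simp
qed

lemma coprime_lift_exists:
  fixes a :: int and M N :: int
  assumes "coprime a M" "N > 0"
  obtains a' where "[a' = a] (mod M)" "coprime a' N"
proof -
  \<comment> \<open>With k the product of the primes of N that do not divide a, every prime of N
    divides exactly one of a and k M, hence not their sum.\<close>
  define k where "k = \<Prod>{p\<in>prime_factors N. \<not> p dvd a}"
  have "coprime (a + k * M) N"
  proof (rule ccontr)
    assume "\<not> ?thesis"
    then obtain p where p: "prime p" "p dvd a + k * M" "p dvd N"
      using prime_factor_int[of "gcd (a + k * M) N"] by (auto simp: coprime_iff_gcd_eq_1)
    have pk: "p dvd k \<longleftrightarrow> \<not> p dvd a"
    proof
      assume "p dvd k"
      then obtain q where q: "q \<in> prime_factors N" "\<not> q dvd a" "p dvd q"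
        unfolding k_def using p(1) by (subst (asm) prime_dvd_prod_iff) auto
      hence "p = q" using p(1) by (metis in_prime_factors_imp_prime primes_dvd_imp_eq)
      thus "\<not> p dvd a" using q by simp
    next
      assume "\<not> p dvd a"
      hence "p \<in> {p\<in>prime_factors N. \<not> p dvd a}" using p assms(2) by (simp add: in_prime_factors_iff)
      thus "p dvd k" unfolding k_def by (intro dvd_prodI) auto
    qed
    show False
    proof (cases "p dvd a")
      case True
      hence "p dvd k * M" using p(2) by (simp add: dvd_add_right_iff)
      hence "p dvd M" using pk True p(1) prime_dvd_mult_iff by blast
      thus False using True assms(1) p(1) by (metis coprime_common_divisor not_prime_unit)
    next
      case False
      hence "p dvd k * M" using pk by simp
      thus False using False p(2) by (simp add: dvd_add_left_iff)
    qed
  qed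
  moreover have "[a + k * M = a] (mod M)" by (simp add: cong_def)
  ultimately show ?thesis using that by blast
qed

locale primitive_char = dirichlet_char +
  assumes N_ge_2: "N \<ge> 2" and primitive: "primitive_dirichlet_character N chi"
begin

text \<open>If chi were trivial on all units modulo N that are 1 modulo M, its values at units would
  depend only on the class modulo M, and chi would be induced from a character modulo the proper
  divisor M.\<close>

lemma primitive_witness:
  assumes M: "int M dvd int N" "M < N" "M > 0"
  obtains c where "coprime c (int N)" "[c = 1] (mod int M)" "chi c \<noteq> 1"
proof -
  have "\<exists>c. coprime c (int N) \<and> [c = 1] (mod int M) \<and> chi c \<noteq> 1"
  proof (rule ccontr)
    assume "\<not> ?thesis"
    hence triv: "chi c = 1" if "coprime c (int N)" "[c = 1] (mod int M)" for c using that by blast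
    have well: "chi a = chi b" if ab: "coprime a (int N)" "coprime b (int N)" "[a = b] (mod int M)" for a b
    proof -
      obtain b' where b': "coprime b' (int N)" "[b * b' = 1] (mod int N)" using chi_coprime_inverse[OF ab(2)] by blast
      have "[a * b' = b * b'] (mod int M)" using ab(3) by (rule cong_scalar_right)
      moreover have "[b * b' = 1] (mod int M)" using b'(2) M(1) by (rule cong_dvd_modulus)
      ultimately have "[a * b' = 1] (mod int M)" by (rule cong_trans)
      hence "chi (a * b') = 1" using ab b' by (intro triv) auto
      moreover have "chi (b * b') = 1" using b'(2) chi_cong chi_1 by metis
      ultimately have "chi a * chi b' = chi b * chi b'" by (simp add: chi_mult)
      thus ?thesis using b'(1) chi_eq_0_iff by simp
    qed
    \<comment> \<open>A chosen lift of a unit modulo M to a unit modulo N. By \<open>well\<close>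
      the value \<open>chi (l a)\<close> does not depend on the choice, which makes
      \<open>psi\<close> multiplicative.\<close>
    define l where "l = (\<lambda>a. SOME a'. [a' = a] (mod int M) \<and> coprime a' (int N))"
    have l: "[l a = a] (mod int M)" "coprime (l a) (int N)" if "coprime a (int M)" for a
    proof -
      have "\<exists>a'. [a' = a] (mod int M) \<and> coprime a' (int N)"
        using coprime_lift_exists[OF that, of "int N"] N_pos by (metis of_nat_0_less_iff)
      from someI_ex[OF this] show "[l a = a] (mod int M)" "coprime (l a) (int N)" by (simp_all add: l_def)
    qed
    define psi where "psi = (\<lambda>a. if coprime a (int M) then chi (l a) else 0)"
    have psi_eq: "psi a = chi b" if "coprime b (int N)" "[a = b] (mod int M)" "coprime a (int M)" for a b
      using that l[of a] well[of "l a" b] unfolding psi_def by (auto intro: cong_trans)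
    have "dirichlet_character M psi"
      unfolding dirichlet_character_def
    proof (intro conjI allI)
      fix a b
      show "psi (a * b) = psi a * psi b"
      proof (cases "coprime a (int M) \<and> coprime b (int M)")
        case True
        have "psi (a * b) = chi (l a * l b)"
          using True l[of a] l[of b] by (intro psi_eq) (auto intro!: cong_mult simp: cong_sym)
        thus ?thesis using True by (simp add: psi_def chi_mult)
      qed (auto simp: psi_def)
      show "psi (a + int M) = psi a"
      proof (cases "coprime a (int M)")
        case True
        have "coprime (a + int M) (int M)" using True by (simp add: coprime_iff_gcd_eq_1)
        hence "psi (a + int M) = chi (l a)"
          using True l[of a] by (intro psi_eq) (auto simp: cong_def)
        thus ?thesis using True by (simp add: psi_def)
      next
        case False
        hence "\<not> coprime (a + int M) (int M)" by (simp add: coprime_iff_gcd_eq_1)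
        thus ?thesis using False by (simp add: psi_def)
      qed
      show "psi a \<noteq> 0 \<longleftrightarrow> coprime a (int M)" using l(2)[of a] chi_eq_0_iff by (auto simp: psi_def)
    qed (use M in auto)
    moreover have "chi a = psi a" if "coprime a (int N)" for a
      using that coprime_divisors[of a a "int M" "int N"] M(1) psi_eq[of a a] by simp
    moreover have "M dvd N" using M(1) by simp
    ultimately show False using primitive M(2) unfolding primitive_dirichlet_character_def by blast
  qed
  thus ?thesis using that by blast
qed

definition gauss :: complex where
  "gauss = (\<Sum>b\<in>{0..<int N}. chi b * unit_root N b)"

text \<open>For n prime to N this is the substitution b -> n b. Otherwise let M = N / gcd(n, N) and
  take a unit c = 1 modulo M with chi c different from 1: then n c b = n b modulo N, so replacing b
  by c b multiplies the sum by chi c, and the sum is 0.\<close>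

lemma gauss_separable:
  "(\<Sum>b\<in>{0..<int N}. chi b * unit_root N (n * b)) = cnj (chi n) * gauss"
proof (cases "coprime n (int N)")
  case True
  have "chi n * (\<Sum>b\<in>{0..<int N}. chi b * unit_root N (n * b)) = (\<Sum>b\<in>{0..<int N}. chi (n * b) * unit_root N (n * b))"
    by (simp add: chi_mult sum_distrib_left mult_ac)
  also have "\<dots> = gauss" unfolding gauss_def
    by (rule sum_residues_mult[OF _ True]) (metis chi_cong unit_root_cong N_pos)
  finally have "cnj (chi n) * chi n * (\<Sum>b\<in>{0..<int N}. chi b * unit_root N (n * b)) = cnj (chi n) * gauss" by simp
  thus ?thesis using chi_cnj_coprime[OF True] by (simp add: mult.commute)
next
  case False
  define d where "d = gcd n (int N)"
  define M where "M = nat (int N div d)"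
  have d: "d > 1" using False N_pos by (metis d_def coprime_iff_gcd_eq_1 gcd_pos_int of_nat_0_less_iff less_irrefl zless_imp_add1_zle add_0 order_less_le zero_less_one_class.zero_less_one)
  have dN: "d dvd int N" by (simp add: d_def)
  have M: "int M * d = int N" using d dN by (simp add: M_def pos_imp_zdiv_nonneg_iff)
  have "int M > 0" using M d N_pos by (metis of_nat_0_less_iff zero_less_mult_pos2 order_less_trans zero_less_one)
  moreover have "int M < int N" using M d \<open>int M > 0\<close> by (metis mult.right_neutral mult_less_cancel_left_pos)
  ultimately obtain c where c: "coprime c (int N)" "[c = 1] (mod int M)" "chi c \<noteq> 1"
    using primitive_witness[of M] M by (metis dvd_triv_left of_nat_0_less_iff of_nat_less_iff)
  have cong: "[n * (c * b) = n * b] (mod int N)" for b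
  proof -
    have "int M dvd c - 1" using c(2) by (simp add: cong_iff_dvd_diff)
    moreover have "d dvd n" by (simp add: d_def)
    ultimately have "int M * d dvd (c - 1) * n" by (rule mult_dvd_mono)
    hence "int N dvd (c - 1) * n * b" using M by simp
    thus ?thesis by (simp add: cong_iff_dvd_diff algebra_simps)
  qed
  define S where "S = (\<Sum>b\<in>{0..<int N}. chi b * unit_root N (n * b))"
  have "S = (\<Sum>b\<in>{0..<int N}. chi (c * b) * unit_root N (n * (c * b)))"
    unfolding S_def by (rule sum_residues_mult[OF _ c(1), symmetric]) (metis chi_cong unit_root_cong N_pos cong_scalar_left)
  also have "\<dots> = chi c * S"
    using unit_root_cong[OF N_pos cong] by (simp add: S_def chi_mult sum_distrib_left mult_ac)
  finally have "S = 0" using c(3) by simp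
  moreover have "chi n = 0" using False chi_eq_0_iff by simp
  ultimately show ?thesis by (simp add: S_def)
qed

text \<open>The case n = 0 of separability, where chi 0 = 0 because N >= 2. It removes the pole of
  the L-function at 1.\<close>

lemma sum_chi: "(\<Sum>b\<in>{0..<int N}. chi b) = 0"
proof -
  have "\<not> coprime (0 :: int) (int N)" using N_ge_2 by simp
  hence "cnj (chi 0) = 0" using chi_eq_0_iff by simp
  thus ?thesis using gauss_separable[of 0] by (simp add: unit_root_def)
qed

lemma cnj_primitive: "primitive_char N (\<lambda>a. cnj (chi a))"
proof -
  interpret c: dirichlet_char N "\<lambda>a. cnj (chi a)" by (rule cnj_char)
  have "primitive_dirichlet_character N (\<lambda>a. cnj (chi a))"
    unfolding primitive_dirichlet_character_def
  proof (intro conjI notI c.character)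
    assume "\<exists>d \<psi>. d dvd N \<and> d < N \<and> dirichlet_character d \<psi> \<and> (\<forall>a. coprime a (int N) \<longrightarrow> cnj (chi a) = \<psi> a)"
    then obtain d psi where *: "d dvd N" "d < N" "dirichlet_character d psi" "\<And>a. coprime a (int N) \<Longrightarrow> cnj (chi a) = psi a" by blast
    have "dirichlet_character d (\<lambda>a. cnj (psi a))" using *(3) unfolding dirichlet_character_def by simp
    moreover have "chi a = cnj (psi a)" if "coprime a (int N)" for a using *(4)[OF that] by (metis complex_cnj_cnj)
    ultimately show False using primitive *(1,2) unfolding primitive_dirichlet_character_def by blast
  qed
  thus ?thesis by unfold_locales (rule N_ge_2)
qed

end

section \<open>The functional equation\<close>

text \<open>Differentiation of the reflection formula for \<open>rGamma\<close>, a form in which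
  both sides are entire and no poles interfere.\<close>

lemma Digamma_reflection:
  fixes z :: complex
  assumes "z \<notin> \<int>"
  shows "Digamma (1 - z) - Digamma z = of_real pi * cos (of_real pi * z) / sin (of_real pi * z)"
proof -
  have nz: "z \<notin> \<int>\<^sub>\<le>\<^sub>0" "1 - z \<notin> \<int>\<^sub>\<le>\<^sub>0"
    using assms by (auto elim!: nonpos_Ints_cases) (metis Ints_1 Ints_diff Ints_of_int diff_diff_cancel add_diff_cancel_left' diff_add_cancel minus_diff_eq)
  have sin: "sin (of_real pi * z) \<noteq> 0"
    using assms by (auto simp: sin_eq_0)
  have d1: "((\<lambda>z. rGamma z * rGamma (1 - z)) has_field_derivative (- rGamma z * Digamma z) * rGamma (1 - z) + (- rGamma (1 - z) * Digamma (1 - z)) * (-1) * rGamma z) (at z)"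
    using nz by (auto intro!: derivative_eq_intros simp: algebra_simps)
  have eq: "(\<lambda>z. rGamma z * rGamma (1 - z)) = (\<lambda>z :: complex. sin (of_real pi * z) / of_real pi)"
    by (simp add: rGamma_reflection_complex)
  have d2: "((\<lambda>z :: complex. sin (of_real pi * z) / of_real pi) has_field_derivative cos (of_real pi * z)) (at z)"
    by (auto intro!: derivative_eq_intros)
  have "(- rGamma z * Digamma z) * rGamma (1 - z) + (- rGamma (1 - z) * Digamma (1 - z)) * (-1) * rGamma z = cos (of_real pi * z)"
    by (rule DERIV_unique[OF d1[unfolded eq] d2])
  hence "(rGamma z * rGamma (1 - z)) * (Digamma (1 - z) - Digamma z) = cos (of_real pi * z)"
    by (simp add: algebra_simps)
  thus ?thesis using sin by (simp add: rGamma_reflection_complex field_simps)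
qed

lemma Trigamma_reflection:
  fixes z :: complex
  assumes "z \<notin> \<int>"
  shows "Polygamma 1 z + Polygamma 1 (1 - z) = of_real pi ^ 2 / sin (of_real pi * z) ^ 2"
proof -
  have nz: "z \<notin> \<int>\<^sub>\<le>\<^sub>0" "1 - z \<notin> \<int>\<^sub>\<le>\<^sub>0"
    using assms by (auto elim!: nonpos_Ints_cases) (metis Ints_1 Ints_diff Ints_of_int diff_diff_cancel add_diff_cancel_left' diff_add_cancel minus_diff_eq)
  have sin: "sin (of_real pi * z) \<noteq> 0"
    using assms by (auto simp: sin_eq_0)
  have 1: "((\<lambda>z. Digamma (1 - z) - Digamma z) has_field_derivative (- Polygamma 1 (1 - z) - Polygamma 1 z)) (at z)"
    using nz by (auto intro!: derivative_eq_intros)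
  have 2: "((\<lambda>z. of_real pi * cos (of_real pi * z) / sin (of_real pi * z)) has_field_derivative - (of_real pi ^ 2 / sin (of_real pi * z) ^ 2)) (at z)"
  proof -
    have "((\<lambda>z. of_real pi * cos (of_real pi * z) / sin (of_real pi * z)) has_field_derivative
       ((- (of_real pi ^ 2) * sin (of_real pi * z)) * sin (of_real pi * z) - of_real pi * cos (of_real pi * z) * (of_real pi * cos (of_real pi * z))) / sin (of_real pi * z) ^ 2) (at z)"
      using sin by (auto intro!: derivative_eq_intros simp: power2_eq_square)
    also have "(- (of_real pi ^ 2) * sin (of_real pi * z)) * sin (of_real pi * z) - of_real pi * cos (of_real pi * z) * (of_real pi * cos (of_real pi * z))
      = - (of_real pi ^ 2) * (sin (of_real pi * z) ^ 2 + cos (of_real pi * z) ^ 2)" by algebra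
    finally show ?thesis by simp
  qed
  have "\<forall>\<^sub>F u in nhds z. u \<in> - (\<int> :: complex set)"
    using assms closed_Ints by (intro eventually_nhds_in_open) (auto simp: open_Compl)
  hence "\<forall>\<^sub>F u in nhds z. Digamma (1 - u) - Digamma u = of_real pi * cos (of_real pi * u) / sin (of_real pi * u)"
    by eventually_elim (use Digamma_reflection in auto)
  from DERIV_cong_ev[OF refl this refl] 1
  have "((\<lambda>z. of_real pi * cos (of_real pi * z) / sin (of_real pi * z)) has_field_derivative (- Polygamma 1 (1 - z) - Polygamma 1 z)) (at z)" by simp
  with 2 have "- Polygamma 1 (1 - z) - Polygamma 1 z = - (of_real pi ^ 2 / sin (of_real pi * z) ^ 2)" by (rule DERIV_unique[symmetric])
  thus ?thesis by (simp add: algebra_simps)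
qed

lemma has_sum_int_halves:
  fixes f :: "int \<Rightarrow> 'a :: banach"
  assumes "((\<lambda>n. f (int n)) has_sum a) UNIV" "((\<lambda>n. f (- int (Suc n))) has_sum b) UNIV"
  shows "(f has_sum (a + b)) UNIV"
proof -
  have 1: "(f has_sum a) (range int)"
    using assms(1) by (subst has_sum_reindex) (auto simp: o_def inj_on_def)
  have 2: "(f has_sum b) (range (\<lambda>n. - int (Suc n)))"
    using assms(2) by (subst has_sum_reindex) (auto simp: o_def inj_on_def)
  have "(UNIV :: int set) = range int \<union> range (\<lambda>n. - int (Suc n))"
  proof (rule UNIV_eq_I)
    fix x :: int
    show "x \<in> range int \<union> range (\<lambda>n. - int (Suc n))" by (cases x rule: int_cases) auto
  qed
  moreover have "range int \<inter> range (\<lambda>n. - int (Suc n)) = {}" by auto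
  ultimately show ?thesis using has_sum_Un_disjoint[OF 1 2] by simp
qed

text \<open>Each half of the two-sided sum is a trigamma value, at z and at 1 - z, and reflection
  evaluates their total. With the exponent 2 both halves converge absolutely, so no symmetric
  summation is involved.\<close>

lemma inverse_squares_has_sum:
  fixes z :: complex
  assumes "z \<notin> \<int>"
  shows "((\<lambda>k::int. 1 / (z + of_int k) ^ 2) has_sum (of_real pi ^ 2 / sin (of_real pi * z) ^ 2)) UNIV"
proof -
  have half: "((\<lambda>n::nat. 1 / (u + of_nat n) ^ 2) has_sum Polygamma 1 u) UNIV" if "u \<notin> \<int>" for u :: complex
  proof -
    have nz: "u \<noteq> 0" using that by auto
    have "summable (\<lambda>n. norm (1 / (u + of_nat n) ^ 2))"
    proof (rule summable_comparison_test_ev)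
      show "summable (\<lambda>n. 4 * inverse (real n ^ 2))" by (intro summable_mult inverse_power_summable) auto
      obtain n0 where n0: "real n0 \<ge> 2 * norm u" using real_arch_simple by blast
      show "\<forall>\<^sub>F n in sequentially. norm (norm (1 / (u + of_nat n) ^ 2)) \<le> 4 * inverse (real n ^ 2)"
        using eventually_ge_at_top[of "max n0 1"]
      proof eventually_elim
        case (elim n)
        hence n: "real n \<ge> 2 * norm u" "real n > 0" using n0 by auto
        have "real n = norm (of_nat n :: complex)" by simp
        also have "\<dots> \<le> norm (u + of_nat n) + norm u" by (metis add_diff_cancel_left' norm_triangle_ineq4)
        finally have "real n / 2 \<le> norm (u + of_nat n)" using n by simp
        hence "(real n / 2) ^ 2 \<le> norm (u + of_nat n) ^ 2" using n by (intro power_mono) auto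
        hence "1 / norm (u + of_nat n) ^ 2 \<le> 1 / (real n / 2) ^ 2" using n by (intro divide_left_mono) (auto intro!: mult_pos_pos zero_less_power intro: less_le_trans[of _ "(real n / 2) ^ 2"])
        thus ?case by (simp add: norm_divide norm_power field_simps)
      qed
    qed
    moreover have "(\<lambda>n. 1 / (u + of_nat n) ^ 2) sums Polygamma 1 u"
      using Polygamma_LIMSEQ[OF nz, of 1] by (simp add: numeral_2_eq_2 inverse_eq_divide)
    ultimately show ?thesis by (intro norm_summable_imp_has_sum)
  qed
  have "1 - z \<notin> \<int>" using assms by (metis Ints_1 Ints_diff diff_diff_cancel add_diff_cancel_left' diff_add_cancel minus_diff_eq cancel_ab_semigroup_add_class.diff_right_commute diff_diff_eq2 add.commute)
  from half[OF this] have b: "((\<lambda>n. 1 / (z + of_int (- int (Suc n))) ^ 2) has_sum Polygamma 1 (1 - z)) UNIV"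
    by (rule has_sum_cong[THEN iffD1, rotated]) (simp add: power2_commute[of z] power2_eq_square algebra_simps)
  have a: "((\<lambda>n. 1 / (z + of_int (int n)) ^ 2) has_sum Polygamma 1 z) UNIV" using half[OF assms] by simp
  show ?thesis using has_sum_int_halves[OF a b] unfolding Trigamma_reflection[OF assms] .
qed

lemma lipschitz_formula:
  fixes z :: complex
  assumes z: "Re z > 0"
  shows "((\<lambda>k::int. 1 / (z - 2 * of_real pi * \<i> * of_int k) ^ 2) has_sum (exp (- z) / (1 - exp (- z)) ^ 2)) UNIV"
proof -
  \<comment> \<open>Chosen so that z - 2 \<pi> i k = -2 \<pi> i (u + k), which turns the sum into
    the partial fraction expansion of 1 / sin^2.\<close>
  define u where "u = \<i> * z / (2 * of_real pi)"
  have Imu: "Im u = Re z / (2 * pi)" unfolding u_def using Im_divide_of_real[of "\<i> * z" "2 * pi"] by simp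
  have u: "u \<notin> \<int>" using z Imu by (auto elim!: Ints_cases)
  have ne: "exp (- z) \<noteq> 1"
  proof
    assume "exp (- z) = 1"
    hence "norm (exp (- z)) = 1" by simp
    thus False using z by simp
  qed
  have e1: "1 / (z - 2 * of_real pi * \<i> * of_int k) ^ 2 = (- 1 / (2 * of_real pi) ^ 2) * (1 / (u + of_int k) ^ 2)" for k
  proof -
    have "z - 2 * of_real pi * \<i> * of_int k = (- 2 * of_real pi * \<i>) * (u + of_int k)"
      by (simp add: u_def field_simps)
    thus ?thesis by (simp add: power_mult_distrib)
  qed
  have e2: "of_real pi ^ 2 / sin (of_real pi * u) ^ 2 * (- 1 / (2 * of_real pi) ^ 2) = exp (- z) / (1 - exp (- z)) ^ 2"
  proof -
    have "sin (of_real pi * u) = (exp (- z / 2) - exp (z / 2)) / (2 * \<i>)"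
      by (simp add: sin_exp_eq u_def mult_ac) 
    hence "sin (of_real pi * u) ^ 2 = - ((exp (- z / 2) - exp (z / 2)) ^ 2) / 4"
      by (simp add: power_divide power_mult_distrib)
    also have "exp (- z / 2) - exp (z / 2) = exp (z / 2) * (exp (- z) - 1)"
      by (simp add: algebra_simps exp_add[symmetric])
    also have "(exp (z / 2) * (exp (- z) - 1)) ^ 2 = exp z * (1 - exp (- z)) ^ 2"
      by (simp add: power_mult_distrib power2_commute exp_double[symmetric])
    finally have s: "sin (of_real pi * u) ^ 2 = - (exp z * (1 - exp (- z)) ^ 2) / 4" .
    show ?thesis unfolding s using ne by (simp add: field_simps exp_minus power_mult_distrib)
  qed
  show ?thesis
    using has_sum_cmult_left[OF inverse_squares_has_sum[OF u], of "- 1 / (2 * of_real pi) ^ 2"] unfolding e1 e2[symmetric]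
    by (simp only: mult.commute)
qed

lemma lipschitz_series:
  fixes z :: complex
  assumes z: "Re z > 0"
  shows "(\<lambda>n. of_nat (Suc n) * exp (- of_nat (Suc n) * z)) sums (exp (- z) / (1 - exp (- z)) ^ 2)"
proof -
  have "norm (exp (- z)) < 1" using z by simp
  from geometric_deriv_sums[OF this]
  have "(\<lambda>n. exp (- z) * (of_nat (Suc n) * exp (- z) ^ n)) sums (exp (- z) * (1 / (1 - exp (- z)) ^ 2))"
    by (rule sums_mult)
  moreover have "exp (- z) * (of_nat (Suc n) * exp (- z) ^ n) = of_nat (Suc n) * exp (- of_nat (Suc n) * z)" for n
  proof -
    have "- of_nat (Suc n) * z = of_nat (Suc n) * (- z)" by (simp only: mult_minus_left mult_minus_right)
    hence "exp (- of_nat (Suc n) * z) = exp (- z) ^ Suc n" by (simp only: exp_of_nat_mult)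
    thus ?thesis by (simp del: of_nat_Suc)
  qed
  ultimately show ?thesis by (simp only: mult_1_right times_divide_eq_right)
qed

lemma pole_quotient_holomorphic:
  assumes "f holomorphic_on S" "a \<in> S" "open S" "f a = 0"
  shows "(\<lambda>z. if z = a then deriv f a else f z / (z - a)) holomorphic_on S"
proof -
  have "(\<lambda>z. if z = a then deriv f a else (f z - f a) / (z - a)) holomorphic_on S"
    using assms by (intro pole_lemma) (auto simp: interior_open)
  thus ?thesis by (simp only: assms(4) diff_zero)
qed

section \<open>Continuation of the L-function to Re s > -1\<close>

context dirichlet_char
begin

lemma sum_chi_shift: "(\<Sum>a<N. chi (int (Suc a))) = (\<Sum>b\<in>{0..<int N}. chi b)"
proof -
  have "(\<Sum>b\<in>{0..<int N}. chi b) = (\<Sum>a<N. chi (int a))"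
    by (rule sum.reindex_bij_witness[of _ int nat]) auto
  moreover have "(\<Sum>a<N. chi (int (Suc a))) = (\<Sum>a<N. chi (int a)) + chi (int N) - chi 0"
    using sum.lessThan_Suc_shift[of "\<lambda>a. chi (int a)" N] by (simp add: algebra_simps)
  moreover have "chi (int N) = chi 0" using chi_add_N[of 0] by simp
  ultimately show ?thesis by simp
qed

definition L_term :: "complex \<Rightarrow> nat \<Rightarrow> complex" where
  "L_term s n = chi (int (Suc n)) / of_nat (Suc n) powr s"

lemma norm_L_term_le: "norm (L_term s n) \<le> real (Suc n) powr (- Re s)"
proof -
  have "norm (L_term s n) = norm (chi (int (Suc n))) * real (Suc n) powr (- Re s)"
    using norm_powr_real_powr[of "real (Suc n)" s] 
    by (simp add: L_term_def norm_divide norm_mult norm_inverse powr_minus divide_inverse del: of_nat_Suc)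
  also have "\<dots> \<le> 1 * real (Suc n) powr (- Re s)" by (intro mult_right_mono norm_chi_le_1) auto
  finally show ?thesis by simp
qed

lemma summable_Suc_powr: "a < -1 \<Longrightarrow> summable (\<lambda>n. real (Suc n) powr a)"
  using summable_shifted_powr[of 1 a] by (simp add: add.commute)

lemma L_term_norm_summable: "Re s > 1 \<Longrightarrow> summable (\<lambda>n. norm (L_term s n))"
  by (rule summable_comparison_test'[OF summable_Suc_powr[of "- Re s"], of 0]) (use norm_L_term_le in auto)

text \<open>This is (s - 1) L(s): splitting n by residue classes gives N^(-s) times Hurwitz zeta
  functions at a / N. The classes are represented by 1, ..., N rather than 0, ..., N - 1 because the
  Hurwitz parameter must be positive.\<close>

definition L_num :: "complex \<Rightarrow> complex" where
  "L_num s = of_nat N powr (- s) * (\<Sum>a<N. chi (int (Suc a)) * hurwitz_K s (of_nat (Suc a) / of_nat N))"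

definition L0 :: "complex \<Rightarrow> complex" where
  "L0 s = (if s = 1 then deriv L_num 1 else L_num s / (s - 1))"

lemma Re_frac_pos: "Re (of_nat (Suc a) / of_nat N) > 0"
  using N_pos Re_divide_of_real[of "of_nat (Suc a)" "real N"] by (simp del: of_nat_Suc)

lemma L_num_holomorphic: "L_num holomorphic_on {s. Re s > -1}"
  unfolding L_num_def using N_pos
  by (auto intro!: holomorphic_intros hurwitz_K_holomorphic Re_frac_pos simp del: of_nat_Suc)

text \<open>Blocks of N consecutive terms turn the series into N Hurwitz series, as the character is
  constant along each residue class.\<close>

lemma L0_sums:
  assumes s: "Re s > 1"
  shows "L_term s sums L0 s"
proof -
  define S where "S = suminf (L_term s)"
  have S: "L_term s sums S"
    unfolding S_def by (intro summable_sums summable_norm_cancel[OF L_term_norm_summable[OF s]])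
  have "(\<lambda>k. \<Sum>n\<in>{k * N..<k * N + N}. L_term s n) sums S"
    using S N_pos by (rule sums_group)
  also have "(\<lambda>k. \<Sum>n\<in>{k * N..<k * N + N}. L_term s n) =
     (\<lambda>k. of_nat N powr (- s) * (\<Sum>a<N. chi (int (Suc a)) * (of_nat (Suc a) / of_nat N + of_nat k) powr (- s)))"
  proof
    fix k
    have "(\<Sum>n\<in>{k * N..<k * N + N}. L_term s n) = (\<Sum>a<N. L_term s (k * N + a))"
      by (rule sum.reindex_bij_witness[of _ "\<lambda>a. k * N + a" "\<lambda>n. n - k * N"]) auto
    also have "\<dots> = (\<Sum>a<N. of_nat N powr (- s) * (chi (int (Suc a)) * (of_nat (Suc a) / of_nat N + of_nat k) powr (- s)))"
    proof (rule sum.cong[OF refl])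
      fix a assume "a \<in> {..<N}"
      have "chi (int (Suc (k * N + a))) = chi (int (Suc a))"
        using chi_add_mult_N[of "int (Suc a)" "int k"] by (simp add: algebra_simps)
      moreover have "(of_nat (Suc (k * N + a)) :: complex) = of_real (real N) * of_real (real (Suc a) / real N + real k)"
        using N_pos by (simp add: field_simps)
      hence "(of_nat (Suc (k * N + a)) :: complex) powr (- s) = of_real (real N) powr (- s) * of_real (real (Suc a) / real N + real k) powr (- s)"
        using N_pos by (simp only: powr_times_real[of "of_real (real N)"]) (subst powr_times_real, auto)
      ultimately show "L_term s (k * N + a) = of_nat N powr (- s) * (chi (int (Suc a)) * (of_nat (Suc a) / of_nat N + of_nat k) powr (- s))"
        by (simp add: L_term_def powr_minus divide_inverse mult_ac del: of_nat_Suc)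
    qed
    finally show "(\<Sum>n\<in>{k * N..<k * N + N}. L_term s n) = of_nat N powr (- s) * (\<Sum>a<N. chi (int (Suc a)) * (of_nat (Suc a) / of_nat N + of_nat k) powr (- s))"
      by (simp only: sum_distrib_left)
  qed
  finally have "(\<lambda>k. of_nat N powr (- s) * (\<Sum>a<N. chi (int (Suc a)) * (of_nat (Suc a) / of_nat N + of_nat k) powr (- s))) sums S" .
  moreover have "(\<lambda>k. of_nat N powr (- s) * (\<Sum>a<N. chi (int (Suc a)) * (of_nat (Suc a) / of_nat N + of_nat k) powr (- s))) sums
     (of_nat N powr (- s) * (\<Sum>a<N. chi (int (Suc a)) * (hurwitz_K s (of_nat (Suc a) / of_nat N) / (s - 1))))"
    by (intro sums_mult sums_sum hurwitz_sums Re_frac_pos s)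
  ultimately have "S = of_nat N powr (- s) * (\<Sum>a<N. chi (int (Suc a)) * (hurwitz_K s (of_nat (Suc a) / of_nat N) / (s - 1)))"
    by (rule sums_unique2)
  also have "\<dots> = L0 s"
  proof -
    have "s \<noteq> 1" using s by auto
    thus ?thesis by (simp add: L0_def L_num_def flip: sum_divide_distrib)
  qed
  finally show ?thesis using S by simp
qed

end

context primitive_char
begin

lemma L_num_1: "L_num 1 = 0"
  unfolding L_num_def using hurwitz_K_1[OF Re_frac_pos] sum_chi_shift sum_chi by (simp del: of_nat_Suc)

lemma L0_holomorphic: "L0 holomorphic_on {s. Re s > -1}"
  unfolding L0_def using pole_quotient_holomorphic[OF L_num_holomorphic _ open_Re_gt L_num_1] by simp

lemma L0_growth: "\<exists>C. \<forall>s. Re s \<ge> 1/2 \<longrightarrow> norm (L0 s) \<le> exp (C * (1 + norm s))"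
proof -
  have "\<exists>C. \<forall>s. Re s \<ge> 1/2 \<longrightarrow> norm (hurwitz_K s (of_nat (Suc a) / of_nat N)) \<le> exp (C * (1 + norm s))" for a
    using hurwitz_K_growth[of "real (Suc a) / real N"] N_pos by simp
  then obtain c where c: "\<And>a s. Re s \<ge> 1/2 \<Longrightarrow> norm (hurwitz_K s (of_nat (Suc a) / of_nat N)) \<le> exp (c a * (1 + norm s))"
    by metis
  define C1 where "C1 = (\<Sum>a<N. \<bar>c a\<bar>)"
  have num: "norm (L_num s) \<le> exp ((real N + C1) * (1 + norm s))" if s: "Re s \<ge> 1/2" for s
  proof -
    have "norm (of_nat N powr (- s)) = real N powr (- Re s)"
      using N_pos norm_powr_real_powr[of "real N" "- s"] by simp
    also have "\<dots> \<le> real N powr 0" using s N_pos by (intro powr_mono) auto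
    finally have 1: "norm (of_nat N powr (- s)) \<le> 1" using N_pos by simp
    have "norm (L_num s) \<le> 1 * (\<Sum>a<N. norm (chi (int (Suc a))) * norm (hurwitz_K s (of_nat (Suc a) / of_nat N)))"
      unfolding L_num_def norm_mult
      by (intro mult_mono 1 order.trans[OF norm_sum] sum_mono) (auto simp: norm_mult)
    also have "\<dots> \<le> 1 * (\<Sum>a<N. 1 * exp (C1 * (1 + norm s)))"
    proof (intro mult_left_mono sum_mono mult_mono norm_chi_le_1)
      fix a assume a: "a \<in> {..<N}"
      have "c a \<le> C1" unfolding C1_def using member_le_sum[of a "{..<N}" "\<lambda>a. \<bar>c a\<bar>"] a by force
      hence "c a * (1 + norm s) \<le> C1 * (1 + norm s)" by (intro mult_right_mono) auto
      thus "norm (hurwitz_K s (of_nat (Suc a) / of_nat N)) \<le> exp (C1 * (1 + norm s))"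
        using c[OF s, of a] by (meson exp_le_cancel_iff order.trans)
    qed auto
    also have "\<dots> = real N * exp (C1 * (1 + norm s))" by simp
    also have "\<dots> \<le> exp (real N * (1 + norm s)) * exp (C1 * (1 + norm s))"
    proof (intro mult_right_mono)
      have "real N * 1 \<le> real N * (1 + norm s)" by (intro mult_left_mono) auto
      thus "real N \<le> exp (real N * (1 + norm s))" using exp_ge_add_one_self[of "real N * (1 + norm s)"] by linarith
    qed auto
    finally show ?thesis by (simp add: exp_add[symmetric] algebra_simps)
  qed
  \<comment> \<open>Close to 1 the division by s - 1 destroys the bound inherited from
    \<open>L_num\<close>. On the unit disc about 1 compactness replaces it, and outside the divisor
    has modulus greater than 1.\<close>
  have "compact (L0 ` (cball 1 1 \<inter> {s. Re s \<ge> 1/2}))"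
  proof (intro compact_continuous_image holomorphic_on_imp_continuous_on)
    show "L0 holomorphic_on cball 1 1 \<inter> {s. 1 / 2 \<le> Re s}"
      by (rule holomorphic_on_subset[OF L0_holomorphic]) auto
    show "compact (cball 1 1 \<inter> {s. Re s \<ge> 1/2})"
      by (intro compact_Int_closed closed_halfspace_Re_ge) auto
  qed
  then obtain B where B: "\<And>s. s \<in> cball 1 1 \<Longrightarrow> Re s \<ge> 1/2 \<Longrightarrow> norm (L0 s) \<le> B"
    using compact_imp_bounded bounded_iff by (metis (mono_tags, lifting) IntI imageI mem_Collect_eq)
  define C where "C = \<bar>B\<bar> + real N + C1"
  have C1: "C1 \<ge> 0" unfolding C1_def by (rule sum_nonneg) auto
  show ?thesis
  proof (intro exI allI impI)
    fix s assume s: "Re s \<ge> 1/2"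
    show "norm (L0 s) \<le> exp (C * (1 + norm s))"
    proof (cases "s \<in> cball 1 1")
      case True
      have "norm (L0 s) \<le> B" using B[OF True s] .
      also have "B \<le> \<bar>B\<bar> * 1" by simp
      also have "\<dots> \<le> C * (1 + norm s)" unfolding C_def using C1 by (intro mult_mono) auto
      also have "\<dots> \<le> exp (C * (1 + norm s))" using exp_ge_add_one_self[of "C * (1 + norm s)"] by linarith
      finally show ?thesis .
    next
      case False
      hence far: "norm (s - 1) > 1" by (auto simp: dist_norm norm_minus_commute)
      hence "s \<noteq> 1" by auto
      hence "norm (L0 s) = norm (L_num s) / norm (s - 1)" by (simp add: L0_def norm_divide)
      also have "\<dots> \<le> norm (L_num s) / 1" using far by (intro divide_left_mono) auto
      also have "\<dots> \<le> exp ((real N + C1) * (1 + norm s))" using num[OF s] by simp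
      also have "\<dots> \<le> exp (C * (1 + norm s))" unfolding C_def by (simp add: mult_right_mono)
      finally show ?thesis .
    qed
  qed
qed

end

section \<open>Two evaluations of one Mellin transform\<close>

lemma Gamma_integral_scaled_real:
  fixes a y :: real
  assumes a: "a > -1" and y: "y > 0"
  shows "integrable lborel (\<lambda>t. indicator {0<..} t * (t powr a * exp (- (y * t))))"
    and "(LINT t|lborel. indicator {0<..} t * (t powr a * exp (- (y * t)))) = Gamma (a + 1) * y powr (- a - 1)"
proof -
  define f where "f = (\<lambda>t. indicator {0<..} t * (t powr a * exp (- (y * t))))"
  have eq: "indicator {0<..} t *\<^sub>R (of_real t powr (of_real (a + 1) - 1) * exp (- complex_of_real (y * t))) = of_real (f t)" for t
  proof (cases "t > 0")
    case True
    have "exp (- complex_of_real (y * t)) = of_real (exp (- (y * t)))" by (metis exp_of_real of_real_minus)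
    thus ?thesis using True powr_of_real[of t a] by (simp add: f_def)
  qed (simp add: f_def)
  have "integrable lborel (\<lambda>t. complex_of_real (f t))"
    using Gamma_integral_scaled(1)[of "of_real (a + 1)" y] a y by (simp only: set_integrable_def eq) simp
  from integrable_Re[OF this] show "integrable lborel f" by simp
  have "complex_of_real (LINT t|lborel. f t) = (LINT t|lborel. complex_of_real (f t))" by simp
  also have "\<dots> = Gamma (of_real (a + 1)) * of_real y powr (- of_real (a + 1))"
    using Gamma_integral_scaled(2)[of "of_real (a + 1)" y] a y by (simp only: set_lebesgue_integral_def eq) simp
  also have "\<dots> = of_real (Gamma (a + 1) * y powr (- a - 1))"
    using y powr_of_real[of y "- (a + 1)"] by (simp only: Gamma_complex_of_real) simp
  finally show "(LINT t|lborel. f t) = Gamma (a + 1) * y powr (- a - 1)" by (simp only: of_real_eq_iff)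
qed

lemma mellin_shifted_power_abs:
  fixes a c :: real and k :: nat
  assumes a: "-1 < a" "a < real k - 1" and c: "c > 0"
  shows "integrable lborel (\<lambda>t. indicator {0<..} t * (t powr a / (t + c) ^ k))"
    and "(LINT t|lborel. indicator {0<..} t * (t powr a / (t + c) ^ k)) =
      Gamma (a + 1) * Gamma (real k - 1 - a) / Gamma (real k) * c powr (- (real k - 1 - a))"
proof -
  define f where "f = (\<lambda>t. indicator {0<..} t * (t powr a / (t + c) ^ k))"
  define w where "w = complex_of_real (real k - 1 - a)"
  have w: "0 < Re w" "Re w < real k" using a by (auto simp: w_def)
  have eq: "indicator {0<..} t *\<^sub>R (of_real t powr (of_nat k - 1 - w) / (of_real t + of_real c) ^ k) = complex_of_real (f t)" for t
  proof (cases "t > 0")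
    case True
    have "of_nat k - 1 - w = of_real a" by (simp add: w_def)
    thus ?thesis using True powr_of_real[of t a] by (simp add: f_def)
  qed (simp add: f_def)
  have "integrable lborel (\<lambda>t. complex_of_real (f t))"
    using mellin_shifted_power_real(1)[OF w c] by (simp only: set_integrable_def eq)
  from integrable_Re[OF this] show "integrable lborel f" by simp
  have "complex_of_real (LINT t|lborel. f t) = (LINT t|lborel. complex_of_real (f t))" by simp
  also have "\<dots> = Gamma (of_nat k - w) * Gamma w / Gamma (of_nat k) * of_real c powr (- w)"
    using mellin_shifted_power_real(2)[OF w c] by (simp only: set_lebesgue_integral_def eq)
  also have "\<dots> = of_real (Gamma (a + 1) * Gamma (real k - 1 - a) / Gamma (real k) * c powr (- (real k - 1 - a)))"
  proof -
    have "of_nat k - w = of_real (a + 1)" by (simp add: w_def)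
    moreover have "of_real c powr (- w) = complex_of_real (c powr (- (real k - 1 - a)))"
      using c powr_of_real[of c "- (real k - 1 - a)"] by (simp add: w_def)
    moreover have "Gamma (of_nat k :: complex) = of_real (Gamma (real k))"
      by (metis Gamma_complex_of_real of_real_of_nat_eq)
    moreover have "Gamma w = of_real (Gamma (real k - 1 - a))" by (simp only: w_def Gamma_complex_of_real)
    ultimately show ?thesis by (simp only: Gamma_complex_of_real) simp
  qed
  finally show "(LINT t|lborel. f t) = Gamma (a + 1) * Gamma (real k - 1 - a) / Gamma (real k) * c powr (- (real k - 1 - a))"
    by (simp only: of_real_eq_iff)
qed

lemma has_sum_int_imp_sums:
  fixes f :: "int \<Rightarrow> complex"
  assumes f: "(f has_sum S) UNIV" and f0: "f 0 = 0"
  shows "(\<lambda>n. f (int (Suc n)) + f (- int (Suc n))) sums S"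
proof -
  define A where "A = range (\<lambda>n. int (Suc n))"
  define B where "B = range (\<lambda>n. - int (Suc n))"
  have summ: "f summable_on X" for X
    using f by (meson has_sum_imp_summable summable_on_subset_banach subset_UNIV)
  have A: "(f has_sum (infsum f A)) A" and B: "(f has_sum (infsum f B)) B"
    using summ by (auto intro: has_sum_infsum)
  have "A \<inter> B = {}" by (auto simp: A_def B_def)
  from has_sum_Un_disjoint[OF A B this] have "(f has_sum (infsum f A + infsum f B)) (A \<union> B)" .
  moreover have "x = 0" if "x \<notin> A \<union> B" for x
    using that by (cases x rule: int_cases3) (auto simp: A_def B_def image_iff dest: gr0_implies_Suc)
  hence "(f has_sum (infsum f A + infsum f B)) (A \<union> B) \<longleftrightarrow> (f has_sum (infsum f A + infsum f B)) UNIV"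
    using f0 by (intro has_sum_cong_neutral) auto
  ultimately have "(f has_sum (infsum f A + infsum f B)) UNIV" by blast
  hence S: "S = infsum f A + infsum f B" using f has_sum_unique by blast
  have "((\<lambda>n. f (int (Suc n))) has_sum (infsum f A)) UNIV"
    using A unfolding A_def by (subst (asm) has_sum_reindex) (auto simp: o_def inj_on_def)
  moreover have "((\<lambda>n. f (- int (Suc n))) has_sum (infsum f B)) UNIV"
    using B unfolding B_def by (subst (asm) has_sum_reindex) (auto simp: o_def inj_on_def)
  ultimately show ?thesis unfolding S by (intro sums_add has_sum_imp_sums)
qed

lemma powr_mult_of_real_left:
  fixes z a :: complex
  assumes "c > 0" shows "(of_real c * z) powr a = of_real c powr a * z powr a"
proof (cases "z = 0")
  case False
  have "Ln (of_real c * z) = of_real (ln c) + Ln z" using assms False Ln_of_real[OF assms] by (simp add: Ln_times_of_real)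
  thus ?thesis using assms False Ln_of_real[OF assms] by (simp add: powr_def exp_add ring_distribs)
qed simp

context primitive_char
begin

interpretation c: primitive_char N "\<lambda>a. cnj (chi a)" by (rule cnj_primitive)

text \<open>
  The Mellin transform of this function is computed twice, from its expansion in exponentials and from its
  expansion in poles (Lipschitz's formula).
\<close>

definition lipschitz_sum :: "real \<Rightarrow> complex" where
  "lipschitz_sum t = (\<Sum>b\<in>{0..<int N}. cnj (chi b) *
     (exp (- (of_real t - 2 * of_real pi * \<i> * of_int b / of_nat N)) /
       (1 - exp (- (of_real t - 2 * of_real pi * \<i> * of_int b / of_nat N))) ^ 2))"

text \<open>The derivative of the geometric series supplies the weight n, and separability of the
  Gauss sum of the conjugate character turns the combination of roots of unity into chi n.\<close>

lemma lipschitz_sum_series: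
  assumes t: "t > 0"
  shows "(\<lambda>n. c.gauss * (of_nat (Suc n) * chi (int (Suc n)) * exp (- of_real (real (Suc n) * t)))) sums lipschitz_sum t"
proof -
  define z where "z = (\<lambda>b::int. complex_of_real t - 2 * of_real pi * \<i> * of_int b / of_nat N)"
  have "Re (z b) = t" for b
    using Re_divide_of_real[of "2 * of_real pi * \<i> * of_int b" "real N"] by (simp add: z_def)
  hence "Re (z b) > 0" for b using t by simp
  hence "(\<lambda>n. \<Sum>b\<in>{0..<int N}. cnj (chi b) * (of_nat (Suc n) * exp (- of_nat (Suc n) * z b))) sums lipschitz_sum t"
    unfolding lipschitz_sum_def z_def by (intro sums_sum sums_mult lipschitz_series)
  also have "(\<lambda>n. \<Sum>b\<in>{0..<int N}. cnj (chi b) * (of_nat (Suc n) * exp (- of_nat (Suc n) * z b))) =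
     (\<lambda>n. c.gauss * (of_nat (Suc n) * chi (int (Suc n)) * exp (- of_real (real (Suc n) * t))))"
  proof
    fix n
    have "exp (- of_nat (Suc n) * z b) = exp (- of_real (real (Suc n) * t)) * unit_root N (int (Suc n) * b)" for b
    proof -
      have "- of_nat (Suc n) * z b = - of_real (real (Suc n) * t) + 2 * of_real pi * \<i> * of_int (int (Suc n) * b) / of_nat N"
        using N_pos by (simp add: z_def field_simps)
      thus ?thesis by (simp only: exp_add unit_root_def)
    qed
    hence "(\<Sum>b\<in>{0..<int N}. cnj (chi b) * (of_nat (Suc n) * exp (- of_nat (Suc n) * z b))) =
       (of_nat (Suc n) * exp (- of_real (real (Suc n) * t))) * (\<Sum>b\<in>{0..<int N}. cnj (chi b) * unit_root N (int (Suc n) * b))"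
      by (simp only: sum_distrib_left mult_ac)
    also have "\<dots> = c.gauss * (of_nat (Suc n) * chi (int (Suc n)) * exp (- of_real (real (Suc n) * t)))"
      unfolding c.gauss_separable complex_cnj_cnj by (simp only: mult_ac)
    finally show "(\<Sum>b\<in>{0..<int N}. cnj (chi b) * (of_nat (Suc n) * exp (- of_nat (Suc n) * z b))) =
       c.gauss * (of_nat (Suc n) * chi (int (Suc n)) * exp (- of_real (real (Suc n) * t)))" .
  qed
  finally show ?thesis .
qed

definition pole_term :: "nat \<Rightarrow> real \<Rightarrow> complex" where
  "pole_term n t = cnj (chi (int (Suc n))) / (of_real t + of_real (2 * pi * real (Suc n) / real N) * (- \<i>)) ^ 2 +
     cnj (chi (- int (Suc n))) / (of_real t + of_real (2 * pi * real (Suc n) / real N) * \<i>) ^ 2"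

text \<open>Applying Lipschitz's formula to every residue b makes b + k N run through all integers
  exactly once. The term m = 0 drops out because chi 0 = 0, so there is no pole at t = 0; this is
  why the Mellin integral converges for Re s > -1.\<close>

lemma lipschitz_sum_poles:
  assumes t: "t > 0"
  shows "(\<lambda>n. pole_term n t) sums lipschitz_sum t"
proof -
  define f where "f = (\<lambda>m::int. cnj (chi m) * (1 / (complex_of_real t - 2 * of_real pi * \<i> * of_int m / of_nat N) ^ 2))"
  define z where "z = (\<lambda>b::int. complex_of_real t - 2 * of_real pi * \<i> * of_int b / of_nat N)"
  define E where "E = (\<lambda>b. exp (- z b) / (1 - exp (- z b)) ^ 2)"
  have "Re (z b) = t" for b
    using Re_divide_of_real[of "2 * of_real pi * \<i> * of_int b" "real N"] by (simp add: z_def)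
  hence Rez: "Re (z b) > 0" for b using t by simp
  have 1: "(f has_sum cnj (chi b) * E b) (range (\<lambda>k. b + k * int N))" for b
  proof -
    have "((\<lambda>k. cnj (chi b) * (1 / (z b - 2 * of_real pi * \<i> * of_int k) ^ 2)) has_sum cnj (chi b) * E b) UNIV"
      unfolding E_def by (rule has_sum_cmult_right[OF lipschitz_formula[OF Rez]])
    also have "(\<lambda>k. cnj (chi b) * (1 / (z b - 2 * of_real pi * \<i> * of_int k) ^ 2)) = (\<lambda>k. f (b + k * int N))"
    proof
      fix k
      have "z b - 2 * of_real pi * \<i> * of_int k = complex_of_real t - 2 * of_real pi * \<i> * of_int (b + k * int N) / of_nat N"
        using N_pos by (simp add: z_def field_simps)
      thus "cnj (chi b) * (1 / (z b - 2 * of_real pi * \<i> * of_int k) ^ 2) = f (b + k * int N)"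
        by (simp only: f_def chi_add_mult_N)
    qed
    finally show ?thesis
      using N_pos by (subst has_sum_reindex) (auto simp: o_def inj_on_def)
  qed
  have "(f has_sum (\<Sum>b\<in>{0..<int N}. cnj (chi b) * E b)) (\<Union>b\<in>{0..<int N}. range (\<lambda>k. b + k * int N))"
  proof (rule sum_has_sum)
    show "range (\<lambda>k. b + k * int N) \<inter> range (\<lambda>k. b' + k * int N) = {}"
      if "b \<in> {0..<int N}" "b' \<in> {0..<int N}" "b \<noteq> b'" for b b'
    proof (rule ccontr)
      assume "\<not> ?thesis"
      then obtain k k' where "b + k * int N = b' + k' * int N" by auto
      hence "b mod int N = b' mod int N" by (metis mod_mult_self1)
      thus False using that by auto
    qed
  qed (use 1 in auto)
  moreover have "(\<Union>b\<in>{0..<int N}. range (\<lambda>k. b + k * int N)) = UNIV"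
  proof (rule UNIV_eq_I[symmetric])
    fix x
    have "x = x mod int N + (x div int N) * int N" by simp
    moreover have "x mod int N \<in> {0..<int N}" using N_pos by simp
    ultimately show "x \<in> (\<Union>b\<in>{0..<int N}. range (\<lambda>k. b + k * int N))" by blast
  qed
  moreover have "(\<Sum>b\<in>{0..<int N}. cnj (chi b) * E b) = lipschitz_sum t"
    by (simp only: lipschitz_sum_def E_def z_def)
  ultimately have "(f has_sum lipschitz_sum t) UNIV" by simp
  moreover have "f 0 = 0" using chi_eq_0_iff[of 0] N_ge_2 by (simp add: f_def)
  ultimately have "(\<lambda>n. f (int (Suc n)) + f (- int (Suc n))) sums lipschitz_sum t" by (rule has_sum_int_imp_sums)
  also have "(\<lambda>n. f (int (Suc n)) + f (- int (Suc n))) = (\<lambda>n. pole_term n t)"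
    by (simp add: fun_eq_iff f_def pole_term_def mult_ac del: of_nat_Suc)
  finally show ?thesis .
qed

lemma norm_pole_term_le:
  assumes t: "t \<ge> 0"
  defines "d \<equiv> \<lambda>n. 2 * pi * real (Suc n) / real N"
  shows "norm (pole_term n t) \<le> 4 * (1 / (t + d n) ^ 2)"
proof -
  have d: "d n > 0" using N_pos by (simp add: d_def del: of_nat_Suc)
  have one: "norm (x / (of_real t + of_real (d n) * y) ^ 2) \<le> 2 * (1 / (t + d n) ^ 2)"
    if "norm x \<le> 1" "y = \<i> \<or> y = - \<i>" for x y :: complex
  proof -
    have "norm (of_real t + of_real (d n) * y) ^ 2 = t ^ 2 + d n ^ 2"
      using that(2) by (auto simp: cmod_power2)
    moreover have "2 * (t ^ 2 + d n ^ 2) \<ge> (t + d n) ^ 2"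
      using sum_squares_ge_zero[of "t - d n" 0] by (simp add: power2_eq_square algebra_simps)
    ultimately have ge: "norm (of_real t + of_real (d n) * y) ^ 2 \<ge> (t + d n) ^ 2 / 2" by simp
    have "norm (x / (of_real t + of_real (d n) * y) ^ 2) = norm x / norm (of_real t + of_real (d n) * y) ^ 2"
      by (simp add: norm_divide norm_power)
    also have "\<dots> \<le> 1 / ((t + d n) ^ 2 / 2)"
      using that(1) ge d t by (intro frac_le) auto
    finally show ?thesis by simp
  qed
  have "pole_term n t = cnj (chi (int (Suc n))) / (of_real t + of_real (d n) * (- \<i>)) ^ 2 + cnj (chi (- int (Suc n))) / (of_real t + of_real (d n) * \<i>) ^ 2"
    by (simp only: pole_term_def d_def)
  also have "norm \<dots> \<le> 2 * (1 / (t + d n) ^ 2) + 2 * (1 / (t + d n) ^ 2)"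
    by (intro order.trans[OF norm_triangle_ineq] add_mono one) (auto simp: norm_chi_le_1)
  finally show ?thesis by simp
qed

text \<open>Each expansion covers one range: the poles keep a distance from t > 0, which gives
  boundedness, and the exponential form gives the decay for t >= 1.\<close>

lemma lipschitz_sum_bound: "\<exists>B. \<forall>t>0. norm (lipschitz_sum t) \<le> B * exp (- t)"
proof -
  define d where "d = (\<lambda>n. 2 * pi * real (Suc n) / real N)"
  have d: "d n > 0" for n using N_pos by (simp add: d_def del: of_nat_Suc)
  have sumd: "summable (\<lambda>n. 4 * (1 / d n ^ 2))"
  proof -
    have "summable (\<lambda>n. real (Suc n) powr (-2))" by (rule summable_Suc_powr) simp
    hence "summable (\<lambda>n. (real N / (2 * pi)) ^ 2 * 4 * real (Suc n) powr (-2))" by (rule summable_mult)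
    also have "(\<lambda>n. (real N / (2 * pi)) ^ 2 * 4 * real (Suc n) powr (-2)) = (\<lambda>n. 4 * (1 / d n ^ 2))"
    proof
      fix n
      have "real (Suc n) powr (-2) = 1 / real (Suc n) ^ 2" by (simp add: powr_minus powr_numeral divide_inverse del: of_nat_Suc)
      thus "(real N / (2 * pi)) ^ 2 * 4 * real (Suc n) powr (-2) = 4 * (1 / d n ^ 2)"
        by (simp only: d_def) (simp add: power_mult_distrib power_divide del: of_nat_Suc)
    qed
    finally show ?thesis .
  qed
  define B1 where "B1 = (\<Sum>n. 4 * (1 / d n ^ 2))"
  have b1: "norm (lipschitz_sum t) \<le> B1" if t: "t > 0" for t
  proof -
    have le: "norm (pole_term n t) \<le> 4 * (1 / d n ^ 2)" for n
    proof -
      have "norm (pole_term n t) \<le> 4 * (1 / (t + d n) ^ 2)" using norm_pole_term_le[of t n] t by (simp add: d_def)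
      also have "\<dots> \<le> 4 * (1 / d n ^ 2)" using t d[of n] by (intro mult_left_mono divide_left_mono power_mono mult_pos_pos) auto
      finally show ?thesis .
    qed
    have "lipschitz_sum t = (\<Sum>n. pole_term n t)" using lipschitz_sum_poles[OF t] by (rule sums_unique)
    also have "norm \<dots> \<le> B1" unfolding B1_def by (rule norm_suminf_le[OF le sumd])
    finally show ?thesis .
  qed
  define q where "q = (1 - exp (-1 :: real)) ^ 2"
  have q: "q > 0" unfolding q_def by simp
  have b2: "norm (lipschitz_sum t) \<le> real N / q * exp (- t)" if t: "t \<ge> 1" for t
  proof -
    have "norm (lipschitz_sum t) \<le> (\<Sum>b\<in>{0..<int N}. 1 * (exp (- t) / q))"
      unfolding lipschitz_sum_def
    proof (intro order.trans[OF norm_sum] sum_mono)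
      fix b :: int
      define z where "z = complex_of_real t - 2 * of_real pi * \<i> * of_int b / of_nat N"
      have Rez: "Re z = t"
        using Re_divide_of_real[of "2 * of_real pi * \<i> * of_int b" "real N"] by (simp add: z_def)
      have "1 - exp (- 1) \<le> 1 - exp (- t)" using t by simp
      also have "\<dots> = norm (1 :: complex) - norm (exp (- z))" by (simp add: Rez)
      also have "\<dots> \<le> norm (1 - exp (- z))" by (rule norm_triangle_ineq2)
      finally have "q \<le> norm (1 - exp (- z)) ^ 2" unfolding q_def by (intro power_mono) auto
      hence "norm (exp (- z) / (1 - exp (- z)) ^ 2) \<le> exp (- t) / q"
        using q by (simp add: norm_divide norm_power Rez) (intro divide_left_mono mult_pos_pos; auto)
      thus "norm (cnj (chi b) * (exp (- (complex_of_real t - 2 * of_real pi * \<i> * of_int b / of_nat N)) /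
          (1 - exp (- (complex_of_real t - 2 * of_real pi * \<i> * of_int b / of_nat N))) ^ 2)) \<le> 1 * (exp (- t) / q)"
        unfolding z_def[symmetric] norm_mult by (intro mult_mono) (auto simp: norm_chi_le_1)
    qed
    thus ?thesis by simp
  qed
  show ?thesis
  proof (intro exI allI impI)
    fix t :: real assume t: "t > 0"
    show "norm (lipschitz_sum t) \<le> (exp 1 * B1 + real N / q) * exp (- t)"
    proof (cases "t \<ge> 1")
      case True
      have "0 \<le> B1" using b1[OF t] norm_ge_zero order.trans by blast
      hence "real N / q * exp (- t) \<le> (exp 1 * B1 + real N / q) * exp (- t)" by (intro mult_right_mono) auto
      thus ?thesis using b2[OF True] by linarith
    next
      case False
      have B1: "0 \<le> B1" using b1[OF t] norm_ge_zero order.trans by blast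
      have "norm (lipschitz_sum t) \<le> B1 * 1" using b1[OF t] by simp
      also have "\<dots> \<le> B1 * exp (1 - t)" using False B1 by (intro mult_left_mono) auto
      also have "\<dots> = (exp 1 * B1) * exp (- t)" by (simp add: exp_diff exp_minus divide_inverse)
      also have "\<dots> \<le> (exp 1 * B1 + real N / q) * exp (- t)" using q by (intro mult_right_mono) auto
      finally show ?thesis .
    qed
  qed
qed

lemma lipschitz_sum_continuous: "continuous_on {0<..} lipschitz_sum"
  unfolding lipschitz_sum_def
proof (intro continuous_intros ballI)
  fix b :: int and t :: real assume t: "t \<in> {0<..}"
  define z where "z = complex_of_real t - 2 * of_real pi * \<i> * of_int b / of_nat N"
  have Rez: "Re z = t"
    using Re_divide_of_real[of "2 * of_real pi * \<i> * of_int b" "real N"] by (simp add: z_def)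
  have "exp (- z) \<noteq> 1"
  proof
    assume "exp (- z) = 1"
    hence "norm (exp (- z)) = 1" by simp
    thus False using t Rez by simp
  qed
  thus "(1 - exp (- (complex_of_real t - 2 * of_real pi * \<i> * of_int b / of_nat N))) ^ 2 \<noteq> 0"
    unfolding z_def[symmetric] by simp
qed

definition mellin_integrand :: "complex \<Rightarrow> real \<Rightarrow> complex" where
  "mellin_integrand s t = indicator {0<..} t *\<^sub>R (of_real t powr s * lipschitz_sum t)"

lemma mellin_integrand_measurable [measurable]: "mellin_integrand s \<in> borel_measurable lborel"
proof -
  have "continuous_on {0<..} (\<lambda>t. of_real t powr s * lipschitz_sum t)"
    by (intro continuous_intros lipschitz_sum_continuous) auto
  thus ?thesis unfolding mellin_integrand_def measurable_lborel2
    by (intro borel_measurable_continuous_on_indicator) auto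
qed

lemma mellin_holomorphic: "(\<lambda>s. LINT t|lborel. mellin_integrand s t) holomorphic_on {s. Re s > -1}"
proof (rule holomorphic_on_lebesgue_integral[OF open_Re_gt _ mellin_integrand_measurable])
  show "(\<lambda>s. mellin_integrand s t) holomorphic_on {s. Re s > -1}" for t
    unfolding mellin_integrand_def by (cases "t > 0") (auto intro!: holomorphic_intros)
  fix s0 :: complex assume s0: "s0 \<in> {s. Re s > -1}"
  obtain B where B: "\<And>t. t > 0 \<Longrightarrow> norm (lipschitz_sum t) \<le> B * exp (- t)" using lipschitz_sum_bound by blast
  define r where "r = (Re s0 + 1) / 2"
  define a where "a = Re s0 - r"
  define b where "b = Re s0 + r"
  have r: "r > 0" and a: "a > -1" and b: "b > -1" using s0 by (auto simp: r_def a_def b_def field_simps)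
  \<comment> \<open>For s in the ball, t^(Re s) is at most t^a when t < 1 and at most t^b when t >=
    1, so the sum of both powers is a majorant independent of s.\<close>
  define g where "g = (\<lambda>t. B * (indicator {0<..} t * (t powr a * exp (- (1 * t))) + indicator {0<..} t * (t powr b * exp (- (1 * t)))))"
  have "integrable lborel g"
    unfolding g_def using a b
    by (intro integrable_mult_right Bochner_Integration.integrable_add Gamma_integral_scaled_real) auto
  moreover have "norm (mellin_integrand s t) \<le> g t" if s: "s \<in> ball s0 r" for s t
  proof (cases "t > 0")
    case True
    have "\<bar>Re s - Re s0\<bar> < r"
      using s abs_Re_le_cmod[of "s - s0"] by (simp add: dist_norm norm_minus_commute)
    hence ab: "a \<le> Re s" "Re s \<le> b" by (auto simp: a_def b_def)
    have "t powr Re s \<le> t powr a + t powr b"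
    proof (cases "t \<ge> 1")
      case True
      thus ?thesis using powr_mono[OF ab(2) True] by (simp add: add_increasing)
    next
      case False
      thus ?thesis using powr_mono'[OF ab(1), of t] \<open>t > 0\<close> by (simp add: add_increasing2)
    qed
    hence "t powr Re s * norm (lipschitz_sum t) \<le> (t powr a + t powr b) * (B * exp (- t))"
      using B[OF True] by (intro mult_mono) auto
    thus ?thesis using True by (simp add: mellin_integrand_def g_def norm_mult norm_powr_real_powr algebra_simps)
  qed (simp add: mellin_integrand_def g_def)
  ultimately show "\<exists>r>0. \<exists>g. integrable lborel g \<and> (\<forall>z\<in>ball s0 r. \<forall>t\<in>space lborel. norm (mellin_integrand z t) \<le> g t)"
    using r by blast
qed

text \<open>Termwise, n exp (- n t) integrates against t^s to Gamma (s + 1) n^(-s). The absolute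
  integrals are summable because Re s > 1.\<close>

lemma mellin_eq_L:
  assumes s: "Re s > 1"
  shows "(LINT t|lborel. mellin_integrand s t) = c.gauss * Gamma (s + 1) * L0 s"
proof -
  define f where "f = (\<lambda>n t. (c.gauss * (of_nat (Suc n) * chi (int (Suc n)))) *
    (indicator {0<..} t *\<^sub>R (of_real t powr (s + 1 - 1) * exp (- complex_of_real (real (Suc n) * t)))))"
  define M where "M = (\<lambda>n t. (norm c.gauss * real (Suc n)) * (indicator {0<..} t * (t powr Re s * exp (- (real (Suc n) * t)))))"
  have int_f: "integrable lborel (f n)" for n
    using Gamma_integral_scaled(1)[of "s + 1" "real (Suc n)"] s
    unfolding f_def set_integrable_def by (intro integrable_mult_right) simp
  have val_f: "(LINT t|lborel. f n t) = c.gauss * Gamma (s + 1) * L_term s n" for n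
  proof -
    have "(LINT t|lborel. f n t) = (c.gauss * (of_nat (Suc n) * chi (int (Suc n)))) * (Gamma (s + 1) * of_real (real (Suc n)) powr (- (s + 1)))"
      unfolding f_def integral_mult_right_zero
      using Gamma_integral_scaled(2)[of "s + 1" "real (Suc n)"] s unfolding set_lebesgue_integral_def by simp
    also have "of_real (real (Suc n)) powr (- (s + 1)) = 1 / (of_nat (Suc n) * of_nat (Suc n) powr s)"
    proof -
      have "of_real (real (Suc n)) powr (s + 1) = of_nat (Suc n) powr s * (of_nat (Suc n) :: complex)"
        by (simp add: powr_add del: of_nat_Suc)
      thus ?thesis by (simp only: powr_minus) (simp add: divide_inverse del: of_nat_Suc)
    qed
    finally show ?thesis by (simp add: L_term_def del: of_nat_Suc)
  qed
  have norm_f: "norm (f n t) \<le> M n t" for n t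
  proof (cases "t > 0")
    case True
    have "norm (exp (- complex_of_real (real (Suc n) * t))) = exp (- (real (Suc n) * t))"
      by (simp del: of_nat_Suc)
    hence "norm (f n t) = norm c.gauss * real (Suc n) * norm (chi (int (Suc n))) * (t powr Re s * exp (- (real (Suc n) * t)))"
      using True by (simp add: f_def norm_mult norm_powr_real_powr del: of_nat_Suc of_real_mult)
    also have "\<dots> \<le> norm c.gauss * real (Suc n) * 1 * (t powr Re s * exp (- (real (Suc n) * t)))"
      by (intro mult_right_mono mult_left_mono norm_chi_le_1) auto
    finally show ?thesis using True by (simp add: M_def del: of_nat_Suc)
  qed (simp add: f_def M_def)
  have int_M: "integrable lborel (M n)" for n
    unfolding M_def using s by (intro integrable_mult_right Gamma_integral_scaled_real) auto
  have val_M: "(LINT t|lborel. M n t) = norm c.gauss * Gamma (Re s + 1) * real (Suc n) powr (- Re s)" for n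
  proof -
    have "(LINT t|lborel. M n t) = norm c.gauss * real (Suc n) * (Gamma (Re s + 1) * real (Suc n) powr (- Re s - 1))"
      unfolding M_def integral_mult_right_zero using s Gamma_integral_scaled_real(2)[of "Re s" "real (Suc n)"] by simp
    also have "real (Suc n) powr (- Re s - 1) = real (Suc n) powr (- Re s) / real (Suc n)"
      by (simp add: powr_diff del: of_nat_Suc)
    finally show ?thesis by (simp del: of_nat_Suc)
  qed
  have "(\<lambda>n. LINT t|lborel. f n t) sums (LINT t|lborel. (\<Sum>n. f n t))"
  proof (rule sums_integral[OF int_f])
    show "AE t in lborel. summable (\<lambda>n. norm (f n t))"
    proof (intro AE_I2)
      fix t :: real
      show "summable (\<lambda>n. norm (f n t))"
      proof (cases "t > 0")
        case True
        have "summable (\<lambda>n. Re (of_nat (Suc n) * exp (- of_nat (Suc n) * complex_of_real t)))"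
          using lipschitz_series[of "of_real t"] True sums_Re sums_summable by fastforce
        also have "(\<lambda>n. Re (of_nat (Suc n) * exp (- of_nat (Suc n) * complex_of_real t))) = (\<lambda>n. real (Suc n) * exp (- (real (Suc n) * t)))"
        proof
          fix n
          have "exp (- of_nat (Suc n) * complex_of_real t) = of_real (exp (- (real (Suc n) * t)))"
            by (subst exp_of_real[symmetric]) (simp del: of_nat_Suc)
          thus "Re (of_nat (Suc n) * exp (- of_nat (Suc n) * complex_of_real t)) = real (Suc n) * exp (- (real (Suc n) * t))"
            by (simp del: of_nat_Suc)
        qed
        finally have "summable (\<lambda>n. (norm c.gauss * t powr Re s) * (real (Suc n) * exp (- (real (Suc n) * t))))"
          by (rule summable_mult)
        also have "(\<lambda>n. (norm c.gauss * t powr Re s) * (real (Suc n) * exp (- (real (Suc n) * t)))) = (\<lambda>n. M n t)"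
          using True by (simp add: M_def mult_ac del: of_nat_Suc)
        finally have "summable (\<lambda>n. M n t)" .
        thus ?thesis by (rule summable_comparison_test'[of _ 0]) (use norm_f in auto)
      qed (simp add: f_def)
    qed
    show "summable (\<lambda>n. LINT t|lborel. norm (f n t))"
    proof (rule summable_comparison_test')
      show "summable (\<lambda>n. norm c.gauss * Gamma (Re s + 1) * real (Suc n) powr (- Re s))"
        using s by (intro summable_mult summable_Suc_powr) auto
      show "norm (LINT t|lborel. norm (f n t)) \<le> norm c.gauss * Gamma (Re s + 1) * real (Suc n) powr (- Re s)" for n
        unfolding val_M[symmetric] using integral_mono[OF integrable_norm[OF int_f] int_M norm_f]
        by (simp add: Bochner_Integration.integral_nonneg)
    qed
  qed
  also have "(\<lambda>n. LINT t|lborel. f n t) = (\<lambda>n. c.gauss * Gamma (s + 1) * L_term s n)" by (simp only: val_f)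
  also have "(\<lambda>t. \<Sum>n. f n t) = mellin_integrand s"
  proof
    fix t
    show "(\<Sum>n. f n t) = mellin_integrand s t"
    proof (cases "t > 0")
      case True
      have "(\<lambda>n. of_real t powr s * (c.gauss * (of_nat (Suc n) * chi (int (Suc n)) * exp (- of_real (real (Suc n) * t))))) sums (of_real t powr s * lipschitz_sum t)"
        by (intro sums_mult lipschitz_sum_series True)
      also have "(\<lambda>n. of_real t powr s * (c.gauss * (of_nat (Suc n) * chi (int (Suc n)) * exp (- of_real (real (Suc n) * t))))) = (\<lambda>n. f n t)"
        using True by (simp add: f_def mult_ac del: of_nat_Suc of_real_mult)
      finally show ?thesis using True by (simp add: mellin_integrand_def sums_iff)
    qed (simp add: f_def mellin_integrand_def)
  qed
  finally have "(\<lambda>n. c.gauss * Gamma (s + 1) * L_term s n) sums (LINT t|lborel. mellin_integrand s t)" .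
  moreover have "(\<lambda>n. c.gauss * Gamma (s + 1) * L_term s n) sums (c.gauss * Gamma (s + 1) * L0 s)"
    by (intro sums_mult L0_sums s)
  ultimately show ?thesis by (rule sums_unique2)
qed

lemma mellin_eq_L_ext:
  assumes s: "Re s > -1"
  shows "(LINT t|lborel. mellin_integrand s t) = c.gauss * Gamma (s + 1) * L0 s"
proof -
  have Gnz: "z + 1 \<notin> \<int>\<^sub>\<le>\<^sub>0" if "Re z > -1" for z using that by (auto elim!: nonpos_Ints_cases simp: complex_eq_iff)
  have "(LINT t|lborel. mellin_integrand s t) - c.gauss * Gamma (s + 1) * L0 s = 0"
  proof (rule analytic_continuation_open[of "{s. Re s > 1}" "{s. Re s > -1}"
      "\<lambda>s. (LINT t|lborel. mellin_integrand s t) - c.gauss * Gamma (s + 1) * L0 s" "\<lambda>_. 0"])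
    show "{s. Re s > 1} \<noteq> {}" by (auto intro!: exI[of _ 2])
    show "connected {s. Re s > -1}" by (intro convex_connected convex_halfspace_Re_gt)
    show "(\<lambda>s. (LINT t|lborel. mellin_integrand s t) - c.gauss * Gamma (s + 1) * L0 s) holomorphic_on {s. Re s > -1}"
      by (intro holomorphic_intros mellin_holomorphic L0_holomorphic) (use Gnz in auto)
  qed (use s mellin_eq_L open_Re_gt in auto)
  thus ?thesis by simp
qed

text \<open>Termwise, \<open>mellin_shifted_power\<close> with k = 2 and exponent 1 - s at the
  points \<plusminus> i d(n) produces powers n^(s - 1). The strip is where the single integrals
  exist and, as Re (1 - s) > 1, the dual Dirichlet series converges absolutely. The parity of chi
  merges the contributions of n and -n.\<close>

lemma mellin_eq_dual:
  assumes s: "-1 < Re s" "Re s < 0"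
  shows "(LINT t|lborel. mellin_integrand s t) =
    Gamma (1 + s) * Gamma (1 - s) * of_real (2 * pi / real N) powr (s - 1) *
      ((- \<i>) powr (s - 1) + chi (-1) * \<i> powr (s - 1)) * c.L0 (1 - s)"
proof -
  define d where "d = (\<lambda>n. 2 * pi * real (Suc n) / real N)"
  have d: "d n > 0" for n using N_pos by (simp add: d_def del: of_nat_Suc)
  define f where "f = (\<lambda>n t. indicator {0<..} t *\<^sub>R (of_real t powr s * pole_term n t))"
  define M where "M = (\<lambda>n t. 4 * (indicator {0<..} t * (t powr Re s / (t + d n) ^ 2)))"
  define K where "K = Gamma (1 + s) * Gamma (1 - s)"
  have slit: "of_real (d n) * (- \<i>) \<notin> \<real>\<^sub>\<le>\<^sub>0" "of_real (d n) * \<i> \<notin> \<real>\<^sub>\<le>\<^sub>0" for n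
    using d[of n] by (auto simp: complex_nonpos_Reals_iff)
  have mell: "integrable lborel (\<lambda>t. indicator {0<..} t *\<^sub>R (of_real t powr s / (of_real t + z) ^ 2))"
    "(LINT t|lborel. indicator {0<..} t *\<^sub>R (of_real t powr s / (of_real t + z) ^ 2)) = K * z powr (s - 1)"
    if "z \<notin> \<real>\<^sub>\<le>\<^sub>0" for z
    using mellin_shifted_power[of "1 - s" 2 z] s that Gamma_fact[of 1, where ?'a = complex]
    by (simp_all add: set_integrable_def set_lebesgue_integral_def K_def)
  have f_eq: "f n t = cnj (chi (int (Suc n))) * (indicator {0<..} t *\<^sub>R (of_real t powr s / (of_real t + of_real (d n) * (- \<i>)) ^ 2)) +
     cnj (chi (- int (Suc n))) * (indicator {0<..} t *\<^sub>R (of_real t powr s / (of_real t + of_real (d n) * \<i>) ^ 2))" for n t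
  proof -
    have "pole_term n t = cnj (chi (int (Suc n))) / (of_real t + of_real (d n) * (- \<i>)) ^ 2 + cnj (chi (- int (Suc n))) / (of_real t + of_real (d n) * \<i>) ^ 2"
      by (simp only: pole_term_def d_def)
    thus ?thesis by (cases "t > 0") (simp_all add: f_def algebra_simps)
  qed
  have int_f: "integrable lborel (f n)" for n
    unfolding f_eq[abs_def] by (intro Bochner_Integration.integrable_add integrable_mult_right mell slit)
  have val_f: "(LINT t|lborel. f n t) = K * of_real (2 * pi / real N) powr (s - 1) * ((- \<i>) powr (s - 1) + chi (-1) * \<i> powr (s - 1)) * c.L_term (1 - s) n" for n
  proof -
    have "(LINT t|lborel. f n t) = cnj (chi (int (Suc n))) * (K * (of_real (d n) * (- \<i>)) powr (s - 1)) +
       cnj (chi (- int (Suc n))) * (K * (of_real (d n) * \<i>) powr (s - 1))"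
      unfolding f_eq
      by (subst Bochner_Integration.integral_add) (simp_all only: integral_mult_right_zero mell slit integrable_mult_right not_False_eq_True)
    also have "cnj (chi (- int (Suc n))) = chi (-1) * cnj (chi (int (Suc n)))"
      using chi_minus[of "int (Suc n)"] chi_minus_1_cases by auto
    also have "(of_real (d n) * (- \<i>)) powr (s - 1) = of_real (d n) powr (s - 1) * (- \<i>) powr (s - 1)"
      by (rule powr_mult_of_real_left[OF d])
    also have "(of_real (d n) * \<i>) powr (s - 1) = of_real (d n) powr (s - 1) * \<i> powr (s - 1)"
      by (rule powr_mult_of_real_left[OF d])
    also have "complex_of_real (d n) powr (s - 1) = of_real (2 * pi / real N) powr (s - 1) * of_nat (Suc n) powr (s - 1)"
    proof -
      have "complex_of_real (d n) = of_real (2 * pi / real N) * of_nat (Suc n)" by (simp add: d_def)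
      thus ?thesis using N_pos powr_mult_of_real_left[of "2 * pi / real N" "of_nat (Suc n)" "s - 1"] by (simp del: of_nat_Suc)
    qed
    also have "of_nat (Suc n) powr (s - 1) = 1 / (of_nat (Suc n) :: complex) powr (1 - s)"
      by (metis minus_diff_eq powr_minus_divide)
    finally show ?thesis by (simp add: c.L_term_def algebra_simps del: of_nat_Suc)
  qed
  have norm_f: "norm (f n t) \<le> M n t" for n t
  proof (cases "t > 0")
    case True
    have "norm (f n t) = t powr Re s * norm (pole_term n t)" using True by (simp add: f_def norm_mult norm_powr_real_powr)
    also have "\<dots> \<le> t powr Re s * (4 * (1 / (t + d n) ^ 2))"
      using norm_pole_term_le[of t n] True unfolding d_def by (intro mult_left_mono) auto
    finally show ?thesis using True by (simp add: M_def mult.commute)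
  qed (simp add: f_def M_def)
  define C where "C = 4 * (Gamma (Re s + 1) * Gamma (1 - Re s) * (2 * pi / real N) powr (Re s - 1))"
  have int_M: "integrable lborel (M n)" for n
    unfolding M_def using s d by (intro integrable_mult_right mellin_shifted_power_abs) auto
  have val_M: "(LINT t|lborel. M n t) = C * real (Suc n) powr (Re s - 1)" for n
  proof -
    have "(LINT t|lborel. M n t) = 4 * (Gamma (Re s + 1) * Gamma (1 - Re s) * d n powr (Re s - 1))"
      unfolding M_def integral_mult_right_zero using s d mellin_shifted_power_abs(2)[of "Re s" 2 "d n"] Gamma_fact[of 1, where ?'a = real] by simp
    also have "d n powr (Re s - 1) = (2 * pi / real N) powr (Re s - 1) * real (Suc n) powr (Re s - 1)"
    proof -
      have "d n = (2 * pi / real N) * real (Suc n)" by (simp add: d_def)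
      thus ?thesis by (simp only:) (subst powr_mult, simp_all del: of_nat_Suc)
    qed
    finally show ?thesis by (simp add: C_def mult_ac)
  qed
  have "(\<lambda>n. LINT t|lborel. f n t) sums (LINT t|lborel. (\<Sum>n. f n t))"
  proof (rule sums_integral[OF int_f])
    show "AE t in lborel. summable (\<lambda>n. norm (f n t))"
    proof (intro AE_I2)
      fix t :: real
      show "summable (\<lambda>n. norm (f n t))"
      proof (cases "t > 0")
        case True
        have "summable (\<lambda>n. (t powr Re s * 4 * (real N / (2 * pi)) ^ 2) * real (Suc n) powr (-2))"
          by (intro summable_mult summable_Suc_powr) auto
        thus ?thesis
        proof (rule summable_comparison_test'[of _ 0])
          fix n
          have "norm (f n t) \<le> 4 * (t powr Re s / (t + d n) ^ 2)" using norm_f[of n t] True by (simp add: M_def)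
          also have "\<dots> \<le> 4 * (t powr Re s / d n ^ 2)"
            using True d[of n] by (intro mult_left_mono divide_left_mono power_mono mult_pos_pos) auto
          also have "\<dots> = (t powr Re s * 4 * (real N / (2 * pi)) ^ 2) * real (Suc n) powr (-2)"
          proof -
            have "real (Suc n) powr (-2) = 1 / real (Suc n) ^ 2" by (simp add: powr_minus powr_numeral divide_inverse del: of_nat_Suc)
            thus ?thesis by (simp only: d_def) (simp add: power_mult_distrib power_divide del: of_nat_Suc)
          qed
          finally show "norm (norm (f n t)) \<le> (t powr Re s * 4 * (real N / (2 * pi)) ^ 2) * real (Suc n) powr (-2)" by simp
        qed
      qed (simp add: f_def)
    qed
    show "summable (\<lambda>n. LINT t|lborel. norm (f n t))"
    proof (rule summable_comparison_test')
      show "summable (\<lambda>n. C * real (Suc n) powr (Re s - 1))"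
        using s by (intro summable_mult summable_Suc_powr) auto
      show "norm (LINT t|lborel. norm (f n t)) \<le> C * real (Suc n) powr (Re s - 1)" for n
        unfolding val_M[symmetric] using integral_mono[OF integrable_norm[OF int_f] int_M norm_f]
        by (simp add: Bochner_Integration.integral_nonneg)
    qed
  qed
  also have "(\<lambda>n. LINT t|lborel. f n t) = (\<lambda>n. K * of_real (2 * pi / real N) powr (s - 1) * ((- \<i>) powr (s - 1) + chi (-1) * \<i> powr (s - 1)) * c.L_term (1 - s) n)"
    by (simp only: val_f)
  also have "(\<lambda>t. \<Sum>n. f n t) = mellin_integrand s"
  proof
    fix t
    show "(\<Sum>n. f n t) = mellin_integrand s t"
    proof (cases "t > 0")
      case True
      have "(\<lambda>n. of_real t powr s * pole_term n t) sums (of_real t powr s * lipschitz_sum t)"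
        by (intro sums_mult lipschitz_sum_poles True)
      thus ?thesis using True by (simp add: mellin_integrand_def f_def sums_iff)
    qed (simp add: f_def mellin_integrand_def)
  qed
  finally have "(\<lambda>n. K * of_real (2 * pi / real N) powr (s - 1) * ((- \<i>) powr (s - 1) + chi (-1) * \<i> powr (s - 1)) * c.L_term (1 - s) n) sums (LINT t|lborel. mellin_integrand s t)" .
  moreover have "(\<lambda>n. K * of_real (2 * pi / real N) powr (s - 1) * ((- \<i>) powr (s - 1) + chi (-1) * \<i> powr (s - 1)) * c.L_term (1 - s) n) sums
     (K * of_real (2 * pi / real N) powr (s - 1) * ((- \<i>) powr (s - 1) + chi (-1) * \<i> powr (s - 1)) * c.L0 (1 - s))"
    using s by (intro sums_mult c.L0_sums) auto
  ultimately show ?thesis unfolding K_def by (rule sums_unique2)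
qed

text \<open>Both evaluations of the Mellin transform hold in this strip, and the common factor Gamma
  (s + 1) is finite and nonzero there.\<close>

theorem functional_equation_strip:
  assumes s: "-1 < Re s" "Re s < 0"
  shows "c.gauss * L0 s = Gamma (1 - s) * of_real (2 * pi / real N) powr (s - 1) *
      ((- \<i>) powr (s - 1) + chi (-1) * \<i> powr (s - 1)) * c.L0 (1 - s)"
proof -
  have "s + 1 \<notin> \<int>\<^sub>\<le>\<^sub>0" using s by (auto elim!: nonpos_Ints_cases simp: complex_eq_iff)
  hence G: "Gamma (s + 1) \<noteq> 0" by (simp add: Gamma_eq_zero_iff)
  have "Gamma (s + 1) * (c.gauss * L0 s) = Gamma (s + 1) * (Gamma (1 - s) * of_real (2 * pi / real N) powr (s - 1) *
      ((- \<i>) powr (s - 1) + chi (-1) * \<i> powr (s - 1)) * c.L0 (1 - s))"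
    using mellin_eq_L_ext[OF s(1)] mellin_eq_dual[OF s] by (simp add: algebra_simps)
  thus ?thesis using G by simp
qed

end

section \<open>Nonvanishing at and to the right of 1\<close>

text \<open>Eratosthenes for sums: by complete multiplicativity the multiples of q among the
  survivors sum to f q times the current total, so removing them multiplies the total by 1 - f q.
  Only finite products of Euler factors occur.\<close>

lemma euler_sieve:
  fixes f :: "nat \<Rightarrow> complex"
  assumes mult: "\<And>m n. f (m * n) = f m * f n" and S: "(f has_sum S) {1..}"
    and A: "finite A" "\<And>p. p \<in> A \<Longrightarrow> prime p"
  shows "(f has_sum (S * (\<Prod>p\<in>A. 1 - f p))) {n. n \<ge> 1 \<and> (\<forall>p\<in>A. \<not> p dvd n)}"
  using A
proof (induction A rule: finite_induct)
  case empty
  thus ?case using S by (simp add: atLeast_def)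
next
  case (insert q A)
  define B where "B = {n. n \<ge> 1 \<and> (\<forall>p\<in>A. \<not> p dvd n)}"
  define P where "P = S * (\<Prod>p\<in>A. 1 - f p)"
  have q: "prime q" using insert by auto
  have B: "(f has_sum P) B" using insert unfolding B_def P_def by auto
  have inj: "inj_on (\<lambda>n. q * n) B" using q by (auto simp: inj_on_def)
  have "((\<lambda>n. f q * f n) has_sum (f q * P)) B" by (rule has_sum_cmult_right[OF B])
  hence qB: "(f has_sum (f q * P)) ((\<lambda>n. q * n) ` B)"
    by (subst has_sum_reindex[OF inj]) (simp add: o_def mult)
  have sub: "(\<lambda>n. q * n) ` B \<subseteq> B"
  proof
    fix m assume "m \<in> (\<lambda>n. q * n) ` B"
    then obtain n where n: "n \<in> B" "m = q * n" by blast
    have "\<not> p dvd q * n" if p: "p \<in> A" for p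
    proof
      assume "p dvd q * n"
      moreover have "prime p" "p \<noteq> q" using insert p by auto
      ultimately have "p dvd n" using q by (metis prime_dvd_mult_iff primes_dvd_imp_eq)
      thus False using n(1) p by (auto simp: B_def)
    qed
    moreover have "q * n \<ge> 1" using q n(1) prime_gt_0_nat[OF q] by (auto simp: B_def)
    ultimately show "m \<in> B" using n(2) by (auto simp: B_def)
  qed
  have "(f has_sum (P - f q * P)) (B - (\<lambda>n. q * n) ` B)" by (rule has_sum_Diff[OF B qB sub])
  moreover have "B - (\<lambda>n. q * n) ` B = {n. n \<ge> 1 \<and> (\<forall>p\<in>insert q A. \<not> p dvd n)}"
  proof (intro equalityI subsetI)
    fix n assume n: "n \<in> B - (\<lambda>n. q * n) ` B"
    have "\<not> q dvd n"
    proof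
      assume "q dvd n"
      then obtain m where m: "n = q * m" by blast
      hence "m \<in> B" using n by (auto simp: B_def)
      thus False using n m by blast
    qed
    thus "n \<in> {n. n \<ge> 1 \<and> (\<forall>p\<in>insert q A. \<not> p dvd n)}" using n by (auto simp: B_def)
  qed (auto simp: B_def)
  moreover have "P - f q * P = S * (\<Prod>p\<in>insert q A. 1 - f p)"
    using insert by (simp add: P_def algebra_simps)
  ultimately show ?case by simp
qed

text \<open>A number greater than 1 that survives the sieve by all primes up to y has all its prime
  factors above y, hence exceeds y itself. Apart from the term 1 only a tail of the sum
  remains.\<close>

lemma euler_sieve_bound:
  fixes f :: "nat \<Rightarrow> complex"
  assumes mult: "\<And>m n. f (m * n) = f m * f n" and S: "(f has_sum S) {1..}" and f1: "f 1 = 1"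
    and g: "g summable_on {1..}" "\<And>n. n \<ge> 1 \<Longrightarrow> norm (f n) \<le> g n"
  shows "norm (S * (\<Prod>p | prime p \<and> p \<le> y. 1 - f p) - 1) \<le> infsum g {Suc y..}"
proof -
  define A where "A = {p::nat. prime p \<and> p \<le> y}"
  have A: "finite A" "\<And>p. p \<in> A \<Longrightarrow> prime p" by (auto simp: A_def)
  define B where "B = {n. n \<ge> 1 \<and> (\<forall>p\<in>A. \<not> p dvd n)}"
  have "(f has_sum (S * (\<Prod>p\<in>A. 1 - f p))) B"
    unfolding B_def by (rule euler_sieve[OF mult S A])
  moreover have "(f has_sum 1) {1}" using has_sum_finite[of "{1}" f] f1 by simp
  moreover have "{1} \<subseteq> B" by (auto simp: B_def A_def dest: prime_gt_1_nat)
  ultimately have 1: "(f has_sum (S * (\<Prod>p\<in>A. 1 - f p) - 1)) (B - {1})" by (rule has_sum_Diff)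
  have sub: "B - {1} \<subseteq> {Suc y..}"
  proof
    fix n assume n: "n \<in> B - {1}"
    then obtain p where p: "prime p" "p dvd n" using prime_factor_nat by blast
    have "p \<notin> A" using n p by (auto simp: B_def)
    hence "p > y" using p by (auto simp: A_def)
    moreover have "p \<le> n" using n p dvd_imp_le by (auto simp: B_def)
    ultimately show "n \<in> {Suc y..}" by simp
  qed
  have gs: "g summable_on X" if "X \<subseteq> {1..}" for X using g(1) that by (rule summable_on_subset_banach)
  have "norm (S * (\<Prod>p\<in>A. 1 - f p) - 1) \<le> infsum g (B - {1})"
    by (rule norm_infsum_le[OF 1 has_sum_infsum[OF gs]]) (auto simp: B_def intro: g(2))
  also have "\<dots> \<le> infsum g {Suc y..}"
  proof (rule infsum_mono_neutral)
    show "0 \<le> g x" if "x \<in> {Suc y..} - (B - {1})" for x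
      using that g(2)[of x] order.trans[OF norm_ge_zero] by auto
  qed (use sub in \<open>auto simp: B_def intro!: gs[simplified]\<close>)
  finally show ?thesis by (simp add: A_def)
qed

lemma infsum_tail_tendsto_0:
  fixes g :: "nat \<Rightarrow> real"
  assumes "g summable_on {1..}"
  shows "(\<lambda>y. infsum g {Suc y..}) \<longlonglongrightarrow> 0"
proof -
  have T: "(g has_sum (infsum g {1..})) {1..}" using assms by (rule has_sum_infsum)
  have eq: "infsum g {Suc y..} = infsum g {1..} - (\<Sum>n<y. g (Suc n))" for y
  proof -
    have "(g has_sum (infsum g {1..} - sum g {1..y})) ({1..} - {1..y})"
      by (rule has_sum_Diff[OF T has_sum_finite]) auto
    moreover have "{1..} - {1..y} = {Suc y..}" by auto
    moreover have "sum g {1..y} = (\<Sum>n<y. g (Suc n))"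
      using sum.shift_bounds_Suc_ivl[of g 0 y] by (simp add: atLeastLessThanSuc_atLeastAtMost atLeast0LessThan)
    ultimately show ?thesis by (simp add: infsumI)
  qed
  have "range Suc = {1..}" by (auto simp: image_iff Suc_le_eq dest: gr0_implies_Suc)
  hence "((\<lambda>n. g (Suc n)) has_sum (infsum g {1..})) UNIV"
    using T has_sum_reindex[of Suc UNIV g] by (simp add: o_def)
  hence "(\<lambda>y. \<Sum>n<y. g (Suc n)) \<longlonglongrightarrow> infsum g {1..}"
    using has_sum_imp_sums sums_def by blast
  hence "(\<lambda>y. infsum g {1..} - (\<Sum>n<y. g (Suc n))) \<longlonglongrightarrow> infsum g {1..} - infsum g {1..}"
    by (intro tendsto_intros)
  thus ?thesis unfolding eq by simp
qed

lemma has_sum_atLeast1_iff: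
  fixes f :: "nat \<Rightarrow> 'a :: banach"
  shows "(f has_sum S) {1..} \<longleftrightarrow> ((\<lambda>n. f (Suc n)) has_sum S) UNIV"
proof -
  have "range Suc = {1..}" by (auto simp: image_iff Suc_le_eq dest: gr0_implies_Suc)
  thus ?thesis using has_sum_reindex[of Suc UNIV f S] by (simp add: o_def)
qed

lemma powr_summable_on_atLeast1: "a < -1 \<Longrightarrow> (\<lambda>n. real n powr a) summable_on {1..}"
proof -
  assume "a < -1"
  hence "summable (\<lambda>n. norm (real (Suc n) powr a))"
    using summable_shifted_powr[of 1 a] by (simp add: add.commute)
  hence "((\<lambda>n. real (Suc n) powr a) has_sum (\<Sum>n. real (Suc n) powr a)) UNIV"
    by (intro norm_summable_imp_has_sum summable_sums) (auto dest: summable_norm_cancel)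
  thus ?thesis using has_sum_atLeast1_iff[of "\<lambda>n. real n powr a"] by (auto simp: summable_on_def)
qed

context dirichlet_char
begin

definition dirichlet_term :: "complex \<Rightarrow> nat \<Rightarrow> complex" where
  "dirichlet_term s n = chi (int n) * of_nat n powr (- s)"

lemma dirichlet_term_mult: "dirichlet_term s (m * n) = dirichlet_term s m * dirichlet_term s n"
proof (cases "m = 0")
  case False
  have "of_nat (m * n) powr (- s) = (of_real (real m) * of_nat n) powr (- s)" by simp
  also have "\<dots> = of_nat m powr (- s) * of_nat n powr (- s)"
    using False by (subst powr_mult_of_real_left) auto
  finally show ?thesis by (simp add: dirichlet_term_def chi_mult)
qed (simp add: dirichlet_term_def)

lemma dirichlet_term_1: "dirichlet_term s 1 = 1" "dirichlet_term s (Suc 0) = 1"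
  by (simp_all add: dirichlet_term_def chi_1)

lemma norm_dirichlet_term_le: "norm (dirichlet_term s n) \<le> real n powr (- Re s)"
proof -
  have "norm (dirichlet_term s n) = norm (chi (int n)) * real n powr (- Re s)"
    using norm_powr_real_powr[of "real n" "- s"] by (cases "n = 0") (auto simp: dirichlet_term_def norm_mult)
  also have "\<dots> \<le> 1 * real n powr (- Re s)" by (intro mult_right_mono norm_chi_le_1) auto
  finally show ?thesis by simp
qed

lemma dirichlet_term_has_sum:
  assumes "Re s > 1"
  shows "(dirichlet_term s has_sum L0 s) {1..}"
proof -
  have "dirichlet_term s (Suc n) = L_term s n" for n
    by (simp add: dirichlet_term_def L_term_def powr_minus divide_inverse)
  moreover have "((\<lambda>n. L_term s n) has_sum L0 s) UNIV"
    using L_term_norm_summable[OF assms] L0_sums[OF assms] by (rule norm_summable_imp_has_sum)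
  ultimately show ?thesis by (subst has_sum_atLeast1_iff) simp
qed

lemma L0_euler_bound:
  assumes "Re s \<ge> a" "a > 1"
  shows "norm (L0 s * (\<Prod>p | prime p \<and> p \<le> y. 1 - dirichlet_term s p) - 1) \<le> infsum (\<lambda>n. real n powr (- a)) {Suc y..}"
proof (rule euler_sieve_bound[OF dirichlet_term_mult dirichlet_term_has_sum dirichlet_term_1(1)])
  fix n :: nat assume "n \<ge> 1"
  hence "real n powr (- Re s) \<le> real n powr (- a)" using assms by (intro powr_mono) auto
  thus "norm (dirichlet_term s n) \<le> real n powr (- a)" using norm_dirichlet_term_le[of s n] by linarith
qed (use assms powr_summable_on_atLeast1[of "- a"] in auto)

text \<open>A zero would make the sieved total 0 for every y, so that the tails, which tend to 0,
  would all be at least 1.\<close>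

lemma L0_nonzero:
  assumes "Re s > 1" shows "L0 s \<noteq> 0"
proof
  assume "L0 s = 0"
  hence "1 \<le> infsum (\<lambda>n. real n powr (- Re s)) {Suc y..}" for y
    using L0_euler_bound[of "Re s" s y] assms by simp
  moreover have "(\<lambda>y. infsum (\<lambda>n. real n powr (- Re s)) {Suc y..}) \<longlonglongrightarrow> 0"
    using assms by (intro infsum_tail_tendsto_0 powr_summable_on_atLeast1) auto
  ultimately have "(1 :: real) \<le> 0" by (intro tendsto_lowerbound[of _ 0 sequentially 1]) auto
  thus False by simp
qed

end

section \<open>Taylor coefficients of Euler products at s = 2\<close>

lemma trivial_char: "dirichlet_char 1 (\<lambda>_. 1)"
  by (simp add: dirichlet_char_def dirichlet_character_def)

text \<open>The variable is u = 2 - s, so the disc of radius 1/2 corresponds to points with Re s >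
  3/2, where the Euler products converge uniformly. Coefficients are kept as derivatives at 0, which
  pass to uniform limits.\<close>

definition nonneg_coeffs :: "(complex \<Rightarrow> complex) \<Rightarrow> bool" where
  "nonneg_coeffs g \<longleftrightarrow> g holomorphic_on ball 0 (1/2) \<and> (\<forall>k. (deriv ^^ k) g 0 \<in> \<real>\<^sub>\<ge>\<^sub>0)"

lemma nonneg_coeffs_cong:
  assumes "\<And>u. u \<in> ball 0 (1/2) \<Longrightarrow> f u = g u" "nonneg_coeffs f"
  shows "nonneg_coeffs g"
proof -
  have "(deriv ^^ k) g 0 = (deriv ^^ k) f 0" for k
    using assms(1) by (intro higher_deriv_cong_ev refl eventually_nhds_in_open[THEN eventually_mono, of "ball 0 (1/2)"]) auto
  moreover have "g holomorphic_on ball 0 (1/2)" using assms by (auto simp: nonneg_coeffs_def intro: holomorphic_transform)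
  ultimately show ?thesis using assms(2) by (simp add: nonneg_coeffs_def)
qed

lemma nonneg_coeffs_const: "c \<in> \<real>\<^sub>\<ge>\<^sub>0 \<Longrightarrow> nonneg_coeffs (\<lambda>_. c)"
  by (simp add: nonneg_coeffs_def higher_deriv_const)

lemma nonneg_coeffs_add:
  assumes "nonneg_coeffs f" "nonneg_coeffs g"
  shows "nonneg_coeffs (\<lambda>u. f u + g u)"
  using assms higher_deriv_add[of f "ball 0 (1/2)" g 0]
  by (auto simp: nonneg_coeffs_def intro!: holomorphic_intros nonneg_Reals_add_I)

lemma sum_nonneg_Reals:
  assumes "\<And>i. i \<in> A \<Longrightarrow> f i \<in> (\<real>\<^sub>\<ge>\<^sub>0 :: complex set)"
  shows "sum f A \<in> \<real>\<^sub>\<ge>\<^sub>0"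
  using assms by (induction A rule: infinite_finite_induct) auto

lemma nonneg_coeffs_mult:
  assumes "nonneg_coeffs f" "nonneg_coeffs g"
  shows "nonneg_coeffs (\<lambda>u. f u * g u)"
proof -
  have "(deriv ^^ k) (\<lambda>u. f u * g u) 0 = (\<Sum>i = 0..k. of_nat (k choose i) * (deriv ^^ i) f 0 * (deriv ^^ (k - i)) g 0)" for k
    using assms by (intro higher_deriv_mult[of f "ball 0 (1/2)"]) (auto simp: nonneg_coeffs_def)
  moreover have "of_nat (k choose i) * (deriv ^^ i) f 0 * (deriv ^^ (k - i)) g 0 \<in> \<real>\<^sub>\<ge>\<^sub>0" for k i
    using assms by (intro nonneg_Reals_mult_I) (auto simp: nonneg_coeffs_def)
  hence "(\<Sum>i = 0..k. of_nat (k choose i) * (deriv ^^ i) f 0 * (deriv ^^ (k - i)) g 0) \<in> \<real>\<^sub>\<ge>\<^sub>0" for k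
    by (intro sum_nonneg_Reals)
  ultimately show ?thesis using assms by (auto simp: nonneg_coeffs_def intro!: holomorphic_intros)
qed

lemma nonneg_coeffs_sum:
  assumes "\<And>i. i \<in> A \<Longrightarrow> nonneg_coeffs (f i)"
  shows "nonneg_coeffs (\<lambda>u. \<Sum>i\<in>A. f i u)"
  using assms
  by (induction A rule: infinite_finite_induct) (auto intro!: nonneg_coeffs_const nonneg_coeffs_add)

lemma nonneg_coeffs_power: "nonneg_coeffs f \<Longrightarrow> nonneg_coeffs (\<lambda>u. f u ^ n)"
  by (induction n) (auto intro!: nonneg_coeffs_const nonneg_coeffs_mult)

text \<open>Derivatives at 0 converge along a locally uniform limit of holomorphic functions, and
  the nonnegative reals are closed.\<close>

lemma nonneg_coeffs_limit:
  assumes F: "\<And>n. nonneg_coeffs (F n)" and lim: "uniform_limit (ball 0 (1/2)) F g sequentially"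
  shows "nonneg_coeffs g"
proof -
  have hol: "F n holomorphic_on ball 0 (1/2)" for n using F by (simp add: nonneg_coeffs_def)
  have "g holomorphic_on ball 0 (1/2)"
  proof (rule holomorphic_uniform_sequence[OF open_ball hol])
    fix x :: complex assume "x \<in> ball 0 (1/2)"
    then obtain d where "d > 0" "cball x d \<subseteq> ball 0 (1/2)" using open_contains_cball open_ball by meson
    thus "\<exists>d>0. cball x d \<subseteq> ball 0 (1/2) \<and> uniform_limit (cball x d) F g sequentially"
      using uniform_limit_on_subset[OF lim] by blast
  qed
  moreover have "(deriv ^^ k) g 0 \<in> \<real>\<^sub>\<ge>\<^sub>0" for k
  proof (rule closed_sequentially[OF closed_nonneg_Reals_complex])
    show "(\<lambda>n. (deriv ^^ k) (F n) 0) \<longlonglongrightarrow> (deriv ^^ k) g 0"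
      by (rule higher_deriv_complex_uniform_limit[OF lim]) (use hol in auto)
    show "(deriv ^^ k) (F n) 0 \<in> \<real>\<^sub>\<ge>\<^sub>0" for n using F by (simp add: nonneg_coeffs_def)
  qed
  ultimately show ?thesis by (simp add: nonneg_coeffs_def)
qed

text \<open>The exponential series without its constant term has nonnegative coefficients; the bound
  on f makes it converge uniformly. The 1 is subtracted because a product E exp G is compared later
  with its factor E, and the difference is E (exp G - 1).\<close>

lemma nonneg_coeffs_exp_minus_1:
  assumes f: "nonneg_coeffs f" and B: "\<And>u. u \<in> ball 0 (1/2) \<Longrightarrow> norm (f u) \<le> B"
  shows "nonneg_coeffs (\<lambda>u. exp (f u) - 1)"
proof (rule nonneg_coeffs_limit)
  have B0: "B \<ge> 0" using B[of 0] order.trans[OF norm_ge_zero] by simp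
  show "nonneg_coeffs (\<lambda>u. \<Sum>k<n. (1 / fact (Suc k)) * f u ^ Suc k)" for n
    by (intro nonneg_coeffs_sum nonneg_coeffs_mult nonneg_coeffs_const nonneg_coeffs_power f)
       (metis nonneg_Reals_divide_I nonneg_Reals_one_I of_nat_fact nonneg_Reals_of_nat_I)
  have "uniform_limit (ball 0 (1/2)) (\<lambda>n u. \<Sum>k<n. (1 / fact (Suc k)) * f u ^ Suc k) (\<lambda>u. \<Sum>k. (1 / fact (Suc k)) * f u ^ Suc k) sequentially"
  proof (rule Weierstrass_m_test)
    show "summable (\<lambda>k. B ^ Suc k / fact (Suc k))"
      using summable_exp_generic[of B] by (subst summable_Suc_iff[of "\<lambda>k. B ^ k / fact k"]) (simp add: divide_inverse mult.commute)
    show "norm ((1 / fact (Suc k)) * f u ^ Suc k) \<le> B ^ Suc k / fact (Suc k)" if "u \<in> ball 0 (1/2)" for k u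
    proof -
      have "norm (f u ^ Suc k) \<le> B ^ Suc k" unfolding norm_power by (rule power_mono[OF B[OF that]]) simp
      thus ?thesis by (simp add: norm_mult norm_divide divide_right_mono del: power_Suc fact_Suc)
    qed
  qed
  moreover have "(\<Sum>k. (1 / fact (Suc k)) * f u ^ Suc k) = exp (f u) - 1" for u
  proof -
    have "(\<lambda>k. f u ^ k / fact k) sums exp (f u)"
      using exp_converges[of "f u"] by (simp add: scaleR_conv_of_real divide_inverse mult.commute)
    hence "(\<lambda>k. f u ^ Suc k / fact (Suc k)) sums (exp (f u) - 1)" by (subst sums_Suc_iff) simp
    thus ?thesis by (simp add: sums_iff)
  qed
  ultimately show "uniform_limit (ball 0 (1/2)) (\<lambda>n u. \<Sum>k<n. (1 / fact (Suc k)) * f u ^ Suc k) (\<lambda>u. exp (f u) - 1) sequentially"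
    by simp
qed

text \<open>This is p^(-s) at s = 2 - u. In u it is p^(-2) exp (u ln p), whose Taylor coefficients
  at 0 are positive.\<close>

definition prime_power_fun :: "nat \<Rightarrow> complex \<Rightarrow> complex" where
  "prime_power_fun p u = of_nat p powr (- (2 - u))"

lemma norm_prime_power_fun:
  assumes "p \<ge> 1" shows "norm (prime_power_fun p u) = real p powr (Re u - 2)"
  using norm_powr_real_powr[of "real p" "- (2 - u)"] assms by (simp add: prime_power_fun_def)

lemma norm_prime_power_fun_less_1:
  assumes "p \<ge> 2" "Re u < 2" shows "norm (prime_power_fun p u) < 1"
proof -
  have "real p powr (Re u - 2) < real p powr 0" using assms by (intro powr_less_mono) auto
  thus ?thesis using assms by (simp add: norm_prime_power_fun)
qed

lemma norm_prime_power_fun_le_half: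
  assumes "p \<ge> 2" "u \<in> ball 0 (1/2)" shows "norm (prime_power_fun p u) \<le> 1/2"
proof -
  have "Re u \<le> 1" using assms(2) complex_Re_le_cmod[of u] by simp
  hence "real p powr (Re u - 2) \<le> real p powr (-1)" using assms by (intro powr_mono) auto
  also have "\<dots> \<le> 2 powr (-1)" using assms by (intro powr_mono2') auto
  finally show ?thesis using assms by (simp add: norm_prime_power_fun powr_minus)
qed

lemma prime_power_fun_holomorphic: "p \<ge> 1 \<Longrightarrow> prime_power_fun p holomorphic_on A"
  unfolding prime_power_fun_def by (auto intro!: holomorphic_intros)

lemma nonneg_coeffs_prime_power_fun:
  assumes "p \<ge> 1" shows "nonneg_coeffs (prime_power_fun p)"
proof -
  define a where "a = complex_of_real (ln (real p))"
  define c where "c = complex_of_real (exp (- 2 * ln (real p)))"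
  have eq: "prime_power_fun p = (\<lambda>u. c * exp (a * u))"
  proof
    fix u
    have "Ln (of_nat p) = a" using assms Ln_of_real[of "real p"] by (simp add: a_def)
    hence "prime_power_fun p u = exp (- (2 - u) * a)" using assms by (simp add: prime_power_fun_def powr_def)
    also have "\<dots> = exp (- 2 * a) * exp (a * u)" by (simp add: exp_add[symmetric] algebra_simps)
    also have "exp (- 2 * a) = c" unfolding c_def a_def by (subst exp_of_real[symmetric]) simp
    finally show "prime_power_fun p u = c * exp (a * u)" .
  qed
  have d: "(deriv ^^ k) (\<lambda>u. c * exp (a * u)) = (\<lambda>u. c * a ^ k * exp (a * u))" for k
  proof (induction k)
    case (Suc k)
    have "deriv (\<lambda>u. c * a ^ k * exp (a * u)) u = c * a ^ Suc k * exp (a * u)" for u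
      by (rule DERIV_imp_deriv) (auto intro!: derivative_eq_intros)
    moreover have "(deriv ^^ Suc k) (\<lambda>u. c * exp (a * u)) = deriv (\<lambda>u. c * a ^ k * exp (a * u))"
      using Suc by simp
    ultimately show ?case by (simp only: fun_eq_iff) simp
  qed simp
  have "a \<in> \<real>\<^sub>\<ge>\<^sub>0" "c \<in> \<real>\<^sub>\<ge>\<^sub>0" using assms by (auto simp: a_def c_def)
  thus ?thesis using prime_power_fun_holomorphic[OF assms] unfolding nonneg_coeffs_def eq
    by (simp add: d)
qed

lemma neg_Ln_series:
  fixes y :: complex
  assumes "norm y < 1"
  shows "(\<lambda>k. y ^ Suc k / of_nat (Suc k)) sums (- Ln (1 - y))"
proof -
  have "(\<lambda>n. - ((-1) ^ Suc n / of_nat n * (- y) ^ n)) sums (- Ln (1 + (- y)))"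
    using assms by (intro sums_minus Ln_series) simp
  also have "(\<lambda>n. - ((-1) ^ Suc n / of_nat n * (- y) ^ n)) = (\<lambda>n. y ^ n / of_nat n)"
  proof
    fix n
    have "(-1) ^ n * (-1) ^ n = (1 :: complex)" by (simp flip: power_mult_distrib)
    hence "(-1) ^ n * ((-1) ^ n * y ^ n) = y ^ n" by (simp flip: mult.assoc)
    thus "- ((-1) ^ Suc n / of_nat n * (- y) ^ n) = y ^ n / of_nat n"
      unfolding power_minus[of y] by simp
  qed
  finally show ?thesis by (subst sums_Suc_iff) simp
qed

text \<open>The logarithm of the Euler factor at p of \<zeta>(s)^2 L(s, chi) L(s, cnj chi), with w
  in the place of chi p and s = 2 - u.\<close>

definition log_local_factor :: "complex \<Rightarrow> nat \<Rightarrow> complex \<Rightarrow> complex" where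
  "log_local_factor w p u = - 2 * Ln (1 - prime_power_fun p u) - Ln (1 - w * prime_power_fun p u) - Ln (1 - cnj w * prime_power_fun p u)"

lemma Ln_one_minus_holomorphic:
  assumes "norm w \<le> 1" "p \<ge> 2"
  shows "(\<lambda>u. Ln (1 - w * prime_power_fun p u)) holomorphic_on {u. Re u < 2}"
proof (intro holomorphic_intros prime_power_fun_holomorphic)
  fix u assume u: "u \<in> {u. Re u < 2}"
  have "norm (w * prime_power_fun p u) \<le> 1 * norm (prime_power_fun p u)"
    unfolding norm_mult by (intro mult_right_mono assms) auto
  also have "\<dots> < 1" using norm_prime_power_fun_less_1[OF assms(2), of u] u by simp
  finally have "Re (w * prime_power_fun p u) < 1" using complex_Re_le_cmod order.strict_trans1 by blast
  thus "1 - w * prime_power_fun p u \<notin> \<real>\<^sub>\<le>\<^sub>0" by (intro not_nonpos_Reals_Re_pos) simp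
qed (use assms in auto)

text \<open>In the expansion of the logarithms the coefficient of the k-th power of p^(-s) is (c0 +
  c1 (w^k + cnj w^k)) / k. The choice c0 = 2, c1 = 1 gives the full local factor, and c0 = 1, c1 = 0
  that of \<zeta> alone.\<close>

lemma nonneg_coeffs_neg_Ln:
  assumes "norm w \<le> 1" "p \<ge> 2"
    and pos: "\<And>k. c0 + c1 * (w ^ Suc k + cnj w ^ Suc k) \<in> \<real>\<^sub>\<ge>\<^sub>0"
  shows "nonneg_coeffs (\<lambda>u. c0 * (- Ln (1 - prime_power_fun p u)) + c1 * (- Ln (1 - w * prime_power_fun p u) + (- Ln (1 - cnj w * prime_power_fun p u))))"
proof (rule nonneg_coeffs_limit)
  define x where "x = prime_power_fun p"
  define a where "a = (\<lambda>k. (c0 + c1 * (w ^ Suc k + cnj w ^ Suc k)) / of_nat (Suc k))"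
  define C where "C = norm c0 + 2 * norm c1"
  show "nonneg_coeffs (\<lambda>u. \<Sum>k<n. a k * x u ^ Suc k)" for n
    unfolding x_def a_def using pos assms
    by (intro nonneg_coeffs_sum nonneg_coeffs_mult nonneg_coeffs_const nonneg_coeffs_power nonneg_coeffs_prime_power_fun nonneg_Reals_divide_I) (auto simp del: of_nat_Suc)
  have x: "norm (x u) \<le> 1/2" if "u \<in> ball 0 (1/2)" for u
    unfolding x_def using norm_prime_power_fun_le_half[OF assms(2) that] .
  have an: "norm (a k) \<le> C" for k
  proof -
    have "norm w ^ Suc k \<le> 1" using assms(1) by (intro power_le_one) auto
    hence "norm (w ^ Suc k) \<le> 1" "norm (cnj w ^ Suc k) \<le> 1" by (simp_all only: norm_power complex_mod_cnj)
    hence "norm (w ^ Suc k + cnj w ^ Suc k) \<le> 2" using norm_triangle_ineq[of "w ^ Suc k" "cnj w ^ Suc k"] by linarith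
    hence "norm c1 * norm (w ^ Suc k + cnj w ^ Suc k) \<le> norm c1 * 2" by (intro mult_left_mono) auto
    hence 1: "norm (c0 + c1 * (w ^ Suc k + cnj w ^ Suc k)) \<le> C"
      unfolding C_def using norm_triangle_ineq[of c0 "c1 * (w ^ Suc k + cnj w ^ Suc k)"] by (simp only: norm_mult)
    have "norm (a k) = norm (c0 + c1 * (w ^ Suc k + cnj w ^ Suc k)) / real (Suc k)" by (simp only: a_def norm_divide norm_of_nat)
    also have "\<dots> \<le> norm (c0 + c1 * (w ^ Suc k + cnj w ^ Suc k)) / 1" by (intro divide_left_mono) auto
    finally show ?thesis using 1 by simp
  qed
  have "uniform_limit (ball 0 (1/2)) (\<lambda>n u. \<Sum>k<n. a k * x u ^ Suc k) (\<lambda>u. \<Sum>k. a k * x u ^ Suc k) sequentially"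
  proof (rule Weierstrass_m_test)
    show "summable (\<lambda>k. C * (1/2) ^ Suc k)"
      using summable_geometric[of "1/2 :: real"] by (intro summable_mult) (subst summable_Suc_iff, simp)
    show "norm (a k * x u ^ Suc k) \<le> C * (1/2) ^ Suc k" if "u \<in> ball 0 (1/2)" for k u
      unfolding norm_mult norm_power using an[of k] x[OF that] order.trans[OF norm_ge_zero an[of k]]
      by (intro mult_mono power_mono) auto
  qed
  moreover have "(\<Sum>k. a k * x u ^ Suc k) = c0 * (- Ln (1 - x u)) + c1 * (- Ln (1 - w * x u) + (- Ln (1 - cnj w * x u)))" if u: "u \<in> ball 0 (1/2)" for u
  proof -
    have n1: "norm (x u) < 1" using x[OF u] by simp
    have n2: "norm (w' * x u) < 1" if "norm w' \<le> 1" for w'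
    proof -
      have "norm (w' * x u) \<le> 1 * norm (x u)" unfolding norm_mult using that by (intro mult_right_mono) auto
      thus ?thesis using n1 by simp
    qed
    have "(\<lambda>k. c0 * (x u ^ Suc k / of_nat (Suc k)) + c1 * ((w * x u) ^ Suc k / of_nat (Suc k) + (cnj w * x u) ^ Suc k / of_nat (Suc k))) sums
       (c0 * (- Ln (1 - x u)) + c1 * (- Ln (1 - w * x u) + (- Ln (1 - cnj w * x u))))"
      using assms(1) by (intro sums_add sums_mult neg_Ln_series n1 n2) auto
    also have "(\<lambda>k. c0 * (x u ^ Suc k / of_nat (Suc k)) + c1 * ((w * x u) ^ Suc k / of_nat (Suc k) + (cnj w * x u) ^ Suc k / of_nat (Suc k))) = (\<lambda>k. a k * x u ^ Suc k)"
    proof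
      fix k
      show "c0 * (x u ^ Suc k / of_nat (Suc k)) + c1 * ((w * x u) ^ Suc k / of_nat (Suc k) + (cnj w * x u) ^ Suc k / of_nat (Suc k)) = a k * x u ^ Suc k"
        unfolding a_def power_mult_distrib by (simp add: field_simps del: of_nat_Suc power_Suc)
    qed
    finally show ?thesis by (simp add: sums_iff)
  qed
  ultimately show "uniform_limit (ball 0 (1/2)) (\<lambda>n u. \<Sum>k<n. a k * x u ^ Suc k)
     (\<lambda>u. c0 * (- Ln (1 - prime_power_fun p u)) + c1 * (- Ln (1 - w * prime_power_fun p u) + (- Ln (1 - cnj w * prime_power_fun p u)))) sequentially"
    unfolding x_def by (subst (asm) uniform_limit_cong'[OF refl]) auto
qed

text \<open>The square of \<zeta> contributes 2 to each coefficient, which offsets w^k + cnj w^k = 2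
  Re (w^k) >= -2.\<close>

lemma nonneg_coeffs_log_local_factor:
  assumes w: "norm w \<le> 1" and p: "p \<ge> 2"
  shows "nonneg_coeffs (log_local_factor w p)"
proof -
  have "2 + 1 * (w ^ Suc k + cnj w ^ Suc k) \<in> \<real>\<^sub>\<ge>\<^sub>0" for k
  proof -
    have "norm (w ^ Suc k) \<le> 1" using power_le_one[of "norm w" "Suc k"] w by (simp only: norm_power norm_ge_zero)
    hence "- 1 \<le> Re (w ^ Suc k)" using abs_Re_le_cmod[of "w ^ Suc k"] by linarith
    moreover have "w ^ Suc k + cnj w ^ Suc k = of_real (2 * Re (w ^ Suc k))"
      unfolding complex_cnj_power[symmetric] by (rule complex_add_cnj)
    ultimately show ?thesis by (simp add: complex_nonneg_Reals_iff del: power_Suc)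
  qed
  from nonneg_coeffs_neg_Ln[OF w p this] show ?thesis
    by (rule nonneg_coeffs_cong[rotated]) (simp add: log_local_factor_def)
qed

lemma nonneg_coeffs_neg_Ln_1:
  assumes p: "p \<ge> 2"
  shows "nonneg_coeffs (\<lambda>u. - Ln (1 - prime_power_fun p u))"
  using nonneg_coeffs_neg_Ln[of 0 p 1 0] p by simp

lemma exp_log_local_factor:
  assumes w: "norm w \<le> 1" and p: "p \<ge> 2" and u: "Re u < 2"
  shows "exp (log_local_factor w p u) * ((1 - prime_power_fun p u) ^ 2 * (1 - w * prime_power_fun p u) * (1 - cnj w * prime_power_fun p u)) = 1"
proof -
  have nz: "1 - w' * prime_power_fun p u \<noteq> 0" if "norm w' \<le> 1" for w'
  proof
    assume "1 - w' * prime_power_fun p u = 0"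
    hence "norm (w' * prime_power_fun p u) = 1" by simp
    moreover have "norm (w' * prime_power_fun p u) \<le> 1 * norm (prime_power_fun p u)"
      unfolding norm_mult using that by (intro mult_right_mono) auto
    ultimately show False using norm_prime_power_fun_less_1[OF p u] by simp
  qed
  have "exp (log_local_factor w p u) = inverse ((1 - prime_power_fun p u) ^ 2) * inverse (1 - w * prime_power_fun p u) * inverse (1 - cnj w * prime_power_fun p u)"
    using nz[of 1] nz[of w] nz[of "cnj w"] w
    by (simp add: log_local_factor_def exp_diff exp_minus exp_double divide_inverse)
  also have "\<dots> = inverse ((1 - prime_power_fun p u) ^ 2 * (1 - w * prime_power_fun p u) * (1 - cnj w * prime_power_fun p u))"
    by (simp only: inverse_mult_distrib)
  finally have e: "exp (log_local_factor w p u) = inverse ((1 - prime_power_fun p u) ^ 2 * (1 - w * prime_power_fun p u) * (1 - cnj w * prime_power_fun p u))" .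
  have "(1 - prime_power_fun p u) ^ 2 * (1 - w * prime_power_fun p u) * (1 - cnj w * prime_power_fun p u) \<noteq> 0"
    using nz[of 1] nz[of w] nz[of "cnj w"] w by simp
  thus ?thesis by (simp only: e left_inverse not_False_eq_True)
qed

lemma uniform_limit_eqI:
  assumes "uniform_limit S f l F" "\<And>n x. x \<in> S \<Longrightarrow> f n x = g n x" "\<And>x. x \<in> S \<Longrightarrow> l x = m x"
  shows "uniform_limit S g m F"
  using assms unfolding uniform_limit_iff by simp

context primitive_char
begin

interpretation c: primitive_char N "\<lambda>a. cnj (chi a)" by (rule cnj_primitive)
interpretation z: dirichlet_char 1 "\<lambda>_. 1" by (rule trivial_char)

lemma L0_cnj:
  assumes "Re s > -1"
  shows "c.L0 s = cnj (L0 (cnj s))"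
proof (rule analytic_continuation_open[of "{s. Re s > 1}" "{s. Re s > -1}" c.L0 "\<lambda>s. cnj (L0 (cnj s))"])
  show "{s. Re s > 1} \<noteq> {}" by (auto intro!: exI[of _ 2])
  show "connected {s. Re s > -1}" by (intro convex_connected convex_halfspace_Re_gt)
  have "cnj ` {s. Re s > -1} = {s. Re s > -1}" by (auto simp: image_iff intro!: exI[of _ "cnj _"])
  hence "(cnj \<circ> L0 \<circ> cnj) holomorphic_on {s. Re s > -1}"
    using L0_holomorphic by (intro holomorphic_on_compose_cnj_cnj open_Re_gt) simp
  thus "(\<lambda>s. cnj (L0 (cnj s))) holomorphic_on {s. Re s > -1}" by (simp add: o_def)
  fix s assume "s \<in> {s. Re s > 1}"
  hence s: "Re s > 1" by simp
  have "(\<lambda>n. cnj (L_term (cnj s) n)) sums cnj (L0 (cnj s))"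
    using L0_sums[of "cnj s"] s by (subst sums_cnj) auto
  moreover have "cnj (L_term (cnj s) n) = c.L_term s n" for n
    by (simp add: L_term_def c.L_term_def cnj_powr del: of_nat_Suc)
  ultimately have "c.L_term s sums cnj (L0 (cnj s))" by simp
  with c.L0_sums[OF s] show "c.L0 s = cnj (L0 (cnj s))" by (rule sums_unique2)
qed (use assms open_Re_gt c.L0_holomorphic in auto)

lemma z_L0_eq: "s \<noteq> 1 \<Longrightarrow> z.L0 s = hurwitz_K s 1 / (s - 1)"
  unfolding z.L0_def z.L_num_def by simp

text \<open>Again s = 2 - u. The Riemann zeta function appears as the L-function of the trivial
  character modulo 1, so the sieve estimates apply to all factors alike.\<close>

definition zeta_L_product :: "complex \<Rightarrow> complex" where
  "zeta_L_product u = z.L0 (2 - u) ^ 2 * L0 (2 - u) * c.L0 (2 - u)"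

lemma euler_factor_eq:
  "z.dirichlet_term (2 - u) p = prime_power_fun p u" "dirichlet_term (2 - u) p = chi (int p) * prime_power_fun p u"
  "c.dirichlet_term (2 - u) p = cnj (chi (int p)) * prime_power_fun p u"
  by (simp_all add: z.dirichlet_term_def dirichlet_term_def c.dirichlet_term_def prime_power_fun_def)

lemma zeta_L_product_holomorphic: "zeta_L_product holomorphic_on {u. Re u < 1}"
proof -
  have h: "(\<lambda>s. hurwitz_K s 1) holomorphic_on {s. Re s > -1}" by (rule hurwitz_K_holomorphic) simp
  have a: "(\<lambda>u. f (2 - u)) holomorphic_on {u. Re u < 1}" if "f holomorphic_on {s. Re s > -1}" for f
  proof -
    have 1: "(\<lambda>u. 2 - u :: complex) holomorphic_on {u. Re u < 1}" by (intro holomorphic_intros)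
    have 2: "(\<lambda>u. 2 - u :: complex) ` {u. Re u < 1} \<subseteq> {s. Re s > -1}" by auto
    from holomorphic_on_compose_gen[OF 1 that 2] show ?thesis by (simp add: o_def)
  qed
  have "(\<lambda>u. (hurwitz_K (2 - u) 1 / ((2 - u) - 1)) ^ 2 * L0 (2 - u) * c.L0 (2 - u)) holomorphic_on {u. Re u < 1}"
    by (intro holomorphic_intros a h L0_holomorphic c.L0_holomorphic) auto
  moreover have "(hurwitz_K (2 - u) 1 / ((2 - u) - 1)) ^ 2 * L0 (2 - u) * c.L0 (2 - u) = zeta_L_product u" if "u \<in> {u. Re u < 1}" for u
  proof -
    have "2 - u \<noteq> 1" using that by auto
    from z_L0_eq[OF this] show ?thesis unfolding zeta_L_product_def by simp
  qed
  ultimately show ?thesis by (rule holomorphic_transform)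
qed

text \<open>Each L-value times its finite sieve product tends to 1 uniformly, with the tail of the
  sum of n^(-3/2) as rate. Dividing the whole function by these expressions leaves exactly the
  finite Euler product.\<close>

lemma zeta_L_product_uniform_limit:
  "uniform_limit (ball 0 (1/2)) (\<lambda>y u. \<Prod>p | prime p \<and> p \<le> y. exp (log_local_factor (chi (int p)) p u)) zeta_L_product sequentially"
proof -
  define T where "T = (\<lambda>y. infsum (\<lambda>n. real n powr (- (3/2))) {Suc y..})"
  have T: "T \<longlonglongrightarrow> 0"
    unfolding T_def by (intro infsum_tail_tendsto_0 powr_summable_on_atLeast1) simp
  have Re_u: "Re (2 - u) \<ge> 3/2" if "u \<in> ball 0 (1/2)" for u using that complex_Re_le_cmod[of u] by simp
  define Sz where "Sz = (\<lambda>y u. z.L0 (2 - u) * (\<Prod>p | prime p \<and> p \<le> y. 1 - z.dirichlet_term (2 - u) p))"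
  define Sx where "Sx = (\<lambda>y u. L0 (2 - u) * (\<Prod>p | prime p \<and> p \<le> y. 1 - dirichlet_term (2 - u) p))"
  define Sc where "Sc = (\<lambda>y u. c.L0 (2 - u) * (\<Prod>p | prime p \<and> p \<le> y. 1 - c.dirichlet_term (2 - u) p))"
  have lim1: "uniform_limit (ball 0 (1/2)) S (\<lambda>_. 1) sequentially"
    if "\<And>y u. u \<in> ball 0 (1/2) \<Longrightarrow> norm (S y u - 1) \<le> T y" for S :: "nat \<Rightarrow> complex \<Rightarrow> complex"
  proof (rule uniform_limitI)
    fix e :: real assume "e > 0"
    have "\<forall>\<^sub>F y in sequentially. T y < e" using T \<open>e > 0\<close> by (rule order_tendstoD)
    thus "\<forall>\<^sub>F y in sequentially. \<forall>u\<in>ball 0 (1/2). dist (S y u) 1 < e"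
    proof eventually_elim
      case (elim y)
      show ?case
      proof
        fix u :: complex assume "u \<in> ball 0 (1/2)"
        from that[OF this, of y] show "dist (S y u) 1 < e" using elim by (simp add: dist_norm)
      qed
    qed
  qed
  have Lz: "uniform_limit (ball 0 (1/2)) Sz (\<lambda>_. 1) sequentially"
    by (rule lim1, unfold Sz_def T_def, rule z.L0_euler_bound) (use Re_u in auto)
  have Lx: "uniform_limit (ball 0 (1/2)) Sx (\<lambda>_. 1) sequentially"
    by (rule lim1, unfold Sx_def T_def, rule L0_euler_bound) (use Re_u in auto)
  have Lc: "uniform_limit (ball 0 (1/2)) Sc (\<lambda>_. 1) sequentially"
    by (rule lim1, unfold Sc_def T_def, rule c.L0_euler_bound) (use Re_u in auto)
  have bd1: "bounded ((\<lambda>_. 1 :: complex) ` ball 0 (1/2 :: real))" for f by (rule bounded_subset[of "{1}"]) auto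
  have "uniform_limit (ball 0 (1/2)) (\<lambda>y u. Sz y u * Sz y u) (\<lambda>u. 1 * 1) sequentially"
    by (rule uniform_lim_mult[OF Lz Lz bd1 bd1])
  hence "uniform_limit (ball 0 (1/2)) (\<lambda>y u. Sz y u * Sz y u) (\<lambda>_. 1) sequentially" by simp
  from uniform_lim_mult[OF this uniform_lim_mult[OF Lx Lc bd1 bd1, simplified] bd1 bd1]
  have D: "uniform_limit (ball 0 (1/2)) (\<lambda>y u. Sz y u * Sz y u * (Sx y u * Sc y u)) (\<lambda>_. 1) sequentially" by simp
  have "cball 0 (1/2) \<subseteq> {u. Re u < 1}"
  proof
    fix u :: complex assume "u \<in> cball 0 (1/2)"
    thus "u \<in> {u. Re u < 1}" using complex_Re_le_cmod[of u] by simp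
  qed
  hence "compact (zeta_L_product ` cball 0 (1/2))"
    by (intro compact_continuous_image holomorphic_on_imp_continuous_on holomorphic_on_subset[OF zeta_L_product_holomorphic]) auto
  hence bF: "bounded (zeta_L_product ` ball 0 (1/2))"
    by (rule bounded_subset[OF compact_imp_bounded]) auto
  have "uniform_limit (ball 0 (1/2)) (\<lambda>y u. zeta_L_product u / (Sz y u * Sz y u * (Sx y u * Sc y u))) (\<lambda>u. zeta_L_product u / 1) sequentially"
  proof (rule uniform_lim_divide[OF uniform_limit_const D])
    show "1 \<le> norm (1 :: complex)" by simp
  qed (use bF in auto)
  moreover have "zeta_L_product u / (Sz y u * Sz y u * (Sx y u * Sc y u)) = (\<Prod>p | prime p \<and> p \<le> y. exp (log_local_factor (chi (int p)) p u))"
    if u: "u \<in> ball 0 (1/2)" for y u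
  proof -
    define E where "E = (\<Prod>p | prime p \<and> p \<le> y. exp (log_local_factor (chi (int p)) p u))"
    define Pz where "Pz = (\<Prod>p | prime p \<and> p \<le> y. 1 - z.dirichlet_term (2 - u) p)"
    define Px where "Px = (\<Prod>p | prime p \<and> p \<le> y. 1 - dirichlet_term (2 - u) p)"
    define Pc where "Pc = (\<Prod>p | prime p \<and> p \<le> y. 1 - c.dirichlet_term (2 - u) p)"
    have "E * (Pz ^ 2 * Px * Pc) = (\<Prod>p | prime p \<and> p \<le> y. exp (log_local_factor (chi (int p)) p u) * ((1 - z.dirichlet_term (2 - u) p) ^ 2 * (1 - dirichlet_term (2 - u) p) * (1 - c.dirichlet_term (2 - u) p)))"
      by (simp only: E_def Pz_def Px_def Pc_def prod.distrib prod_power_distrib)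
    also have "\<dots> = 1"
    proof (intro prod.neutral ballI)
      fix p assume "p \<in> {p. prime p \<and> p \<le> y}"
      hence "p \<ge> 2" using prime_ge_2_nat by blast
      moreover have "Re u < 2" using Re_u[OF u] by simp
      ultimately show "exp (log_local_factor (chi (int p)) p u) * ((1 - z.dirichlet_term (2 - u) p) ^ 2 * (1 - dirichlet_term (2 - u) p) * (1 - c.dirichlet_term (2 - u) p)) = 1"
        unfolding euler_factor_eq by (intro exp_log_local_factor norm_chi_le_1)
    qed
    finally have EP: "E * (Pz ^ 2 * Px * Pc) = 1" .
    have nz: "Pz \<noteq> 0" "Px \<noteq> 0" "Pc \<noteq> 0" using EP by auto
    have L: "L0 (2 - u) \<noteq> 0" "c.L0 (2 - u) \<noteq> 0" "z.L0 (2 - u) \<noteq> 0"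
    proof -
      have "Re (2 - u) > 1" using Re_u[OF u] by linarith
      thus "L0 (2 - u) \<noteq> 0" "c.L0 (2 - u) \<noteq> 0" "z.L0 (2 - u) \<noteq> 0"
        by (rule L0_nonzero c.L0_nonzero z.L0_nonzero)+
    qed
    have "zeta_L_product u / (Sz y u * Sz y u * (Sx y u * Sc y u)) = 1 / (Pz ^ 2 * Px * Pc)"
      unfolding zeta_L_product_def Sz_def Sx_def Sc_def Pz_def[symmetric] Px_def[symmetric] Pc_def[symmetric]
      using nz L by (simp add: field_simps power2_eq_square)
    also have "\<dots> = E" using EP nz by (simp add: divide_eq_eq)
    finally show ?thesis by (simp add: E_def)
  qed
  ultimately show ?thesis by (rule uniform_limit_eqI) auto
qed

text \<open>As chi q = 0, the local factor at q is E^2 with E the Euler factor of \<zeta>. A finite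
  Euler product is therefore E exp G, where G collects one more copy of log E and the other primes,
  and the difference E (exp G - 1) has nonnegative coefficients.\<close>

lemma nonneg_coeffs_zeta_L_product_minus_factor:
  assumes q: "prime q" "chi (int q) = 0"
  shows "nonneg_coeffs (\<lambda>u. zeta_L_product u - exp (- Ln (1 - prime_power_fun q u)))"
proof (rule nonneg_coeffs_limit)
  define g where "g = (\<lambda>p. log_local_factor (chi (int p)) p)"
  define E where "E = (\<lambda>u. exp (- Ln (1 - prime_power_fun q u)))"
  \<comment> \<open>The range is y + q rather than y so that q belongs to every finite product and
    can be split off for all y.\<close>
  define A where "A = (\<lambda>y. {p. prime p \<and> p \<le> y + q} - {q})"
  define G where "G = (\<lambda>y u. - Ln (1 - prime_power_fun q u) + (\<Sum>p\<in>A y. g p u))"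
  have q2: "q \<ge> 2" using q prime_ge_2_nat by blast
  have A2: "p \<ge> 2" if "p \<in> A y" for p y using that prime_ge_2_nat by (auto simp: A_def)
  have hol_Ln: "(\<lambda>u. Ln (1 - prime_power_fun p u)) holomorphic_on {u. Re u < 2}" if "p \<ge> 2" for p
    using Ln_one_minus_holomorphic[of 1 p] that by simp
  have hol_g: "g p holomorphic_on {u. Re u < 2}" if "p \<ge> 2" for p
    unfolding g_def log_local_factor_def[abs_def] using that
    by (intro holomorphic_intros hol_Ln Ln_one_minus_holomorphic) (auto simp: norm_chi_le_1)
  have hol_G: "G y holomorphic_on {u. Re u < 2}" for y
    unfolding G_def by (intro holomorphic_intros hol_Ln hol_g A2 q2)
  have sub: "cball 0 (1/2) \<subseteq> {u. Re u < 2}"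
  proof
    fix u :: complex assume "u \<in> cball 0 (1/2)"
    thus "u \<in> {u. Re u < 2}" using complex_Re_le_cmod[of u] by simp
  qed
  have bnd: "\<exists>B. \<forall>u\<in>ball 0 (1/2). norm (f u) \<le> B" if "f holomorphic_on {u. Re u < 2}" for f :: "complex \<Rightarrow> complex"
  proof -
    have "compact (f ` cball 0 (1/2))"
      by (intro compact_continuous_image holomorphic_on_imp_continuous_on holomorphic_on_subset[OF that sub]) auto
    then obtain B where "\<And>u. u \<in> cball 0 (1/2) \<Longrightarrow> norm (f u) \<le> B"
      using compact_imp_bounded bounded_iff by (metis imageI)
    thus ?thesis by (intro exI[of _ B]) auto
  qed
  have expm1: "nonneg_coeffs (\<lambda>u. exp (f u) - 1)" if "nonneg_coeffs f" "f holomorphic_on {u. Re u < 2}" for f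
    using bnd[OF that(2)] nonneg_coeffs_exp_minus_1[OF that(1)] by blast
  have nE: "nonneg_coeffs E"
  proof -
    have "nonneg_coeffs (\<lambda>u. (exp (- Ln (1 - prime_power_fun q u)) - 1) + 1)"
      by (intro nonneg_coeffs_add expm1 nonneg_coeffs_const nonneg_coeffs_neg_Ln_1 q2 holomorphic_intros hol_Ln) auto
    thus ?thesis by (simp add: E_def)
  qed
  have nG: "nonneg_coeffs (G y)" for y
    unfolding G_def g_def
    by (intro nonneg_coeffs_add nonneg_coeffs_neg_Ln_1 nonneg_coeffs_sum nonneg_coeffs_log_local_factor norm_chi_le_1 q2 A2)
  show "nonneg_coeffs (\<lambda>u. E u * (exp (G y u) - 1))" for y
    by (intro nonneg_coeffs_mult nE expm1 nG hol_G)
  have "uniform_limit (ball 0 (1/2)) (\<lambda>y u. (\<Prod>p | prime p \<and> p \<le> y + q. exp (g p u))) zeta_L_product sequentially"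
    unfolding g_def by (rule filterlim_compose[OF zeta_L_product_uniform_limit filterlim_add_const_nat_at_top])
  hence "uniform_limit (ball 0 (1/2)) (\<lambda>y u. (\<Prod>p | prime p \<and> p \<le> y + q. exp (g p u)) - E u) (\<lambda>u. zeta_L_product u - E u) sequentially"
    by (intro uniform_limit_intros)
  moreover have "(\<Prod>p | prime p \<and> p \<le> y + q. exp (g p u)) - E u = E u * (exp (G y u) - 1)" for y u
  proof -
    have "{p. prime p \<and> p \<le> y + q} = insert q (A y)" using q by (auto simp: A_def)
    moreover have "finite (A y)" "q \<notin> A y" by (auto simp: A_def)
    ultimately have "(\<Prod>p | prime p \<and> p \<le> y + q. exp (g p u)) = exp (g q u) * exp (\<Sum>p\<in>A y. g p u)"
      by (simp add: exp_sum)
    also have "exp (g q u) = E u * exp (- Ln (1 - prime_power_fun q u))"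
      by (simp add: g_def E_def log_local_factor_def q exp_add[symmetric])
    finally show ?thesis by (simp only: G_def exp_add right_diff_distrib mult_1_right mult.assoc)
  qed
  ultimately show "uniform_limit (ball 0 (1/2)) (\<lambda>y u. E u * (exp (G y u) - 1)) (\<lambda>u. zeta_L_product u - exp (- Ln (1 - prime_power_fun q u))) sequentially"
    by (simp add: E_def)
qed

text \<open>
  If \<open>L(1) = 0\<close>, then \<open>\<zeta>(2 - u)^2 L(2 - u, \<chi>) L(2 - u, cnj \<chi>)\<close> is holomorphic for \<open>Re u < 3\<close>.  Its Taylor
  coefficients at \<open>0\<close> dominate those of the Euler factor of \<open>\<zeta>\<close> at a prime \<open>q\<close> dividing \<open>N\<close>, which is unbounded
  as \<open>u\<close> tends to \<open>2\<close>.
\<close>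

theorem L0_1_nonzero: "L0 1 \<noteq> 0"
proof
  assume L1: "L0 1 = 0"
  have cL1: "c.L0 1 = 0" using L0_cnj[of 1] L1 by simp
  \<comment> \<open>The supposed zeros of both L-functions at 1 absorb the two factors 1 / (s - 1)
    of \<zeta>^2, one each.\<close>
  define M where "M = (\<lambda>s. if s = 1 then deriv L0 1 else L0 s / (s - 1))"
  define Mc where "Mc = (\<lambda>s. if s = 1 then deriv c.L0 1 else c.L0 s / (s - 1))"
  have M: "M holomorphic_on {s. Re s > -1}"
    unfolding M_def by (rule pole_quotient_holomorphic[OF L0_holomorphic _ open_Re_gt L1]) simp
  have Mc: "Mc holomorphic_on {s. Re s > -1}"
    unfolding Mc_def by (rule pole_quotient_holomorphic[OF c.L0_holomorphic _ open_Re_gt cL1]) simp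
  obtain q :: nat where q: "prime q" "q dvd N" using prime_factor_nat N_ge_2 by (metis One_nat_def Suc_1 Suc_n_not_le_n)
  have "chi (int q) = 0"
    unfolding chi_eq_0_iff using q by (metis coprime_common_divisor coprime_int_iff dvd_refl not_prime_unit)
  define E where "E = (\<lambda>u. exp (- Ln (1 - prime_power_fun q u)))"
  have q2: "q \<ge> 2" using q prime_ge_2_nat by blast
  have E_hol: "E holomorphic_on {u. Re u < 2}"
    unfolding E_def using Ln_one_minus_holomorphic[of 1 q] q2 by (auto intro!: holomorphic_intros)
  define D where "D = (\<lambda>u. hurwitz_K (2 - u) 1 ^ 2 * M (2 - u) * Mc (2 - u))"
  have comp: "(\<lambda>u. f (2 - u)) holomorphic_on {u. Re u < 3}" if "f holomorphic_on {s. Re s > -1}" for f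
  proof -
    have 1: "(\<lambda>u. 2 - u :: complex) holomorphic_on {u. Re u < 3}" by (intro holomorphic_intros)
    have 2: "(\<lambda>u. 2 - u :: complex) ` {u. Re u < 3} \<subseteq> {s. Re s > -1}" by auto
    from holomorphic_on_compose_gen[OF 1 that 2] show ?thesis by (simp add: o_def)
  qed
  have D_hol: "D holomorphic_on {u. Re u < 3}"
    unfolding D_def by (intro holomorphic_intros comp M Mc hurwitz_K_holomorphic) simp
  have D_eq: "D u = zeta_L_product u" if "Re u < 1" for u
  proof -
    have "2 - u \<noteq> 1" using that by auto
    thus ?thesis by (simp add: D_def zeta_L_product_def M_def Mc_def z_L0_eq[unfolded One_nat_def] power2_eq_square field_simps)
  qed
  have nn: "nonneg_coeffs (\<lambda>u. D u - E u)"
  proof (rule nonneg_coeffs_cong[OF _ nonneg_coeffs_zeta_L_product_minus_factor[OF q(1) \<open>chi (int q) = 0\<close>]])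
    fix u :: complex assume "u \<in> ball 0 (1/2)"
    hence "Re u < 1" using complex_Re_le_cmod[of u] by simp
    thus "zeta_L_product u - exp (- Ln (1 - prime_power_fun q u)) = D u - E u" using D_eq by (simp add: E_def)
  qed
  \<comment> \<open>On the disc of radius 2 about u = 0 both D and E are holomorphic, so the Taylor
    series of D - E converges there; its nonnegative coefficients give the inequality at positive
    real points.\<close>
  have ge: "Re (D (of_real x)) \<ge> Re (E (of_real x))" if x: "0 < x" "x < 2" for x
  proof -
    have hol: "(\<lambda>u. D u - E u) holomorphic_on ball 0 2"
    proof (intro holomorphic_intros)
      have "Re u < 2" if "u \<in> ball 0 2" for u using that complex_Re_le_cmod[of u] by simp
      hence "ball 0 2 \<subseteq> {u. Re u < 2}" "ball 0 2 \<subseteq> {u. Re u < 3}" by force+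
      thus "D holomorphic_on ball 0 2" "E holomorphic_on ball 0 2"
        using D_hol E_hol holomorphic_on_subset by blast+
    qed
    have "complex_of_real x \<in> ball 0 2" using x by simp
    from holomorphic_power_series[OF hol this]
    have sums: "(\<lambda>n. (deriv ^^ n) (\<lambda>u. D u - E u) 0 / fact n * (of_real x) ^ n) sums (D (of_real x) - E (of_real x))" by simp
    have "0 \<le> Re ((deriv ^^ n) (\<lambda>u. D u - E u) 0 / fact n * (of_real x) ^ n)" for n
    proof -
      have "(deriv ^^ n) (\<lambda>u. D u - E u) 0 / fact n * (of_real x) ^ n \<in> \<real>\<^sub>\<ge>\<^sub>0"
        using nn x unfolding nonneg_coeffs_def
        by (intro nonneg_Reals_mult_I nonneg_Reals_divide_I nonneg_Reals_pow_I) (auto intro: nonneg_Reals_of_nat_I[of "fact n", simplified])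
      thus ?thesis by (simp only: complex_nonneg_Reals_iff)
    qed
    hence "0 \<le> Re (D (of_real x) - E (of_real x))"
      by (rule sums_le[OF _ sums_zero sums_Re[OF sums]])
    thus ?thesis by simp
  qed
  have "compact (D ` (of_real ` {0..2}))"
    by (intro compact_continuous_image holomorphic_on_imp_continuous_on holomorphic_on_subset[OF D_hol] continuous_intros) auto
  then obtain B where "\<And>x. x \<in> of_real ` {0..2::real} \<Longrightarrow> norm (D x) \<le> B"
    using compact_imp_bounded bounded_iff by (metis imageI)
  hence B: "Re (D (of_real x)) \<le> B" if "0 \<le> x" "x \<le> 2" for x
    using complex_Re_le_cmod[of "D (of_real x)"] that by (meson atLeastAtMost_iff imageI order.trans)
  \<comment> \<open>The contradiction is taken near u = 2, that is s = 0, where 1 / (1 - q^(-s))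
    blows up: th is chosen to make E equal to \<bar>B\<bar> + 2, above the bound for D, and e solves
    q^(-e) = th. From th >= 1/2 follows e <= 1, which keeps 2 - e in the range of both
    estimates.\<close>
  define th where "th = 1 - 1 / (\<bar>B\<bar> + 2)"
  have th: "th \<ge> 1/2" "th < 1" by (auto simp: th_def field_simps)
  define e where "e = - ln th / ln (real q)"
  have lq: "ln (real q) \<ge> ln 2" using q2 by simp
  have e: "0 < e" "e \<le> 1"
  proof -
    have l2: "ln (2::real) > 0" by simp
    have "ln th < 0" using th by simp
    thus "0 < e" unfolding e_def using lq l2 by (intro divide_pos_pos) linarith+
    have "ln (1/2) \<le> ln th" using th by (subst ln_le_cancel_iff) auto
    hence "- ln th \<le> ln (real q)" using lq by (simp add: ln_div)
    moreover have "ln (real q) > 0" using lq l2 by linarith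
    ultimately show "e \<le> 1" unfolding e_def by (subst pos_divide_le_eq) auto
  qed
  have pe: "prime_power_fun q (of_real (2 - e)) = of_real th"
  proof -
    have "prime_power_fun q (of_real (2 - e)) = of_real (real q) powr (of_real (- e))" by (simp add: prime_power_fun_def)
    also have "\<dots> = of_real (real q powr (- e))" by (rule powr_of_real) simp
    also have "real q powr (- e) = th"
      using q2 th lq by (simp add: powr_def e_def)
    finally show ?thesis .
  qed
  have "E (of_real (2 - e)) = inverse (1 - of_real th)"
  proof -
    have "1 - complex_of_real th \<noteq> 0" using th by (metis eq_iff_diff_eq_0 less_irrefl of_real_1 of_real_eq_iff)
    thus ?thesis unfolding E_def pe exp_minus by (subst exp_Ln) auto
  qed
  also have "\<dots> = of_real (inverse (1 - th))" by simp
  also have "inverse (1 - th) = \<bar>B\<bar> + 2" unfolding th_def by simp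
  finally have "Re (E (of_real (2 - e))) = \<bar>B\<bar> + 2" by simp
  thus False using ge[of "2 - e"] B[of "2 - e"] e by simp
qed

end

section \<open>The entire continuation\<close>

lemma norm_Gamma_le_Gamma_Re:
  assumes "Re z > 0" shows "norm (Gamma z) \<le> Gamma (Re z)"
proof -
  have "Gamma z = (LINT t:{0<..}|lborel. of_real t powr (z - 1) * exp (- of_real (1 * t)))"
    using Gamma_integral_scaled(2)[OF assms, of 1] by simp
  also have "norm \<dots> \<le> (LINT t|lborel. norm (indicator {0<..} t *\<^sub>R (of_real t powr (z - 1) * exp (- complex_of_real (1 * t)))))"
    unfolding set_lebesgue_integral_def by (rule integral_norm_bound)
  also have "(\<lambda>t. norm (indicator {0<..} t *\<^sub>R (of_real t powr (z - 1) * exp (- complex_of_real (1 * t))))) = (\<lambda>t. indicator {0<..} t * (t powr (Re z - 1) * exp (- (1 * t))))"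
    by (auto simp: fun_eq_iff indicator_def norm_mult norm_powr_real_powr)
  also have "(LINT t|lborel. indicator {0<..} t * (t powr (Re z - 1) * exp (- (1 * t)))) = Gamma (Re z)"
    using Gamma_integral_scaled_real(2)[of "Re z - 1" 1] assms by simp
  finally show ?thesis .
qed

text \<open>Induction on unit steps: Gamma x = (x - 1) Gamma (x - 1), the factor x - 1 is at most
  exp (x - 1), and (x - 1) + (x - 1)^2 <= x^2. The square in the exponent is the source of order two
  in the growth of L.\<close>

lemma Gamma_real_growth: "\<exists>M>0. \<forall>x\<ge>1/2. Gamma x \<le> M * exp (x ^ 2 :: real)"
proof -
  have "compact (Gamma ` {1/2..3/2::real})"
    by (intro compact_continuous_image continuous_on_Gamma) (auto elim!: nonpos_Ints_cases)
  then obtain M0 where M0: "\<And>x. x \<in> {1/2..3/2::real} \<Longrightarrow> norm (Gamma x) \<le> M0"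
    using compact_imp_bounded bounded_iff by (metis imageI)
  define M where "M = max M0 1"
  have "\<forall>x. 1/2 \<le> x \<and> x \<le> 3/2 + real n \<longrightarrow> Gamma x \<le> M * exp (x ^ 2)" for n
  proof (induction n)
    case 0
    have "Gamma x \<le> M * exp (x ^ 2)" if "1/2 \<le> x" "x \<le> 3/2" for x
    proof -
      have "Gamma x \<le> M * 1" using M0[of x] that by (auto simp: M_def)
      also have "\<dots> \<le> M * exp (x ^ 2)" by (intro mult_left_mono) (auto simp: M_def)
      finally show ?thesis .
    qed
    thus ?case by simp
  next
    case (Suc n)
    show ?case
    proof (intro allI impI)
      fix x :: real assume x: "1/2 \<le> x \<and> x \<le> 3/2 + real (Suc n)"
      show "Gamma x \<le> M * exp (x ^ 2)"
      proof (cases "x \<le> 3/2")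
        case True
        thus ?thesis using Suc x by auto
      next
        case False
        have "x - 1 \<notin> \<int>\<^sub>\<le>\<^sub>0" using False by (auto elim!: nonpos_Ints_cases)
        hence "Gamma x = (x - 1) * Gamma (x - 1)" using Gamma_plus1[of "x - 1"] by simp
        also have "\<dots> \<le> exp (x - 1) * (M * exp ((x - 1) ^ 2))"
          using Suc x False exp_ge_add_one_self[of "x - 1"] by (intro mult_mono) (auto simp: Gamma_real_nonneg)
        also have "\<dots> = M * exp ((x - 1) + (x - 1) ^ 2)" by (simp add: exp_add)
        also have "\<dots> \<le> M * exp (x ^ 2)" using False
          by (intro mult_left_mono) (auto simp: M_def power2_eq_square algebra_simps)
        finally show ?thesis .
      qed
    qed
  qed
  hence "Gamma x \<le> M * exp (x ^ 2)" if "x \<ge> 1/2" for x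
    using that real_arch_simple[of "x - 3/2"] by (metis diff_le_eq add.commute)
  thus ?thesis by (intro exI[of _ M]) (auto simp: M_def)
qed

lemma ii_powr: "\<i> powr z = exp (\<i> * of_real pi * z / 2)" "(- \<i>) powr z = exp (- (\<i> * of_real pi * z / 2))"
  by (simp_all add: powr_def Ln_minus_ii mult_ac)

context primitive_char
begin

interpretation c: primitive_char N "\<lambda>a. cnj (chi a)" by (rule cnj_primitive)

text \<open>The parity of the character, so that (3 + chi (-1)) / 2 = 2 - delta and the trivial
  zeros are the points -(2 n + delta) with n >= 0.\<close>

definition delta :: nat where "delta = (if chi (-1) = 1 then 0 else 1)"

definition fe_trig :: "complex \<Rightarrow> complex" where
  "fe_trig s = (- \<i>) powr (s - 1) + chi (-1) * \<i> powr (s - 1)"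

lemma fe_trig_eq:
  "fe_trig s = (if chi (-1) = 1 then 2 * cos (of_real pi * (s - 1) / 2) else - 2 * \<i> * sin (of_real pi * (s - 1) / 2))"
proof -
  have "fe_trig s = exp (- (\<i> * (of_real pi * (s - 1) / 2))) + chi (-1) * exp (\<i> * (of_real pi * (s - 1) / 2))"
    unfolding fe_trig_def ii_powr by (simp add: mult_ac)
  thus ?thesis using chi_minus_1_cases
    by (auto simp: cos_exp_eq sin_exp_eq' algebra_simps)
qed

lemma fe_trig_eq_0_iff: "fe_trig s = 0 \<longleftrightarrow> (\<exists>n::int. s = 2 * of_int n - of_nat delta)"
proof (cases "chi (-1) = 1")
  case True
  have "fe_trig s = 2 * cos (of_real pi * (s - 1) / 2)" using True by (simp add: fe_trig_eq)
  also have "cos (of_real pi * (s - 1) / 2) = sin (of_real pi * (s / 2))"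
  proof -
    have "of_real pi * (s - 1) / 2 = - (of_real pi / 2 - of_real pi * (s / 2))" by (simp add: field_simps)
    thus ?thesis by (simp only: cos_minus sin_cos_eq)
  qed
  finally have "fe_trig s = 0 \<longleftrightarrow> (\<exists>n::int. s / 2 = of_int n)"
    by (auto simp: sin_eq_0)
  also have "\<dots> \<longleftrightarrow> (\<exists>n::int. s = 2 * of_int n)" by (simp add: field_simps)
  finally show ?thesis using True by (simp add: delta_def)
next
  case False
  have "fe_trig s = 0 \<longleftrightarrow> sin (of_real pi * ((s - 1) / 2)) = 0" using False by (simp add: fe_trig_eq)
  also have "\<dots> \<longleftrightarrow> (\<exists>n::int. (s - 1) / 2 = of_int n)" by (auto simp: sin_eq_0)
  also have "\<dots> \<longleftrightarrow> (\<exists>n::int. s = 2 * of_int n - 1)"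
  proof
    assume "\<exists>n::int. (s - 1) / 2 = of_int n"
    then obtain n :: int where "(s - 1) / 2 = of_int n" by blast
    hence "s = 2 * of_int (n + 1) - 1" by (simp add: field_simps)
    thus "\<exists>n::int. s = 2 * of_int n - 1" by blast
  next
    assume "\<exists>n::int. s = 2 * of_int n - 1"
    then obtain n :: int where "s = 2 * of_int n - 1" by blast
    hence "(s - 1) / 2 = of_int (n - 1)" by (simp add: field_simps)
    thus "\<exists>n::int. (s - 1) / 2 = of_int n" by blast
  qed
  finally show ?thesis using False by (simp add: delta_def)
qed

lemma fe_trig_deriv_nonzero:
  assumes "fe_trig s = 0"
  shows "\<exists>D. (fe_trig has_field_derivative D) (at s) \<and> D \<noteq> 0"
proof (cases "chi (-1) = 1")
  case True
  have eq: "fe_trig = (\<lambda>s. 2 * cos (of_real pi * (s - 1) / 2))" using True by (simp add: fe_trig_eq fun_eq_iff)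
  have "(fe_trig has_field_derivative (- of_real pi * sin (of_real pi * (s - 1) / 2))) (at s)"
    unfolding eq by (auto intro!: derivative_eq_intros)
  moreover have "sin (of_real pi * (s - 1) / 2) \<noteq> 0"
  proof
    assume "sin (of_real pi * (s - 1) / 2) = 0"
    moreover have "cos (of_real pi * (s - 1) / 2) = 0" using assms unfolding eq by simp
    ultimately show False using sin_cos_squared_add[of "of_real pi * (s - 1) / 2"] by simp
  qed
  ultimately show ?thesis by (intro exI[of _ "- of_real pi * sin (of_real pi * (s - 1) / 2)"]) simp
next
  case False
  have eq: "fe_trig = (\<lambda>s. - 2 * \<i> * sin (of_real pi * (s - 1) / 2))" using False by (simp add: fe_trig_eq fun_eq_iff)
  have "(fe_trig has_field_derivative (- \<i> * of_real pi * cos (of_real pi * (s - 1) / 2))) (at s)"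
    unfolding eq by (auto intro!: derivative_eq_intros)
  moreover have "cos (of_real pi * (s - 1) / 2) \<noteq> 0"
  proof
    assume "cos (of_real pi * (s - 1) / 2) = 0"
    moreover have "sin (of_real pi * (s - 1) / 2) = 0" using assms unfolding eq by simp
    ultimately show False using sin_cos_squared_add[of "of_real pi * (s - 1) / 2"] by simp
  qed
  ultimately show ?thesis by (intro exI[of _ "- \<i> * of_real pi * cos (of_real pi * (s - 1) / 2)"]) simp
qed

definition fe_rest :: "complex \<Rightarrow> complex" where
  "fe_rest s = Gamma (1 - s) * of_real (2 * pi / real N) powr (s - 1) / c.gauss"

text \<open>At s = -1/2 the right side of the functional equation cannot vanish: the dual L-value is
  taken at 3/2, inside the region of the Euler product, and the trigonometric factor vanishes at
  integers only.\<close>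

lemma c_gauss_nonzero: "c.gauss \<noteq> 0"
proof
  assume 0: "c.gauss = 0"
  define s where "s = complex_of_real (- 1/2)"
  have "1 - s \<notin> \<int>\<^sub>\<le>\<^sub>0" by (auto elim!: nonpos_Ints_cases simp: complex_eq_iff s_def)
  hence G: "Gamma (1 - s) \<noteq> 0" by (simp add: Gamma_eq_zero_iff)
  have T: "fe_trig s \<noteq> 0"
  proof
    assume "fe_trig s = 0"
    then obtain n :: int where "s = 2 * of_int n - of_nat delta" using fe_trig_eq_0_iff by blast
    hence "- 1 = 2 * (2 * real_of_int n - real delta)" by (simp add: s_def complex_eq_iff)
    hence "real_of_int (- 1) = real_of_int (2 * (2 * n - int delta))" by simp
    hence "- 1 = 2 * (2 * n - int delta)" by (simp only: of_int_eq_iff)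
    thus False by presburger
  qed
  have "0 = Gamma (1 - s) * of_real (2 * pi / real N) powr (s - 1) * fe_trig s * c.L0 (1 - s)"
    using functional_equation_strip[of s] 0 by (simp add: fe_trig_def s_def)
  moreover have "c.L0 (1 - s) \<noteq> 0" by (rule c.L0_nonzero) (simp add: s_def)
  ultimately show False using G T N_pos by simp
qed

text \<open>Two formulas glued along Re s = -1; they agree on the strip -1 < Re s < 0, which makes
  the result entire.\<close>

definition L_ext :: "complex \<Rightarrow> complex" where
  "L_ext s = (if s \<in> {s. Re s > -1} then L0 s else fe_rest s * fe_trig s * c.L0 (1 - s))"

lemma fe_rest_holomorphic: "fe_rest holomorphic_on {s. Re s < 1}"
proof -
  have "1 - s \<notin> \<int>\<^sub>\<le>\<^sub>0" if "Re s < 1" for s using that by (auto elim!: nonpos_Ints_cases simp: complex_eq_iff)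
  thus ?thesis unfolding fe_rest_def using N_pos c_gauss_nonzero by (auto intro!: holomorphic_intros)
qed

lemma fe_trig_holomorphic: "fe_trig holomorphic_on A"
  unfolding fe_trig_def by (auto intro!: holomorphic_intros)

lemma L0_dual_holomorphic: "(\<lambda>s. c.L0 (1 - s)) holomorphic_on {s. Re s < 2}"
proof -
  have 1: "(\<lambda>u. 1 - u :: complex) holomorphic_on {u. Re u < 2}" by (intro holomorphic_intros)
  have 2: "(\<lambda>u. 1 - u :: complex) ` {u. Re u < 2} \<subseteq> {s. Re s > -1}" by auto
  from holomorphic_on_compose_gen[OF 1 c.L0_holomorphic 2] show ?thesis by (simp add: o_def)
qed

lemma fe_rhs_holomorphic: "(\<lambda>s. fe_rest s * fe_trig s * c.L0 (1 - s)) holomorphic_on {s. Re s < 1}"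
  by (intro holomorphic_intros fe_rest_holomorphic fe_trig_holomorphic holomorphic_on_subset[OF L0_dual_holomorphic]) auto

lemma fe_strip: "-1 < Re s \<Longrightarrow> Re s < 0 \<Longrightarrow> L0 s = fe_rest s * fe_trig s * c.L0 (1 - s)"
  using functional_equation_strip[of s] c_gauss_nonzero by (simp add: fe_rest_def fe_trig_def field_simps)

lemma L_ext_holomorphic: "L_ext holomorphic_on A"
proof -
  have "L_ext holomorphic_on ({s. Re s > -1} \<union> {s. Re s < 0})"
    unfolding L_ext_def
  proof (rule holomorphic_on_If_Un)
    show "(\<lambda>s. fe_rest s * fe_trig s * c.L0 (1 - s)) holomorphic_on {s. Re s < 0}"
      by (rule holomorphic_on_subset[OF fe_rhs_holomorphic]) auto
  qed (use L0_holomorphic fe_strip in \<open>auto simp: open_Re_gt open_halfspace_Re_lt\<close>)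
  moreover have "{s. Re s > -1} \<union> {s. Re s < 0} = UNIV" by auto
  ultimately show ?thesis using holomorphic_on_subset[of L_ext UNIV A] by simp
qed

lemma L_ext_eq_L0: "Re s > -1 \<Longrightarrow> L_ext s = L0 s"
  by (simp add: L_ext_def)

theorem functional_equation:
  assumes "Re s < 1" shows "L_ext s = fe_rest s * fe_trig s * c.L0 (1 - s)"
proof (rule analytic_continuation_open[of "{s. Re s < -1}" "{s. Re s < 1}" L_ext "\<lambda>s. fe_rest s * fe_trig s * c.L0 (1 - s)"])
  show "{s. Re s < - 1} \<noteq> {}" by (auto intro!: exI[of _ "-2"])
  show "connected {s. Re s < 1}" by (intro convex_connected convex_halfspace_Re_lt)
qed (use assms L_ext_holomorphic fe_rhs_holomorphic in \<open>auto simp: open_halfspace_Re_lt L_ext_def\<close>)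

lemma fe_rest_nonzero: "Re s < 1 \<Longrightarrow> fe_rest s \<noteq> 0"
proof -
  assume "Re s < 1"
  hence "1 - s \<notin> \<int>\<^sub>\<le>\<^sub>0" by (auto elim!: nonpos_Ints_cases simp: complex_eq_iff)
  thus ?thesis using N_pos c_gauss_nonzero by (simp add: fe_rest_def Gamma_eq_zero_iff)
qed

lemma L_ext_nonzero_right:
  assumes "Im s = 0" "Re s \<ge> 1" shows "L_ext s \<noteq> 0"
proof (cases "Re s = 1")
  case True
  hence "s = 1" using assms by (simp add: complex_eq_iff)
  thus ?thesis using L0_1_nonzero by (simp add: L_ext_eq_L0)
next
  case False
  thus ?thesis using assms L0_nonzero[of s] by (simp add: L_ext_eq_L0)
qed

lemma c_L0_eq: "Re s > -1 \<Longrightarrow> c.L0 s = cnj (L_ext (cnj s))"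
  by (simp add: L0_cnj L_ext_eq_L0)

lemma c_L0_nonzero_right:
  assumes "Im s = 0" "Re s \<ge> 1" shows "c.L0 s \<noteq> 0"
  using L_ext_nonzero_right[of "cnj s"] assms by (simp add: c_L0_eq)

text \<open>The point 1 - s is real and at least 1, where the dual function does not vanish, so only
  the trigonometric factor contributes zeros. At s = 0 this rests on the nonvanishing at 1.\<close>

lemma L_ext_real_left_zero_iff:
  assumes "Im s = 0" "Re s \<le> 0"
  shows "L_ext s = 0 \<longleftrightarrow> (\<exists>n::nat. s = - (2 * of_nat n + of_nat delta))"
proof -
  have "c.L0 (1 - s) \<noteq> 0" using assms by (intro c_L0_nonzero_right) auto
  hence "L_ext s = 0 \<longleftrightarrow> fe_trig s = 0" using functional_equation[of s] fe_rest_nonzero[of s] assms by simp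
  also have "\<dots> \<longleftrightarrow> (\<exists>n::int. s = 2 * of_int n - of_nat delta)" by (rule fe_trig_eq_0_iff)
  also have "\<dots> \<longleftrightarrow> (\<exists>n::nat. s = - (2 * of_nat n + of_nat delta))"
  proof
    assume "\<exists>n::int. s = 2 * of_int n - of_nat delta"
    then obtain n :: int where n: "s = 2 * of_int n - of_nat delta" by blast
    have "real_of_int (2 * n) \<le> real_of_int (int delta)" using n assms(2) by simp
    hence "2 * n \<le> int delta" by (simp only: of_int_le_iff)
    hence "n \<le> 0" by (auto simp: delta_def split: if_splits)
    hence "s = - (2 * of_nat (nat (- n)) + of_nat delta)" using n by simp
    thus "\<exists>n::nat. s = - (2 * of_nat n + of_nat delta)" by blast
  next
    assume "\<exists>n::nat. s = - (2 * of_nat n + of_nat delta)"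
    then obtain n :: nat where "s = - (2 * of_nat n + of_nat delta)" by blast
    hence "s = 2 * of_int (- int n) - of_nat delta" by simp
    thus "\<exists>n::int. s = 2 * of_int n - of_nat delta" by blast
  qed
  finally show ?thesis .
qed

text \<open>The functional equation writes L as the trigonometric factor, whose zeros are simple,
  times a function without zeros at real points s <= 0.\<close>

lemma L_ext_trivial_zero_deriv:
  assumes "Im s = 0" "Re s \<le> 0" "L_ext s = 0"
  shows "deriv L_ext s \<noteq> 0"
proof -
  define h where "h = (\<lambda>s. fe_rest s * c.L0 (1 - s))"
  have h0: "h s \<noteq> 0"
    using fe_rest_nonzero[of s] assms c_L0_nonzero_right[of "1 - s"] by (simp add: h_def)
  have eq: "L_ext s' = fe_trig s' * h s'" if "s' \<in> {s. Re s < 1}" for s'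
    using functional_equation[of s'] that by (simp add: h_def)
  have t0: "fe_trig s = 0" using eq[of s] assms h0 by simp
  obtain D where D: "(fe_trig has_field_derivative D) (at s)" "D \<noteq> 0" using fe_trig_deriv_nonzero[OF t0] by blast
  have "h holomorphic_on {s. Re s < 1}"
    unfolding h_def by (intro holomorphic_intros fe_rest_holomorphic holomorphic_on_subset[OF L0_dual_holomorphic]) auto
  hence "(h has_field_derivative deriv h s) (at s)"
    using assms by (intro holomorphic_derivI[of h "{s. Re s < 1}"]) (auto simp: open_halfspace_Re_lt)
  from DERIV_mult[OF D(1) this]
  have "((\<lambda>s. fe_trig s * h s) has_field_derivative D * h s) (at s)" using t0 by simp
  hence "(L_ext has_field_derivative D * h s) (at s)"
    by (rule has_field_derivative_transform_within_open[of _ _ _ "{s. Re s < 1}"])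
       (use eq assms in \<open>auto simp: open_halfspace_Re_lt\<close>)
  thus ?thesis using D(2) h0 DERIV_imp_deriv by fastforce
qed

text \<open>For Re s >= 1/2 the Hurwitz representation suffices. The rest is reflected into Re s >
  1/2, where every factor of the functional equation is bounded separately and \<open>T ^ 2\<close>
  absorbs the linear exponents along with the quadratic one of Gamma.\<close>

lemma L_ext_growth: "\<exists>C. \<forall>s. norm (L_ext s) \<le> exp (C * (1 + norm s) ^ 2)"
proof -
  obtain C1 where C1: "\<And>s. Re s \<ge> 1/2 \<Longrightarrow> norm (L0 s) \<le> exp (C1 * (1 + norm s))" using L0_growth by blast
  obtain C2 where C2: "\<And>s. Re s \<ge> 1/2 \<Longrightarrow> norm (c.L0 s) \<le> exp (C2 * (1 + norm s))" using c.L0_growth by blast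
  obtain M where M: "M > 0" "\<And>x::real. x \<ge> 1/2 \<Longrightarrow> Gamma x \<le> M * exp (x ^ 2)" using Gamma_real_growth by blast
  define l where "l = \<bar>ln (2 * pi / real N)\<bar>"
  define g where "g = M * inverse (norm c.gauss) * 2"
  have g: "g > 0" using M c_gauss_nonzero by (simp add: g_def)
  define C where "C = \<bar>C1\<bar> + 2 * \<bar>C2\<bar> + 1 + l + pi + \<bar>ln g\<bar>"
  show ?thesis
  proof (intro exI allI)
    fix s :: complex
    define T where "T = 1 + norm s"
    have T: "T \<ge> 1" by (simp add: T_def)
    have T2: "T \<le> T ^ 2" "1 \<le> T ^ 2" using T mult_mono[of 1 T 1 T] by (simp_all add: power2_eq_square)
    show "norm (L_ext s) \<le> exp (C * (1 + norm s) ^ 2)"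
    proof (cases "Re s \<ge> 1/2")
      case True
      have "C1 * T \<le> \<bar>C1\<bar> * T ^ 2" using T T2 by (intro mult_mono) auto
      also have "\<dots> \<le> C * T ^ 2" by (intro mult_right_mono) (auto simp: C_def l_def)
      finally show ?thesis using C1[OF True] L_ext_eq_L0[of s] True by (simp add: T_def) (meson exp_le_cancel_iff order.trans)
    next
      case False
      have "norm (1 - s) \<le> T" using norm_triangle_ineq4[of 1 s] by (simp add: T_def)
      have a: "norm (Gamma (1 - s)) \<le> M * exp (T ^ 2)"
      proof -
        have "norm (Gamma (1 - s)) \<le> Gamma (1 - Re s)" using norm_Gamma_le_Gamma_Re[of "1 - s"] False by simp
        also have "\<dots> \<le> M * exp ((1 - Re s) ^ 2)" using False by (intro M) auto
        also have "1 - Re s \<le> T" using abs_Re_le_cmod[of s] by (simp add: T_def)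
        hence "M * exp ((1 - Re s) ^ 2) \<le> M * exp (T ^ 2)"
          using M False by (intro mult_left_mono) (auto intro!: power_mono)
        finally show ?thesis .
      qed
      have b: "norm (of_real (2 * pi / real N) powr (s - 1)) \<le> exp (l * T ^ 2)"
      proof -
        have "norm (of_real (2 * pi / real N) powr (s - 1)) = exp ((Re s - 1) * ln (2 * pi / real N))"
          using N_pos norm_powr_real_powr[of "2 * pi / real N" "s - 1"] by (simp add: powr_def)
        moreover have "(Re s - 1) * ln (2 * pi / real N) \<le> l * T ^ 2"
        proof -
          have "(Re s - 1) * ln (2 * pi / real N) \<le> \<bar>Re s - 1\<bar> * l" unfolding l_def by (metis abs_ge_self abs_mult)
          also have "\<dots> \<le> T * l" using abs_Re_le_cmod[of s] by (intro mult_right_mono) (auto simp: T_def l_def)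
          also have "\<dots> \<le> T ^ 2 * l" using T2 by (intro mult_right_mono) (auto simp: l_def)
          finally show ?thesis by (simp add: mult.commute)
        qed
        ultimately show ?thesis by simp
      qed
      have c: "norm (fe_trig s) \<le> 2 * exp (pi * T ^ 2)"
      proof -
        have i: "norm (y powr (s - 1)) \<le> exp (pi * T ^ 2)" if "norm y = 1" for y
        proof -
          have "norm (y powr (s - 1)) \<le> exp (pi * \<bar>Im s\<bar>)" using norm_powr_le_exp[of y "s - 1"] that by simp
          also have "\<dots> \<le> exp (pi * T ^ 2)"
          proof -
            have "\<bar>Im s\<bar> \<le> T" using abs_Im_le_cmod[of s] by (simp add: T_def)
            hence "\<bar>Im s\<bar> \<le> T ^ 2" using T2 by linarith
            thus ?thesis by simp
          qed
          finally show ?thesis .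
        qed
        have "norm (fe_trig s) \<le> norm ((- \<i>) powr (s - 1)) + norm (chi (-1)) * norm (\<i> powr (s - 1))"
          unfolding fe_trig_def norm_mult[symmetric] by (rule norm_triangle_ineq)
        also have "\<dots> \<le> exp (pi * T ^ 2) + 1 * exp (pi * T ^ 2)"
          by (intro add_mono mult_mono i norm_chi_le_1) auto
        finally show ?thesis by simp
      qed
      have d: "norm (c.L0 (1 - s)) \<le> exp (2 * \<bar>C2\<bar> * T ^ 2)"
      proof -
        have "norm (c.L0 (1 - s)) \<le> exp (C2 * (1 + norm (1 - s)))" using False by (intro C2) auto
        moreover have "C2 * (1 + norm (1 - s)) \<le> \<bar>C2\<bar> * (2 * T ^ 2)"
          using \<open>norm (1 - s) \<le> T\<close> T2 by (intro mult_mono) auto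
        ultimately show ?thesis by (simp add: mult_ac) (meson exp_le_cancel_iff order.trans)
      qed
      have "norm (L_ext s) = norm (Gamma (1 - s)) * norm (of_real (2 * pi / real N) powr (s - 1)) * inverse (norm c.gauss) * norm (fe_trig s) * norm (c.L0 (1 - s))"
      proof -
        have "Re s < 1" using False by simp
        thus ?thesis by (simp only: functional_equation fe_rest_def norm_mult norm_divide divide_inverse norm_inverse mult.assoc)
      qed
      also have "\<dots> \<le> (M * exp (T ^ 2)) * exp (l * T ^ 2) * inverse (norm c.gauss) * (2 * exp (pi * T ^ 2)) * exp (2 * \<bar>C2\<bar> * T ^ 2)"
        using M by (intro mult_mono a b c d) (auto intro!: mult_nonneg_nonneg)
      also have "\<dots> = g * exp (T ^ 2 + l * T ^ 2 + pi * T ^ 2 + 2 * \<bar>C2\<bar> * T ^ 2)"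
        by (simp only: g_def exp_add mult_ac)
      also have "\<dots> = exp (ln g + (T ^ 2 + l * T ^ 2 + pi * T ^ 2 + 2 * \<bar>C2\<bar> * T ^ 2))"
        using g by (simp add: exp_add)
      also have "\<dots> \<le> exp (C * T ^ 2)"
      proof -
        have "ln g \<le> \<bar>ln g\<bar> * 1" by simp
        also have "\<dots> \<le> \<bar>ln g\<bar> * T ^ 2" using T2 by (intro mult_left_mono) auto
        finally have "ln g \<le> \<bar>ln g\<bar> * T ^ 2" .
        moreover have "0 \<le> \<bar>C1\<bar> * T ^ 2" by simp
        ultimately show ?thesis unfolding exp_le_cancel_iff C_def distrib_right by linarith
      qed
      finally show ?thesis by (simp add: T_def)
    qed
  qed
qed

end

section \<open>Zeros of entire functions of order two\<close>

lemma factor_finite_zeros: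
  assumes f: "f holomorphic_on UNIV" and nz: "\<exists>z. f z \<noteq> 0" and "finite A"
  shows "\<exists>h. h holomorphic_on UNIV \<and> (\<forall>z. f z = h z * (\<Prod>a\<in>A. (z - a) ^ nat (zorder f a))) \<and> (\<forall>a\<in>A. h a \<noteq> 0)"
  using \<open>finite A\<close>
proof (induction A rule: finite_induct)
  case empty
  show ?case using f by (intro exI[of _ f]) auto
next
  case (insert a A)
  then obtain h where h: "h holomorphic_on UNIV" "\<And>z. f z = h z * (\<Prod>b\<in>A. (z - b) ^ nat (zorder f b))" "\<And>b. b \<in> A \<Longrightarrow> h b \<noteq> 0"
    by blast
  define P where "P = (\<lambda>z. \<Prod>b\<in>A. (z - b) ^ nat (zorder f b))"
  have P: "P holomorphic_on UNIV" unfolding P_def by (intro holomorphic_intros)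
  have Pa: "P a \<noteq> 0" using insert unfolding P_def by (auto simp: prod_zero_iff)
  have hnz: "\<exists>z\<in>UNIV. h z \<noteq> 0" using nz h(2) by (metis UNIV_I mult_zero_left)
  define n where "n = nat (zorder h a)"
  define g where "g = zor_poly h a"
  note Z = zorder_exist_zero[OF h(1) open_UNIV connected_UNIV UNIV_I hnz, of a, folded g_def n_def]
  have ord0: "zorder h a \<ge> 0" using conjunct1[OF Z] by (cases "h a = 0") simp_all
  from conjunct2[OF Z] obtain r where
    r: "r > 0" "g holomorphic_on cball a r" "\<And>w. w \<in> cball a r \<Longrightarrow> h w = g w * (w - a) ^ n \<and> g w \<noteq> 0"
    by blast
  have "zorder f a = zorder h a"
  proof (rule zorder_eqI[of "ball a r" a "\<lambda>w. g w * P w"])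
    show "(\<lambda>w. g w * P w) holomorphic_on ball a r"
      by (intro holomorphic_intros holomorphic_on_subset[OF r(2)] holomorphic_on_subset[OF P]) auto
    show "g a * P a \<noteq> 0" using r(3)[of a] r(1) Pa by simp
    show "f w = g w * P w * (w - a) powi zorder h a" if "w \<in> ball a r" "w \<noteq> a" for w
      using r(3)[of w] that h(2)[of w] ord0 by (simp add: P_def n_def power_int_def)
  qed (use r in auto)
  hence n: "n = nat (zorder f a)" by (simp add: n_def)
  \<comment> \<open>Near a the zero-free local cofactor g replaces the quotient h / (z - a)^n, with
    which it agrees on the punctured disc; this removes the singularity.\<close>
  define h' where "h' = (\<lambda>z. if z \<in> ball a r then g z else h z / (z - a) ^ n)"
  have "h' holomorphic_on (ball a r \<union> (- {a}))"
    unfolding h'_def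
  proof (rule holomorphic_on_If_Un)
    show "g holomorphic_on ball a r" by (rule holomorphic_on_subset[OF r(2)]) auto
    show "(\<lambda>z. h z / (z - a) ^ n) holomorphic_on - {a}"
      by (intro holomorphic_intros holomorphic_on_subset[OF h(1)]) auto
    show "g z = h z / (z - a) ^ n" if "z \<in> ball a r" "z \<in> - {a}" for z
      using r(3)[of z] that by simp
  qed auto
  moreover have "ball a r \<union> (- {a}) = UNIV" using r by auto
  ultimately have "h' holomorphic_on UNIV" by simp
  moreover have hh': "h z = h' z * (z - a) ^ n" for z
    using r(3)[of z] r(1) by (auto simp: h'_def)
  have "f z = h' z * (\<Prod>b\<in>insert a A. (z - b) ^ nat (zorder f b))" for z
    using h(2)[of z] hh'[of z] insert n by simp
  moreover have "h' b \<noteq> 0" if "b \<in> insert a A" for b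
    using that h(3)[of b] hh'[of b] r(3)[of a] r(1) by (auto simp: h'_def)
  ultimately show ?case by blast
qed

text \<open>After normalization G maps the unit disc into the half-plane Re < B, and G / (2 B - G)
  into the unit disc with 0 fixed. Schwarz's lemma gives |G| <= (2 B + |G|) / 2 on the half disc,
  hence |G| <= 2 B there, and Cauchy's inequality finishes.\<close>

lemma borel_caratheodory_coeff:
  assumes g: "g holomorphic_on ball s R" and R: "R > 0" and A: "\<And>z. z \<in> ball s R \<Longrightarrow> Re (g z) \<le> A" and k: "k > 0"
  shows "norm ((deriv ^^ k) g s) \<le> fact k * (2 * (A - Re (g s) + 1)) / (R / 2) ^ k"
proof -
  \<comment> \<open>The summand 1 makes B strictly positive even when Re g attains the bound A at
    the centre, so the denominator 2 B - G never vanishes.\<close>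
  define B where "B = A - Re (g s) + 1"
  have B: "B > 0" using A[of s] R by (simp add: B_def)
  define G where "G = (\<lambda>z. g (s + of_real R * z) - g s)"
  have in_ball: "s + of_real R * z \<in> ball s R" if "norm z < 1" for z
    using that R by (simp add: dist_norm norm_mult)
  have G: "G holomorphic_on ball 0 1"
  proof -
    have "(\<lambda>z. s + of_real R * z) ` ball 0 1 \<subseteq> ball s R" using in_ball by auto
    note img = this
    have lin: "(\<lambda>z. s + of_real R * z) holomorphic_on ball 0 1" by (intro holomorphic_intros)
    from holomorphic_on_compose_gen[OF lin g img] have "(\<lambda>z. g (s + of_real R * z)) holomorphic_on ball 0 1"
      by (simp add: o_def)
    thus ?thesis unfolding G_def by (intro holomorphic_intros)
  qed
  have ReG: "Re (G z) < B" if "norm z < 1" for z using A[OF in_ball[OF that]] by (simp add: G_def B_def)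
  have den: "2 * of_real B - G z \<noteq> 0" if "norm z < 1" for z using ReG[OF that] B by (auto simp: complex_eq_iff)
  define p where "p = (\<lambda>z. G z / (2 * of_real B - G z))"
  have p_hol: "p holomorphic_on ball 0 1" unfolding p_def using den by (intro holomorphic_intros G) auto
  have p1: "norm (p z) < 1" if "norm z < 1" for z
  proof -
    have "norm (G z) ^ 2 < norm (2 * of_real B - G z) ^ 2"
      using ReG[OF that] B unfolding cmod_power2 by (simp add: power2_eq_square algebra_simps)
    hence lt: "norm (G z) < norm (2 * of_real B - G z)" by (rule power_less_imp_less_base) simp
    show ?thesis using lt le_less_trans[OF norm_ge_zero lt] by (simp add: p_def norm_divide divide_less_eq_1)
  qed
  have p_le: "norm (p z) \<le> norm z" if "norm z < 1" for z
    using Schwarz_Lemma(1)[OF p_hol _ p1 that] by (simp add: p_def G_def)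
  have G_le: "norm (G z) \<le> 2 * B" if z: "norm z \<le> 1/2" for z
  proof -
    have z1: "norm z < 1" using z by simp
    have "G z = p z * (2 * of_real B - G z)" using den[OF z1] by (simp add: p_def)
    hence "norm (G z) = norm (p z) * norm (2 * of_real B - G z)" by (metis norm_mult)
    also have "\<dots> \<le> (1/2) * (2 * B + norm (G z))"
      using p_le[OF z1] z norm_triangle_ineq4[of "2 * of_real B" "G z"] B by (intro mult_mono) (auto simp: norm_mult)
    finally show ?thesis by simp
  qed
  have sub: "cball s (R/2) \<subseteq> ball s R" using R by auto
  have "norm ((deriv ^^ k) (\<lambda>z. g z - g s) s) \<le> fact k * (2 * B) / (R/2) ^ k"
  proof (rule Cauchy_inequality)
    show "(\<lambda>z. g z - g s) holomorphic_on ball s (R/2)"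
      using sub by (intro holomorphic_intros holomorphic_on_subset[OF g]) auto
    show "continuous_on (cball s (R/2)) (\<lambda>z. g z - g s)"
      using sub by (intro continuous_intros holomorphic_on_imp_continuous_on holomorphic_on_subset[OF g]) auto
    show "norm (g x - g s) \<le> 2 * B" if "norm (s - x) = R/2" for x
    proof -
      have "norm ((x - s) / of_real R) \<le> 1/2" using that R by (simp add: norm_divide norm_minus_commute)
      from G_le[OF this] show ?thesis using R by (simp add: G_def)
    qed
  qed (use R in auto)
  also have "(deriv ^^ k) (\<lambda>z. g z - g s) s = (deriv ^^ k) g s"
    using R k by (subst higher_deriv_diff[OF g holomorphic_on_const]) auto
  finally show ?thesis by (simp add: B_def)
qed

definition zero_index :: "(complex \<Rightarrow> complex) \<Rightarrow> (complex \<times> nat) set" where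
  "zero_index f = {(\<rho>, k). f \<rho> = 0 \<and> k < nat (zorder f \<rho>)}"

locale entire_order_two =
  fixes f :: "complex \<Rightarrow> complex" and C :: real
  assumes hol: "f holomorphic_on UNIV" and growth: "\<And>z. norm (f z) \<le> exp (C * (1 + norm z) ^ 2)"
    and nonzero: "\<exists>z. f z \<noteq> 0"
begin

lemma finite_zeros_cball: "finite {z \<in> cball s R. f z = 0}"
proof (cases "\<exists>z. f z = 0")
  case True
  hence "\<not> f constant_on UNIV" using nonzero unfolding constant_on_def by (metis UNIV_I)
  thus ?thesis using holomorphic_compact_finite_zeros[OF hol open_UNIV connected_UNIV compact_cball[of s R]] by simp
qed simp

definition zeros_in :: "complex \<Rightarrow> real \<Rightarrow> (complex \<times> nat) set" where
  "zeros_in s R = {i \<in> zero_index f. norm (fst i - s) \<le> R}"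

lemma zeros_in_eq: "zeros_in s R = (SIGMA \<rho>:{z \<in> cball s R. f z = 0}. {..<nat (zorder f \<rho>)})"
  by (auto simp: zeros_in_def zero_index_def dist_norm norm_minus_commute)

lemma finite_zeros_in: "finite (zeros_in s R)"
  unfolding zeros_in_eq using finite_zeros_cball by (intro finite_SigmaI) auto

lemma growth_shift: "norm (z - s) \<le> r \<Longrightarrow> norm (f z) \<le> exp (\<bar>C\<bar> * (1 + norm s + r) ^ 2)"
proof -
  assume z: "norm (z - s) \<le> r"
  have "norm z \<le> norm s + r" using z norm_triangle_sub[of z s] by simp
  hence "(1 + norm z) ^ 2 \<le> (1 + norm s + r) ^ 2" by (intro power_mono) auto
  hence "C * (1 + norm z) ^ 2 \<le> \<bar>C\<bar> * (1 + norm s + r) ^ 2" by (intro mult_mono) auto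
  thus ?thesis using growth[of z] by (meson exp_le_cancel_iff order.trans)
qed

text \<open>
  Dividing out the zeros in a disc by factors that equal \<open>1\<close> at the centre leaves a function
  which on larger circles is smaller than the original one.
\<close>
lemma factor_zeros_in:
  assumes s: "f s \<noteq> 0" and R: "R > 0"
  obtains H where "H holomorphic_on UNIV" "\<And>z. f z = H z * (\<Prod>i\<in>zeros_in s R. (z - fst i) / (s - fst i))"
    "\<And>z. z \<in> cball s R \<Longrightarrow> H z \<noteq> 0" "H s = f s"
    "\<And>m z. m \<ge> 2 \<Longrightarrow> norm (z - s) \<le> m * R \<Longrightarrow>
        norm (H z) * (m - 1) ^ card (zeros_in s R) \<le> exp (\<bar>C\<bar> * (1 + norm s + m * R) ^ 2)"
proof -
  define A where "A = {z \<in> cball s R. f z = 0}"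
  have A: "finite A" unfolding A_def by (rule finite_zeros_cball)
  obtain h where h: "h holomorphic_on UNIV" "\<And>z. f z = h z * (\<Prod>a\<in>A. (z - a) ^ nat (zorder f a))" "\<And>a. a \<in> A \<Longrightarrow> h a \<noteq> 0"
    using factor_finite_zeros[OF hol nonzero A] by blast
  have sA: "s - a \<noteq> 0" if "a \<in> A" for a using s that by (auto simp: A_def)
  have prod_eq: "(\<Prod>i\<in>zeros_in s R. q (fst i)) = (\<Prod>a\<in>A. q a ^ nat (zorder f a))" for q :: "complex \<Rightarrow> complex"
  proof -
    have "(\<Prod>i\<in>zeros_in s R. q (fst i)) = (\<Prod>a\<in>A. \<Prod>k<nat (zorder f a). q a)"
      unfolding zeros_in_eq A_def[symmetric] using A by (subst prod.Sigma) (auto simp: case_prod_unfold)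
    thus ?thesis by simp
  qed
  define K where "K = (\<Prod>i\<in>zeros_in s R. s - fst i)"
  have K: "K \<noteq> 0" unfolding K_def prod_eq using sA A by (auto simp: prod_zero_iff)
  define H where "H = (\<lambda>z. h z * K)"
  have H_hol: "H holomorphic_on UNIV" unfolding H_def by (intro holomorphic_intros h)
  have fH: "f z = H z * (\<Prod>i\<in>zeros_in s R. (z - fst i) / (s - fst i))" for z
  proof -
    have "(\<Prod>i\<in>zeros_in s R. (z - fst i) / (s - fst i)) = (\<Prod>i\<in>zeros_in s R. z - fst i) / K"
      unfolding K_def by (rule prod_dividef)
    also have "(\<Prod>i\<in>zeros_in s R. z - fst i) = (\<Prod>a\<in>A. (z - a) ^ nat (zorder f a))" by (rule prod_eq)
    finally show ?thesis using h(2)[of z] K by (simp add: H_def)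
  qed
  have zne: "s \<noteq> fst i" if "i \<in> zeros_in s R" for i using that s by (auto simp: zeros_in_def zero_index_def)
  have one: "(\<Prod>i\<in>zeros_in s R. (s - fst i) / (s - fst i)) = 1" using zne by (intro prod.neutral) auto
  show ?thesis
  proof (rule that[OF H_hol fH])
    show "H z \<noteq> 0" if "z \<in> cball s R" for z
    proof (cases "z \<in> A")
      case True thus ?thesis using h(3) K by (simp add: H_def)
    next
      case False
      hence "f z \<noteq> 0" using that by (simp add: A_def)
      thus ?thesis using h(2)[of z] K by (auto simp: H_def)
    qed
    show "H s = f s" using fH[of s] one by simp
    fix m :: real and z assume m: "m \<ge> 2" and z: "norm (z - s) \<le> m * R"
    define E where "E = exp (\<bar>C\<bar> * (1 + norm s + m * R) ^ 2)"
    have mR: "m * R > 0" using m R by simp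
    \<comment> \<open>On the circle of radius m R every zero in the disc is at least (m - 1) R away,
      whereas the centre is at most R from it, so each factor has modulus at least m - 1. The
      maximum principle carries the bound inwards.\<close>
    have bd: "norm (H w) \<le> E / (m - 1) ^ card (zeros_in s R)" if w: "norm (w - s) = m * R" for w
    proof -
      have "(m - 1) ^ card (zeros_in s R) = (\<Prod>i\<in>zeros_in s R. m - 1)" by simp
      also have "\<dots> \<le> (\<Prod>i\<in>zeros_in s R. norm ((w - fst i) / (s - fst i)))"
      proof (rule prod_mono, intro conjI)
        fix i assume i: "i \<in> zeros_in s R"
        have iR: "norm (fst i - s) \<le> R" using i by (simp add: zeros_in_def)
        have "m * R - R \<le> norm (w - fst i)"
          using norm_triangle_ineq[of "w - fst i" "fst i - s"] w iR by simp
        moreover have "(m - 1) * norm (s - fst i) \<le> (m - 1) * R"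
          using iR m by (intro mult_left_mono) (auto simp: norm_minus_commute)
        ultimately have "(m - 1) * norm (s - fst i) \<le> norm (w - fst i)" by (simp add: algebra_simps)
        thus "m - 1 \<le> norm ((w - fst i) / (s - fst i))" using zne[OF i] by (simp add: norm_divide pos_le_divide_eq)
      qed (use m in auto)
      also have "\<dots> = norm (\<Prod>i\<in>zeros_in s R. (w - fst i) / (s - fst i))" by (simp add: prod_norm)
      finally have "norm (H w) * (m - 1) ^ card (zeros_in s R) \<le> norm (H w) * norm (\<Prod>i\<in>zeros_in s R. (w - fst i) / (s - fst i))"
        by (intro mult_left_mono) auto
      also have "\<dots> = norm (f w)" using fH[of w] by (metis norm_mult)
      also have "\<dots> \<le> E" unfolding E_def using w by (intro growth_shift) auto
      finally show ?thesis using m by (subst pos_le_divide_eq) auto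
    qed
    have "norm (H z) \<le> E / (m - 1) ^ card (zeros_in s R)"
    proof (rule maximum_modulus_frontier[of H "cball s (m * R)"])
      show "H holomorphic_on interior (cball s (m * R))" "continuous_on (closure (cball s (m * R))) H"
        using H_hol by (auto intro: holomorphic_on_subset holomorphic_on_imp_continuous_on continuous_on_subset)
      show "norm (H w) \<le> E / (m - 1) ^ card (zeros_in s R)" if "w \<in> frontier (cball s (m * R))" for w
        using that bd mR by (auto simp: frontier_cball dist_norm norm_minus_commute)
      show "z \<in> cball s (m * R)" using z by (simp add: dist_norm norm_minus_commute)
    qed auto
    thus "norm (H z) * (m - 1) ^ card (zeros_in s R) \<le> exp (\<bar>C\<bar> * (1 + norm s + m * R) ^ 2)"
      using m unfolding E_def by (subst (asm) pos_le_divide_eq) auto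
  qed
qed

text \<open>Jensen's inequality in a weak form: with m = 4 and z = s the zeros in the disc
  contribute a factor 3 each, so |f s| 3^n is at most the growth bound on the disc of radius 4 R.
  Taking logarithms gives O(R^2).\<close>

lemma card_zeros_in:
  assumes s: "f s \<noteq> 0"
  shows "\<exists>K\<ge>0. \<forall>R>0. real (card (zeros_in s R)) \<le> K * (1 + R) ^ 2"
proof -
  define K where "K = (\<bar>C\<bar> * (1 + norm s + 4) ^ 2 + \<bar>ln (norm (f s))\<bar>) / ln 3"
  have K: "K \<ge> 0" unfolding K_def by simp
  have "real (card (zeros_in s R)) \<le> K * (1 + R) ^ 2" if R: "R > 0" for R
  proof -
    obtain H where H: "H s = f s" "\<And>m z. m \<ge> 2 \<Longrightarrow> norm (z - s) \<le> m * R \<Longrightarrow>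
        norm (H z) * (m - 1) ^ card (zeros_in s R) \<le> exp (\<bar>C\<bar> * (1 + norm s + m * R) ^ 2)"
      by (rule factor_zeros_in[OF s R]) blast
    have le: "norm (f s) * 3 ^ card (zeros_in s R) \<le> exp (\<bar>C\<bar> * (1 + norm s + 4 * R) ^ 2)"
      using H(2)[of 4 s] H(1) R by simp
    have pos: "norm (f s) * 3 ^ card (zeros_in s R) > 0" using s by simp
    have "ln (norm (f s) * 3 ^ card (zeros_in s R)) \<le> \<bar>C\<bar> * (1 + norm s + 4 * R) ^ 2"
      using ln_mono[OF le pos] by simp
    hence 1: "ln (norm (f s)) + real (card (zeros_in s R)) * ln 3 \<le> \<bar>C\<bar> * (1 + norm s + 4 * R) ^ 2"
      using s by (simp add: ln_mult ln_realpow)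
    have "(1 + norm s + 4 * R) ^ 2 \<le> ((1 + norm s + 4) * (1 + R)) ^ 2"
      using R by (intro power_mono) (auto simp: algebra_simps)
    also have "((1 + norm s + 4) * (1 + R)) ^ 2 = (1 + norm s + 4) ^ 2 * (1 + R) ^ 2" by (rule power_mult_distrib)
    finally have "\<bar>C\<bar> * (1 + norm s + 4 * R) ^ 2 \<le> \<bar>C\<bar> * ((1 + norm s + 4) ^ 2 * (1 + R) ^ 2)"
      by (intro mult_left_mono) auto
    moreover have "\<bar>ln (norm (f s))\<bar> * 1 \<le> \<bar>ln (norm (f s))\<bar> * (1 + R) ^ 2"
      using R by (intro mult_left_mono one_le_power) auto
    ultimately have "real (card (zeros_in s R)) * ln 3 \<le> (\<bar>C\<bar> * (1 + norm s + 4) ^ 2 + \<bar>ln (norm (f s))\<bar>) * (1 + R) ^ 2"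
      using 1 unfolding distrib_right[of _ _ "(1 + R) ^ 2"] mult.assoc by linarith
    thus ?thesis unfolding K_def by (simp add: pos_le_divide_eq)
  qed
  thus ?thesis using K by blast
qed

text \<open>With the zeros in the disc of radius R divided out, the rest H has a logarithm there
  whose real part is O(R^2) from above. Its third derivative at the centre is O(R^2 / R^3) and
  disappears as R grows.\<close>

lemma third_log_deriv_limit:
  assumes s: "f s \<noteq> 0"
  shows "(\<lambda>n. \<Sum>i\<in>zeros_in s (real (Suc n)). 2 / (s - fst i) ^ 3) \<longlonglongrightarrow> (deriv ^^ 2) (\<lambda>z. deriv f z / f z) s"
proof -
  define E where "E = (\<lambda>R. fact 3 * (2 * (\<bar>C\<bar> * (1 + norm s + 2 * R) ^ 2 - ln (norm (f s)) + 1)) / (R / 2) ^ 3)"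
  have bound: "norm ((deriv ^^ 2) (\<lambda>z. deriv f z / f z) s - (\<Sum>i\<in>zeros_in s R. 2 / (s - fst i) ^ 3)) \<le> E R" if R: "R > 0" for R
  proof -
    obtain H where H: "H holomorphic_on UNIV" "\<And>z. f z = H z * (\<Prod>i\<in>zeros_in s R. (z - fst i) / (s - fst i))"
      "\<And>z. z \<in> cball s R \<Longrightarrow> H z \<noteq> 0" "H s = f s" "\<And>m z. m \<ge> 2 \<Longrightarrow> norm (z - s) \<le> m * R \<Longrightarrow>
        norm (H z) * (m - 1) ^ card (zeros_in s R) \<le> exp (\<bar>C\<bar> * (1 + norm s + m * R) ^ 2)"
      by (rule factor_zeros_in[OF s R]) blast
    have Hb: "H holomorphic_on ball s R" by (rule holomorphic_on_subset[OF H(1)]) auto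
    obtain g where g: "g holomorphic_on ball s R" "\<And>z. z \<in> ball s R \<Longrightarrow> exp (g z) = H z"
      by (rule holomorphic_logarithm_exists[of "ball s R" H s]) (use Hb H(3) R in auto)
    have Reg: "Re (g z) = ln (norm (H z))" if "z \<in> ball s R" for z
      using g(2)[OF that] by (metis ln_exp norm_exp_eq_Re)
    have "Re (g z) \<le> \<bar>C\<bar> * (1 + norm s + 2 * R) ^ 2" if z: "z \<in> ball s R" for z
    proof -
      have "norm (z - s) \<le> 2 * R" using z R by (simp add: dist_norm norm_minus_commute)
      \<comment> \<open>With m = 2 the factor (m - 1)^n equals 1, so the number of zeros does not
        enter the bound for H.\<close>
      hence "norm (H z) \<le> exp (\<bar>C\<bar> * (1 + norm s + 2 * R) ^ 2)" using H(5)[of 2 z] by simp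
      moreover have "norm (H z) > 0" using H(3)[of z] z by simp
      ultimately show ?thesis using Reg[OF z] ln_mono[of "norm (H z)" "exp (\<bar>C\<bar> * (1 + norm s + 2 * R) ^ 2)"] by simp
    qed
    from borel_caratheodory_coeff[OF g(1) R this, of 3]
    have g3: "norm ((deriv ^^ 3) g s) \<le> E R"
      unfolding E_def using Reg[of s] R H(4) by simp
    have "continuous_on UNIV f" using hol by (rule holomorphic_on_imp_continuous_on)
    hence "open (ball s R \<inter> {z. f z \<noteq> 0})"
      by (intro open_Int open_ball open_Collect_neq continuous_on_const)
    moreover define S where "S = ball s R \<inter> {z. f z \<noteq> 0}"
    ultimately have S: "open S" "s \<in> S" using s R by auto
    have zne: "z \<noteq> fst i" if "i \<in> zeros_in s R" "z \<in> S" for i z using that by (auto simp: zeros_in_def zero_index_def S_def)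
    have log_deriv: "deriv f z / f z = deriv g z + (\<Sum>i\<in>zeros_in s R. 1 / (z - fst i))" if z: "z \<in> S" for z
    proof -
      have zb: "z \<in> ball s R" and fz: "f z \<noteq> 0" using z by (auto simp: S_def)
      define P where "P = (\<lambda>z. \<Prod>i\<in>zeros_in s R. (z - fst i) / (s - fst i))"
      have Hz: "H z \<noteq> 0" "P z \<noteq> 0" using H(2)[of z] fz by (auto simp: P_def)
      have dP: "(P has_field_derivative P z * (\<Sum>i\<in>zeros_in s R. 1 / (z - fst i))) (at z)"
      proof -
        have "(P has_field_derivative P z * (\<Sum>i\<in>zeros_in s R. (1 / (s - fst i)) / ((z - fst i) / (s - fst i)))) (at z)"
          unfolding P_def
        proof (rule has_field_derivative_prod')
          fix i assume i: "i \<in> zeros_in s R"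
          have "s \<noteq> fst i" "z \<noteq> fst i" using zne[OF i S(2)] zne[OF i z] by auto
          thus "(z - fst i) / (s - fst i) \<noteq> 0" by simp
          show "((\<lambda>z. (z - fst i) / (s - fst i)) has_field_derivative 1 / (s - fst i)) (at z)"
            using \<open>s \<noteq> fst i\<close> by (auto intro!: derivative_eq_intros)
        qed
        also have "(\<Sum>i\<in>zeros_in s R. (1 / (s - fst i)) / ((z - fst i) / (s - fst i))) = (\<Sum>i\<in>zeros_in s R. 1 / (z - fst i))"
          using zne[OF _ S(2)] by (intro sum.cong) auto
        finally show ?thesis .
      qed
      have dg: "(g has_field_derivative deriv g z) (at z)" using g(1) zb by (intro holomorphic_derivI[of g "ball s R"]) auto
      have dexp: "((\<lambda>z. exp (g z)) has_field_derivative exp (g z) * deriv g z) (at z)"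
        by (rule DERIV_chain2[OF DERIV_exp dg])
      have dH: "(H has_field_derivative H z * deriv g z) (at z)"
        using has_field_derivative_transform_within_open[OF dexp open_ball zb, of H] g(2) zb by simp
      have "((\<lambda>z. H z * P z) has_field_derivative (H z * deriv g z) * P z + (P z * (\<Sum>i\<in>zeros_in s R. 1 / (z - fst i))) * H z) (at z)"
        by (rule DERIV_mult[OF dH dP])
      moreover have "(\<lambda>z. H z * P z) = f" using H(2) by (simp add: P_def fun_eq_iff)
      ultimately have "deriv f z = (H z * deriv g z) * P z + (P z * (\<Sum>i\<in>zeros_in s R. 1 / (z - fst i))) * H z"
        using DERIV_imp_deriv by simp
      moreover have "f z = H z * P z" using H(2) by (simp add: P_def)
      ultimately show ?thesis using Hz by (simp add: field_simps)
    qed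
    have hol_g': "deriv g holomorphic_on S"
      using holomorphic_deriv[OF g(1) open_ball] by (rule holomorphic_on_subset) (auto simp: S_def)
    have hol_sum: "(\<lambda>z. \<Sum>i\<in>zeros_in s R. 1 / (z - fst i)) holomorphic_on S"
      using zne by (intro holomorphic_intros) auto
    have "(deriv ^^ 2) (\<lambda>z. deriv f z / f z) s = (deriv ^^ 2) (\<lambda>z. deriv g z + (\<Sum>i\<in>zeros_in s R. 1 / (z - fst i))) s"
      using log_deriv S by (intro higher_deriv_cong_ev refl eventually_nhds_in_open[THEN eventually_mono, of S]) auto
    also have "\<dots> = (deriv ^^ 2) (deriv g) s + (deriv ^^ 2) (\<lambda>z. \<Sum>i\<in>zeros_in s R. 1 / (z - fst i)) s"
      by (rule higher_deriv_add[OF hol_g' hol_sum S])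
    also have "(deriv ^^ 2) (\<lambda>z. \<Sum>i\<in>zeros_in s R. 1 / (z - fst i)) s = (\<Sum>i\<in>zeros_in s R. 2 / (s - fst i) ^ 3)"
    proof -
      have d1: "deriv (\<lambda>z. \<Sum>i\<in>zeros_in s R. 1 / (z - fst i)) z = (\<Sum>i\<in>zeros_in s R. - 1 / (z - fst i) ^ 2)" if "z \<in> S" for z
        by (rule DERIV_imp_deriv) (use zne that in \<open>auto intro!: derivative_eq_intros sum.cong simp: power2_eq_square\<close>)
      have "(deriv ^^ 2) (\<lambda>z. \<Sum>i\<in>zeros_in s R. 1 / (z - fst i)) s = deriv (deriv (\<lambda>z. \<Sum>i\<in>zeros_in s R. 1 / (z - fst i))) s"
        by (simp add: numeral_2_eq_2)
      also have "\<dots> = deriv (\<lambda>z. \<Sum>i\<in>zeros_in s R. - 1 / (z - fst i) ^ 2) s"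
        using d1 S by (intro deriv_cong_ev refl eventually_nhds_in_open[THEN eventually_mono, of S]) auto
      also have "\<dots> = (\<Sum>i\<in>zeros_in s R. 2 / (s - fst i) ^ 3)"
      proof (rule DERIV_imp_deriv)
        have "((\<lambda>z. - 1 / (z - fst i) ^ 2) has_field_derivative 2 / (s - fst i) ^ 3) (at s)" if "i \<in> zeros_in s R" for i
        proof -
          have u: "s - fst i \<noteq> 0" using zne[OF that S(2)] by simp
          have alg: "(0 * v ^ 2 - (- 1) * (2 * v)) / (v ^ 2 * v ^ 2) = 2 / v ^ 3" if "v \<noteq> 0" for v :: complex
            using that by (simp add: power2_eq_square power3_eq_cube)
          have "((\<lambda>z. (z - fst i) ^ 2) has_field_derivative 2 * (s - fst i)) (at s)"
            by (auto intro!: derivative_eq_intros)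
          from DERIV_divide[OF DERIV_const[of "- 1"] this] u show ?thesis unfolding alg[OF u] by simp
        qed
        thus "((\<lambda>z. \<Sum>i\<in>zeros_in s R. - 1 / (z - fst i) ^ 2) has_field_derivative (\<Sum>i\<in>zeros_in s R. 2 / (s - fst i) ^ 3)) (at s)"
          by (intro DERIV_sum)
      qed
      finally show ?thesis .
    qed
    also have "(deriv ^^ 2) (deriv g) s = (deriv ^^ 3) g s"
      by (simp add: numeral_2_eq_2 numeral_3_eq_3)
    finally show ?thesis using g3 by simp
  qed
  \<comment> \<open>96 = 3! * 2 * 2^3 collects the constants of \<open>E\<close>; what remains is a
    numerator of order R^2 over R^3.\<close>
  define K where "K = 96 * (\<bar>C\<bar> * (3 + norm s) ^ 2 + \<bar>1 - ln (norm (f s))\<bar>)"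
  have Eb: "E R \<le> K * inverse R" if R: "R \<ge> 1" for R
  proof -
    have R0: "R > 0" using R by simp
    have "1 + norm s + 2 * R \<le> (3 + norm s) * R"
      using mult_left_mono[OF R, of "1 + norm s"] by (simp add: algebra_simps)
    hence "(1 + norm s + 2 * R) ^ 2 \<le> ((3 + norm s) * R) ^ 2" using R by (intro power_mono) auto
    also have "\<dots> = (3 + norm s) ^ 2 * R ^ 2" by (rule power_mult_distrib)
    finally have "\<bar>C\<bar> * (1 + norm s + 2 * R) ^ 2 \<le> \<bar>C\<bar> * ((3 + norm s) ^ 2 * R ^ 2)" by (intro mult_left_mono) auto
    moreover have "\<bar>1 - ln (norm (f s))\<bar> \<le> \<bar>1 - ln (norm (f s))\<bar> * R ^ 2"
      using mult_left_mono[of 1 "R ^ 2" "\<bar>1 - ln (norm (f s))\<bar>"] R by (simp add: one_le_power)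
    moreover have "a - l + 1 \<le> c + d" if "a \<le> c" "\<bar>1 - l\<bar> \<le> d" for a l c d :: real
      using that abs_ge_self[of "1 - l"] by linarith
    ultimately have "\<bar>C\<bar> * (1 + norm s + 2 * R) ^ 2 - ln (norm (f s)) + 1 \<le> (\<bar>C\<bar> * (3 + norm s) ^ 2 + \<bar>1 - ln (norm (f s))\<bar>) * R ^ 2"
      unfolding distrib_right mult.assoc by blast
    hence "E R \<le> fact 3 * (2 * ((\<bar>C\<bar> * (3 + norm s) ^ 2 + \<bar>1 - ln (norm (f s))\<bar>) * R ^ 2)) / (R / 2) ^ 3"
      unfolding E_def using R0 by (intro divide_right_mono mult_left_mono) auto
    also have "\<dots> = K * inverse R"
      using R0 by (simp add: K_def fact_numeral field_simps power2_eq_square power3_eq_cube)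
    finally show ?thesis .
  qed
  have bound': "norm ((deriv ^^ 2) (\<lambda>z. deriv f z / f z) s - (\<Sum>i\<in>zeros_in s (real (Suc n)). 2 / (s - fst i) ^ 3)) \<le> K * inverse (real (Suc n))" for n
    by (rule order.trans[OF bound Eb]) simp_all
  have "(\<lambda>n. K * inverse (real (Suc n))) \<longlonglongrightarrow> K * 0"
    by (intro tendsto_intros LIMSEQ_inverse_real_of_nat)
  hence "(\<lambda>n. K * inverse (real (Suc n))) \<longlonglongrightarrow> 0" by simp
  hence "(\<lambda>n. (deriv ^^ 2) (\<lambda>z. deriv f z / f z) s - (\<Sum>i\<in>zeros_in s (real (Suc n)). 2 / (s - fst i) ^ 3)) \<longlonglongrightarrow> 0"
    by (rule Lim_null_comparison[rotated]) (use bound' in \<open>auto intro!: always_eventually simp del: of_nat_Suc\<close>)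
  from tendsto_diff[OF tendsto_const[of "(deriv ^^ 2) (\<lambda>z. deriv f z / f z) s"] this] show ?thesis by simp
qed

text \<open>In a dyadic shell at distance about 2^j there are O(4^j) zeros, each contributing at
  most 2^(-c j), so the shells are dominated by a geometric series with ratio 2^(2 - c).\<close>

lemma zeros_summable:
  assumes s: "f s \<noteq> 0" and c: "c > 2"
  shows "(\<lambda>i. norm (s - fst i) powr (- c)) summable_on zero_index f"
proof -
  obtain K where K: "K \<ge> 0" "\<And>R. R > 0 \<Longrightarrow> real (card (zeros_in s R)) \<le> K * (1 + R) ^ 2"
    using card_zeros_in[OF s] by blast
  define r where "r = (\<lambda>i :: complex \<times> nat. norm (s - fst i))"
  define q where "q = 2 powr (2 - c)"
  have q: "0 < q" "q < 1" using c powr_less_mono[of "2 - c" 0 2] by (simp_all add: q_def)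
  define B where "B = (\<Sum>i\<in>zeros_in s 1. r i powr (- c)) + 9 * K * (1 / (1 - q))"
  have "(\<Sum>i\<in>F. r i powr (- c)) \<le> B" if F: "F \<subseteq> zero_index f" "finite F" for F
  proof -
    define F1 where "F1 = {i\<in>F. r i \<le> 1}"
    \<comment> \<open>Locally this name denotes a set, the indices of zeros at distance greater than
      1 from s; \<open>J\<close> sorts them into dyadic shells.\<close>
    define zeta_L_product where "zeta_L_product = {i\<in>F. r i > 1}"
    define J where "J = (\<lambda>i. nat \<lfloor>log 2 (r i)\<rfloor>)"
    have fin: "finite F1" "finite zeta_L_product" using F by (auto simp: F1_def zeta_L_product_def)
    have "F1 \<subseteq> zeros_in s 1" using F by (auto simp: F1_def zeros_in_def r_def norm_minus_commute)
    hence 1: "(\<Sum>i\<in>F1. r i powr (- c)) \<le> (\<Sum>i\<in>zeros_in s 1. r i powr (- c))"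
      using finite_zeros_in by (intro sum_mono2) auto
    have J: "2 powr real (J i) \<le> r i" "r i \<le> 2 powr (real (J i) + 1)" if "i \<in> zeta_L_product" for i
    proof -
      have ri: "r i > 1" using that by (simp add: zeta_L_product_def)
      hence l: "log 2 (r i) \<ge> 0" by simp
      hence Jr: "real (J i) = of_int \<lfloor>log 2 (r i)\<rfloor>" by (simp add: J_def)
      have "real (J i) \<le> log 2 (r i)" "log 2 (r i) \<le> real (J i) + 1" unfolding Jr by linarith+
      moreover have "2 powr log 2 (r i) = r i" using ri by simp
      ultimately show "2 powr real (J i) \<le> r i" "r i \<le> 2 powr (real (J i) + 1)"
        by (metis powr_mono one_le_numeral)+
    qed
    have "(\<Sum>i\<in>zeta_L_product. r i powr (- c)) = (\<Sum>j\<in>J ` zeta_L_product. \<Sum>i\<in>{i\<in>zeta_L_product. J i = j}. r i powr (- c))"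
      using fin by (intro sum.image_gen)
    also have "\<dots> \<le> (\<Sum>j\<in>J ` zeta_L_product. 9 * K * q ^ j)"
    proof (rule sum_mono)
      fix j
      define p where "p = (2::real) powr real j"
      have p: "p \<ge> 1" unfolding p_def by (rule ge_one_powr_ge_zero) auto
      have "(\<Sum>i\<in>{i\<in>zeta_L_product. J i = j}. r i powr (- c)) \<le> (\<Sum>i\<in>{i\<in>zeta_L_product. J i = j}. p powr (- c))"
        unfolding p_def using J(1) c by (intro sum_mono powr_mono2') auto
      also have "\<dots> = real (card {i\<in>zeta_L_product. J i = j}) * p powr (- c)" by simp
      also have "\<dots> \<le> real (card (zeros_in s (2 * p))) * p powr (- c)"
      proof (intro mult_right_mono of_nat_mono card_mono finite_zeros_in)
        have "r i \<le> 2 * p" if "i \<in> zeta_L_product" "J i = j" for i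
          using J(2)[OF that(1)] that(2) by (simp add: p_def powr_add)
        thus "{i\<in>zeta_L_product. J i = j} \<subseteq> zeros_in s (2 * p)"
          using F by (auto simp: zeta_L_product_def zeros_in_def r_def norm_minus_commute)
      qed auto
      also have "\<dots> \<le> (K * (1 + 2 * p) ^ 2) * p powr (- c)"
        using p by (intro mult_right_mono K) auto
      also have "\<dots> \<le> (K * (3 * p) ^ 2) * p powr (- c)"
        using p K(1) by (intro mult_right_mono mult_left_mono power_mono) auto
      also have "\<dots> = 9 * K * (p ^ 2 * p powr (- c))" by (simp add: power_mult_distrib)
      also have "p ^ 2 * p powr (- c) = p powr (2 - c)"
        using p by (simp add: powr_diff powr_minus powr_numeral divide_inverse)
      also have "\<dots> = q ^ j" by (simp add: p_def q_def powr_powr powr_realpow[symmetric] mult.commute)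
      finally show "(\<Sum>i\<in>{i\<in>zeta_L_product. J i = j}. r i powr (- c)) \<le> 9 * K * q ^ j" .
    qed
    also have "\<dots> = 9 * K * (\<Sum>j\<in>J ` zeta_L_product. q ^ j)" by (simp add: sum_distrib_left)
    also have "\<dots> \<le> 9 * K * (\<Sum>j. q ^ j)"
      using q K(1) fin by (intro mult_left_mono sum_le_suminf summable_geometric) auto
    also have "(\<Sum>j. q ^ j) = 1 / (1 - q)" using q by (intro suminf_geometric) auto
    finally have 2: "(\<Sum>i\<in>zeta_L_product. r i powr (- c)) \<le> 9 * K * (1 / (1 - q))" .
    have "F = F1 \<union> zeta_L_product" "F1 \<inter> zeta_L_product = {}" by (auto simp: F1_def zeta_L_product_def)
    hence "(\<Sum>i\<in>F. r i powr (- c)) = (\<Sum>i\<in>F1. r i powr (- c)) + (\<Sum>i\<in>zeta_L_product. r i powr (- c))"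
      using fin by (simp add: sum.union_disjoint)
    thus ?thesis using 1 2 by (simp add: B_def)
  qed
  hence "(\<lambda>i. r i powr (- c)) summable_on zero_index f"
    by (intro nonneg_bdd_above_summable_on bdd_aboveI[of _ B]) auto
  thus ?thesis by (simp add: r_def)
qed

text \<open>Growing discs exhaust the zeros, so an unordered sum over zeros is the limit of its sums
  over discs, the form in which the logarithmic derivative is obtained.\<close>

lemma zeros_in_filterlim:
  "filterlim (\<lambda>n. zeros_in s (real (Suc n))) (finite_subsets_at_top (zero_index f)) sequentially"
  unfolding filterlim_finite_subsets_at_top
proof (intro allI impI)
  fix X assume X: "finite X \<and> X \<subseteq> zero_index f"
  obtain n0 where n0: "(\<Sum>i\<in>X. norm (fst i - s)) \<le> real n0" using real_arch_simple by blast
  have "norm (fst i - s) \<le> real n0" if "i \<in> X" for i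
    using member_le_sum[of i X "\<lambda>i. norm (fst i - s)"] that X n0 by auto
  hence "X \<subseteq> zeros_in s (real (Suc n))" if "n \<ge> n0" for n
    using X that unfolding zeros_in_def by fastforce
  thus "\<forall>\<^sub>F n in sequentially. finite (zeros_in s (real (Suc n))) \<and> X \<subseteq> zeros_in s (real (Suc n)) \<and> zeros_in s (real (Suc n)) \<subseteq> zero_index f"
    using finite_zeros_in by (intro eventually_sequentiallyI[of n0]) (auto simp: zeros_in_def)
qed

lemma countable_zero_index: "countable (zero_index f)"
proof -
  have "zero_index f \<subseteq> (\<Union>n. zeros_in 0 (real n))"
    using real_arch_simple by (fastforce simp: zeros_in_def)
  thus ?thesis by (rule countable_subset) (auto intro: countable_finite finite_zeros_in)
qed

lemma infsum_zeros_cube: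
  assumes s: "f s \<noteq> 0"
  shows "infsum (\<lambda>i. 1 / (s - fst i) ^ 3) (zero_index f) = (deriv ^^ 2) (\<lambda>z. deriv f z / f z) s / 2"
proof -
  have ne: "norm (s - fst i) > 0" if "i \<in> zero_index f" for i using s that by (auto simp: zero_index_def)
  have "(\<lambda>i. 2 * norm (s - fst i) powr (- 3)) summable_on zero_index f"
    by (intro summable_on_cmult_right zeros_summable s) auto
  hence "(\<lambda>i. norm (2 / (s - fst i) ^ 3)) summable_on zero_index f"
    by (rule summable_on_cong[THEN iffD1, rotated])
       (use ne in \<open>simp add: powr_minus powr_numeral norm_divide norm_power norm_inverse norm_mult divide_inverse\<close>)
  from has_sum_infsum[OF abs_summable_summable[OF this]]
  have "((\<lambda>i. 2 / (s - fst i) ^ 3) has_sum infsum (\<lambda>i. 2 / (s - fst i) ^ 3) (zero_index f)) (zero_index f)" .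
  hence "(\<lambda>n. \<Sum>i\<in>zeros_in s (real (Suc n)). 2 / (s - fst i) ^ 3) \<longlonglongrightarrow> infsum (\<lambda>i. 2 / (s - fst i) ^ 3) (zero_index f)"
    unfolding has_sum_def by (rule filterlim_compose[OF _ zeros_in_filterlim])
  hence "infsum (\<lambda>i. 2 / (s - fst i) ^ 3) (zero_index f) = (deriv ^^ 2) (\<lambda>z. deriv f z / f z) s"
    using third_log_deriv_limit[OF s] by (rule LIMSEQ_unique)
  moreover have "infsum (\<lambda>i. 2 / (s - fst i) ^ 3) (zero_index f) = 2 * infsum (\<lambda>i. 1 / (s - fst i) ^ 3) (zero_index f)"
    by (subst infsum_cmult_right'[symmetric]) simp
  ultimately show ?thesis by (simp add: mult.commute)
qed

end

section \<open>The Mellin transform of the sum over zeros\<close>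

text \<open>An enumeration padded with zero terms makes an unordered sum a series, the form in which
  summation and integration are exchanged.\<close>

lemma countable_infsum_sums:
  fixes h :: "'i \<Rightarrow> 'b :: banach"
  assumes Z: "countable Z" and h: "(\<lambda>i. norm (h i)) summable_on Z"
  defines "k \<equiv> \<lambda>n. if n \<in> to_nat_on Z ` Z then h (inv_into Z (to_nat_on Z) n) else 0"
  shows "summable (\<lambda>n. norm (k n))" "k sums infsum h Z"
proof -
  define e where "e = to_nat_on Z"
  have inj: "inj_on e Z" unfolding e_def using Z by (rule inj_on_to_nat_on)
  have *: "((\<lambda>n. if n \<in> e ` Z then g (inv_into Z e n) else 0) has_sum infsum g Z) UNIV" if "g summable_on Z" for g :: "'i \<Rightarrow> 'c :: banach"
  proof -
    have "((\<lambda>n. g (inv_into Z e n)) has_sum infsum g Z) (e ` Z)"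
      using has_sum_infsum[OF that] inj by (subst has_sum_reindex[OF inj]) (simp add: o_def cong: has_sum_cong)
    thus ?thesis by (rule has_sum_cong_neutral[THEN iffD1, rotated -1]) auto
  qed
  have "h summable_on Z" using h by (rule abs_summable_summable)
  from *[OF this] show "k sums infsum h Z" unfolding k_def e_def by (rule has_sum_imp_sums)
  from *[OF h] have "summable (\<lambda>n. if n \<in> e ` Z then norm (h (inv_into Z e n)) else 0)"
    using has_sum_imp_sums sums_summable by blast
  moreover have "(\<lambda>n. if n \<in> e ` Z then norm (h (inv_into Z e n)) else 0) = (\<lambda>n. norm (k n))"
    by (auto simp: k_def e_def fun_eq_iff)
  ultimately show "summable (\<lambda>n. norm (k n))" by simp
qed

lemma integral_infsum_countable:
  fixes F :: "'i \<Rightarrow> 'a \<Rightarrow> complex"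
  assumes Z: "countable Z" and int: "\<And>i. i \<in> Z \<Longrightarrow> integrable M (F i)"
    and norm: "(\<lambda>i. LINT t|M. norm (F i t)) summable_on Z"
    and pt: "\<And>t. (\<lambda>i. norm (F i t)) summable_on Z"
  shows "(LINT t|M. infsum (\<lambda>i. F i t) Z) = infsum (\<lambda>i. LINT t|M. F i t) Z"
proof -
  define e where "e = to_nat_on Z"
  define G where "G = (\<lambda>n t. if n \<in> e ` Z then F (inv_into Z e n) t else 0)"
  have inv: "inv_into Z e n \<in> Z" if "n \<in> e ` Z" for n using that by (rule inv_into_into)
  have intG: "integrable M (G n)" for n
    using int[OF inv[of n]] by (cases "n \<in> e ` Z") (simp_all add: G_def[abs_def])
  have ptG: "summable (\<lambda>n. norm (G n t))" "(\<lambda>n. G n t) sums infsum (\<lambda>i. F i t) Z" for t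
    using countable_infsum_sums[OF Z pt[of t], folded e_def] by (simp_all only: G_def)
  have nn: "(\<lambda>i. norm (LINT t|M. norm (F i t))) summable_on Z"
    using norm by (simp add: Bochner_Integration.integral_nonneg)
  have "summable (\<lambda>n. if n \<in> e ` Z then LINT t|M. norm (F (inv_into Z e n) t) else 0)"
    using countable_infsum_sums(2)[OF Z nn, folded e_def] by (simp only: sums_iff)
  also have "(\<lambda>n. if n \<in> e ` Z then LINT t|M. norm (F (inv_into Z e n) t) else 0) = (\<lambda>n. LINT t|M. norm (G n t))"
    by (auto simp: G_def fun_eq_iff)
  finally have sG: "summable (\<lambda>n. LINT t|M. norm (G n t))" .
  have "(\<lambda>n. LINT t|M. G n t) sums (LINT t|M. (\<Sum>n. G n t))"
    by (rule sums_integral[OF intG _ sG]) (use ptG in auto)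
  also have "(\<lambda>t. \<Sum>n. G n t) = (\<lambda>t. infsum (\<lambda>i. F i t) Z)"
    using ptG(2) by (simp add: sums_iff fun_eq_iff)
  finally have 1: "(\<lambda>n. LINT t|M. G n t) sums (LINT t|M. infsum (\<lambda>i. F i t) Z)" .
  have nF: "(\<lambda>i. norm (LINT t|M. F i t)) summable_on Z"
    by (rule summable_on_comparison_test[OF norm]) auto
  have "(\<lambda>n. if n \<in> e ` Z then LINT t|M. F (inv_into Z e n) t else 0) sums infsum (\<lambda>i. LINT t|M. F i t) Z"
    using countable_infsum_sums(2)[OF Z nF, folded e_def] .
  also have "(\<lambda>n. if n \<in> e ` Z then LINT t|M. F (inv_into Z e n) t else 0) = (\<lambda>n. LINT t|M. G n t)"
    by (auto simp: G_def fun_eq_iff)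
  finally show ?thesis using 1 sums_unique2 by blast
qed

context entire_order_two
begin

text \<open>The formula for 1 / (t + z)^3 is applied to each zero with z = s - \<rho>. The exchange
  of sum and integral needs |s - \<rho>|^(-Re w) to be summable, hence Re w > 2, and the single
  integrals need Re w < 3.\<close>

lemma mellin_zeros:
  assumes left: "\<And>i. i \<in> zero_index f \<Longrightarrow> Re (fst i) < Re s" and w: "2 < Re w" "Re w < 3"
    and nz: "\<And>t. t \<ge> 0 \<Longrightarrow> f (s + of_real t) \<noteq> 0"
  shows "(LINT t:{0<..}|lborel. of_real t powr (2 - w) * ((deriv ^^ 2) (\<lambda>z. deriv f z / f z) (s + of_real t) / 2)) =
    Gamma (3 - w) * Gamma w / 2 * infsum (\<lambda>i. (s - fst i) powr (- w)) (zero_index f)"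
proof -
  define Z where "Z = zero_index f"
  define F where "F = (\<lambda>(i :: complex \<times> nat) t. indicator {0<..} t *\<^sub>R (of_real t powr (of_nat 3 - 1 - w) / (of_real t + (s - fst i)) ^ 3))"
  have s: "f s \<noteq> 0" using nz[of 0] by simp
  have Rei: "Re (s - fst i) > 0" if "i \<in> Z" for i using left that by (simp add: Z_def)
  have G3: "Gamma (of_nat 3 :: complex) = 2" using Gamma_numeral[of "num.Bit1 num.One", where ?'a = complex] by simp
  have mell: "integrable lborel (F i)" "(LINT t|lborel. F i t) = Gamma (3 - w) * Gamma w / 2 * (s - fst i) powr (- w)" if "i \<in> Z" for i
    using mellin_shifted_power[of w 3 "s - fst i"] w Rei[OF that] not_nonpos_Reals_Re_pos[of "s - fst i"] G3
    by (simp_all add: F_def set_integrable_def set_lebesgue_integral_def)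
  have lower: "norm (of_real t + z) \<ge> t" "norm (of_real t + z) \<ge> norm z" if "Re z > 0" "t > 0" for z t
  proof -
    show "norm (of_real t + z) \<ge> t" using complex_Re_le_cmod[of "of_real t + z"] that by simp
    have "norm z ^ 2 \<le> norm (of_real t + z) ^ 2"
      using that unfolding cmod_power2 by (simp add: power2_eq_square algebra_simps)
    thus "norm (of_real t + z) \<ge> norm z" by (rule power2_le_imp_le) simp
  qed
  \<comment> \<open>As Re (s - \<rho>) > 0, the modulus of t + (s - \<rho>) is at least t and at
    least |s - \<rho>|, hence at least their mean. The factor 1/2 cubed gives the 8.\<close>
  define M where "M = (\<lambda>(i :: complex \<times> nat) t. 8 * (indicator {0<..} t * (t powr (2 - Re w) / (t + norm (s - fst i)) ^ 3)))"
  have normF: "norm (F i t) \<le> M i t" if i: "i \<in> Z" for i t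
  proof (cases "t > 0")
    case True
    have r: "norm (s - fst i) > 0" using Rei[OF i] by auto
    have "(t + norm (s - fst i)) / 2 \<le> norm (of_real t + (s - fst i))"
    proof -
      have "(a + b) / 2 \<le> c" if "a \<le> c" "b \<le> c" for a b c :: real using that by simp
      thus ?thesis using lower[OF Rei[OF i] True] by blast
    qed
    hence "((t + norm (s - fst i)) / 2) ^ 3 \<le> norm (of_real t + (s - fst i)) ^ 3"
      using True by (intro power_mono) auto
    moreover have "((t + norm (s - fst i)) / 2) ^ 3 > 0"
      using add_pos_pos[OF True r] by simp
    ultimately have "t powr (2 - Re w) / norm (of_real t + (s - fst i)) ^ 3 \<le> t powr (2 - Re w) / ((t + norm (s - fst i)) / 2) ^ 3"
      by (intro frac_le) auto
    also have "\<dots> = 8 * (t powr (2 - Re w) / (t + norm (s - fst i)) ^ 3)" by (simp add: power_divide)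
    finally show ?thesis using True by (simp add: F_def M_def norm_divide norm_power norm_powr_real_powr)
  qed (simp add: F_def M_def)
  define c where "c = 8 * (Gamma (3 - Re w) * Gamma (Re w) / Gamma 3)"
  have M: "integrable lborel (M i)" "(LINT t|lborel. M i t) = c * norm (s - fst i) powr (- Re w)" if i: "i \<in> Z" for i
  proof -
    have r: "norm (s - fst i) > 0" using Rei[OF i] by auto
    show "integrable lborel (M i)" unfolding M_def using w r by (intro integrable_mult_right mellin_shifted_power_abs) auto
    show "(LINT t|lborel. M i t) = c * norm (s - fst i) powr (- Re w)"
      unfolding M_def integral_mult_right_zero using mellin_shifted_power_abs(2)[of "2 - Re w" 3 "norm (s - fst i)"] w r
      by (simp add: c_def)
  qed
  have pt: "(\<lambda>i. norm (F i t)) summable_on Z" for t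
  proof (cases "t > 0")
    case True
    have "(\<lambda>i. t powr (2 - Re w) * norm (s - fst i) powr (- 3)) summable_on Z"
      unfolding Z_def by (intro summable_on_cmult_right zeros_summable s) auto
    thus ?thesis
    proof (rule summable_on_comparison_test)
      fix i assume i: "i \<in> Z"
      have r: "norm (s - fst i) > 0" using Rei[OF i] by auto
      have "norm (s - fst i) ^ 3 \<le> norm (of_real t + (s - fst i)) ^ 3"
        using lower[OF Rei[OF i] True] by (intro power_mono) auto
      hence "t powr (2 - Re w) / norm (of_real t + (s - fst i)) ^ 3 \<le> t powr (2 - Re w) / norm (s - fst i) ^ 3"
        using r by (intro frac_le) auto
      also have "\<dots> = t powr (2 - Re w) * norm (s - fst i) powr (- 3)"
        using r by (simp add: powr_minus powr_numeral divide_inverse)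
      finally show "norm (F i t) \<le> t powr (2 - Re w) * norm (s - fst i) powr (- 3)"
        using True by (simp add: F_def norm_divide norm_power norm_powr_real_powr)
    qed auto
  qed (simp add: F_def)
  have "(\<lambda>i. LINT t|lborel. norm (F i t)) summable_on Z"
  proof (rule summable_on_comparison_test)
    show "(\<lambda>i. c * norm (s - fst i) powr (- Re w)) summable_on Z"
      unfolding Z_def using w by (intro summable_on_cmult_right zeros_summable s) auto
    show "(LINT t|lborel. norm (F i t)) \<le> c * norm (s - fst i) powr (- Re w)" if "i \<in> Z" for i
      unfolding M(2)[OF that, symmetric] by (intro integral_mono integrable_norm mell M normF that)
  qed (simp add: Bochner_Integration.integral_nonneg)
  from integral_infsum_countable[OF countable_zero_index[folded Z_def] mell(1) this pt]
  have "(LINT t|lborel. infsum (\<lambda>i. F i t) Z) = infsum (\<lambda>i. LINT t|lborel. F i t) Z" .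
  also have "\<dots> = infsum (\<lambda>i. Gamma (3 - w) * Gamma w / 2 * (s - fst i) powr (- w)) Z"
    by (rule infsum_cong) (rule mell)
  also have "\<dots> = Gamma (3 - w) * Gamma w / 2 * infsum (\<lambda>i. (s - fst i) powr (- w)) Z"
    by (rule infsum_cmult_right')
  also have "(\<lambda>t. infsum (\<lambda>i. F i t) Z) = (\<lambda>t. indicator {0<..} t *\<^sub>R (of_real t powr (2 - w) * ((deriv ^^ 2) (\<lambda>z. deriv f z / f z) (s + of_real t) / 2)))"
  proof
    fix t
    show "infsum (\<lambda>i. F i t) Z = indicator {0<..} t *\<^sub>R (of_real t powr (2 - w) * ((deriv ^^ 2) (\<lambda>z. deriv f z / f z) (s + of_real t) / 2))"
    proof (cases "t > 0")
      case True
      have "infsum (\<lambda>i. F i t) Z = infsum (\<lambda>i. of_real t powr (2 - w) * (1 / (s + of_real t - fst i) ^ 3)) Z"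
        using True by (intro infsum_cong) (simp add: F_def algebra_simps)
      also have "\<dots> = of_real t powr (2 - w) * infsum (\<lambda>i. 1 / (s + of_real t - fst i) ^ 3) Z"
        by (rule infsum_cmult_right')
      finally show ?thesis using True infsum_zeros_cube[OF nz[of t]] by (simp add: Z_def)
    qed (simp add: F_def)
  qed
  finally show ?thesis by (simp only: set_lebesgue_integral_def Z_def)
qed

end

section \<open>The zeta function of all zeros and its derivative at w = 0\<close>

context dirichlet_char
begin

text \<open>Every term with n >= 2 is at most n^(-2) 2^(-(Re z - 2)), and the n^(-2) are summable.
  The resulting exponential decay of log L along horizontal rays makes the Mellin integral converge
  at infinity and kills the boundary terms there.\<close>

lemma L0_near_1: "\<exists>C\<ge>0. \<forall>z. Re z \<ge> 2 \<longrightarrow> norm (L0 z - 1) \<le> C * 2 powr (- Re z)"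
proof -
  define S where "S = (\<Sum>n. real (n + 2) powr (- 2))"
  have summ: "summable (\<lambda>n. real (n + 2) powr (- 2))"
    using summable_shifted_powr[of 2 "- 2"] by (simp add: add.commute)
  have S: "S \<ge> 0" unfolding S_def by (rule suminf_nonneg[OF summ]) simp
  have "norm (L0 z - 1) \<le> 4 * S * 2 powr (- Re z)" if z: "Re z \<ge> 2" for z
  proof -
    have "L_term z 0 = 1" by (simp add: L_term_def chi_1)
    hence "(\<lambda>n. L_term z (Suc n)) sums (L0 z - 1)"
      using L0_sums[of z] z by (subst sums_Suc_iff) simp
    hence eq: "L0 z - 1 = (\<Sum>n. L_term z (Suc n))" by (rule sums_unique)
    have le: "norm (L_term z (Suc n)) \<le> 4 * 2 powr (- Re z) * real (n + 2) powr (- 2)" for n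
    proof -
      have "norm (L_term z (Suc n)) \<le> real (n + 2) powr (- Re z)" using norm_L_term_le[of z "Suc n"] by simp
      also have "\<dots> = real (n + 2) powr (- 2) * real (n + 2) powr (- (Re z - 2))"
        by (simp flip: powr_add)
      also have "real (n + 2) powr (- (Re z - 2)) \<le> 2 powr (- (Re z - 2))"
        using z by (intro powr_mono2') auto
      also have "2 powr (- (Re z - 2)) = 4 * 2 powr (- Re z)" by (simp add: powr_diff powr_minus powr_numeral divide_inverse)
      finally show ?thesis by (simp add: mult_ac)
    qed
    have "norm (L0 z - 1) \<le> (\<Sum>n. 4 * 2 powr (- Re z) * real (n + 2) powr (- 2))"
      unfolding eq by (rule norm_suminf_le[OF le summable_mult[OF summ]])
    also have "\<dots> = 4 * S * 2 powr (- Re z)" using summ by (simp add: S_def suminf_mult)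
    finally show ?thesis .
  qed
  thus ?thesis using S by (intro exI[of _ "4 * S"]) auto
qed

end

context primitive_char
begin

lemma L_ext_entire_order_two: "entire_order_two L_ext (SOME C. \<forall>s. norm (L_ext s) \<le> exp (C * (1 + norm s) ^ 2))"
proof
  show "norm (L_ext z) \<le> exp ((SOME C. \<forall>s. norm (L_ext s) \<le> exp (C * (1 + norm s) ^ 2)) * (1 + norm z) ^ 2)" for z
    using someI_ex[OF L_ext_growth] by blast
  show "\<exists>z. L_ext z \<noteq> 0" using L_ext_nonzero_right[of 1] by auto
qed (rule L_ext_holomorphic)

text \<open>The Mellin integral of the third derivative of log L converges for all Re w < 3 and
  equals Gamma (3 - w) Gamma w / 2 times the series over zeros where the latter converges. Solving
  for the series continues it to w = 0, where 1 / Gamma w vanishes to first order.\<close>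

lemma zeta_of_zeros:
  "\<exists>\<sigma>0. (\<forall>s. Re s \<ge> \<sigma>0 \<longrightarrow> L_ext s \<noteq> 0) \<and>
    (\<forall>s. Re s > \<sigma>0 + 1 \<longrightarrow> (\<exists>F. F holomorphic_on {w. Re w < 3} \<and>
       (\<forall>w. 2 < Re w \<and> Re w < 3 \<longrightarrow> F w = infsum (\<lambda>i. (s - fst i) powr (- w)) (zero_index L_ext)) \<and>
       exp (- deriv F 0) = L_ext s))"
proof -
  interpret e: entire_order_two L_ext "SOME C. \<forall>s. norm (L_ext s) \<le> exp (C * (1 + norm s) ^ 2)"
    by (rule L_ext_entire_order_two)
  obtain C where C: "C \<ge> 0" "\<And>z. Re z \<ge> 2 \<Longrightarrow> norm (L0 z - 1) \<le> C * 2 powr (- Re z)" using L0_near_1 by blast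
  obtain n0 :: nat where n0: "real n0 > 2 * C" using reals_Archimedean2 by blast
  define \<sigma>0 where "\<sigma>0 = real n0 + 2"
  have pw: "C * 2 powr (- \<sigma>) < 1/2" if "\<sigma> \<ge> \<sigma>0" for \<sigma>
  proof -
    have "real n0 < 2 ^ n0" by (rule of_nat_less_two_power)
    also have "(2::real) ^ n0 = 2 powr real n0" by (simp add: powr_realpow)
    also have "\<dots> \<le> 2 powr \<sigma>" using that by (intro powr_mono) (auto simp: \<sigma>0_def)
    finally have "real n0 < 2 powr \<sigma>" .
    with n0 have "2 * C < 2 powr \<sigma>" by (rule less_trans)
    thus ?thesis by (simp add: powr_minus field_simps)
  qed
  have near: "norm (L_ext z - 1) \<le> C * 2 powr (- Re z)" "norm (L_ext z - 1) < 1/2" if "Re z \<ge> \<sigma>0" for z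
  proof -
    show 1: "norm (L_ext z - 1) \<le> C * 2 powr (- Re z)" using C(2)[of z] that by (simp add: L_ext_eq_L0 \<sigma>0_def)
    show "norm (L_ext z - 1) < 1/2" using 1 pw[OF that] by linarith
  qed
  have nz: "L_ext z \<noteq> 0" if "Re z \<ge> \<sigma>0" for z using near(2)[OF that] by auto
  define V where "V = {z. Re z > \<sigma>0}"
  have V: "open V" by (simp add: V_def open_Re_gt)
  \<comment> \<open>Beyond \<open>\<sigma>0\<close> the values of L stay within 1/2 of 1, so the
    principal logarithm is holomorphic and tends to 0 to the right.\<close>
  define l where "l = (\<lambda>z. Ln (L_ext z))"
  have slit: "L_ext z \<notin> \<real>\<^sub>\<le>\<^sub>0" if "Re z \<ge> \<sigma>0" for z
  proof (rule not_nonpos_Reals_Re_pos)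
    have "\<bar>Re (L_ext z - 1)\<bar> < 1/2" using near(2)[OF that] abs_Re_le_cmod[of "L_ext z - 1"] by linarith
    hence "- (1/2) < Re (L_ext z - 1)" by (simp only: abs_less_iff minus_less_iff)
    thus "Re (L_ext z) > 0" by simp
  qed
  have l_hol: "l holomorphic_on V"
    unfolding l_def using slit by (intro holomorphic_intros L_ext_holomorphic) (auto simp: V_def)
  have l_le: "norm (l z) \<le> 2 * (C * 2 powr (- Re z))" if "Re z \<ge> \<sigma>0" for z
  proof -
    have "norm (Ln (1 + (L_ext z - 1))) \<le> 2 * norm (L_ext z - 1)" using near(2)[OF that] by (intro norm_Ln_le) auto
    thus ?thesis using near(1)[OF that] by (simp add: l_def)
  qed
  have l_exp: "exp (l z) = L_ext z" if "Re z \<ge> \<sigma>0" for z using nz[OF that] by (simp add: l_def)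
  \<comment> \<open>Cauchy's inequality on the unit circle passes the decay 2^(-Re z) to all
    derivatives. The circle has to stay in V, hence the margin 1 in
    \<open>\<sigma>0 + 1\<close>.\<close>
  have der_le: "norm ((deriv ^^ k) l z) \<le> fact k * (4 * C * 2 powr (- Re z))" if z: "Re z > \<sigma>0 + 1" for k z
  proof -
    have in_V: "x \<in> V" "Re x \<ge> Re z - 1" if "norm (z - x) \<le> 1" for x
      using that abs_Re_le_cmod[of "z - x"] z by (auto simp: V_def)
    have "norm ((deriv ^^ k) l z) \<le> fact k * (2 * (C * 2 powr (- (Re z - 1)))) / 1 ^ k"
    proof (rule Cauchy_inequality)
      show "l holomorphic_on ball z 1" by (rule holomorphic_on_subset[OF l_hol]) (use in_V in \<open>auto simp: dist_norm\<close>)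
      show "continuous_on (cball z 1) l"
        by (rule holomorphic_on_imp_continuous_on, rule holomorphic_on_subset[OF l_hol]) (use in_V in \<open>auto simp: dist_norm\<close>)
      show "norm (l x) \<le> 2 * (C * 2 powr (- (Re z - 1)))" if "norm (z - x) = 1" for x
      proof -
        have "norm (l x) \<le> 2 * (C * 2 powr (- Re x))" using in_V(1)[of x] that by (intro l_le) (auto simp: V_def)
        also have "\<dots> \<le> 2 * (C * 2 powr (- (Re z - 1)))"
          using in_V(2)[of x] that C(1) by (intro mult_left_mono powr_mono) auto
        finally show ?thesis .
      qed
    qed auto
    also have "2 powr (- (Re z - 1)) = 2 * 2 powr (- Re z)" by (simp add: powr_diff powr_minus divide_inverse)
    finally show ?thesis by (simp add: mult_ac)
  qed
  have l_der: "((deriv ^^ k) l has_field_derivative (deriv ^^ Suc k) l z) (at z)" if "Re z > \<sigma>0" for k z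
  proof -
    have "(deriv ^^ k) l holomorphic_on V" using l_hol V by (rule holomorphic_higher_deriv)
    from holomorphic_derivI[OF this V] show ?thesis using that by (simp add: V_def)
  qed
  have D_eq: "(deriv ^^ 2) (\<lambda>z. deriv L_ext z / L_ext z) z = (deriv ^^ 3) l z" if z: "Re z > \<sigma>0" for z
  proof -
    have "deriv L_ext u / L_ext u = deriv l u" if "u \<in> V" for u
    proof -
      have u: "Re u \<ge> \<sigma>0" using that by (simp add: V_def)
      have "(L_ext has_field_derivative deriv L_ext u) (at u)"
        using holomorphic_derivI[OF L_ext_holomorphic[of UNIV] open_UNIV] by simp
      hence "(l has_field_derivative inverse (L_ext u) * deriv L_ext u) (at u)"
        unfolding l_def by (intro DERIV_chain2[where f = Ln] has_field_derivative_Ln slit u)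
      thus ?thesis using DERIV_imp_deriv by (metis divide_inverse mult.commute)
    qed
    hence "(deriv ^^ 2) (\<lambda>z. deriv L_ext z / L_ext z) z = (deriv ^^ 2) (deriv l) z"
      using z V by (intro higher_deriv_cong_ev refl eventually_nhds_in_open[THEN eventually_mono, of V]) (auto simp: V_def)
    thus ?thesis by (simp add: numeral_2_eq_2 numeral_3_eq_3)
  qed
  have main: "\<exists>F. F holomorphic_on {w. Re w < 3} \<and>
       (\<forall>w. 2 < Re w \<and> Re w < 3 \<longrightarrow> F w = infsum (\<lambda>i. (s - fst i) powr (- w)) (zero_index L_ext)) \<and>
       exp (- deriv F 0) = L_ext s" if s: "Re s > \<sigma>0 + 1" for s
  proof -
    define d where "d = (\<lambda>k t. (deriv ^^ k) l (s + complex_of_real t))"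
    define B where "B = 4 * C * 2 powr (- Re s)"
    have d_le: "norm (d k t) \<le> fact k * B * exp (- (ln 2 * t))" if "t \<ge> 0" for k t
    proof -
      have "norm (d k t) \<le> fact k * (4 * C * 2 powr (- (Re s + t)))" using der_le[of "s + of_real t" k] s that by (simp add: d_def)
      also have "2 powr (- (Re s + t)) = 2 powr (- Re s) * exp (- (ln 2 * t))"
        by (simp add: powr_def exp_add[symmetric] algebra_simps)
      finally show ?thesis by (simp add: B_def mult_ac)
    qed
    have B: "B \<ge> 0" using C by (simp add: B_def)
    have d_der: "(d k has_vector_derivative d (Suc k) t) (at t)" if "t > -1" for k t
    proof -
      have "((deriv ^^ k) l has_field_derivative d (Suc k) t) (at (s + of_real t))"
        unfolding d_def using s that by (intro l_der) auto
      moreover have "((\<lambda>t. s + complex_of_real t) has_vector_derivative 1) (at t)"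
        by (auto intro!: derivative_eq_intros)
      ultimately show ?thesis using field_vector_diff_chain_at[of "\<lambda>t. s + complex_of_real t" 1 t "(deriv ^^ k) l" "d (Suc k) t"]
        by (simp add: d_def o_def)
    qed
    have d_cont: "continuous_on {0..} (d k)" for k
      by (rule continuous_at_imp_continuous_on)
         (use d_der[THEN has_vector_derivative_continuous] in auto)
    define G where "G = (\<lambda>w t. indicator {0<..} t *\<^sub>R (of_real t powr (2 - w) * (d 3 t / 2)))"
    have G_meas: "G w \<in> borel_measurable lborel" for w
      unfolding G_def measurable_lborel2
      by (intro borel_measurable_continuous_on_indicator continuous_intros continuous_on_subset[OF d_cont]) auto
    define I where "I = (\<lambda>w. LINT t|lborel. G w t)"
    have G_le: "norm (G w t) \<le> 3 * B * (indicator {0<..} t * (t powr (2 - Re w) * exp (- (ln 2 * t))))" for w t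
    proof (cases "t > 0")
      case True
      have "norm (G w t) = t powr (2 - Re w) * (norm (d 3 t) / 2)"
        using True by (simp add: G_def norm_mult norm_powr_real_powr norm_divide)
      also have "\<dots> \<le> t powr (2 - Re w) * ((fact 3 * B * exp (- (ln 2 * t))) / 2)"
        using d_le[of t 3] True by (intro mult_left_mono divide_right_mono) auto
      finally show ?thesis using True by (simp add: fact_numeral mult_ac)
    qed (simp add: G_def)
    have I_hol: "I holomorphic_on {w. Re w < 3}"
      unfolding I_def
    proof (rule holomorphic_on_lebesgue_integral[OF open_halfspace_Re_lt _ G_meas])
      show "(\<lambda>w. G w t) holomorphic_on {w. Re w < 3}" for t
        unfolding G_def by (cases "t > 0") (auto intro!: holomorphic_intros)
      fix w0 :: complex assume w0: "w0 \<in> {w. Re w < 3}"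
      define r where "r = (3 - Re w0) / 2"
      define a where "a = 2 - Re w0 - r"
      define b where "b = 2 - Re w0 + r"
      have r: "r > 0" and a: "a > -1" and b: "b > -1" using w0 by (auto simp: r_def a_def b_def field_simps)
      define g where "g = (\<lambda>t. 3 * B * (indicator {0<..} t * (t powr a * exp (- (ln 2 * t))) + indicator {0<..} t * (t powr b * exp (- (ln 2 * t)))))"
      have "integrable lborel g"
        unfolding g_def using a b
        by (intro integrable_mult_right Bochner_Integration.integrable_add Gamma_integral_scaled_real) auto
      moreover have "norm (G w t) \<le> g t" if w: "w \<in> ball w0 r" for w t
      proof (cases "t > 0")
        case True
        have "\<bar>Re w - Re w0\<bar> < r"
          using w abs_Re_le_cmod[of "w - w0"] by (simp add: dist_norm norm_minus_commute)
        hence ab: "a \<le> 2 - Re w" "2 - Re w \<le> b" by (auto simp: a_def b_def)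
        have "t powr (2 - Re w) \<le> t powr a + t powr b"
        proof (cases "t \<ge> 1")
          case True
          thus ?thesis using powr_mono[OF ab(2) True] by (simp add: add_increasing)
        next
          case False
          thus ?thesis using powr_mono'[OF ab(1), of t] \<open>t > 0\<close> by (simp add: add_increasing2)
        qed
        hence "3 * B * (t powr (2 - Re w) * exp (- (ln 2 * t))) \<le> 3 * B * ((t powr a + t powr b) * exp (- (ln 2 * t)))"
          using B by (intro mult_left_mono mult_right_mono) auto
        thus ?thesis using True G_le[of w t] by (simp add: g_def algebra_simps)
      qed (simp add: G_def g_def)
      ultimately show "\<exists>r>0. \<exists>g. integrable lborel g \<and> (\<forall>z\<in>ball w0 r. \<forall>t\<in>space lborel. norm (G z t) \<le> g t)"
        using r by blast
    qed
    define F where "F = (\<lambda>w. rGamma w * (2 * rGamma (3 - w) * I w))"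
    have F_hol: "F holomorphic_on {w. Re w < 3}"
      unfolding F_def by (intro holomorphic_intros I_hol)
    have F_sum: "F w = infsum (\<lambda>i. (s - fst i) powr (- w)) (zero_index L_ext)" if w: "2 < Re w" "Re w < 3" for w
    proof -
      have left: "Re (fst i) < Re s" if "i \<in> zero_index L_ext" for i
        using that nz[of "fst i"] s by (auto simp: zero_index_def not_le[symmetric])
      have "I w = (LINT t:{0<..}|lborel. of_real t powr (2 - w) * ((deriv ^^ 2) (\<lambda>z. deriv L_ext z / L_ext z) (s + of_real t) / 2))"
        unfolding I_def set_lebesgue_integral_def
      proof (rule Bochner_Integration.integral_cong[OF refl])
        fix t :: real
        show "G w t = indicator {0<..} t *\<^sub>R (of_real t powr (2 - w) * ((deriv ^^ 2) (\<lambda>z. deriv L_ext z / L_ext z) (s + of_real t) / 2))"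
          using D_eq[of "s + of_real t"] s by (cases "t > 0") (auto simp: G_def d_def)
      qed
      also have "\<dots> = Gamma (3 - w) * Gamma w / 2 * infsum (\<lambda>i. (s - fst i) powr (- w)) (zero_index L_ext)"
        by (rule e.mellin_zeros[OF left w]) (use nz s in auto)
      finally have Iw: "I w = Gamma (3 - w) * Gamma w / 2 * infsum (\<lambda>i. (s - fst i) powr (- w)) (zero_index L_ext)" .
      have "w \<notin> \<int>\<^sub>\<le>\<^sub>0" "3 - w \<notin> \<int>\<^sub>\<le>\<^sub>0" using w by (auto elim!: nonpos_Ints_cases simp: complex_eq_iff)
      hence "Gamma w \<noteq> 0" "Gamma (3 - w) \<noteq> 0" by (simp_all add: Gamma_eq_zero_iff)
      thus ?thesis unfolding F_def Iw by (simp add: rGamma_inverse_Gamma field_simps)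
    qed
    \<comment> \<open>\<open>rGamma\<close> has a simple zero with derivative 1 at 0, so the product
      rule keeps only the value of the other factor there, and 2 \<open>rGamma\<close> 3 =
      1.\<close>
    have F_der: "deriv F 0 = I 0"
    proof -
      have "(rGamma has_field_derivative (-1) ^ 0 * fact 0) (at (- of_nat 0 :: complex))"
        by (rule has_field_derivative_rGamma_nonpos_int)
      hence r: "(rGamma has_field_derivative 1) (at (0 :: complex))" by simp
      have "(\<lambda>w. 2 * rGamma (3 - w) * I w) holomorphic_on {w. Re w < 3}" by (intro holomorphic_intros I_hol)
      hence h: "((\<lambda>w. 2 * rGamma (3 - w) * I w) has_field_derivative deriv (\<lambda>w. 2 * rGamma (3 - w) * I w) 0) (at 0)"
        by (rule holomorphic_derivI[OF _ open_halfspace_Re_lt]) simp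
      have g3: "rGamma (3 :: complex) = 1 / 2"
        by (simp add: rGamma_inverse_Gamma Gamma_numeral fact_numeral)
      have "(F has_field_derivative (1 * (2 * rGamma (3 - 0) * I 0) + deriv (\<lambda>w. 2 * rGamma (3 - w) * I w) 0 * rGamma 0)) (at 0)"
        unfolding F_def by (rule DERIV_mult[OF r h])
      hence "(F has_field_derivative I 0) (at 0)" by (simp add: g3)
      thus ?thesis by (rule DERIV_imp_deriv)
    qed
    have I0: "I 0 = - l s"
    proof -
      \<comment> \<open>The antiderivative that three integrations by parts produce. At t = 0 only
        \<open>d 0 0 = l s\<close> survives, and at infinity the exponential decay of the
        derivatives beats the powers of t.\<close>
      define P where "P = (\<lambda>t. (of_real t) ^ 2 / 2 * d 2 t - of_real t * d 1 t + d 0 t)"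
      have "(LBINT t=ereal 0..\<infinity>. (of_real t) ^ 2 * (d 3 t / 2)) = 0 - P 0"
      proof (rule interval_integral_FTC_integrable[where F = P])
        show "(P has_vector_derivative (of_real t) ^ 2 * (d 3 t / 2)) (at t)" if "ereal 0 < ereal t" for t
        proof -
          have t: "t > -1" using that by simp
          have o: "((\<lambda>t. complex_of_real t) has_vector_derivative 1) (at t)" by (auto intro!: derivative_eq_intros)
          have o2: "((\<lambda>t. (of_real t) ^ 2 / 2 :: complex) has_vector_derivative of_real t) (at t)"
            using has_vector_derivative_divide[OF has_vector_derivative_mult[OF o o], of 2] by (simp add: power2_eq_square)
          have "(P has_vector_derivative ((of_real t) ^ 2 / 2 * d 3 t + of_real t * d 2 t) - (of_real t * d 2 t + 1 * d 1 t) + d 1 t) (at t)"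
            unfolding P_def
            using has_vector_derivative_add[OF has_vector_derivative_diff[OF has_vector_derivative_mult[OF o2 d_der[OF t, of 2]] has_vector_derivative_mult[OF o d_der[OF t, of 1]]] d_der[OF t, of 0]]
            by (simp add: numeral_2_eq_2 numeral_3_eq_3)
          thus ?thesis by (simp add: algebra_simps)
        qed
        show "isCont (\<lambda>t. (of_real t) ^ 2 * (d 3 t / 2)) t" if "ereal 0 < ereal t" for t
        proof -
          have "isCont (d 3) t" using d_der[of t 3] that by (intro has_vector_derivative_continuous) auto
          thus ?thesis by (intro continuous_intros) auto
        qed
        have eint: "einterval (ereal 0) \<infinity> = {0<..}" by (auto simp: einterval_def)
        have pw: "(of_real t :: complex) powr (2 - 0) = of_real t ^ 2" if "t > 0" for t :: real
          using that powr_nat'[of "complex_of_real t" 2] by simp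
        show "set_integrable lborel (einterval (ereal 0) \<infinity>) (\<lambda>t. (of_real t) ^ 2 * (d 3 t / 2))"
        proof -
          have "integrable lborel (G 0)"
          proof (rule Bochner_Integration.integrable_bound[OF _ G_meas])
            show "integrable lborel (\<lambda>t. 3 * B * (indicator {0<..} t * (t powr 2 * exp (- (ln 2 * t)))))"
              by (intro integrable_mult_right Gamma_integral_scaled_real) auto
            show "AE t in lborel. norm (G 0 t) \<le> norm (3 * B * (indicator {0<..} t * (t powr 2 * exp (- (ln 2 * t)))))"
              using G_le[of 0] B by (intro AE_I2) (auto intro: order.trans[OF _ abs_ge_self])
          qed
          moreover have "G 0 = (\<lambda>t. indicator {0<..} t *\<^sub>R ((of_real t) ^ 2 * (d 3 t / 2)))"
            using pw by (auto simp: G_def fun_eq_iff indicator_def)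
          ultimately show ?thesis unfolding set_integrable_def eint by simp
        qed
        show "((P \<circ> real_of_ereal) \<longlongrightarrow> P 0) (at_right (ereal 0))"
        proof -
          have "isCont P 0"
          proof -
            have "isCont (d k) 0" for k using d_der[of 0 k] by (intro has_vector_derivative_continuous) auto
            thus ?thesis unfolding P_def by (intro continuous_intros) auto
          qed
          hence "(P \<longlongrightarrow> P 0) (at_right 0)" by (simp add: isCont_def filterlim_at_split)
          thus ?thesis by (simp add: ereal_tendsto_simps1)
        qed
        show "((P \<circ> real_of_ereal) \<longlongrightarrow> 0) (at_left \<infinity>)"
        proof -
          define E where "E = (\<lambda>t :: real. B * (t ^ 2 * exp (- (ln 2 * t)) + t * exp (- (ln 2 * t)) + exp (- (ln 2 * t))))"
          have pe: "((\<lambda>t::real. t ^ k * exp (- (ln 2 * t))) \<longlongrightarrow> 0) at_top" for k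
          proof -
            have "((\<lambda>t::real. (ln 2 * t) ^ k / exp (ln 2 * t)) \<longlongrightarrow> 0) at_top"
              by (rule filterlim_compose[OF tendsto_power_div_exp_0])
                 (intro filterlim_tendsto_pos_mult_at_top[OF tendsto_const] filterlim_ident, auto)
            hence "((\<lambda>t::real. (1 / ln 2 ^ k) * ((ln 2 * t) ^ k / exp (ln 2 * t))) \<longlongrightarrow> (1 / ln 2 ^ k) * 0) at_top"
              by (rule tendsto_mult_left)
            moreover have "(1 / ln 2 ^ k) * ((ln 2 * t) ^ k / exp (ln 2 * t)) = t ^ k * exp (- (ln 2 * t))" for t :: real
              by (simp add: power_mult_distrib exp_minus field_simps)
            ultimately show ?thesis by simp
          qed
          have "(E \<longlongrightarrow> B * (0 + 0 + 0)) at_top"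
            unfolding E_def using pe[of 2] pe[of 1] pe[of 0] by (intro tendsto_intros) auto
          hence E: "(E \<longlongrightarrow> 0) at_top" by simp
          have "\<forall>\<^sub>F t in at_top. norm (P t) \<le> E t"
            using eventually_ge_at_top[of 0]
          proof eventually_elim
            case (elim t)
            have "norm (P t) \<le> norm ((of_real t) ^ 2 / 2 * d 2 t) + norm (of_real t * d 1 t) + norm (d 0 t)"
              unfolding P_def by (intro order.trans[OF norm_triangle_ineq] add_mono order.trans[OF norm_triangle_ineq4] order.refl)
            also have "\<dots> \<le> t ^ 2 / 2 * (fact 2 * B * exp (- (ln 2 * t))) + t * (fact 1 * B * exp (- (ln 2 * t))) + fact 0 * B * exp (- (ln 2 * t))"
              unfolding norm_mult using elim d_le[of t 2] d_le[of t 1] d_le[of t 0] by (intro add_mono mult_mono) (auto simp: norm_power norm_divide)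
            also have "\<dots> = E t" by (simp add: E_def algebra_simps)
            finally show ?case .
          qed
          hence "(P \<longlongrightarrow> 0) at_top" using E by (rule Lim_null_comparison)
          thus ?thesis by (simp add: ereal_tendsto_simps1)
        qed
      qed auto
      also have "P 0 = l s" by (simp add: P_def d_def)
      also have "(LBINT t=ereal 0..\<infinity>. (of_real t) ^ 2 * (d 3 t / 2)) = I 0"
      proof -
        have eint: "einterval (ereal 0) \<infinity> = {0<..}" by (auto simp: einterval_def)
        have pw: "(of_real t :: complex) powr (2 - 0) = of_real t ^ 2" if "t > 0" for t :: real
          using that powr_nat'[of "complex_of_real t" 2] by simp
        show ?thesis
          unfolding interval_lebesgue_integral_def eint set_lebesgue_integral_def I_def G_def
          using pw by (auto intro!: Bochner_Integration.integral_cong simp: indicator_def)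
      qed
      finally show ?thesis by simp
    qed
    have "exp (- deriv F 0) = L_ext s" using F_der I0 l_exp[of s] s by simp
    thus ?thesis using F_hol F_sum by blast
  qed
  show ?thesis using nz main by (intro exI[of _ \<sigma>0]) blast
qed

end

section \<open>The regularized product over the trivial zeros\<close>

lemma residue_div_square:
  assumes "open A" "0 \<in> A" "f holomorphic_on A"
  shows "residue (\<lambda>w. f w / w\<^sup>2) 0 = deriv f 0"
  using residue_holomorphic_over_power'[OF assms, of 1] by (simp add: power2_eq_square)

lemma hurwitz_K_0: "Re x > 0 \<Longrightarrow> hurwitz_K 0 x = x - 1 / 2"
proof -
  assume x: "Re x > 0"
  have "x + of_nat n \<noteq> 0" for n using x by (intro Re_pos_neq_0) simp
  hence "hurwitz_partial M 0 x = x - 1 / 2" for M by (simp add: hurwitz_partial_def)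
  thus ?thesis using hurwitz_K_LIMSEQ[OF x, of 0] by (simp add: LIMSEQ_const_iff)
qed

lemma hurwitz_partial_deriv_0:
  assumes x: "Re x > 0"
  shows "deriv (\<lambda>w. hurwitz_partial M w x) 0 =
    of_nat M + 1 / 2 + (\<Sum>n<M. Ln (x + of_nat n)) - (x + of_nat M) * Ln (x + of_nat M) + Ln (x + of_nat M) / 2"
proof -
  have nz: "x + of_nat n \<noteq> 0" for n using x by (intro Re_pos_neq_0) simp
  have p: "((\<lambda>w. (x + of_nat n) powr (a - w)) has_field_derivative - Ln (x + of_nat n) * (x + of_nat n) powr a) (at 0)" for a n
    unfolding powr_def using nz[of n] by (auto intro!: derivative_eq_intros)
  have S: "((\<lambda>w. \<Sum>n<M. (x + of_nat n) powr (- w)) has_field_derivative (\<Sum>n<M. - Ln (x + of_nat n))) (at 0)"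
  proof (rule DERIV_sum)
    fix n
    show "((\<lambda>w. (x + of_nat n) powr (- w)) has_field_derivative - Ln (x + of_nat n)) (at 0)"
      using p[of n 0] nz[of n] by simp
  qed
  have T: "((\<lambda>w. (x + of_nat M) powr (1 - w)) has_field_derivative - Ln (x + of_nat M) * (x + of_nat M)) (at 0)"
    using p[of M 1] nz[of M] by simp
  have U: "((\<lambda>w. (x + of_nat M) powr (- w)) has_field_derivative - Ln (x + of_nat M)) (at 0)"
    using p[of M 0] nz[of M] by simp
  have d1: "((\<lambda>w::complex. w - 1) has_field_derivative 1) (at 0)" by (auto intro!: derivative_eq_intros)
  have d2: "((\<lambda>w::complex. (w - 1) / 2) has_field_derivative 1 / 2) (at 0)" by (auto intro!: derivative_eq_intros)
  have "((\<lambda>w. hurwitz_partial M w x) has_field_derivative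
      (1 * (\<Sum>n<M. (x + of_nat n) powr (- 0)) + (\<Sum>n<M. - Ln (x + of_nat n)) * (0 - 1)) +
      (- Ln (x + of_nat M) * (x + of_nat M)) +
      (1 / 2 * (x + of_nat M) powr (- 0) + (- Ln (x + of_nat M)) * ((0 - 1) / 2))) (at 0)"
    unfolding hurwitz_partial_def by (intro DERIV_add DERIV_mult d1 d2 S T U)
  thus ?thesis using nz by (intro DERIV_imp_deriv) (simp add: sum_negf algebra_simps)
qed

lemma hurwitz_K_deriv_LIMSEQ:
  assumes "Re x > 0"
  shows "(\<lambda>M. deriv (\<lambda>w. hurwitz_partial M w x) 0) \<longlonglongrightarrow> deriv (\<lambda>w. hurwitz_K w x) 0"
proof -
  obtain d where d: "d > 0" "uniform_limit (cball 0 d) (\<lambda>M w. hurwitz_partial M w x) (\<lambda>w. hurwitz_K w x) sequentially"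
    using hurwitz_K_uniform_limit[OF assms, of 0] by auto
  have "uniform_limit (ball 0 d) (\<lambda>M w. hurwitz_partial M w x) (\<lambda>w. hurwitz_K w x) sequentially"
    by (rule uniform_limit_on_subset[OF d(2)]) auto
  from higher_deriv_complex_uniform_limit[OF this _ _ open_ball, of 0 1] show ?thesis
    using hurwitz_partial_holomorphic[OF assms] d(1) by simp
qed

text \<open>Exponentiating turns the sum of logarithms into a Pochhammer symbol, independently of
  branches. The factor in the middle does not involve x, so it cancels when two values of x are
  compared.\<close>

lemma exp_hurwitz_partial_deriv_0:
  assumes x: "Re x > 0" and M: "M > 0"
  shows "exp (deriv (\<lambda>w. hurwitz_partial M w x) 0) =
    rGamma_series x M * (fact M * exp ((of_nat M + 1 / 2) * (1 - of_real (ln (of_nat M))))) *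
    exp (- ((x + of_nat M + 1 / 2) * (Ln (x + of_nat M) - of_real (ln (of_nat M)))))"
proof -
  have nz: "x + of_nat n \<noteq> 0" for n using x by (intro Re_pos_neq_0) simp
  define L l where "L = Ln (x + of_nat M)" and "l = complex_of_real (ln (of_nat M))"
  have "exp (\<Sum>n<M. Ln (x + of_nat n)) = (\<Prod>n<M. x + of_nat n)" using nz by (simp add: exp_sum)
  also have "\<dots> = pochhammer x M" by (simp add: pochhammer_prod lessThan_atLeast0)
  finally have s: "exp (\<Sum>n<M. Ln (x + of_nat n)) = pochhammer x M" .
  have rs: "rGamma_series x M = pochhammer x M * (x + of_nat M) * exp (- (x * l)) / fact M"
    unfolding rGamma_series_def Suc_eq_plus1[symmetric] pochhammer_Suc l_def exp_minus by (simp add: divide_inverse mult_ac)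
  have "exp (deriv (\<lambda>w. hurwitz_partial M w x) 0) =
      exp ((\<Sum>n<M. Ln (x + of_nat n)) + (of_nat M + 1 / 2 - (x + of_nat M) * L + L / 2))"
    unfolding hurwitz_partial_deriv_0[OF x] L_def by (rule arg_cong[of _ _ exp]) simp
  also have "\<dots> = pochhammer x M * exp (of_nat M + 1 / 2 - (x + of_nat M) * L + L / 2)"
    by (simp only: exp_add[of "\<Sum>n<M. Ln (x + of_nat n)"] s)
  also have "of_nat M + 1 / 2 - (x + of_nat M) * L + L / 2 =
      L + - (x * l) + (of_nat M + 1 / 2) * (1 - l) + - ((x + of_nat M + 1 / 2) * (L - l))"
    by (simp add: field_simps)
  also have "exp \<dots> = exp L * exp (- (x * l)) * exp ((of_nat M + 1 / 2) * (1 - l)) * exp (- ((x + of_nat M + 1 / 2) * (L - l)))"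
    by (simp only: exp_add)
  also have "exp L = x + of_nat M" using nz by (simp add: L_def)
  also have "pochhammer x M * ((x + of_nat M) * exp (- (x * l)) * exp ((of_nat M + 1 / 2) * (1 - l)) * exp (- ((x + of_nat M + 1 / 2) * (L - l)))) =
      rGamma_series x M * (fact M * exp ((of_nat M + 1 / 2) * (1 - l))) * exp (- ((x + of_nat M + 1 / 2) * (L - l)))"
    unfolding rs by simp
  finally show ?thesis by (simp only: L_def l_def)
qed

lemma tendsto_mult_Ln_shift:
  assumes x: "Re x > 0"
  shows "(\<lambda>M. (x + of_nat M + 1 / 2) * (Ln (x + of_nat M) - of_real (ln (of_nat M)))) \<longlonglongrightarrow> x"
proof -
  have "(Ln has_field_derivative inverse 1) (at 1)" by (rule has_field_derivative_Ln) simp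
  \<comment> \<open>Caratheodory's form of the derivative of Ln at 1. It writes Ln (1 + x / M) as g
    (1 + x / M) x / M, so that the factor of order M cancels exactly.\<close>
  then obtain g where g: "\<And>z. Ln z - Ln 1 = g z * (z - 1)" "isCont g 1" "g 1 = inverse 1"
    unfolding CARAT_DERIV by blast
  have "(\<lambda>M. 1 + x / of_nat M) \<longlonglongrightarrow> 1 + 0" by (intro tendsto_intros lim_const_over_n)
  hence "(\<lambda>M. g (1 + x / of_nat M)) \<longlonglongrightarrow> g 1" using isCont_tendsto_compose[OF g(2)] by simp
  hence "(\<lambda>M. (1 + (x + 1 / 2) / of_nat M) * g (1 + x / of_nat M) * x) \<longlonglongrightarrow> (1 + 0) * g 1 * x"
    by (intro tendsto_intros lim_const_over_n)
  moreover have "\<forall>\<^sub>F M in sequentially. (1 + (x + 1 / 2) / of_nat M) * g (1 + x / of_nat M) * x =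
      (x + of_nat M + 1 / 2) * (Ln (x + of_nat M) - of_real (ln (of_nat M)))"
    using eventually_gt_at_top[of 0]
  proof eventually_elim
    case (elim M)
    have nz: "1 + x / of_nat M \<noteq> 0" using x elim by (intro Re_pos_neq_0) (simp add: add_pos_pos)
    have "x + of_nat M = of_real (real M) * (1 + x / of_nat M)" using elim by (simp add: field_simps)
    hence "Ln (x + of_nat M) = of_real (ln (real M)) + Ln (1 + x / of_nat M)"
      using Ln_times_of_real[OF _ nz, of "real M"] elim by simp
    moreover have "Ln (1 + x / of_nat M) = g (1 + x / of_nat M) * (x / of_nat M)" using g(1)[of "1 + x / of_nat M"] by simp
    ultimately have "Ln (x + of_nat M) - of_real (ln (real M)) = g (1 + x / of_nat M) * (x / of_nat M)" by simp
    moreover have "(1 + (x + 1 / 2) / m) * G * x = (x + m + 1 / 2) * (G * (x / m))" if "m \<noteq> 0" for m G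
      using that by (simp add: field_simps)
    ultimately show ?case using elim by simp
  qed
  ultimately show ?thesis using g(3) by (simp add: Lim_transform_eventually)
qed

text \<open>By Lerch's formula this is the square root of \<open>2 \<pi> e\<close>; only its being nonzero and independent of \<open>x\<close> matters.\<close>

definition hurwitz_const :: complex where
  "hurwitz_const = exp (deriv (\<lambda>w. hurwitz_K w 1) 0 + 1)"

text \<open>Lerch's formula up to a constant. The expressions for x and for 1 are multiplied
  crosswise, so that their common factor, whose limit stays implicit, drops out before M tends to
  infinity; \<open>rGamma 1 = 1\<close> leaves the normalization in
  \<open>hurwitz_const\<close>.\<close>

lemma exp_deriv_hurwitz_K:
  assumes x: "Re x > 0"
  shows "exp (deriv (\<lambda>w. hurwitz_K w x) 0) = rGamma x * hurwitz_const * exp (- x)"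
proof -
  define E where "E = (\<lambda>x M. exp (deriv (\<lambda>w. hurwitz_partial M w x) 0))"
  define b where "b = (\<lambda>x M. exp (- ((x + of_nat M + 1 / 2) * (Ln (x + of_nat M) - complex_of_real (ln (of_nat M))))))"
  have E: "E y \<longlonglongrightarrow> exp (deriv (\<lambda>w. hurwitz_K w y) 0)" if "Re y > 0" for y
    unfolding E_def by (intro tendsto_exp hurwitz_K_deriv_LIMSEQ that)
  have b: "b y \<longlonglongrightarrow> exp (- y)" if "Re y > 0" for y
    unfolding b_def by (intro tendsto_exp tendsto_minus tendsto_mult_Ln_shift that)
  have l1: "(\<lambda>M. E x M * (rGamma_series 1 M * b 1 M)) \<longlonglongrightarrow> exp (deriv (\<lambda>w. hurwitz_K w x) 0) * (rGamma 1 * exp (- 1))"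
    by (intro tendsto_mult E b x rGamma_series_LIMSEQ) simp_all
  have l2: "(\<lambda>M. E 1 M * (rGamma_series x M * b x M)) \<longlonglongrightarrow> exp (deriv (\<lambda>w. hurwitz_K w 1) 0) * (rGamma x * exp (- x))"
    by (intro tendsto_mult E b x rGamma_series_LIMSEQ) simp_all
  have ev: "\<forall>\<^sub>F M in sequentially. E x M * (rGamma_series 1 M * b 1 M) = E 1 M * (rGamma_series x M * b x M)"
    using eventually_gt_at_top[of 0]
  proof eventually_elim
    case (elim M)
    show ?case unfolding E_def exp_hurwitz_partial_deriv_0[OF x elim] exp_hurwitz_partial_deriv_0[of 1, OF _ elim, simplified one_complex.sel, OF zero_less_one] b_def
      by (simp only: mult_ac)
  qed
  have "exp (deriv (\<lambda>w. hurwitz_K w x) 0) = exp 1 * (exp (deriv (\<lambda>w. hurwitz_K w x) 0) * (rGamma 1 * exp (- 1)))"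
    by (simp add: exp_minus)
  also have "exp (deriv (\<lambda>w. hurwitz_K w x) 0) * (rGamma 1 * exp (- 1)) = exp (deriv (\<lambda>w. hurwitz_K w 1) 0) * (rGamma x * exp (- x))"
    by (rule tendsto_unique[OF trivial_limit_sequentially Lim_transform_eventually[OF l1 ev] l2])
  also have "exp 1 * \<dots> = rGamma x * hurwitz_const * exp (- x)"
    by (simp only: hurwitz_const_def exp_add mult_ac)
  finally show ?thesis .
qed

text \<open>The product and quotient rules bring in the value
  \<open>hurwitz_K 0 x = x - 1 / 2\<close>. Its contribution exp x cancels exp (- x) from Lerch's
  formula, and differentiating 2^(-w) gives the power of 2.\<close>

lemma exp_deriv_scaled_hurwitz:
  assumes x: "Re x > 0"
  shows "exp (- deriv (\<lambda>w. 2 powr (- w) * (hurwitz_K w x / (w - 1))) 0) =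
    exp (of_real (ln 2) * (1 / 2 - x) - 1 / 2) * hurwitz_const * rGamma x"
proof -
  define k where "k = deriv (\<lambda>w. hurwitz_K w x) 0"
  have K: "((\<lambda>w. hurwitz_K w x) has_field_derivative k) (at 0)"
    unfolding k_def by (rule holomorphic_derivI[OF hurwitz_K_holomorphic[OF x] open_Re_gt]) simp
  have p: "((\<lambda>w :: complex. 2 powr (- w)) has_field_derivative - of_real (ln 2)) (at 0)"
    unfolding powr_def using Ln_of_real[of 2] by (auto intro!: derivative_eq_intros)
  have d: "((\<lambda>w :: complex. w - 1) has_field_derivative 1) (at 0)" by (auto intro!: derivative_eq_intros)
  have "((\<lambda>w. 2 powr (- w) * (hurwitz_K w x / (w - 1))) has_field_derivative
      - of_real (ln 2) * (hurwitz_K 0 x / (0 - 1)) +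
      (k * (0 - 1) - hurwitz_K 0 x * 1) / ((0 - 1) * (0 - 1)) * 2 powr (- 0)) (at 0)"
    by (intro DERIV_mult DERIV_divide p K d) simp
  hence "deriv (\<lambda>w. 2 powr (- w) * (hurwitz_K w x / (w - 1))) 0 = of_real (ln 2) * (x - 1 / 2) - k - (x - 1 / 2)"
    using hurwitz_K_0[OF x] by (intro DERIV_imp_deriv) (simp add: algebra_simps)
  hence "- deriv (\<lambda>w. 2 powr (- w) * (hurwitz_K w x / (w - 1))) 0 = (of_real (ln 2) * (1 / 2 - x) - 1 / 2) + x + k"
    by (simp add: algebra_simps)
  hence "exp (- deriv (\<lambda>w. 2 powr (- w) * (hurwitz_K w x / (w - 1))) 0) = exp (of_real (ln 2) * (1 / 2 - x) - 1 / 2) * exp x * exp k"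
    by (simp only: exp_add)
  thus ?thesis unfolding k_def exp_deriv_hurwitz_K[OF x] by (simp add: exp_minus)
qed

section \<open>Convergence of the regularizing zeta series on half-planes\<close>

text \<open>On a compact set the ratio |s0 - a| / |s - a| is bounded uniformly in all points a,
  because |s - a| stays away from 0 and |s0 - s| is bounded. Summability at the single point s0 thus
  yields one majorant for the whole set.\<close>

lemma norm_powr_bound_compact:
  fixes a :: "'i \<Rightarrow> complex"
  assumes a: "\<And>i. i \<in> I \<Longrightarrow> Re (a i) \<le> \<sigma>" and s0: "Re s0 \<ge> \<sigma> + 1" and "C \<ge> 0"
    and K: "compact K" "K \<subseteq> {w. Re w > C} \<times> {s. Re s > \<sigma>}" "K \<noteq> {}"
  shows "\<exists>c>C. \<exists>B. \<forall>i\<in>I. \<forall>(w, s)\<in>K. norm ((s - a i) powr (- w)) \<le> B * norm (s0 - a i) powr (- c)"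
proof -
  have cw: "continuous_on K (\<lambda>p. Re (fst p))" and cs: "continuous_on K (\<lambda>p. Re (snd p))"
    by (intro continuous_intros)+
  obtain p where p: "p \<in> K" "\<And>q. q \<in> K \<Longrightarrow> Re (fst p) \<le> Re (fst q)"
    using continuous_attains_inf[OF K(1,3) cw] by blast
  obtain p' where p': "p' \<in> K" "\<And>q. q \<in> K \<Longrightarrow> Re (snd p') \<le> Re (snd q)"
    using continuous_attains_inf[OF K(1,3) cs] by blast
  obtain B where B: "\<And>q. q \<in> K \<Longrightarrow> norm q \<le> B"
    using compact_imp_bounded[OF K(1)] by (auto simp: bounded_iff)
  \<comment> \<open>c is the least Re w on K, \<eta> the least distance of Re s from
    \<open>\<sigma>\<close>, and \<Lambda> the constant in |s0 - a| <= \<Lambda> |s - a|. Since |s0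
    - a| >= 1, lowering the exponent from Re w to c only enlarges the bound.\<close>
  define c where "c = Re (fst p)"
  define \<eta> where "\<eta> = Re (snd p') - \<sigma>"
  define \<Lambda> where "\<Lambda> = 1 + (norm s0 + B) / \<eta>"
  have c: "c > C" and \<eta>: "\<eta> > 0" using p(1) p'(1) K(2) by (auto simp: c_def \<eta>_def)
  have "B \<ge> 0" using B[OF p(1)] norm_ge_zero order.trans by blast
  hence \<Lambda>: "\<Lambda> \<ge> 1" using \<eta> by (simp add: \<Lambda>_def)
  have bound: "norm ((s - a i) powr (- w)) \<le> (\<Lambda> powr B * exp (pi * B)) * norm (s0 - a i) powr (- c)" if i: "i \<in> I" and ws: "(w, s) \<in> K" for i w s
  proof -
    have wB: "norm w \<le> B" and sB: "norm s \<le> B"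
      using B[OF ws] norm_fst_le[of w s] norm_snd_le[of s w] by linarith+
    have \<eta>s: "\<eta> \<le> norm (s - a i)"
      using p'(2)[OF ws] a[OF i] complex_Re_le_cmod[of "s - a i"] by (simp add: \<eta>_def)
    have one: "1 \<le> norm (s0 - a i)" using s0 a[OF i] complex_Re_le_cmod[of "s0 - a i"] by simp
    have cw: "c \<le> Re w" using p(2)[OF ws] by (simp add: c_def)
    have pos: "norm (s - a i) > 0" using \<eta>s \<eta> by linarith
    have "norm (s0 - a i) \<le> norm (s - a i) + norm (s0 - s)"
      using norm_triangle_ineq[of "s - a i" "s0 - s"] by simp
    also have "norm (s0 - s) \<le> norm s0 + B" using norm_triangle_ineq4[of s0 s] sB by linarith
    also have "norm s0 + B = (norm s0 + B) / \<eta> * \<eta>" using \<eta> by simp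
    also have "\<dots> \<le> (norm s0 + B) / \<eta> * norm (s - a i)"
      using \<eta>s \<eta> \<open>B \<ge> 0\<close> by (intro mult_left_mono) auto
    finally have "norm (s0 - a i) \<le> \<Lambda> * norm (s - a i)" by (simp add: \<Lambda>_def algebra_simps)
    hence le: "norm (s0 - a i) / \<Lambda> \<le> norm (s - a i)" using \<Lambda> by (simp add: field_simps)
    have "norm (s0 - a i) / \<Lambda> > 0" using one \<Lambda> by (intro divide_pos_pos) linarith+
    note le = le this
    have "norm ((s - a i) powr (- w)) \<le> norm (s - a i) powr (- Re w) * exp (pi * \<bar>Im w\<bar>)"
      using norm_powr_le_exp[of "s - a i" "- w"] by simp
    also have "norm (s - a i) powr (- Re w) \<le> (norm (s0 - a i) / \<Lambda>) powr (- Re w)"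
      using le one \<Lambda> cw c \<open>C \<ge> 0\<close> by (intro powr_mono2') auto
    also have "\<dots> = norm (s0 - a i) powr (- Re w) / \<Lambda> powr (- Re w)"
      by (rule powr_divide)
    also have "\<dots> = \<Lambda> powr Re w * norm (s0 - a i) powr (- Re w)" by (simp add: powr_minus divide_inverse)
    also have "\<Lambda> powr Re w \<le> \<Lambda> powr B" using \<Lambda> wB complex_Re_le_cmod[of w] by (intro powr_mono) auto
    also have "norm (s0 - a i) powr (- Re w) \<le> norm (s0 - a i) powr (- c)" using one cw by (intro powr_mono) auto
    also have "exp (pi * \<bar>Im w\<bar>) \<le> exp (pi * B)" using wB abs_Im_le_cmod[of w] by simp
    finally show ?thesis by (simp add: mult_ac mult_left_mono mult_right_mono)
  qed
  show ?thesis using c bound by (intro exI[of _ c] conjI exI[of _ "\<Lambda> powr B * exp (pi * B)"]) auto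
qed

lemma
  fixes a :: "'i \<Rightarrow> complex"
  assumes a: "\<And>i. i \<in> I \<Longrightarrow> Re (a i) \<le> \<sigma>" and s0: "Re s0 \<ge> \<sigma> + 1" and C: "C \<ge> 0"
    and summ: "\<And>c. c > C \<Longrightarrow> (\<lambda>i. norm (s0 - a i) powr (- c)) summable_on I"
  shows reg_zeta_converges_half_plane: "reg_zeta_converges I a (\<lambda>_. 1) C {s. Re s > \<sigma>}"
    and reg_zeta_holomorphic: "Re s > \<sigma> \<Longrightarrow> (\<lambda>w. reg_zeta I a (\<lambda>_. 1) w s) holomorphic_on {w. Re w > C}"
    and reg_zeta_summable: "Re w > C \<Longrightarrow> Re s > \<sigma> \<Longrightarrow> (\<lambda>i. (s - a i) powr (- w)) summable_on I"
proof -
  have abs: "(\<lambda>i. norm ((s - a i) powr (- w))) summable_on I" if "Re w > C" "Re s > \<sigma>" for w s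
  proof -
    have "\<exists>c>C. \<exists>B. \<forall>i\<in>I. \<forall>(w, s)\<in>{(w, s)}. norm ((s - a i) powr (- w)) \<le> B * norm (s0 - a i) powr (- c)"
      by (rule norm_powr_bound_compact) (use a s0 C that in auto)
    then obtain c B where
      cB: "c > C" "\<forall>i\<in>I. norm ((s - a i) powr (- w)) \<le> B * norm (s0 - a i) powr (- c)" by auto
    have "(\<lambda>i. B * norm (s0 - a i) powr (- c)) summable_on I" by (rule summable_on_cmult_right[OF summ[OF cB(1)]])
    thus ?thesis by (rule summable_on_comparison_test) (use cB(2) in auto)
  qed
  show "(\<lambda>i. (s - a i) powr (- w)) summable_on I" if "Re w > C" "Re s > \<sigma>" for w s
    using abs[OF that] by (rule abs_summable_summable)
  have ul: "uniform_limit K (\<lambda>X (w, s). \<Sum>i\<in>X. 1 * (s - a i) powr (- w))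
      (\<lambda>(w, s). reg_zeta I a (\<lambda>_. 1) w s) (finite_subsets_at_top I)"
    if K: "compact K" "K \<subseteq> {w. Re w > C} \<times> {s. Re s > \<sigma>}" for K
  proof (cases "K = {}")
    case False
    have "\<exists>c>C. \<exists>B. \<forall>i\<in>I. \<forall>(w, s)\<in>K. norm ((s - a i) powr (- w)) \<le> B * norm (s0 - a i) powr (- c)"
      by (rule norm_powr_bound_compact) (use a s0 C K False in auto)
    then obtain c B where
      cB: "c > C" "\<forall>i\<in>I. \<forall>(w, s)\<in>K. norm ((s - a i) powr (- w)) \<le> B * norm (s0 - a i) powr (- c)" by auto
    have "(\<lambda>i. B * norm (s0 - a i) powr (- c)) summable_on I" by (rule summable_on_cmult_right[OF summ[OF cB(1)]])
    moreover have "norm ((\<lambda>(w, s). (s - a i) powr (- w)) p) \<le> B * norm (s0 - a i) powr (- c)" if "i \<in> I" "p \<in> K" for i p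
      using cB(2) that by auto
    ultimately have "uniform_limit K (\<lambda>X p. \<Sum>i\<in>X. (\<lambda>(w, s). (s - a i) powr (- w)) p)
        (\<lambda>p. \<Sum>\<^sub>\<infinity>i\<in>I. (\<lambda>(w, s). (s - a i) powr (- w)) p) (finite_subsets_at_top I)"
      by (intro Weierstrass_m_test_general[of I K "\<lambda>i. (\<lambda>(w, s). (s - a i) powr (- w))"])
    thus ?thesis by (simp add: reg_zeta_def case_prod_unfold)
  qed simp
  show "reg_zeta_converges I a (\<lambda>_. 1) C {s. Re s > \<sigma>}"
    unfolding reg_zeta_converges_def using abs ul by simp
  show "(\<lambda>w. reg_zeta I a (\<lambda>_. 1) w s) holomorphic_on {w. Re w > C}" if s: "Re s > \<sigma>" for s
  proof (rule holomorphic_on_open[THEN iffD2, OF open_Re_gt], intro ballI)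
    fix w0 assume "w0 \<in> {w. Re w > C}"
    then obtain r where r: "r > 0" "cball w0 r \<subseteq> {w. Re w > C}" using open_Re_gt open_contains_cball by blast
    have "compact (cball w0 r \<times> {s})" "cball w0 r \<times> {s} \<subseteq> {w. Re w > C} \<times> {s. Re s > \<sigma>}"
      using r s by (auto intro: compact_Times)
    from ul[OF this]
    have u: "uniform_limit (cball w0 r) (\<lambda>X w. \<Sum>i\<in>X. (s - a i) powr (- w)) (\<lambda>w. reg_zeta I a (\<lambda>_. 1) w s) (finite_subsets_at_top I)"
      unfolding uniform_limit_iff by simp
    have "\<forall>\<^sub>F X in finite_subsets_at_top I. finite X \<and> X \<subseteq> I" by (rule eventually_finite_subsets_at_top_weakI) auto
    hence "\<forall>\<^sub>F X in finite_subsets_at_top I. continuous_on (cball w0 r) (\<lambda>w. \<Sum>i\<in>X. (s - a i) powr (- w)) \<and>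
        (\<lambda>w. \<Sum>i\<in>X. (s - a i) powr (- w)) holomorphic_on ball w0 r"
    proof eventually_elim
      case (elim X)
      have h: "(\<lambda>w. \<Sum>i\<in>X. (s - a i) powr (- w)) holomorphic_on A" for A
        by (intro holomorphic_intros)
      show ?case using h holomorphic_on_imp_continuous_on by blast
    qed
    from holomorphic_uniform_limit[OF this u finite_subsets_at_top_neq_bot]
    have "(\<lambda>w. reg_zeta I a (\<lambda>_. 1) w s) holomorphic_on ball w0 r" by blast
    thus "\<exists>f'. ((\<lambda>w. reg_zeta I a (\<lambda>_. 1) w s) has_field_derivative f') (at w0)"
      using r(1) holomorphic_on_open[OF open_ball] by auto
  qed
qed

section \<open>The factor of the trivial zeros\<close>

context primitive_char
begin

text \<open>Up to a constant this is 2^(-s/2) / Gamma ((s + delta) / 2). The elementary factor in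
  front is dictated by the derivative at w = 0 of 2^(-w) \<zeta>(w, (s + delta) / 2).\<close>

definition trivial_prod :: "complex \<Rightarrow> complex" where
  "trivial_prod s = exp (of_real (ln 2) * (1 / 2 - (s + of_nat delta) / 2) - 1 / 2) * hurwitz_const * rGamma ((s + of_nat delta) / 2)"

lemma trivial_prod_holomorphic: "trivial_prod holomorphic_on A"
  unfolding trivial_prod_def by (intro holomorphic_intros) auto

lemma trivial_prod_eq_0_iff: "trivial_prod s = 0 \<longleftrightarrow> (\<exists>n::nat. s = - (2 * of_nat n + of_nat delta))"
proof -
  have "trivial_prod s = 0 \<longleftrightarrow> (s + of_nat delta) / 2 \<in> \<int>\<^sub>\<le>\<^sub>0"
    by (simp add: trivial_prod_def hurwitz_const_def rGamma_eq_zero_iff)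
  also have "\<dots> \<longleftrightarrow> (\<exists>n::nat. (s + of_nat delta) / 2 = - of_nat n)" by (auto elim!: nonpos_Ints_cases')
  also have "\<dots> \<longleftrightarrow> (\<exists>n::nat. s = - (2 * of_nat n + of_nat delta))"
    by (intro ex_cong1) (auto simp: field_simps eq_neg_iff_add_eq_0 add_ac)
  finally show ?thesis .
qed

lemma trivial_zero_shift: "s - - (2 * of_nat (Suc m) - (3 + chi (- 1)) / 2) = 2 * ((s + of_nat delta) / 2 + of_nat m)"
  using chi_minus_1_cases by (auto simp: delta_def field_simps)

lemma trivial_reg_zeta:
  assumes "Re s > 0"
  shows "Re w > 1 \<Longrightarrow> ((\<lambda>n. (s - - (2 * of_nat n - (3 + chi (- 1)) / 2)) powr (- w)) has_sum
    2 powr (- w) * (hurwitz_K w ((s + of_nat delta) / 2) / (w - 1))) {1::nat..}"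
proof -
  assume w: "Re w > 1"
  define x where "x = (s + of_nat delta) / 2"
  have x: "Re x > 0" using assms by (simp add: x_def)
  have "((\<lambda>n. (x + of_nat n) powr (- w)) has_sum (hurwitz_K w x / (w - 1))) UNIV"
    by (rule norm_summable_imp_has_sum[OF hurwitz_norm_summable[OF x w] hurwitz_sums[OF x w]])
  have double: "(2 * z) powr u = 2 powr u * z powr u" for z u :: complex
    using powr_mult_of_real_left[of 2 z u] by simp
  from \<open>((\<lambda>n. (x + of_nat n) powr (- w)) has_sum (hurwitz_K w x / (w - 1))) UNIV\<close>
  have "((\<lambda>n. 2 powr (- w) * (x + of_nat n) powr (- w)) has_sum 2 powr (- w) * (hurwitz_K w x / (w - 1))) UNIV"
    by (rule has_sum_cmult_right)
  hence "((\<lambda>n. (2 * (x + of_nat n)) powr (- w)) has_sum 2 powr (- w) * (hurwitz_K w x / (w - 1))) UNIV"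
    by (simp only: double)
  hence "(((\<lambda>n. (s - - (2 * of_nat n - (3 + chi (- 1)) / 2)) powr (- w)) \<circ> Suc) has_sum 2 powr (- w) * (hurwitz_K w x / (w - 1))) UNIV"
    unfolding o_def trivial_zero_shift x_def .
  hence "((\<lambda>n. (s - - (2 * of_nat n - (3 + chi (- 1)) / 2)) powr (- w)) has_sum 2 powr (- w) * (hurwitz_K w x / (w - 1))) (Suc ` UNIV)"
    by (subst has_sum_reindex) auto
  moreover have "Suc ` UNIV = {1..}" by (auto simp: image_iff Suc_le_eq gr0_conv_Suc)
  ultimately show ?thesis by (simp add: x_def)
qed

lemma trivial_continuation_holomorphic:
  assumes "Re s > 0"
  shows "(\<lambda>w. 2 powr (- w) * (hurwitz_K w ((s + of_nat delta) / 2) / (w - 1))) holomorphic_on {w. Re w > - 1} - {1}"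
  by (intro holomorphic_intros holomorphic_on_subset[OF hurwitz_K_holomorphic]) (use assms in auto)

lemma trivial_continuation_meromorphic:
  assumes "Re s > 0"
  shows "(\<lambda>w. 2 powr (- w) * (hurwitz_K w ((s + of_nat delta) / 2) / (w - 1))) meromorphic_on {w. Re w > - 1}"
proof -
  have "(\<lambda>w. hurwitz_K w ((s + of_nat delta) / 2)) analytic_on {w. Re w > - 1}"
    using assms by (subst analytic_on_open[OF open_Re_gt]) (auto intro!: hurwitz_K_holomorphic)
  moreover have "(\<lambda>w::complex. 2 powr (- w)) analytic_on {w. Re w > - 1}" by (auto intro!: analytic_intros)
  ultimately show ?thesis by (intro meromorphic_intros analytic_on_imp_meromorphic_on) (auto intro!: analytic_intros)
qed

text \<open>On Re s > 0 each s - a n is twice a shifted Hurwitz parameter, and the positive factor 2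
  leaves the principal branch intact. The continuation has its pole at w = 1, away from the point 0
  where the residue is taken.\<close>

lemma trivial_has_reg_prod: "has_reg_prod {1::nat..} (\<lambda>n. - (2 * of_nat n - (3 + chi (- 1)) / 2)) (\<lambda>_. 1) trivial_prod"
proof -
  define a where "a = (\<lambda>n::nat. - (2 * of_nat n - (3 + chi (- 1)) / 2))"
  have an: "a (Suc m) = - (2 * of_nat m + of_nat delta)" for m
    using chi_minus_1_cases by (auto simp: a_def delta_def field_simps)
  have Re_a: "Re (a n) \<le> 0" if "n \<in> {1..}" for n
    using an[of "n - 1"] that by simp
  have img: "{1..} = Suc ` UNIV" by (auto simp: image_iff Suc_le_eq gr0_conv_Suc)
  have summ: "(\<lambda>n. norm (1 - a n) powr (- c)) summable_on {1..}" if c: "c > 1" for c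
  proof -
    have eq: "norm (1 - a (Suc m)) = 1 + (2 * real m + real delta)" for m
    proof -
      have "1 - a (Suc m) = of_real (1 + (2 * real m + real delta))" by (simp add: an)
      hence "norm (1 - a (Suc m)) = \<bar>1 + (2 * real m + real delta)\<bar>" by (simp only: norm_of_real)
      thus ?thesis by simp
    qed
    have "summable (\<lambda>m. (1 + real m) powr (- c))" using summable_shifted_powr[of 1 "- c"] c by simp
    hence "(\<lambda>m. (1 + real m) powr (- c)) summable_on UNIV" by (subst summable_on_UNIV_nonneg_real_iff) simp_all
    hence "(\<lambda>m. norm (1 - a (Suc m)) powr (- c)) summable_on UNIV"
    proof (rule summable_on_comparison_test)
      show "norm (1 - a (Suc m)) powr (- c) \<le> (1 + real m) powr (- c)" for m
        unfolding eq using c by (intro powr_mono2') auto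
    qed auto
    thus ?thesis unfolding img by (subst summable_on_reindex) (auto simp: o_def)
  qed
  have conv: "reg_zeta_converges {1..} a (\<lambda>_. 1) 1 {s. Re s > 0}"
    by (rule reg_zeta_converges_half_plane[where ?s0.0 = 1]) (use Re_a summ in auto)
  have prod: "\<exists>Z. reg_zeta_continuation {1..} a (\<lambda>_. 1) 1 s Z \<and> trivial_prod s = exp (- residue (\<lambda>w. Z w / w\<^sup>2) 0)" if s: "Re s > 0" for s
  proof -
    define Z where "Z = (\<lambda>w. 2 powr (- w) * (hurwitz_K w ((s + of_nat delta) / 2) / (w - 1)))"
    have "Z w = reg_zeta {1..} a (\<lambda>_. 1) w s" if "Re w > 1" for w
      using infsumI[OF trivial_reg_zeta[OF s that]] by (simp add: reg_zeta_def a_def Z_def)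
    moreover have "Z meromorphic_on {w. Re w > - 1}" unfolding Z_def by (rule trivial_continuation_meromorphic[OF s])
    ultimately have "reg_zeta_continuation {1..} a (\<lambda>_. 1) 1 s Z"
      unfolding reg_zeta_continuation_def using zero_less_one by blast
    moreover have "residue (\<lambda>w. Z w / w\<^sup>2) 0 = deriv Z 0"
      using trivial_continuation_holomorphic[OF s] unfolding Z_def
      by (intro residue_div_square[of "{w. Re w > - 1} - {1}"]) (auto intro: open_delete open_Re_gt)
    moreover have "exp (- deriv Z 0) = trivial_prod s"
      unfolding Z_def trivial_prod_def using s by (intro exp_deriv_scaled_hurwitz) simp
    ultimately show ?thesis by auto
  qed
  have "trivial_prod analytic_on UNIV"
    by (subst analytic_on_open) (auto intro: trivial_prod_holomorphic)
  hence "trivial_prod nicely_meromorphic_on UNIV" by (rule analytic_on_imp_nicely_meromorphic_on)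
  moreover have "connected {s. Re s > 0}" by (intro convex_connected convex_halfspace_Re_gt)
  moreover have "{s. Re s > 0} \<inter> a ` {1..} = {}" using Re_a by force
  moreover have "{s. Re s > 0} \<noteq> {}" by (auto intro!: exI[of _ 1])
  ultimately have "has_reg_prod {1..} a (\<lambda>_. 1) trivial_prod"
    unfolding has_reg_prod_def using conv prod open_Re_gt[of 0]
    by (intro conjI exI[of _ "{s. Re s > 0}"] exI[of _ 1]) auto
  thus ?thesis by (simp only: a_def)
qed

interpretation c: primitive_char N "\<lambda>a. cnj (chi a)" by (rule cnj_primitive)

section \<open>The zeros of the L-function\<close>

lemma L_ext_analytic: "L_ext analytic_on A"
  by (rule analytic_on_subset[of _ UNIV]) (simp_all add: analytic_on_open L_ext_holomorphic)

text \<open>Only uniqueness needs an argument: agreement on Re s > 1 propagates to all points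
  outside a sparse set, and being nicely meromorphic fixes the remaining values.\<close>

lemma dirichlet_L_eq: "dirichlet_L chi = L_ext"
  unfolding dirichlet_L_def
proof (rule the_equality)
  have sums: "(\<lambda>n. chi (int (Suc n)) / of_nat (Suc n) powr s) sums L_ext s" if "Re s > 1" for s
  proof -
    have "L_term s = (\<lambda>n. chi (int (Suc n)) / of_nat (Suc n) powr s)" by (rule ext) (rule L_term_def)
    thus ?thesis using L0_sums[OF that] that L_ext_eq_L0[of s] by simp
  qed
  show "L_ext nicely_meromorphic_on UNIV \<and> (\<forall>s. Re s > 1 \<longrightarrow> (\<lambda>n. chi (int (Suc n)) / of_nat (Suc n) powr s) sums L_ext s)"
    using sums analytic_on_imp_nicely_meromorphic_on[OF L_ext_analytic] by blast
  fix f assume f: "f nicely_meromorphic_on UNIV \<and> (\<forall>s. Re s > 1 \<longrightarrow> (\<lambda>n. chi (int (Suc n)) / of_nat (Suc n) powr s) sums f s)"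
  have eq: "f s = L_ext s" if "Re s > 1" for s using f sums that sums_unique2 by blast
  have "f meromorphic_on UNIV" using f by (simp add: nicely_meromorphic_on_def)
  moreover have "L_ext meromorphic_on UNIV" by (intro analytic_on_imp_meromorphic_on L_ext_analytic)
  ultimately have mero: "(\<lambda>s. f s - L_ext s) meromorphic_on UNIV" by (intro meromorphic_intros)
  \<comment> \<open>A meromorphic function on a connected set either is 0 or avoids 0 outside a
    sparse set; vanishing near 2 excludes the second case.\<close>
  have ev: "\<forall>\<^sub>F s in cosparse UNIV. f s - L_ext s = 0"
  proof (rule ccontr)
    assume "\<not> (\<forall>\<^sub>F s in cosparse UNIV. f s - L_ext s = 0)"
    hence "\<forall>\<^sub>F s in cosparse UNIV. f s - L_ext s \<noteq> 0"
      using meromorphic_imp_constant_or_avoid[OF mero open_UNIV connected_UNIV, of 0] by blast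
    hence "\<forall>\<^sub>F s in at 2. f s - L_ext s \<noteq> 0" by (simp only: eventually_cosparse_open_eq[OF open_UNIV] ball_UNIV)
    moreover have "\<forall>\<^sub>F s in at 2. s \<in> {s. Re s > 1}" by (rule eventually_at_in_open'[OF open_Re_gt]) simp
    ultimately have "\<forall>\<^sub>F s in at (2 :: complex). False" by eventually_elim (use eq in auto)
    thus False by simp
  qed
  show "f = L_ext"
  proof
    fix z
    have ev_z: "\<forall>\<^sub>F s in at z. f s - L_ext s = 0" using ev by (simp only: eventually_cosparse_open_eq[OF open_UNIV] ball_UNIV)
    hence ev_z: "\<forall>\<^sub>F s in at z. L_ext s = f s" by eventually_elim simp
    have "L_ext \<midarrow>z\<rightarrow> L_ext z" using analytic_at_imp_isCont[OF L_ext_analytic] by (simp add: isContD)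
    hence lim: "f \<midarrow>z\<rightarrow> L_ext z" using ev_z by (rule Lim_transform_eventually)
    \<comment> \<open>The entire function gives f a finite limit at z, which rules out a pole and
      leaves continuity of f as the only alternative.\<close>
    have "is_pole f z \<and> f z = 0 \<or> f \<midarrow>z\<rightarrow> f z" using f by (auto simp: nicely_meromorphic_on_def)
    thus "f z = L_ext z"
    proof
      assume "is_pole f z \<and> f z = 0"
      hence False using not_tendsto_and_filterlim_at_infinity[OF at_neq_bot lim] by (auto simp: is_pole_def)
      thus ?thesis ..
    next
      assume "f \<midarrow>z\<rightarrow> f z"
      thus ?thesis using tendsto_unique[OF at_neq_bot] lim by blast
    qed
  qed
qed

lemma L_order_eq: "L_order chi s = nat (zorder L_ext s)"
  by (simp add: L_order_def dirichlet_L_eq)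

lemma zorder_L_ext: "(if L_ext z = 0 then zorder L_ext z > 0 else zorder L_ext z = 0) \<and>
    (\<exists>r. r > 0 \<and> cball z r \<subseteq> UNIV \<and> zor_poly L_ext z holomorphic_on cball z r \<and>
      (\<forall>w\<in>cball z r. L_ext w = zor_poly L_ext z w * (w - z) ^ nat (zorder L_ext z) \<and> zor_poly L_ext z w \<noteq> 0))"
  using L_ext_nonzero_right[of 1] by (intro zorder_exist_zero L_ext_holomorphic) auto

lemma zorder_L_ext_pos_iff: "nat (zorder L_ext z) > 0 \<longleftrightarrow> L_ext z = 0"
  using zorder_L_ext[of z] by (auto split: if_splits)

lemma zorder_L_ext_nonneg: "zorder L_ext z \<ge> 0"
  using zorder_L_ext[of z] by (auto split: if_splits)

lemma zorder_trivial_zero: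
  assumes "Im s = 0" "Re s \<le> 0" "L_ext s = 0" shows "zorder L_ext s = 1"
proof (rule zorder_zero_eqI'[OF L_ext_analytic])
  show "(deriv ^^ i) L_ext s = 0" if "i < nat 1" for i using that assms by simp
  show "(deriv ^^ nat 1) L_ext s \<noteq> 0" using L_ext_trivial_zero_deriv[OF assms] by simp
qed simp

text \<open>The functional equation relates chi at x to the conjugate character at 1 - x, and
  complex conjugation returns to chi because x is real. The other factors do not vanish, as the
  zeros of the trigonometric factor are integers.\<close>

lemma zorder_L_ext_reflect:
  assumes x: "0 < x" "x < 1"
  shows "zorder L_ext (of_real x) = zorder L_ext (of_real (1 - x))"
proof -
  define z where "z = complex_of_real (1 - x)"
  define n where "n = nat (zorder L_ext z)"
  define g where "g = zor_poly L_ext z"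
  obtain r where r: "r > 0" "g holomorphic_on cball z r" "\<And>w. w \<in> cball z r \<Longrightarrow> L_ext w = g w * (w - z) ^ n \<and> g w \<noteq> 0"
    using zorder_L_ext[of z] unfolding n_def g_def by blast
  define S where "S = ball (complex_of_real x) r \<inter> {s. Re s < 1}"
  \<comment> \<open>The cofactor at x: the local cofactor at 1 - x, conjugated and reflected, times
    the factors of the functional equation. The sign (-1)^n comes from (1 - w) - (1 - x) = -(w -
    x).\<close>
  define G where "G = (\<lambda>s. fe_rest s * fe_trig s * (cnj \<circ> g \<circ> cnj) (1 - s) * (-1) ^ n)"
  have refl: "cnj (1 - w) \<in> cball z r" if "w \<in> ball (complex_of_real x) r" for w
  proof -
    have "z - cnj (1 - w) = cnj (w - complex_of_real x)" by (simp add: z_def)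
    hence "norm (z - cnj (1 - w)) = norm (w - complex_of_real x)" by (simp only: complex_mod_cnj)
    thus ?thesis using that by (simp add: dist_norm norm_minus_commute)
  qed
  have "zorder L_ext (of_real x) = int n"
  proof (rule zorder_eqI)
    show "open S" by (auto simp: S_def open_halfspace_Re_lt)
    show "complex_of_real x \<in> S" using x r(1) by (simp add: S_def)
    have "cnj \<circ> g \<circ> cnj holomorphic_on ball z r"
    proof (rule holomorphic_on_compose_cnj_cnj[OF holomorphic_on_subset[OF r(2)] open_ball])
      show "cnj ` ball z r \<subseteq> cball z r"
      proof
        fix u assume "u \<in> cnj ` ball z r"
        then obtain w where w: "w \<in> ball z r" "u = cnj w" by blast
        have "z - cnj w = cnj (z - w)" by (simp add: z_def)
        hence "norm (z - u) = norm (z - w)" using w(2) by (simp only: complex_mod_cnj)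
        thus "u \<in> cball z r" using w(1) by (simp add: dist_norm)
      qed
    qed
    moreover have "(\<lambda>s. 1 - s) ` S \<subseteq> ball z r"
      by (auto simp: S_def z_def dist_norm norm_minus_commute)
    ultimately have "((cnj \<circ> g \<circ> cnj) \<circ> (\<lambda>s. 1 - s)) holomorphic_on S"
      by (intro holomorphic_on_compose_gen[of "\<lambda>s. 1 - s"] holomorphic_intros)
    thus "G holomorphic_on S"
      unfolding G_def o_def
      by (intro holomorphic_intros fe_trig_holomorphic holomorphic_on_subset[OF fe_rest_holomorphic]) (auto simp: S_def)
    have "fe_trig (of_real x) \<noteq> 0"
    proof
      assume "fe_trig (of_real x) = 0"
      then obtain k :: int where "complex_of_real x = 2 * of_int k - of_nat delta" unfolding fe_trig_eq_0_iff by blast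
      hence "complex_of_real x = of_real (of_int (2 * k - int delta))" by simp
      hence "x = of_int (2 * k - int delta)" by (simp only: of_real_eq_iff)
      with x have "0 < 2 * k - int delta" "2 * k - int delta < 1" by (simp_all only: of_int_0_less_iff of_int_less_1_iff)
      thus False by linarith
    qed
    moreover have "g (cnj (1 - of_real x)) \<noteq> 0" using r(3)[OF refl[of "of_real x"]] r(1) by simp
    ultimately show "G (of_real x) \<noteq> 0"
      using fe_rest_nonzero[of "of_real x"] x by (simp add: G_def)
    fix w assume w: "w \<in> S"
    have "L_ext w = fe_rest w * fe_trig w * cnj (L_ext (cnj (1 - w)))"
      using functional_equation[of w] c_L0_eq[of "1 - w"] w by (simp add: S_def)
    also have "L_ext (cnj (1 - w)) = g (cnj (1 - w)) * (cnj (1 - w) - z) ^ n" using r(3)[OF refl] w by (simp add: S_def)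
    also have "cnj (1 - w) - z = cnj ((- 1) * (w - of_real x))" by (simp add: z_def)
    finally show "L_ext w = G w * (w - of_real x) powi int n"
      by (simp add: G_def power_mult_distrib[symmetric] del: mult_minus1 minus_diff_eq)
  qed
  thus ?thesis using zorder_L_ext_nonneg[of z] by (simp add: n_def z_def)
qed

section \<open>Real zeros and the index set of all zeros\<close>

lemma real_zero_pair_iff: "real_zero_pair chi t \<longleftrightarrow> 0 < t \<and> t < 1 / 2 \<and>
    L_ext (of_real (1 / 2 + t)) = 0 \<and> L_ext (of_real (1 / 2 - t)) = 0"
  by (simp add: real_zero_pair_def dirichlet_L_eq)

lemma L_ext_reflect_zero:
  assumes "0 < x" "x < 1" shows "L_ext (of_real (1 - x)) = 0 \<longleftrightarrow> L_ext (of_real x) = 0"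
  unfolding zorder_L_ext_pos_iff[symmetric] zorder_L_ext_reflect[OF assms] ..

lemma real_zero_pairI:
  assumes x: "0 < x" "x < 1" "x \<noteq> 1 / 2" "L_ext (of_real x) = 0"
  shows "real_zero_pair chi \<bar>x - 1 / 2\<bar>"
proof (cases "x > 1 / 2")
  case True
  have "1 / 2 + \<bar>x - 1 / 2\<bar> = x" "1 / 2 - \<bar>x - 1 / 2\<bar> = 1 - x" using True by auto
  thus ?thesis unfolding real_zero_pair_iff using x True L_ext_reflect_zero[OF x(1,2)] by simp
next
  case False
  have "1 / 2 + \<bar>x - 1 / 2\<bar> = 1 - x" "1 / 2 - \<bar>x - 1 / 2\<bar> = x" using False by auto
  thus ?thesis unfolding real_zero_pair_iff using x False L_ext_reflect_zero[OF x(1,2)] by simp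
qed

lemma real_zero_pair_tau0: "real_zero_pair chi t \<Longrightarrow> real_zero_pair chi (tau0 chi)"
  unfolding tau0_def using someI[of "real_zero_pair chi" t] by auto

lemma tau0_bounds: "0 < tau0 chi" "tau0 chi < 1 / 2"
proof -
  have "0 < tau0 chi \<and> tau0 chi < 1 / 2"
  proof (cases "\<exists>t. real_zero_pair chi t")
    case True
    hence "real_zero_pair chi (tau0 chi)" using real_zero_pair_tau0 by blast
    thus ?thesis by (simp only: real_zero_pair_def)
  qed (simp add: tau0_def)
  thus "0 < tau0 chi" "tau0 chi < 1 / 2" by blast+
qed

text \<open>This holds for the default value as well: without a real pair, tau0 = 1/4 and L vanishes
  neither at 3/4 nor at 1/4, so the order there is 0. Later arguments need no distinction of
  cases.\<close>

lemma mu_tau0_eq: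
  "mu_tau0 chi = nat (zorder L_ext (of_real (1 / 2 + tau0 chi)))"
  "mu_tau0 chi = nat (zorder L_ext (of_real (1 / 2 - tau0 chi)))"
proof -
  define t where "t = tau0 chi"
  have t: "0 < t" "t < 1 / 2" using tau0_bounds by (simp_all add: t_def)
  show 1: "mu_tau0 chi = nat (zorder L_ext (of_real (1 / 2 + tau0 chi)))"
  proof (cases "\<exists>t. real_zero_pair chi t")
    case True
    thus ?thesis by (simp add: mu_tau0_def L_order_eq)
  next
    case False
    have "L_ext (of_real (1 / 2 + t)) \<noteq> 0"
      using real_zero_pairI[of "1 / 2 + t"] t False by auto
    thus ?thesis using False zorder_L_ext_pos_iff[of "of_real (1 / 2 + t)"] by (simp add: mu_tau0_def t_def)
  qed
  have "1 - (1 / 2 + t) = 1 / 2 - t" by simp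
  hence "zorder L_ext (of_real (1 / 2 + t)) = zorder L_ext (of_real (1 / 2 - t))"
    using zorder_L_ext_reflect[of "1 / 2 + t"] t by (simp only:)
  thus "mu_tau0 chi = nat (zorder L_ext (of_real (1 / 2 - tau0 chi)))" using 1 by (simp only: t_def)
qed

lemma real_zero_in_strip:
  assumes uniq: "\<And>t t'. real_zero_pair chi t \<Longrightarrow> real_zero_pair chi t' \<Longrightarrow> t = t'"
    and x: "0 < x" "x < 1" "L_ext (of_real x) = 0"
  shows "x = 1 / 2 \<or> x = 1 / 2 + tau0 chi \<or> x = 1 / 2 - tau0 chi"
proof (rule ccontr)
  assume not: "\<not> ?thesis"
  have pair: "real_zero_pair chi \<bar>x - 1 / 2\<bar>" using x not by (intro real_zero_pairI) auto
  hence "real_zero_pair chi (tau0 chi)" by (rule real_zero_pair_tau0)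
  hence "\<bar>x - 1 / 2\<bar> = tau0 chi" by (rule uniq[OF pair])
  thus False using not by linarith
qed

lemma nonreal_L_zeros_eq: "nonreal_L_zeros chi = {i \<in> zero_index L_ext. Im (fst i) \<noteq> 0}"
  by (auto simp: nonreal_L_zeros_def zero_index_def dirichlet_L_eq L_order_eq)

text \<open>The zeros are simple, so the multiplicity index is always 0. The index n >= 1 of the
  product belongs to the zero -(2 (n - 1) + delta).\<close>

lemma trivial_zero_index:
  "(\<lambda>n. (- (2 * of_nat n - (3 + chi (- 1)) / 2), 0)) ` {1::nat..} = {i \<in> zero_index L_ext. Im (fst i) = 0 \<and> Re (fst i) \<le> 0}"
  (is "?f ` _ = ?Z")
proof -
  have f: "?f (Suc m) = (- (2 * of_nat m + of_nat delta), 0)" for m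
    using chi_minus_1_cases by (auto simp: delta_def field_simps)
  have "{1::nat..} = Suc ` UNIV" by (auto simp: image_iff Suc_le_eq gr0_conv_Suc)
  hence "?f ` {1..} = range (\<lambda>m::nat. (- (2 * of_nat m + of_nat delta) :: complex, 0 :: nat))"
    unfolding image_image by (simp only: image_image f)
  also have "\<dots> = ?Z"
  proof (intro equalityI subsetI)
    fix i assume "i \<in> range (\<lambda>m::nat. (- (2 * of_nat m + of_nat delta) :: complex, 0 :: nat))"
    then obtain m :: nat where i: "i = (- (2 * of_nat m + of_nat delta), 0)" by blast
    have *: "Im (fst i) = 0" "Re (fst i) \<le> 0" by (simp_all add: i)
    have "\<exists>n::nat. fst i = - (2 * of_nat n + of_nat delta)" by (rule exI[of _ m]) (simp add: i)
    hence "L_ext (fst i) = 0" by (simp only: L_ext_real_left_zero_iff[OF *])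
    thus "i \<in> ?Z" using * zorder_L_ext_pos_iff[of "fst i"] by (auto simp: zero_index_def i)
  next
    fix i assume i: "i \<in> ?Z"
    obtain \<rho> k where ik: "i = (\<rho>, k)" by (cases i)
    have \<rho>: "Im \<rho> = 0" "Re \<rho> \<le> 0" "L_ext \<rho> = 0" "k < nat (zorder L_ext \<rho>)" using i by (auto simp: ik zero_index_def)
    have "k = 0" using \<rho>(4) zorder_trivial_zero[OF \<rho>(1-3)] by simp
    moreover obtain m :: nat where "\<rho> = - (2 * of_nat m + of_nat delta)" using L_ext_real_left_zero_iff[OF \<rho>(1,2)] \<rho>(3) by blast
    ultimately show "i \<in> range (\<lambda>m::nat. (- (2 * of_nat m + of_nat delta) :: complex, 0 :: nat))" by (simp add: ik)
  qed
  finally show ?thesis .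
qed

lemma strip_zero_index:
  assumes uniq: "\<And>t t'. real_zero_pair chi t \<Longrightarrow> real_zero_pair chi t' \<Longrightarrow> t = t'"
  shows "{i \<in> zero_index L_ext. Im (fst i) = 0 \<and> Re (fst i) > 0} =
    (SIGMA \<rho>:{of_real (1 / 2), of_real (1 / 2 + tau0 chi), of_real (1 / 2 - tau0 chi)}. {..<nat (zorder L_ext \<rho>)})"
    (is "?Z = Sigma ?E _")
proof (intro equalityI subsetI)
  fix i assume i: "i \<in> ?Z"
  obtain \<rho> k where ik: "i = (\<rho>, k)" by (cases i)
  have \<rho>: "Im \<rho> = 0" "Re \<rho> > 0" "L_ext \<rho> = 0" "k < nat (zorder L_ext \<rho>)" using i by (auto simp: ik zero_index_def)
  have eq: "\<rho> = of_real (Re \<rho>)" using \<rho>(1) by (simp add: complex_eq_iff)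
  have "Re \<rho> < 1" using L_ext_nonzero_right[OF \<rho>(1)] \<rho>(3) by fastforce
  hence "Re \<rho> = 1 / 2 \<or> Re \<rho> = 1 / 2 + tau0 chi \<or> Re \<rho> = 1 / 2 - tau0 chi"
    using real_zero_in_strip[OF uniq \<rho>(2)] \<rho>(3) eq by simp
  hence "\<rho> \<in> ?E" using eq by (metis insertCI)
  thus "i \<in> Sigma ?E (\<lambda>\<rho>. {..<nat (zorder L_ext \<rho>)})" using \<rho>(4) by (simp add: ik)
next
  fix i assume i: "i \<in> Sigma ?E (\<lambda>\<rho>. {..<nat (zorder L_ext \<rho>)})"
  obtain \<rho> k where "i = (\<rho>, k)" by (cases i)
  hence ik: "i = (\<rho>, k)" "\<rho> \<in> ?E" "k < nat (zorder L_ext \<rho>)"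
    using i by (simp_all only: mem_Sigma_iff lessThan_iff)
  have "L_ext \<rho> = 0" using le_less_trans[OF le0 ik(3)] by (simp only: zorder_L_ext_pos_iff)
  moreover have "Im \<rho> = 0 \<and> (Re \<rho> = 1 / 2 \<or> Re \<rho> = 1 / 2 + tau0 chi \<or> Re \<rho> = 1 / 2 - tau0 chi)"
    using ik(2) by (elim insertE emptyE) (simp_all only: Re_complex_of_real Im_complex_of_real simp_thms)
  hence "Im \<rho> = 0" "Re \<rho> > 0" using tau0_bounds by auto
  ultimately show "i \<in> ?Z" using ik by (simp add: zero_index_def)
qed

section \<open>Splitting off the real zeros and the final factorization\<close>

definition strip_prod :: "complex \<Rightarrow> complex" where
  "strip_prod s = (s - 1 / 2 - of_real (tau0 chi)) ^ mu_tau0 chi * (s - 1 / 2 + of_real (tau0 chi)) ^ mu_tau0 chi *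
     (s - 1 / 2) ^ L_order chi (1 / 2)"

definition strip_zeta :: "complex \<Rightarrow> complex \<Rightarrow> complex" where
  "strip_zeta s w = of_nat (mu_tau0 chi) * (s - 1 / 2 - of_real (tau0 chi)) powr (- w) +
     of_nat (mu_tau0 chi) * (s - 1 / 2 + of_real (tau0 chi)) powr (- w) +
     of_nat (L_order chi (1 / 2)) * (s - 1 / 2) powr (- w)"

lemma strip_zeta_has_sum:
  assumes uniq: "\<And>t t'. real_zero_pair chi t \<Longrightarrow> real_zero_pair chi t' \<Longrightarrow> t = t'"
  shows "((\<lambda>i. (s - fst i) powr (- w)) has_sum strip_zeta s w) {i \<in> zero_index L_ext. Im (fst i) = 0 \<and> Re (fst i) > 0}"
proof -
  define m where "m = (\<lambda>\<rho>. nat (zorder L_ext \<rho>))"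
  define r where "r = (\<lambda>x. complex_of_real x)"
  define E where "E = {r (1 / 2), r (1 / 2 + tau0 chi), r (1 / 2 - tau0 chi)}"
  define F where "F = Sigma E (\<lambda>\<rho>. {..<m \<rho>})"
  have fin: "finite F" by (simp add: F_def E_def)
  have dist: "r (1 / 2) \<noteq> r (1 / 2 + tau0 chi)" "r (1 / 2) \<noteq> r (1 / 2 - tau0 chi)" "r (1 / 2 + tau0 chi) \<noteq> r (1 / 2 - tau0 chi)"
    unfolding r_def of_real_eq_iff using tau0_bounds by auto
  have "(\<Sum>i\<in>F. (s - fst i) powr (- w)) = (\<Sum>\<rho>\<in>E. \<Sum>k<m \<rho>. (s - \<rho>) powr (- w))"
    unfolding F_def by (subst sum.Sigma) (auto simp: E_def case_prod_unfold)
  also have "\<dots> = (\<Sum>\<rho>\<in>E. of_nat (m \<rho>) * (s - \<rho>) powr (- w))" by simp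
  also have "\<dots> = of_nat (m (r (1 / 2))) * (s - r (1 / 2)) powr (- w) +
     (of_nat (m (r (1 / 2 + tau0 chi))) * (s - r (1 / 2 + tau0 chi)) powr (- w) +
      of_nat (m (r (1 / 2 - tau0 chi))) * (s - r (1 / 2 - tau0 chi)) powr (- w))"
    unfolding E_def using dist by simp
  also have "m (r (1 / 2)) = L_order chi (1 / 2)" by (simp add: m_def r_def L_order_eq)
  also have "m (r (1 / 2 + tau0 chi)) = mu_tau0 chi" unfolding m_def r_def mu_tau0_eq(1) ..
  also have "m (r (1 / 2 - tau0 chi)) = mu_tau0 chi" unfolding m_def r_def mu_tau0_eq(2) ..
  also have "s - r (1 / 2) = s - 1 / 2" by (simp add: r_def)
  also have "s - r (1 / 2 + tau0 chi) = s - 1 / 2 - of_real (tau0 chi)" by (simp add: r_def)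
  also have "s - r (1 / 2 - tau0 chi) = s - 1 / 2 + of_real (tau0 chi)" by (simp add: r_def)
  finally have "(\<Sum>i\<in>F. (s - fst i) powr (- w)) = strip_zeta s w" by (simp add: strip_zeta_def add_ac)
  moreover have "((\<lambda>i. (s - fst i) powr (- w)) has_sum (\<Sum>i\<in>F. (s - fst i) powr (- w))) F" by (rule has_sum_finite[OF fin])
  moreover have "{i \<in> zero_index L_ext. Im (fst i) = 0 \<and> Re (fst i) > 0} = F"
    unfolding F_def E_def r_def m_def by (rule strip_zero_index, rule uniq)
  ultimately show ?thesis by simp
qed

text \<open>For finitely many zeros the regularized product is the ordinary one, since -d/dw z^(-w)
  at w = 0 is Ln z. The condition Re s > 1 keeps s apart from the zeros in the strip.\<close>

lemma strip_zeta_deriv: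
  assumes "Re s > 1"
  shows "(\<lambda>w. strip_zeta s w) holomorphic_on A" "exp (- deriv (strip_zeta s) 0) = strip_prod s" "strip_prod s \<noteq> 0"
proof -
  have nz: "s - 1 / 2 - of_real (tau0 chi) \<noteq> 0" "s - 1 / 2 + of_real (tau0 chi) \<noteq> 0" "s - 1 / 2 \<noteq> 0"
    by (rule Re_pos_neq_0, use assms tau0_bounds in simp)+
  show "(\<lambda>w. strip_zeta s w) holomorphic_on A" unfolding strip_zeta_def by (intro holomorphic_intros)
  show "strip_prod s \<noteq> 0" using nz by (simp add: strip_prod_def)
  have p: "((\<lambda>w. of_nat k * z powr (- w)) has_field_derivative of_nat k * (- Ln z)) (at 0)" if "z \<noteq> 0" for k :: nat and z :: complex
    unfolding powr_def using that by (auto intro!: derivative_eq_intros)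
  have "(strip_zeta s has_field_derivative
      of_nat (mu_tau0 chi) * (- Ln (s - 1 / 2 - of_real (tau0 chi))) +
      of_nat (mu_tau0 chi) * (- Ln (s - 1 / 2 + of_real (tau0 chi))) +
      of_nat (L_order chi (1 / 2)) * (- Ln (s - 1 / 2))) (at 0)"
    unfolding strip_zeta_def[abs_def] by (intro DERIV_add p nz)
  hence "- deriv (strip_zeta s) 0 = of_nat (mu_tau0 chi) * Ln (s - 1 / 2 - of_real (tau0 chi)) +
      of_nat (mu_tau0 chi) * Ln (s - 1 / 2 + of_real (tau0 chi)) +
      of_nat (L_order chi (1 / 2)) * Ln (s - 1 / 2)" by (simp only: DERIV_imp_deriv) simp
  hence "exp (- deriv (strip_zeta s) 0) = exp (Ln (s - 1 / 2 - of_real (tau0 chi))) ^ mu_tau0 chi *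
     exp (Ln (s - 1 / 2 + of_real (tau0 chi))) ^ mu_tau0 chi * exp (Ln (s - 1 / 2)) ^ L_order chi (1 / 2)"
    by (simp only: exp_add exp_of_nat_mult)
  thus "exp (- deriv (strip_zeta s) 0) = strip_prod s" using nz by (simp add: strip_prod_def)
qed

text \<open>The zeros split into non-real ones, real ones with Re <= 0 and finitely many in the
  strip. Subtracting the last two zeta functions from that of all zeros continues the first, and
  exponentiating the derivative at 0 turns the difference into a quotient.\<close>

lemma nonreal_has_reg_prod:
  assumes uniq: "\<And>t t'. real_zero_pair chi t \<Longrightarrow> real_zero_pair chi t' \<Longrightarrow> t = t'"
  shows "\<exists>P. has_reg_prod (nonreal_L_zeros chi) fst (\<lambda>_. 1) P \<and> (\<forall>s. L_ext s = P s * trivial_prod s * strip_prod s)"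
proof -
  interpret e: entire_order_two L_ext "SOME C. \<forall>s. norm (L_ext s) \<le> exp (C * (1 + norm s) ^ 2)"
    by (rule L_ext_entire_order_two)
  obtain \<sigma>0 where \<sigma>0: "\<And>s. Re s \<ge> \<sigma>0 \<Longrightarrow> L_ext s \<noteq> 0"
    and F_ex: "\<And>s. Re s > \<sigma>0 + 1 \<Longrightarrow> \<exists>F. F holomorphic_on {w. Re w < 3} \<and>
       (\<forall>w. 2 < Re w \<and> Re w < 3 \<longrightarrow> F w = infsum (\<lambda>i. (s - fst i) powr (- w)) (zero_index L_ext)) \<and>
       exp (- deriv F 0) = L_ext s"
    using zeta_of_zeros by blast
  define I where "I = nonreal_L_zeros chi"
  \<comment> \<open>At least 1 to lie to the right of the real zeros in the strip and of the trivial
    zeros, and at least \<open>\<sigma>0 + 1\<close> so that the continuation from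
    \<open>zeta_of_zeros\<close> is available.\<close>
  define \<sigma> where "\<sigma> = max (\<sigma>0 + 1) 1"
  define U where "U = {s. Re s > \<sigma>}"
  have \<sigma>: "\<sigma> \<ge> 1" "\<sigma> \<ge> \<sigma>0 + 1" by (simp_all add: \<sigma>_def)
  have I_sub: "I \<subseteq> zero_index L_ext" by (auto simp: I_def nonreal_L_zeros_eq)
  have Re_I: "Re (fst i) \<le> \<sigma>" if "i \<in> I" for i
  proof (rule ccontr)
    assume "\<not> Re (fst i) \<le> \<sigma>"
    hence "L_ext (fst i) \<noteq> 0" using \<sigma> by (intro \<sigma>0) linarith
    thus False using that I_sub by (auto simp: zero_index_def)
  qed
  define s0 where "s0 = complex_of_real (\<sigma> + 1)"
  have s0: "Re s0 \<ge> \<sigma> + 1" "L_ext s0 \<noteq> 0" using \<sigma> by (auto simp: s0_def intro!: \<sigma>0)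
  have summ: "(\<lambda>i. norm (s0 - fst i) powr (- c)) summable_on I" if "c > 2" for c
    by (rule summable_on_subset_banach[OF e.zeros_summable[OF s0(2) that] I_sub])
  have conv: "reg_zeta_converges I fst (\<lambda>_. 1) 2 U"
    unfolding U_def by (rule reg_zeta_converges_half_plane[OF Re_I s0(1) _ summ]) auto
  have hol: "(\<lambda>w. reg_zeta I fst (\<lambda>_. 1) w s) holomorphic_on {w. Re w > 2}" if "s \<in> U" for s
    by (rule reg_zeta_holomorphic[OF Re_I s0(1) _ summ]) (use that in \<open>auto simp: U_def\<close>)
  have sum_I: "(\<lambda>i. (s - fst i) powr (- w)) summable_on I" if "s \<in> U" "Re w > 2" for s w
    by (rule reg_zeta_summable[OF Re_I s0(1) _ summ]) (use that in \<open>auto simp: U_def\<close>)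
  define T where "T = (\<lambda>s w. 2 powr (- w) * (hurwitz_K w ((s + of_nat delta) / 2) / (w - 1)))"
  have trivial_U: "trivial_prod s \<noteq> 0" if "s \<in> U" for s
  proof
    assume "trivial_prod s = 0"
    then obtain n :: nat where "s = - (2 * of_nat n + of_nat delta)" unfolding trivial_prod_eq_0_iff by blast
    hence "Re s \<le> 0" by simp
    thus False using that \<sigma> by (simp add: U_def)
  qed
  have strip_U: "strip_prod s \<noteq> 0" if "s \<in> U" for s
    using that \<sigma> by (intro strip_zeta_deriv(3)) (simp add: U_def)
  have cont: "\<exists>Z. reg_zeta_continuation I fst (\<lambda>_. 1) 2 s Z \<and>
      exp (- residue (\<lambda>w. Z w / w\<^sup>2) 0) = L_ext s / (trivial_prod s * strip_prod s)" if sU: "s \<in> U" for s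
  proof -
    have s: "Re s > 1" "Re s > \<sigma>0 + 1" "Re s > 0" using sU \<sigma> by (auto simp: U_def)
    obtain F where F: "F holomorphic_on {w. Re w < 3}"
      "\<And>w. 2 < Re w \<Longrightarrow> Re w < 3 \<Longrightarrow> F w = infsum (\<lambda>i. (s - fst i) powr (- w)) (zero_index L_ext)"
      "exp (- deriv F 0) = L_ext s"
      using F_ex[OF s(2)] by blast
    define Y where "Y = (\<lambda>w. F w - T s w - strip_zeta s w)"
    \<comment> \<open>The continuation of the total is known only for Re w < 3 and the series only
      for Re w > 2. They agree on the strip between, so the case distinction gives a single
      meromorphic function on Re w > -1.\<close>
    define Z where "Z = (\<lambda>w. if Re w < 3 then Y w else reg_zeta I fst (\<lambda>_. 1) w s)"
    have Y_eq: "Y w = reg_zeta I fst (\<lambda>_. 1) w s" if w: "2 < Re w" "Re w < 3" for w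
    proof -
      define g where "g = (\<lambda>i :: complex \<times> nat. (s - fst i) powr (- w))"
      have 1: "(g has_sum reg_zeta I fst (\<lambda>_. 1) w s) I"
        unfolding reg_zeta_def g_def using sum_I[OF sU w(1)] by simp
      have "inj_on (\<lambda>n. (- (2 * of_nat n - (3 + chi (- 1)) / 2), 0 :: nat)) {1::nat..}" by (auto simp: inj_on_def)
      hence 2: "(g has_sum T s w) {i \<in> zero_index L_ext. Im (fst i) = 0 \<and> Re (fst i) \<le> 0}"
        unfolding trivial_zero_index[symmetric] using trivial_reg_zeta[OF s(3), of w] w
        by (subst has_sum_reindex) (simp_all add: g_def o_def T_def)
      have 3: "(g has_sum strip_zeta s w) {i \<in> zero_index L_ext. Im (fst i) = 0 \<and> Re (fst i) > 0}"
        unfolding g_def by (rule strip_zeta_has_sum[OF uniq])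
      have "(g has_sum (reg_zeta I fst (\<lambda>_. 1) w s + T s w + strip_zeta s w))
          (I \<union> {i \<in> zero_index L_ext. Im (fst i) = 0 \<and> Re (fst i) \<le> 0} \<union> {i \<in> zero_index L_ext. Im (fst i) = 0 \<and> Re (fst i) > 0})"
        by (intro has_sum_Un_disjoint 1 2 3) (auto simp: I_def nonreal_L_zeros_eq)
      also have "I \<union> {i \<in> zero_index L_ext. Im (fst i) = 0 \<and> Re (fst i) \<le> 0} \<union> {i \<in> zero_index L_ext. Im (fst i) = 0 \<and> Re (fst i) > 0} = zero_index L_ext"
        by (auto simp: I_def nonreal_L_zeros_eq)
      finally have "infsum g (zero_index L_ext) = reg_zeta I fst (\<lambda>_. 1) w s + T s w + strip_zeta s w" by (rule infsumI)
      thus ?thesis using F(2)[OF w] by (simp add: Y_def g_def)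
    qed
    have Z_reg: "Z w = reg_zeta I fst (\<lambda>_. 1) w s" if "Re w > 2" for w
      using Y_eq[OF that] by (simp add: Z_def)
    define A where "A = {w. Re w > - 1} \<inter> {w. Re w < 3}"
    have A: "open A" unfolding A_def by (intro open_Int open_Re_gt open_halfspace_Re_lt)
    have T_hol: "T s holomorphic_on A - {1}"
      unfolding T_def by (rule holomorphic_on_subset[OF trivial_continuation_holomorphic[OF s(3)]]) (auto simp: A_def)
    have F_hol: "F holomorphic_on A" by (rule holomorphic_on_subset[OF F(1)]) (auto simp: A_def)
    have Y_hol: "Y holomorphic_on A - {1}"
      unfolding Y_def
      by (intro holomorphic_intros strip_zeta_deriv(1)[OF s(1)] T_hol holomorphic_on_subset[OF F_hol]) auto
    have Y_mero: "Y meromorphic_on A"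
    proof -
      have "T s meromorphic_on A"
        unfolding T_def by (rule meromorphic_on_subset[OF trivial_continuation_meromorphic[OF s(3)]]) (auto simp: A_def)
      moreover have "F meromorphic_on A" "strip_zeta s meromorphic_on A"
        using F_hol strip_zeta_deriv(1)[OF s(1), of A] analytic_on_open[OF A] analytic_on_imp_meromorphic_on by blast+
      ultimately show ?thesis unfolding Y_def by (intro meromorphic_intros)
    qed
    have "Z meromorphic_on A"
    proof (rule meromorphic_on_cong[THEN iffD1, OF _ refl Y_mero])
      fix z assume "z \<in> A"
      have "\<forall>\<^sub>F w in at z. w \<in> A" by (rule eventually_at_in_open'[OF A \<open>z \<in> A\<close>])
      thus "\<forall>\<^sub>F w in at z. Y w = Z w" by eventually_elim (simp add: A_def Z_def)
    qed
    moreover have "Z meromorphic_on {w. Re w > 2}"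
    proof -
      have "Z holomorphic_on {w. Re w > 2}" by (rule holomorphic_transform[OF hol[OF sU]]) (simp add: Z_reg)
      thus ?thesis by (intro analytic_on_imp_meromorphic_on) (simp add: analytic_on_open open_Re_gt)
    qed
    ultimately have "Z meromorphic_on (A \<union> {w. Re w > 2})" by (rule meromorphic_on_Un)
    moreover have "{w. Re w > - 1} \<subseteq> A \<union> {w. Re w > 2}" by (auto simp: A_def)
    ultimately have "Z meromorphic_on {w. Re w > - 1}" by (rule meromorphic_on_subset)
    hence "reg_zeta_continuation I fst (\<lambda>_. 1) 2 s Z"
      unfolding reg_zeta_continuation_def using Z_reg zero_less_one by blast
    moreover have "exp (- residue (\<lambda>w. Z w / w\<^sup>2) 0) = L_ext s / (trivial_prod s * strip_prod s)"
    proof -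
      have A0: "open (A - {1})" "0 \<in> A - {1}" using A by (auto simp: A_def)
      have "Z holomorphic_on A - {1}" by (rule holomorphic_transform[OF Y_hol]) (auto simp: Z_def A_def)
      hence "residue (\<lambda>w. Z w / w\<^sup>2) 0 = deriv Z 0" by (rule residue_div_square[OF A0])
      also have "deriv Z 0 = deriv F 0 - deriv (T s) 0 - deriv (strip_zeta s) 0"
      proof (rule DERIV_imp_deriv)
        have "(Y has_field_derivative deriv F 0 - deriv (T s) 0 - deriv (strip_zeta s) 0) (at 0)"
          unfolding Y_def
          by (intro DERIV_diff holomorphic_derivI[OF _ A0] T_hol strip_zeta_deriv(1)[OF s(1)] holomorphic_on_subset[OF F_hol]) auto
        thus "(Z has_field_derivative deriv F 0 - deriv (T s) 0 - deriv (strip_zeta s) 0) (at 0)"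
          by (rule has_field_derivative_transform_within_open[OF _ A0]) (auto simp: Z_def A_def)
      qed
      finally have "- residue (\<lambda>w. Z w / w\<^sup>2) 0 = - deriv F 0 - (- deriv (T s) 0) - (- deriv (strip_zeta s) 0)" by simp
      hence "exp (- residue (\<lambda>w. Z w / w\<^sup>2) 0) = exp (- deriv F 0) / exp (- deriv (T s) 0) / exp (- deriv (strip_zeta s) 0)"
        by (simp only: exp_diff)
      moreover have "exp (- deriv (T s) 0) = trivial_prod s"
        unfolding T_def trivial_prod_def using s by (intro exp_deriv_scaled_hurwitz) simp
      ultimately show ?thesis using F(3) strip_zeta_deriv(2)[OF s(1)] by simp
    qed
    ultimately show ?thesis by blast
  qed
  define f where "f = (\<lambda>s. L_ext s / (trivial_prod s * strip_prod s))"
  \<comment> \<open>The quotient is formed pointwise and has arbitrary values at zeros of its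
    denominator; removing singularities makes it nicely meromorphic without changing it on
    U.\<close>
  define P where "P = remove_sings f"
  have triv_an: "trivial_prod analytic_on A" for A
    by (rule analytic_on_subset[of _ UNIV]) (simp_all add: analytic_on_open trivial_prod_holomorphic)
  have strip_an: "strip_prod analytic_on A" for A
    unfolding strip_prod_def by (intro analytic_intros)
  have f_mero: "f meromorphic_on UNIV"
    unfolding f_def by (intro meromorphic_intros analytic_on_imp_meromorphic_on L_ext_analytic triv_an strip_an)
  have P_eq: "P s = f s" if "trivial_prod s * strip_prod s \<noteq> 0" for s
    unfolding P_def
  proof (rule remove_sings_at_analytic)
    show "f analytic_on {s}"
      unfolding f_def using that by (intro analytic_intros L_ext_analytic triv_an strip_an) auto
  qed
  have "P nicely_meromorphic_on UNIV" unfolding P_def by (rule remove_sings_nicely_meromorphic[OF f_mero])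
  moreover have "open U" "connected U" "U \<noteq> {}"
  proof -
    show "open U" unfolding U_def by (rule open_Re_gt)
    show "connected U" unfolding U_def by (intro convex_connected convex_halfspace_Re_gt)
    have "s0 \<in> U" using s0 by (simp add: U_def)
    thus "U \<noteq> {}" by blast
  qed
  moreover have "U \<inter> fst ` I = {}" using Re_I by (force simp: U_def)
  moreover have "\<exists>Z. reg_zeta_continuation I fst (\<lambda>_. 1) 2 s Z \<and> P s = exp (- residue (\<lambda>w. Z w / w\<^sup>2) 0)" if "s \<in> U" for s
    using cont[OF that] P_eq[of s] trivial_U[OF that] strip_U[OF that] by (auto simp: f_def)
  ultimately have "has_reg_prod I fst (\<lambda>_. 1) P" unfolding has_reg_prod_def using conv by blast
  moreover have "L_ext s = P s * trivial_prod s * strip_prod s" for s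
  proof (cases "trivial_prod s * strip_prod s = 0")
    case False
    thus ?thesis using P_eq[OF False] by (simp add: f_def)
  next
    case True
    \<comment> \<open>At a zero of the denominator the right side is 0 whatever value P takes there,
      so the identity amounts to the vanishing of L, which both kinds of factors encode.\<close>
    have "L_ext s = 0"
    proof (cases "trivial_prod s = 0")
      case True
      then obtain n :: nat where n: "s = - (2 * of_nat n + of_nat delta)" unfolding trivial_prod_eq_0_iff by blast
      hence "Im s = 0" "Re s \<le> 0" by simp_all
      thus ?thesis using L_ext_real_left_zero_iff n by blast
    next
      case False
      hence "strip_prod s = 0" using True by simp
      hence "(s = of_real (1 / 2 + tau0 chi) \<and> mu_tau0 chi > 0) \<or> (s = of_real (1 / 2 - tau0 chi) \<and> mu_tau0 chi > 0) \<or>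
          (s = 1 / 2 \<and> L_order chi (1 / 2) > 0)"
        by (auto simp: strip_prod_def algebra_simps add_eq_0_iff)
      thus ?thesis using zorder_L_ext_pos_iff mu_tau0_eq L_order_eq by metis
    qed
    thus ?thesis using True by auto
  qed
  ultimately show ?thesis unfolding I_def by blast
qed

end

theorem theorem1p1:
  fixes N\<^sub>1 :: nat and chi\<^sub>1 :: "int \<Rightarrow> complex"
  assumes "N\<^sub>1 \<ge> 2"
    and "primitive_dirichlet_character N\<^sub>1 chi\<^sub>1"
    and at_most_one_real_pair:
      "\<And>t t'. real_zero_pair chi\<^sub>1 t \<Longrightarrow> real_zero_pair chi\<^sub>1 t' \<Longrightarrow> t = t'"
  shows "\<exists>P Q.
      has_reg_prod (nonreal_L_zeros chi\<^sub>1) fst (\<lambda>_. 1) P \<and>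
      has_reg_prod {1::nat..} (\<lambda>n. - (2 * of_nat n - (3 + chi\<^sub>1 (- 1)) / 2)) (\<lambda>_. 1) Q \<and>
      (\<forall>s. dirichlet_L chi\<^sub>1 s =
             P s * Q s *
             (s - 1 / 2 - of_real (tau0 chi\<^sub>1)) ^ mu_tau0 chi\<^sub>1 *
             (s - 1 / 2 + of_real (tau0 chi\<^sub>1)) ^ mu_tau0 chi\<^sub>1 *
             (s - 1 / 2) ^ L_order chi\<^sub>1 (1 / 2))"
proof -
  interpret primitive_char N\<^sub>1 chi\<^sub>1
    using assms(1,2) by unfold_locales (auto simp: primitive_dirichlet_character_def)
  obtain P where P: "has_reg_prod (nonreal_L_zeros chi\<^sub>1) fst (\<lambda>_. 1) P" "\<And>s. L_ext s = P s * trivial_prod s * strip_prod s"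
    using nonreal_has_reg_prod[OF at_most_one_real_pair] by blast
  have "dirichlet_L chi\<^sub>1 s = P s * trivial_prod s *
             (s - 1 / 2 - of_real (tau0 chi\<^sub>1)) ^ mu_tau0 chi\<^sub>1 *
             (s - 1 / 2 + of_real (tau0 chi\<^sub>1)) ^ mu_tau0 chi\<^sub>1 *
             (s - 1 / 2) ^ L_order chi\<^sub>1 (1 / 2)" for s
    unfolding dirichlet_L_eq P(2)[of s] strip_prod_def by (simp only: mult.assoc)
  thus ?thesis using P(1) trivial_has_reg_prod by blast
qed

end
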